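(* The operation $\star$ makes $\Omega_*(G_{\mathfrak N, M})_{\mathbb Q}$ into an associative, graded commutative algebra. Namely, for all $\mathfrak N$ and all $\eta_i\in \Omega_{j_i}(G_{\mathfrak N, M})_{\mathbb Q}$, $i=1,2,3$ (with $|\eta_i|=j_i$), we have: 1. $\eta_1\star \eta_2=(-1)^{|\eta_1||\eta_2|}\,\eta_2\star \eta_1$; 2. $(\eta_1\star \eta_2)\star \eta_3=\eta_1\star (\eta_2\star \eta_3)$; 3. the $\star$-product is of degree zero, i.e. for all $j_1, j_2\in \mathbb N$ (including $0$) it restricts to a map $\star: \Omega_{j_1}(G_{\mathfrak N, M})_{\mathbb Q}\otimes \Omega_{j_2}(G_{\mathfrak N, M})_{\mathbb Q}\to \Omega_{j_1+j_2}(G_{\mathfrak N, M})_{\mathbb Q}$.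
   Context: All manifolds are smooth ($C^\infty$) and oriented; $\mathrm{pt}$ is the one-point space. $M$ is a fixed connected oriented manifold of dimension $\mathfrak m$, and $\mathfrak N$ is a fixed set of closed connected oriented manifolds, all of the same odd dimension $\mathfrak n$. Allowed graphs. An allowed graph $\Gamma$ is a directed graph with: one vertex $M$; a finite number $\nu(\Gamma)$ of "$N$-vertices" $N_1,\dots,N_{\nu(\Gamma)}$ (enumerated), each labelled by a manifold of $\mathfrak N$ (also denoted $N_i$; the same manifold may be used repeatedly) and each having exactly one edge $N_i\to M$; and finitely many "$\mathrm{pt}$-vertices", each with exactly two outgoing edges, going to two different $N$-vertices $N_a,N_b$ with $a<b$; $\{a,b\}$ is called the index of the $\mathrm{pt}$-vertex. It is required that the unoriented bipartite graph obtained by deleting the vertex $M$ and all edges leading to it has no loops (i.e. is a disjoint union of trees); in particular all indices of $\mathrm{pt}$-vertices are distinct. An allowed graph is completely determined by $\nu(\Gamma)$, the manifolds labelling the $N$-vertices, and the set of indices of its $\mathrm{pt}$-vertices. Space of garlands. Order the edges $\mathrm{pt}\to N$ of $\Gamma$ (lexicographically by the index of the $\mathrm{pt}$-vertex, then by the target); let $\pi(\Gamma)$ be their number and let the $j$-th one go to $N_{i(j)}$. Then $G_{\mathfrak N,M}^{\Gamma}$ is the subspace of $\prod_{j=1}^{\pi(\Gamma)}N_{i(j)}\times\prod_{i=1}^{\nu(\Gamma)}C(N_i,M)$ ($C$ = space of continuous maps with its standard topology) consisting of the commutative diagrams: for each $\mathrm{pt}$-vertex of index $\{a,b\}$ with chosen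 image points $x_a\in N_a$, $x_b\in N_b$ and maps $\phi_a:N_a\to M$, $\phi_b:N_b\to M$, one has $\phi_a(x_a)=\phi_b(x_b)$. Put $G_{\mathfrak N,M}=\bigsqcup_\Gamma G_{\mathfrak N,M}^\Gamma$, the disjoint union over all allowed graphs. Bordism. $\Omega_j(Y)$ is the $j$-dimensional oriented bordism group of a space $Y$; $[V,f]$ is the class of $f:V\to Y$, $V$ a closed oriented $j$-manifold. $\Omega_*(Y)_{\mathbb Q}=\bigoplus_{j\ge0}\Omega_j(Y)\otimes\mathbb Q$, and $|\eta|=j$ for $\eta\in\Omega_j(Y)_{\mathbb Q}$. For $\omega\in \Omega_*(Y)$, $1\omega$ denotes $\omega\otimes1$. Permutations. For $\alpha\in S_n$, put $\alpha\cdot\Gamma=\Gamma$ if $n\ne\nu(\Gamma)$; if $n=\nu(\Gamma)$, $\alpha\cdot\Gamma$ is obtained from $\Gamma$ by changing the number $i$ of each $N$-vertex to $\alpha(i)$ (keeping labels and edges) and changing the indices of the $\mathrm{pt}$-vertices accordingly. The corresponding renumbering of diagrams (identity if $n\neq\nu(\Gamma)$) gives homeomorphisms $G^{\Gamma}_{\mathfrak N,M}\to G^{\alpha\cdot\Gamma}_{\mathfrak N,M}$, hence an auto-homeomorphism $\widetilde\alpha$ of $G_{\mathfrak N,M}$, and $\alpha_*[V,f]=[V,\widetilde\alpha\circ f]$. Operation $C$. $D(\Gamma_1,\Gamma_2)$ is the allowed graph obtained from $\Gamma_1\sqcup\Gamma_2$ by increasing by $\nu(\Gamma_1)$ the numbers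 of the $N$-vertices coming from $\Gamma_2$ (and changing the indices of the $\mathrm{pt}$-vertices from $\Gamma_2$ accordingly) and identifying the two $M$-vertices. For $\omega_i=[V_i,f_i]\in\Omega_{j_i}(G^{\Gamma_i}_{\mathfrak N,M})$, $i=1,2$, $C(\omega_1,\omega_2)=[V_1\times V_2,g]\in\Omega_{j_1+j_2}(G^{D(\Gamma_1,\Gamma_2)}_{\mathfrak N,M})$, where $V_1\times V_2$ has the product orientation and $g(v_1,v_2)$ is the diagram whose part corresponding to $\Gamma_1$ is $f_1(v_1)$ and whose part corresponding to $\Gamma_2$ is $f_2(v_2)$. This class depends only on $\omega_1,\omega_2$. Operation $\star$. For $\omega_i\in\Omega_{j_i}(G^{\Gamma_i}_{\mathfrak N,M})$ realized by maps of connected manifolds, $i=1,2$, with $\nu_i=\nu(\Gamma_i)$, $$1\omega_1\star1\omega_2=\frac1{(\nu_1+\nu_2)!}\sum_{\beta\in S_{\nu_1+\nu_2}}\beta_*\bigl(C(\omega_1,\omega_2)\bigr),$$ and $\star$ is extended to $\Omega_*(G_{\mathfrak N,M})_{\mathbb Q}$ by ($\mathbb Q$-bi)linearity. *)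

theory Defs
  imports
    "HOL-Analysis.Analysis"
    "HOL-Algebra.Free_Abelian_Groups"
    "HOL-Algebra.Product_Groups"
    "HOL-Combinatorics.Permutations"
    "Jordan_Normal_Form.Determinant"
begin

section \<open>Smooth maps between subsets of Euclidean spaces\<close>

text \<open>
  Dimensions vary inside the statement, so \<open>\<real>\<^sup>n\<close> is the library space
  \<^const>\<open>Euclidean_space\<close> \<open>n\<close>: real sequences vanishing from index \<open>n\<close> on.
  \<open>Ck k n U f\<close> says that all iterated partial derivatives of \<open>f\<close> of order at most \<open>k\<close>
  exist and are continuous on the open subset \<open>U\<close> of \<open>\<real>\<^sup>n\<close>.
\<close>

primrec Ck :: "nat \<Rightarrow> nat \<Rightarrow> (nat \<Rightarrow> real) set \<Rightarrow> ((nat \<Rightarrow> real) \<Rightarrow> real) \<Rightarrow> bool" where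
  "Ck 0 n U f \<longleftrightarrow> continuous_map (subtopology (Euclidean_space n) U) euclideanreal f"
| "Ck (Suc k) n U f \<longleftrightarrow>
     continuous_map (subtopology (Euclidean_space n) U) euclideanreal f \<and>
     (\<exists>g. \<forall>i<n. (\<forall>x\<in>U. ((\<lambda>t. f (x(i := t))) has_real_derivative g i x) (at (x i))) \<and>
                Ck k n U (g i))"

text \<open>Smoothness on an arbitrary subset \<open>S\<close> of \<open>\<real>\<^sup>n\<close> (needed for open subsets of a
  half-space): locally there is a smooth extension to an open subset of \<open>\<real>\<^sup>n\<close>.\<close>

definition smooth_on :: "nat \<Rightarrow> nat \<Rightarrow> (nat \<Rightarrow> real) set \<Rightarrow> ((nat \<Rightarrow> real) \<Rightarrow> (nat \<Rightarrow> real)) \<Rightarrow> bool"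
  where "smooth_on n m S F \<longleftrightarrow>
    (\<forall>i<m. \<forall>x\<in>S. \<exists>U g. openin (Euclidean_space n) U \<and> x \<in> U \<and> (\<forall>k. Ck k n U g) \<and>
                     (\<forall>y\<in>S \<inter> U. g y = F y i))"

text \<open>The partial derivatives are taken within \<open>S\<close>, so they are one-sided at boundary points of a
  half-space.\<close>

definition jacobian_det :: "nat \<Rightarrow> (nat \<Rightarrow> real) set \<Rightarrow> ((nat \<Rightarrow> real) \<Rightarrow> (nat \<Rightarrow> real)) \<Rightarrow> (nat \<Rightarrow> real) \<Rightarrow> real"
  where "jacobian_det n S F x =
    Determinant.det (Matrix.mat n n (\<lambda>(i, k).
      vector_derivative (\<lambda>t. F (x(k := t)) i) (at (x k) within {t. x(k := t) \<in> S})))"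

section \<open>Oriented smooth manifolds\<close>

text \<open>
  A chart is a triple \<open>(U, \<phi>, \<epsilon>)\<close>: an open set, a homeomorphism onto an open subset of the model
  space, and a sign \<open>\<epsilon>\<close> telling whether \<open>\<phi>\<close> preserves (\<open>1\<close>) or reverses (\<open>-1\<close>) orientation.  The
  Jacobian of the transition from \<open>(U, \<phi>, \<epsilon>)\<close> to \<open>(U', \<phi>', \<epsilon>')\<close> must have sign \<open>\<epsilon> * \<epsilon>'\<close>.
  Compared with atlases of orientation preserving charts only, this also gives the right notion for
  0-manifolds (signed points) and for 1-manifolds with boundary.
\<close>

type_synonym 'a chart = "'a set \<times> ('a \<Rightarrow> nat \<Rightarrow> real) \<times> real"

record 'a omanifold =
  mf_top :: "'a topology"
  mf_dim :: nat
  mf_charts :: "'a chart set"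

definition chart_rep :: "'a chart \<Rightarrow> 'b chart \<Rightarrow> ('a \<Rightarrow> 'b) \<Rightarrow> (nat \<Rightarrow> real) \<Rightarrow> (nat \<Rightarrow> real)"
  where "chart_rep = (\<lambda>(U, \<phi>, \<epsilon>) (U', \<phi>', \<epsilon>') h. \<phi>' \<circ> h \<circ> inv_into U \<phi>)"

definition chart_rep_dom :: "'a chart \<Rightarrow> 'b chart \<Rightarrow> ('a \<Rightarrow> 'b) \<Rightarrow> (nat \<Rightarrow> real) set"
  where "chart_rep_dom = (\<lambda>(U, \<phi>, \<epsilon>) (U', \<phi>', \<epsilon>') h. \<phi> ` {p \<in> U. h p \<in> U'})"

definition smooth_in_charts :: "'a omanifold \<Rightarrow> 'b omanifold \<Rightarrow> ('a \<Rightarrow> 'b) \<Rightarrow> bool"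
  where "smooth_in_charts X Y h \<longleftrightarrow>
    (\<forall>c\<in>mf_charts X. \<forall>c'\<in>mf_charts Y.
       smooth_on (mf_dim X) (mf_dim Y) (chart_rep_dom c c' h) (chart_rep c c' h))"

definition orientation_preserving :: "'a omanifold \<Rightarrow> 'b omanifold \<Rightarrow> ('a \<Rightarrow> 'b) \<Rightarrow> bool"
  where "orientation_preserving X Y h \<longleftrightarrow>
    (\<forall>c\<in>mf_charts X. \<forall>c'\<in>mf_charts Y. \<forall>x\<in>chart_rep_dom c c' h.
       sgn (jacobian_det (mf_dim X) (chart_rep_dom c c' h) (chart_rep c c' h) x)
         = snd (snd c) * snd (snd c'))"

text \<open>\<open>manifold_modelled_on H X\<close>: the charts of \<open>X\<close> have values in \<open>H \<inter> \<real>\<^sup>n\<close>.  The transition maps are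
  the coordinate representations of the identity.\<close>

definition manifold_modelled_on :: "(nat \<Rightarrow> real) set \<Rightarrow> 'a omanifold \<Rightarrow> bool"
  where "manifold_modelled_on H X \<longleftrightarrow>
    Hausdorff_space (mf_top X) \<and> second_countable (mf_top X) \<and>
    topspace (mf_top X) = (\<Union>(U, \<phi>, \<epsilon>)\<in>mf_charts X. U) \<and>
    (\<forall>(U, \<phi>, \<epsilon>)\<in>mf_charts X.
       openin (mf_top X) U \<and>
       openin (subtopology (Euclidean_space (mf_dim X)) H) (\<phi> ` U) \<and>
       homeomorphic_map (subtopology (mf_top X) U)
         (subtopology (Euclidean_space (mf_dim X)) (\<phi> ` U)) \<phi> \<and>
       \<epsilon> \<in> {1, -1}) \<and>
    smooth_in_charts X X id \<and> orientation_preserving X X id"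

definition oriented_manifold :: "'a omanifold \<Rightarrow> bool"
  where "oriented_manifold X \<longleftrightarrow> manifold_modelled_on UNIV X"

definition closed_oriented_manifold :: "'a omanifold \<Rightarrow> bool"
  where "closed_oriented_manifold X \<longleftrightarrow> oriented_manifold X \<and> compact_space (mf_top X)"

definition connected_manifold :: "'a omanifold \<Rightarrow> bool"
  where "connected_manifold X \<longleftrightarrow> connected_space (mf_top X)"

definition half_space :: "(nat \<Rightarrow> real) set"
  where "half_space = {x. x 0 \<le> 0}"

text \<open>In dimension 0 the coordinate \<open>x 0\<close> vanishes identically, so positive dimension is required.\<close>

definition oriented_manifold_with_boundary :: "'a omanifold \<Rightarrow> bool"
  where "oriented_manifold_with_boundary W \<longleftrightarrow> 0 < mf_dim W \<and> manifold_modelled_on half_space W"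

definition boundary_points :: "'a omanifold \<Rightarrow> 'a set"
  where "boundary_points W = (\<Union>(U, \<phi>, \<epsilon>)\<in>mf_charts W. {p \<in> U. \<phi> p 0 = 0})"

text \<open>The outward normal of the half-space is the first basis vector, so keeping the sign of a chart
  while dropping its first coordinate is the outward-normal-first boundary orientation.\<close>

definition mf_boundary :: "'a omanifold \<Rightarrow> 'a omanifold"
  where "mf_boundary W =
    \<lparr>mf_top = subtopology (mf_top W) (boundary_points W),
     mf_dim = mf_dim W - 1,
     mf_charts = (\<lambda>(U, \<phi>, \<epsilon>). (U \<inter> boundary_points W, \<lambda>p i. \<phi> p (Suc i), \<epsilon>)) ` mf_charts W\<rparr>"

definition coproduct_topology :: "'a topology \<Rightarrow> 'b topology \<Rightarrow> ('a + 'b) topology"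
  where "coproduct_topology X Y = topology (\<lambda>S. openin X (Inl -` S) \<and> openin Y (Inr -` S))"

lemma openin_coproduct_topology:
  "openin (coproduct_topology X Y) S \<longleftrightarrow> openin X (Inl -` S) \<and> openin Y (Inr -` S)"
proof -
  have "istopology (\<lambda>S. openin X (Inl -` S) \<and> openin Y (Inr -` S))"
    unfolding istopology_def by (auto simp: vimage_Union)
  then show ?thesis
    by (simp add: coproduct_topology_def topology_inverse')
qed

text \<open>Only used for manifolds of equal dimension.\<close>

definition mf_sum :: "'a omanifold \<Rightarrow> 'b omanifold \<Rightarrow> ('a + 'b) omanifold"
  where "mf_sum X Y =
    \<lparr>mf_top = coproduct_topology (mf_top X) (mf_top Y),
     mf_dim = mf_dim X,
     mf_charts = (\<lambda>(U, \<phi>, \<epsilon>). (Inl ` U, \<phi> \<circ> projl, \<epsilon>)) ` mf_charts X \<union>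
                 (\<lambda>(U, \<phi>, \<epsilon>). (Inr ` U, \<phi> \<circ> projr, \<epsilon>)) ` mf_charts Y\<rparr>"

definition mf_empty :: "nat \<Rightarrow> 'a omanifold"
  where "mf_empty j = \<lparr>mf_top = discrete_topology {}, mf_dim = j, mf_charts = {}\<rparr>"

definition mf_prod :: "'a omanifold \<Rightarrow> 'b omanifold \<Rightarrow> ('a \<times> 'b) omanifold"
  where "mf_prod X Y =
    \<lparr>mf_top = prod_topology (mf_top X) (mf_top Y),
     mf_dim = mf_dim X + mf_dim Y,
     mf_charts = (\<lambda>((U, \<phi>, \<epsilon>), (U', \<phi>', \<epsilon>')).
        (U \<times> U',
         \<lambda>(p, q) i. if i < mf_dim X then \<phi> p i else \<phi>' q (i - mf_dim X),
         \<epsilon> * \<epsilon>')) ` (mf_charts X \<times> mf_charts Y)\<rparr>"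

definition oriented_diffeo :: "'a omanifold \<Rightarrow> 'b omanifold \<Rightarrow> ('a \<Rightarrow> 'b) \<Rightarrow> bool"
  where "oriented_diffeo X Y h \<longleftrightarrow>
    mf_dim X = mf_dim Y \<and> homeomorphic_map (mf_top X) (mf_top Y) h \<and>
    smooth_in_charts X Y h \<and> smooth_in_charts Y X (inv_into (topspace (mf_top X)) h) \<and>
    orientation_preserving X Y h"

section \<open>Oriented bordism\<close>

text \<open>
  A manifold (Hausdorff, second countable) has at most continuum many points, so up to
  diffeomorphism all manifolds have their points in the following type.  The manifolds
  representing the elements of the bordism group, and the bordisms, are taken there;
  representatives with points in another type (disjoint unions, products) are allowed
  through the polymorphic definitions of \<open>bordant\<close> and \<open>bclass\<close>.
\<close>

type_synonym pts = "nat \<Rightarrow> real"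

definition singular_manifold :: "nat \<Rightarrow> 'y topology \<Rightarrow> 'a omanifold \<Rightarrow> ('a \<Rightarrow> 'y) \<Rightarrow> bool"
  where "singular_manifold j Y V f \<longleftrightarrow>
    closed_oriented_manifold V \<and> mf_dim V = j \<and> continuous_map (mf_top V) Y f"

definition singular_bordism :: "nat \<Rightarrow> 'y topology \<Rightarrow> 'a omanifold \<Rightarrow> ('a \<Rightarrow> 'y) \<Rightarrow> bool"
  where "singular_bordism j Y W F \<longleftrightarrow>
    oriented_manifold_with_boundary W \<and> compact_space (mf_top W) \<and> mf_dim W = Suc j \<and>
    continuous_map (mf_top W) Y F"

text \<open>
  Bordism in the form of Stong (Notes on Cobordism Theory, Ch. I): \<open>(V, f)\<close> and \<open>(V', f')\<close> are
  bordant iff \<open>V + \<partial>W\<close> and \<open>V' + \<partial>W'\<close> are diffeomorphic over \<open>Y\<close> for some compact \<open>W\<close>, \<open>W'\<close> over \<open>Y\<close>.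
  Gluing cylinders and \<open>W\<close>, \<open>W'\<close> along the diffeomorphism makes this the same as \<open>V' - V\<close> being
  the boundary of a compact manifold over \<open>Y\<close>.
\<close>

definition bordant :: "nat \<Rightarrow> 'y topology \<Rightarrow> 'a omanifold \<Rightarrow> ('a \<Rightarrow> 'y) \<Rightarrow> 'b omanifold \<Rightarrow> ('b \<Rightarrow> 'y) \<Rightarrow> bool"
  where "bordant j Y V f V' f' \<longleftrightarrow>
    (\<exists>(W :: pts omanifold) F (W' :: pts omanifold) F' h.
       singular_bordism j Y W F \<and> singular_bordism j Y W' F' \<and>
       oriented_diffeo (mf_sum V (mf_boundary W)) (mf_sum V' (mf_boundary W')) h \<and>
       (\<forall>p\<in>topspace (mf_top (mf_sum V (mf_boundary W))). case_sum f' F' (h p) = case_sum f F p))"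

type_synonym 'y bordism_class = "(pts omanifold \<times> (pts \<Rightarrow> 'y)) set"

definition bclass :: "nat \<Rightarrow> 'y topology \<Rightarrow> 'a omanifold \<Rightarrow> ('a \<Rightarrow> 'y) \<Rightarrow> 'y bordism_class"
  where "bclass j Y V f = {(V', f'). singular_manifold j Y V' f' \<and> bordant j Y V f V' f'}"

text \<open>As usual for quotients, an operation on classes is written as the union of the (equal) results
  over all representatives.\<close>

definition bordism_group :: "nat \<Rightarrow> 'y topology \<Rightarrow> 'y bordism_class monoid"
  where "bordism_group j Y =
    \<lparr>carrier = {bclass j Y V f | (V :: pts omanifold) f. singular_manifold j Y V f},
     monoid.mult = (\<lambda>\<omega>1 \<omega>2. \<Union>(V1, f1)\<in>\<omega>1. \<Union>(V2, f2)\<in>\<omega>2.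
        bclass j Y (mf_sum V1 V2) (case_sum f1 f2)),
     one = bclass j Y (mf_empty j :: pts omanifold) (\<lambda>_. undefined)\<rparr>"

definition bordism_push :: "nat \<Rightarrow> 'z topology \<Rightarrow> ('y \<Rightarrow> 'z) \<Rightarrow> 'y bordism_class \<Rightarrow> 'z bordism_class"
  where "bordism_push j Z h \<omega> = (\<Union>(V, f)\<in>\<omega>. bclass j Z V (h \<circ> f))"

section \<open>Tensor product with the rationals\<close>

text \<open>The tensor product of an abelian group \<open>A\<close> (written multiplicatively, as always in HOL-Algebra)
  with the additive group of the rationals: free abelian group on pairs modulo biadditivity.\<close>

definition tensor_gens :: "('a, 'b) monoid_scheme \<Rightarrow> ('a \<times> rat \<Rightarrow>\<^sub>0 int) monoid"
  where "tensor_gens A = free_Abelian_group (carrier A \<times> UNIV)"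

definition tensor_rels :: "('a, 'b) monoid_scheme \<Rightarrow> ('a \<times> rat \<Rightarrow>\<^sub>0 int) set"
  where "tensor_rels A = generate (tensor_gens A)
    ({frag_of (a \<otimes>\<^bsub>A\<^esub> b, q) - frag_of (a, q) - frag_of (b, q) | a b q. a \<in> carrier A \<and> b \<in> carrier A} \<union>
     {frag_of (a, q + r) - frag_of (a, q) - frag_of (a, r) | a q r. a \<in> carrier A})"

type_synonym 'a tensor = "('a \<times> rat \<Rightarrow>\<^sub>0 int) set"

definition rat_tensor :: "('a, 'b) monoid_scheme \<Rightarrow> 'a tensor monoid"
  where "rat_tensor A = tensor_gens A Mod tensor_rels A"

definition tensor_elt :: "('a, 'b) monoid_scheme \<Rightarrow> 'a \<Rightarrow> rat \<Rightarrow> 'a tensor"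
  where "tensor_elt A a q = tensor_rels A #>\<^bsub>tensor_gens A\<^esub> frag_of (a, q)"

text \<open>Scalar multiplication, induced by \<open>(a, r) \<mapsto> (a, q * r)\<close> on generators.\<close>

definition tensor_scale :: "('a, 'b) monoid_scheme \<Rightarrow> rat \<Rightarrow> 'a tensor \<Rightarrow> 'a tensor"
  where "tensor_scale A q c =
    (\<Union>z\<in>c. tensor_rels A #>\<^bsub>tensor_gens A\<^esub> frag_extend (\<lambda>(a, r). frag_of (a, q * r)) z)"

text \<open>\<open>\<Omega>\<^sub>*(Y)\<^sub>\<rat>\<close>, its scalar multiplication, its homogeneous part of degree \<open>j\<close>, and the
  homogeneous element \<open>1\<omega> = \<omega> \<otimes> 1\<close>.\<close>

type_synonym 'y graded_bordism = "nat \<Rightarrow> 'y bordism_class tensor"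

definition bordism_rat :: "'y topology \<Rightarrow> 'y graded_bordism monoid"
  where "bordism_rat Y = sum_group UNIV (\<lambda>j. rat_tensor (bordism_group j Y))"

definition bordism_scale :: "'y topology \<Rightarrow> rat \<Rightarrow> 'y graded_bordism \<Rightarrow> 'y graded_bordism"
  where "bordism_scale Y q \<eta> = (\<lambda>j. tensor_scale (bordism_group j Y) q (\<eta> j))"

definition bordism_rat_deg :: "nat \<Rightarrow> 'y topology \<Rightarrow> 'y graded_bordism set"
  where "bordism_rat_deg j Y =
    {\<eta> \<in> carrier (bordism_rat Y). \<forall>i. i \<noteq> j \<longrightarrow> \<eta> i = \<one>\<^bsub>rat_tensor (bordism_group i Y)\<^esub>}"

definition bordism_rat_elt :: "nat \<Rightarrow> 'y topology \<Rightarrow> 'y bordism_class \<Rightarrow> 'y graded_bordism"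
  where "bordism_rat_elt j Y \<omega> =
    (\<lambda>i. if i = j then tensor_elt (bordism_group j Y) \<omega> 1 else \<one>\<^bsub>rat_tensor (bordism_group i Y)\<^esub>)"

section \<open>Allowed graphs\<close>

text \<open>
  An allowed graph is given by the data determining it: the list of manifolds labelling its
  \<open>N\<close>-vertices (numbered from \<open>0\<close>) and the set of indices \<open>{a, b}\<close> of its \<open>pt\<close>-vertices.  The
  \<open>pt\<close>-vertices are identified with their indices, and \<open>(e, i)\<close> is the edge from the
  \<open>pt\<close>-vertex \<open>e\<close> to the \<open>N\<close>-vertex \<open>i\<close>.
\<close>

record 'n garland_graph =
  gg_labels :: "'n omanifold list"
  gg_indices :: "nat set set"

definition gg_nu :: "'n garland_graph \<Rightarrow> nat"
  where "gg_nu \<Gamma> = length (gg_labels \<Gamma>)"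

definition gg_edges :: "'n garland_graph \<Rightarrow> (nat set \<times> nat) set"
  where "gg_edges \<Gamma> = {(e, i). e \<in> gg_indices \<Gamma> \<and> i \<in> e}"

text \<open>Adjacency in the unoriented bipartite graph left after deleting the vertex \<open>M\<close>.\<close>

definition gg_adj :: "'n garland_graph \<Rightarrow> nat + nat set \<Rightarrow> nat + nat set \<Rightarrow> bool"
  where "gg_adj \<Gamma> v w \<longleftrightarrow>
    (\<exists>e i. (e, i) \<in> gg_edges \<Gamma> \<and> (v = Inl i \<and> w = Inr e \<or> v = Inr e \<and> w = Inl i))"

definition gg_cycle :: "'n garland_graph \<Rightarrow> (nat + nat set) list \<Rightarrow> bool"
  where "gg_cycle \<Gamma> vs \<longleftrightarrow> 3 \<le> length vs \<and> distinct vs \<and>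
    (\<forall>k<length vs. gg_adj \<Gamma> (vs ! k) (vs ! (Suc k mod length vs)))"

definition allowed_graph :: "'n omanifold set \<Rightarrow> 'n garland_graph \<Rightarrow> bool"
  where "allowed_graph \<NN> \<Gamma> \<longleftrightarrow>
    set (gg_labels \<Gamma>) \<subseteq> \<NN> \<and>
    (\<forall>e\<in>gg_indices \<Gamma>. \<exists>a b. a < b \<and> b < gg_nu \<Gamma> \<and> e = {a, b}) \<and>
    (\<nexists>vs. gg_cycle \<Gamma> vs)"

text \<open>\<open>\<alpha> \<cdot> \<Gamma>\<close> for a permutation \<open>\<alpha>\<close> of \<open>{..<n}\<close>: vertex \<open>i\<close> gets the number \<open>\<alpha> i\<close>, i.e. the new
  vertex \<open>k\<close> carries the old label of \<open>inv_into UNIV \<alpha> k\<close>.\<close>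

definition gg_permute :: "nat \<Rightarrow> (nat \<Rightarrow> nat) \<Rightarrow> 'n garland_graph \<Rightarrow> 'n garland_graph"
  where "gg_permute n \<alpha> \<Gamma> =
    (if gg_nu \<Gamma> = n
     then \<lparr>gg_labels = permute_list (inv_into UNIV \<alpha>) (gg_labels \<Gamma>), gg_indices = (`) \<alpha> ` gg_indices \<Gamma>\<rparr>
     else \<Gamma>)"

definition gg_join :: "'n garland_graph \<Rightarrow> 'n garland_graph \<Rightarrow> 'n garland_graph"
  where "gg_join \<Gamma>1 \<Gamma>2 =
    \<lparr>gg_labels = gg_labels \<Gamma>1 @ gg_labels \<Gamma>2,
     gg_indices = gg_indices \<Gamma>1 \<union> (`) ((+) (gg_nu \<Gamma>1)) ` gg_indices \<Gamma>2\<rparr>"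

section \<open>Spaces of garlands\<close>

text \<open>The space \<open>C(X, Y)\<close> of continuous maps with the compact-open topology; maps are made extensional
  so that they are determined by their values on \<open>X\<close>.\<close>

definition compact_open_topology :: "'a topology \<Rightarrow> 'b topology \<Rightarrow> ('a \<Rightarrow> 'b) topology"
  where "compact_open_topology X Y = topology_generated_by
    {{f \<in> extensional (topspace X). continuous_map X Y f \<and> f ` K \<subseteq> U} | K U.
       compactin X K \<and> openin Y U}"

text \<open>A diagram is a pair \<open>(x, \<phi>)\<close>, \<open>x (e, i)\<close> being the image point in \<open>N\<^sub>i\<close> of the \<open>pt\<close>-vertex \<open>e\<close>.\<close>

type_synonym ('n, 'm) diagram = "(nat set \<times> nat \<Rightarrow> 'n) \<times> (nat \<Rightarrow> 'n \<Rightarrow> 'm)"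

definition garlands_of_type :: "'m omanifold \<Rightarrow> 'n garland_graph \<Rightarrow> ('n, 'm) diagram topology"
  where "garlands_of_type M \<Gamma> = subtopology
    (prod_topology
      (product_topology (\<lambda>(e, i). mf_top (gg_labels \<Gamma> ! i)) (gg_edges \<Gamma>))
      (product_topology (\<lambda>i. compact_open_topology (mf_top (gg_labels \<Gamma> ! i)) (mf_top M)) {..<gg_nu \<Gamma>}))
    {(x, \<phi>). \<forall>e\<in>gg_indices \<Gamma>. \<forall>a\<in>e. \<forall>b\<in>e. \<phi> a (x (e, a)) = \<phi> b (x (e, b))}"

type_synonym ('n, 'm) garland = "'n garland_graph \<times> ('n, 'm) diagram"

definition garlands :: "'n omanifold set \<Rightarrow> 'm omanifold \<Rightarrow> ('n, 'm) garland topology"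
  where "garlands \<NN> M = sum_topology (garlands_of_type M) {\<Gamma>. allowed_graph \<NN> \<Gamma>}"

text \<open>The auto-homeomorphism of the space of garlands given by a permutation \<open>\<alpha>\<close> of \<open>{..<n}\<close>.\<close>

definition garland_permute :: "nat \<Rightarrow> (nat \<Rightarrow> nat) \<Rightarrow> ('n, 'm) garland \<Rightarrow> ('n, 'm) garland"
  where "garland_permute n \<alpha> = (\<lambda>(\<Gamma>, (x, \<phi>)).
    if gg_nu \<Gamma> = n
    then (gg_permute n \<alpha> \<Gamma>,
          (restrict (\<lambda>(e, i). x (inv_into UNIV \<alpha> ` e, inv_into UNIV \<alpha> i)) (gg_edges (gg_permute n \<alpha> \<Gamma>)),
           restrict (\<lambda>i. \<phi> (inv_into UNIV \<alpha> i)) {..<n}))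
    else (\<Gamma>, (x, \<phi>)))"

definition diagram_join ::
    "'n garland_graph \<Rightarrow> 'n garland_graph \<Rightarrow> ('n, 'm) diagram \<Rightarrow> ('n, 'm) diagram \<Rightarrow> ('n, 'm) diagram"
  where "diagram_join \<Gamma>1 \<Gamma>2 = (\<lambda>(x1, \<phi>1) (x2, \<phi>2).
    (restrict (\<lambda>(e, i). if i < gg_nu \<Gamma>1 then x1 (e, i)
                        else x2 ((\<lambda>k. k - gg_nu \<Gamma>1) ` e, i - gg_nu \<Gamma>1))
       (gg_edges (gg_join \<Gamma>1 \<Gamma>2)),
     restrict (\<lambda>i. if i < gg_nu \<Gamma>1 then \<phi>1 i else \<phi>2 (i - gg_nu \<Gamma>1))
       {..<gg_nu \<Gamma>1 + gg_nu \<Gamma>2}))"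

section \<open>The operations \<open>C\<close> and \<open>\<star>\<close>\<close>

definition garland_C ::
    "'m omanifold \<Rightarrow> nat \<Rightarrow> nat \<Rightarrow> 'n garland_graph \<Rightarrow> 'n garland_graph \<Rightarrow>
     ('n, 'm) diagram bordism_class \<Rightarrow> ('n, 'm) diagram bordism_class \<Rightarrow> ('n, 'm) diagram bordism_class"
  where "garland_C M j1 j2 \<Gamma>1 \<Gamma>2 \<omega>1 \<omega>2 =
    (\<Union>(V1, f1)\<in>\<omega>1. \<Union>(V2, f2)\<in>\<omega>2.
       bclass (j1 + j2) (garlands_of_type M (gg_join \<Gamma>1 \<Gamma>2)) (mf_prod V1 V2)
         (\<lambda>(v1, v2). diagram_join \<Gamma>1 \<Gamma>2 (f1 v1) (f2 v2)))"

text \<open>The map on bordism induced by the inclusion of the garlands of type \<open>\<Gamma>\<close>.\<close>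

definition garland_incl ::
    "'n omanifold set \<Rightarrow> 'm omanifold \<Rightarrow> nat \<Rightarrow> 'n garland_graph \<Rightarrow>
     ('n, 'm) diagram bordism_class \<Rightarrow> ('n, 'm) garland bordism_class"
  where "garland_incl \<NN> M j \<Gamma> = bordism_push j (garlands \<NN> M) (Pair \<Gamma>)"

definition bordism_rat_bilinear ::
    "'y topology \<Rightarrow> ('y graded_bordism \<times> 'y graded_bordism \<Rightarrow> 'y graded_bordism) \<Rightarrow> bool"
  where "bordism_rat_bilinear Y S \<longleftrightarrow>
    S \<in> carrier (bordism_rat Y) \<times> carrier (bordism_rat Y) \<rightarrow>\<^sub>E carrier (bordism_rat Y) \<and>
    (\<forall>x\<in>carrier (bordism_rat Y). \<forall>y\<in>carrier (bordism_rat Y). \<forall>z\<in>carrier (bordism_rat Y).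
       S (x \<otimes>\<^bsub>bordism_rat Y\<^esub> y, z) = S (x, z) \<otimes>\<^bsub>bordism_rat Y\<^esub> S (y, z) \<and>
       S (x, y \<otimes>\<^bsub>bordism_rat Y\<^esub> z) = S (x, y) \<otimes>\<^bsub>bordism_rat Y\<^esub> S (x, z)) \<and>
    (\<forall>q. \<forall>x\<in>carrier (bordism_rat Y). \<forall>y\<in>carrier (bordism_rat Y).
       S (bordism_scale Y q x, y) = bordism_scale Y q (S (x, y)) \<and>
       S (x, bordism_scale Y q y) = bordism_scale Y q (S (x, y)))"

text \<open>The averaging formula on classes realized by maps of connected manifolds, together with bilinearity.
  The sum over the permutations is a \<^const>\<open>finprod\<close> in the multiplicative notation of
  HOL-Algebra.\<close>

definition is_garland_star ::
    "'n omanifold set \<Rightarrow> 'm omanifold \<Rightarrow>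
     (('n, 'm) garland graded_bordism \<times> ('n, 'm) garland graded_bordism \<Rightarrow> ('n, 'm) garland graded_bordism)
     \<Rightarrow> bool"
  where "is_garland_star \<NN> M S \<longleftrightarrow>
    bordism_rat_bilinear (garlands \<NN> M) S \<and>
    (\<forall>\<Gamma>1 \<Gamma>2 j1 j2 (V1 :: pts omanifold) f1 (V2 :: pts omanifold) f2.
       allowed_graph \<NN> \<Gamma>1 \<and> allowed_graph \<NN> \<Gamma>2 \<and>
       singular_manifold j1 (garlands_of_type M \<Gamma>1) V1 f1 \<and> connected_manifold V1 \<and>
       singular_manifold j2 (garlands_of_type M \<Gamma>2) V2 f2 \<and> connected_manifold V2 \<longrightarrow>
       (let Y = garlands \<NN> M; n = gg_nu \<Gamma>1 + gg_nu \<Gamma>2;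
            \<omega>1 = bclass j1 (garlands_of_type M \<Gamma>1) V1 f1;
            \<omega>2 = bclass j2 (garlands_of_type M \<Gamma>2) V2 f2;
            c = garland_incl \<NN> M (j1 + j2) (gg_join \<Gamma>1 \<Gamma>2) (garland_C M j1 j2 \<Gamma>1 \<Gamma>2 \<omega>1 \<omega>2)
        in S (bordism_rat_elt j1 Y (garland_incl \<NN> M j1 \<Gamma>1 \<omega>1),
              bordism_rat_elt j2 Y (garland_incl \<NN> M j2 \<Gamma>2 \<omega>2)) =
           bordism_scale Y (1 / fact n)
             (finprod (bordism_rat Y)
               (\<lambda>\<beta>. bordism_rat_elt (j1 + j2) Y
                      (bordism_push (j1 + j2) Y (garland_permute n \<beta>) c))
               {\<beta>. \<beta> permutes {..<n}})))"

definition garland_star ::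
    "'n omanifold set \<Rightarrow> 'm omanifold \<Rightarrow>
     ('n, 'm) garland graded_bordism \<Rightarrow> ('n, 'm) garland graded_bordism \<Rightarrow> ('n, 'm) garland graded_bordism"
  where "garland_star \<NN> M \<eta>1 \<eta>2 = (THE S. is_garland_star \<NN> M S) (\<eta>1, \<eta>2)"

end

theory Submission
  imports Defs
begin

text \<open>A bordism class of garlands is a sum of classes of maps of connected manifolds, and such a map has values in garlands of one
type \<open>\<Gamma>\<close>; rationally these classes are therefore generators. Joining diagrams is a continuous, strictly associative operation on
the space of garlands, so it induces an associative bilinear product on \<open>\<Omega>\<^sub>*(G)\<^sub>\<rat>\<close>. The product \<open>\<star>\<close> is obtained from it by averaging
over the renumberings of the \<open>N\<close>-vertices. The averaging operator \<open>A\<close> is linear, and \<open>A (A x \<cdot> y) = A (x \<cdot> y) = A (x \<cdot> A y)\<close>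
because renumbering one factor is a renumbering of the product; hence \<open>\<star>\<close> is associative. It is graded
commutative because interchanging the factors of a join is a renumbering, while interchanging the factors of \<open>V\<^sub>1 \<times> V\<^sub>2\<close> multiplies the
orientation by \<open>(-1)\<^sup>j\<^sup>k\<close>, and the cylinder shows that reversing the orientation negates a bordism class.\<close>

text \<open>Bordism has the form \<open>V + \<partial>W = V' + \<partial>W'\<close>, so that
  equivalence and compatibility with sums and products follow from formal identities between
  disjoint unions, without collars or gluing. What remains geometric concerns charts: boundaries
  must be oriented manifolds, and the cylinder and the interchange of factors must carry the right
  signs. Two obstacles shape the algebra. The product is specified only by bilinearity and its
  values on \<open>1\<omega>\<close> for connected manifolds, so existence and uniqueness have to be
  shown. And the symmetric group over which one averages depends on the number of N-vertices, which
  is no part of the grading of bordism. Hence \<open>average n\<close> is an operator on the whole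
  space for every \<open>n\<close>, trivial on garlands with another number of N-vertices, and
  symmetrization is the eventually constant composite of all these operators. Its properties are
  tested on generators, where identities between classes become pointwise identities between
  garlands. Scalars come for free, since additive maps of rational vector spaces are linear.\<close>

abbreviation "Eucl \<equiv> Euclidean_space"
abbreviation "omanif \<equiv> oriented_manifold"
abbreviation "diagrams \<equiv> garlands_of_type"
abbreviation "Om j Y \<equiv> carrier (bordism_group j Y)"
abbreviation "rOm j Y \<equiv> rat_tensor (bordism_group j Y)"
abbreviation "OmQ Y \<equiv> carrier (bordism_rat Y)"

section \<open>Calculus on Euclidean spaces\<close>

abbreviation Eu :: "nat => (nat => real) set"
 where "Eu n \<equiv> topspace (Eucl n)"

text \<open>Boxes around \<open>x\<close> serve as a neighbourhood base of
  \<open>\<real>\<^sup>n\<close>. Only the first \<open>n\<close> coordinates are bounded, since the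
  others vanish on \<open>Eu n\<close>.\<close>

definition cube :: "nat => (nat => real) => real => (nat => real) set"
 where "cube n x e = {y \<in> Eu n. \<forall>i<n. \<bar>y i - x i\<bar> < e}"

lemma Eu_iff: "x \<in> Eu n \<longleftrightarrow> (\<forall>i\<ge>n. x i = 0)"
 by (auto simp: topspace_Euclidean_space)

lemma cont_coord: "continuous_map (Eucl n) euclideanreal (\<lambda>x. x i)"
 unfolding Euclidean_space_def
 by (intro continuous_map_from_subtopology continuous_map_product_projection) auto

lemma openin_cube: "openin (Eucl n) (cube n x e)"
proof -
 have "cube n x e = Eu n \<inter> (\<Inter>i\<in>{..<n}. {y \<in> Eu n. y i \<in> {x i - e<..<x i + e}})"
  by (auto simp: cube_def abs_diff_less_iff)
 moreover have "openin (Eucl n) (Eu n \<inter> (\<Inter>i\<in>{..<n}. {y \<in> Eu n. y i \<in> {x i - e<..<x i + e}}))"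
 proof (rule openin_Int_Inter)
  fix S assume "S \<in> (\<lambda>i. {y \<in> Eu n. y i \<in> {x i - e<..<x i + e}}) ` {..<n}"
  then obtain i where "S = {y \<in> Eu n. y i \<in> {x i - e<..<x i + e}}" by blast
  thus "openin (Eucl n) S"
   using openin_continuous_map_preimage[OF cont_coord,of "{x i - e<..<x i + e}" n i]
   by (simp only: open_openin[symmetric] open_greaterThanLessThan simp_thms)
 qed auto
 ultimately show ?thesis by simp
qed

text \<open>A basic open set of the product topology constrains finitely many coordinates, so the
  smallest of finitely many radii gives a cube. The coordinates from \<open>n\<close> on cause no
  trouble because both points vanish there.\<close>

lemma openin_cube_iff:
 "openin (Eucl n) U \<longleftrightarrow> U \<subseteq> Eu n \<and> (\<forall>x\<in>U. \<exists>e>0. cube n x e \<subseteq> U)"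
proof (intro iffI conjI ballI)
 assume U: "openin (Eucl n) U"
 thus "U \<subseteq> Eu n" by (rule openin_subset)
 fix x assume x: "x \<in> U"
 obtain T where T: "openin (powertop_real UNIV) T" and UT: "U = T \<inter> {x. \<forall>i\<ge>n. x i = 0}"
  using U unfolding Euclidean_space_def openin_subtopology by blast
 obtain V where fin: "finite {i. V i \<noteq> (UNIV::real set)}" and op: "!!i. open (V i)"
  and xV: "!!i. x i \<in> V i" and VT: "!!y. (\<forall>i. y i \<in> V i) ==> y \<in> T"
  using T x unfolding UT openin_product_topology_alt by (force simp: PiE_iff)
 have "\<forall>i. \<exists>e>0. \<forall>s. \<bar>s - x i\<bar> < e \<longrightarrow> s \<in> V i"
  using op xV by (metis dist_real_def open_dist)
 then obtain e where e: "!!i. e i > 0" "!!i s. \<bar>s - x i\<bar> < e i ==> s \<in> V i" by metis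
 \<comment> \<open>The entry \<open>1\<close> keeps the set nonempty, and hence the minimum
   meaningful, when no coordinate is constrained.\<close>
 define d where "d = Min (insert 1 (e ` {i. V i \<noteq> UNIV}))"
 have "d > 0" unfolding d_def using fin e by auto
 moreover have "cube n x d \<subseteq> U"
 proof
  fix y assume y: "y \<in> cube n x d"
  have "y i \<in> V i" for i
  proof (cases "V i = UNIV")
   case False
   hence "d \<le> e i" unfolding d_def using fin by (intro Min_le) auto
   moreover have "\<bar>y i - x i\<bar> < d"
    using y x \<open>d > 0\<close> unfolding cube_def UT Eu_iff by (cases "i < n") auto
   ultimately show ?thesis using e(2)[of "y i" i] by linarith
  qed auto
  thus "y \<in> U" using VT y unfolding UT cube_def Eu_iff by auto
 qed
 ultimately show "\<exists>e>0. cube n x e \<subseteq> U" by blast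
next
 assume A: "U \<subseteq> Eu n \<and> (\<forall>x\<in>U. \<exists>e>0. cube n x e \<subseteq> U)"
 show "openin (Eucl n) U"
 proof (subst openin_subopen,intro ballI)
  fix x assume "x \<in> U"
  then obtain e where "e > 0" "cube n x e \<subseteq> U" using A by blast
  moreover have "x \<in> cube n x e" using \<open>x \<in> U\<close> A \<open>e > 0\<close> by (auto simp: cube_def)
  ultimately show "\<exists>T. openin (Eucl n) T \<and> x \<in> T \<and> T \<subseteq> U" using openin_cube by blast
 qed
qed

lemma cont_cube:
 assumes U: "openin (Eucl n) U" and x: "x \<in> U"
  and f: "continuous_map (subtopology (Eucl n) U) euclideanreal f" and e: "e > 0"
 shows "\<exists>d>0. cube n x d \<subseteq> U \<and> (\<forall>y\<in>cube n x d. \<bar>f y - f x\<bar> < e)"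
proof -
 have "openin (subtopology (Eucl n) U)
   {y \<in> topspace (subtopology (Eucl n) U). f y \<in> {f x - e<..<f x + e}}"
  by (rule openin_continuous_map_preimage[OF f]) auto
 hence "openin (Eucl n) {y \<in> topspace (subtopology (Eucl n) U). f y \<in> {f x - e<..<f x + e}}"
  using U openin_trans_full by blast
 moreover have "x \<in> {y \<in> topspace (subtopology (Eucl n) U). f y \<in> {f x - e<..<f x + e}}"
  using x e openin_subset[OF U] by auto
 ultimately obtain d where d: "d > 0" "cube n x d \<subseteq> {y \<in> topspace (subtopology (Eucl n) U). f y \<in> {f x - e<..<f x + e}}"
  unfolding openin_cube_iff by blast
 thus ?thesis by (intro exI[of _ d]) (auto simp: abs_less_iff)
qed

section \<open>Differentiation along coordinate lines and curves\<close>

lemma open_line: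
 assumes U: "openin (Eucl n) U" and k: "k < n"
 shows "open {t. x(k := t) \<in> U}"
 unfolding open_dist
proof (intro ballI)
 fix t assume "t \<in> {t. x(k := t) \<in> U}"
 hence t: "x(k := t) \<in> U" by simp
 then obtain e where e: "e > 0" "cube n (x(k := t)) e \<subseteq> U"
  using U unfolding openin_cube_iff by blast
 have xE: "x(k := t) \<in> Eu n" using t openin_subset[OF U] by blast
 show "\<exists>e>0. \<forall>y. dist y t < e \<longrightarrow> y \<in> {t. x(k := t) \<in> U}"
 proof (intro exI[of _ e] conjI allI impI e)
  fix y assume y: "dist y t < e"
  hence "x(k := y) \<in> cube n (x(k := t)) e"
   using xE k e(1) by (auto simp: cube_def Eu_iff dist_real_def)
  thus "y \<in> {t. x(k := t) \<in> U}" using e by blast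
 qed
qed

text \<open>Going from \<open>y\<close> to \<open>z\<close> one coordinate at a time, the increments
  of \<open>g\<close> telescope. By the mean value theorem each difference quotient
  \<open>q k z\<close> is a value of the partial derivative \<open>d k\<close> at a nearby point, so
  continuity of \<open>d k\<close> makes \<open>q k z\<close> tend to \<open>d k y\<close>. This is
  Caratheodory's form of differentiability; it avoids total derivatives on a space of varying
  dimension.\<close>

lemma caratheodory_partial:
 assumes U: "openin (Eucl m) U" and y: "y \<in> U"
  and d: "!!k x. k < m ==> x \<in> U ==> ((\<lambda>t. g (x(k := t))) has_real_derivative d k x) (at (x k))"
  and c: "!!k. k < m ==> continuous_map (subtopology (Eucl m) U) euclideanreal (d k)"
 obtains q r where "r > 0"
  "!!z. z \<in> cube m y r ==> g z - g y = (\<Sum>k<m. q k z * (z k - y k))"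
  "!!k e. k < m ==> e > 0 ==> \<exists>s>0. \<forall>z\<in>cube m y s. \<bar>q k z - d k y\<bar> < e"
proof -
 \<comment> \<open>\<open>p k z\<close> is the k-th corner of the path: its first \<open>k\<close>
   coordinates are already those of \<open>z\<close>.\<close>
 define p where "p k z = (\<lambda>i. if i < k then z i else y i)" for k :: nat and z
 \<comment> \<open>At a vanishing denominator the increment is 0 as well, so any value would do
   there; the limit is chosen to let \<open>q k z\<close> tend to \<open>d k y\<close>.\<close>
 define q where "q k z = (if z k = y k then d k y else (g (p (Suc k) z) - g (p k z)) / (z k - y k))" for k z
 have yE: "y \<in> Eu m" using y openin_subset[OF U] by blast
 obtain r where r: "r > 0" "cube m y r \<subseteq> U"
  using U y unfolding openin_cube_iff by blast
 have seg: "(p k z)(k := t) \<in> cube m y s"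
  if "z \<in> cube m y s" "k < m" "\<bar>t - y k\<bar> \<le> \<bar>z k - y k\<bar>" "s > 0" for k z s t
  using that yE unfolding cube_def Eu_iff p_def by (fastforce simp: )
 have val: "\<exists>w\<in>cube m y s. q k z = d k w" if z: "z \<in> cube m y s" "k < m" "s > 0" "s \<le> r" for k z s
 proof -
  have pk: "p k z = (p k z)(k := y k)" "p (Suc k) z = (p k z)(k := z k)"
   by (auto simp: p_def fun_eq_iff less_Suc_eq)
  have D: "((\<lambda>t. g ((p k z)(k := t))) has_real_derivative d k ((p k z)(k := t))) (at t)"
   if "\<bar>t - y k\<bar> \<le> \<bar>z k - y k\<bar>" for t
  proof -
   have "(p k z)(k := t) \<in> U"
    using seg[OF z(1,2) that z(3)] r(2) z(4) by (force simp: cube_def)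
   from d[OF z(2) this] show ?thesis by simp
  qed
  consider "z k = y k" | "y k < z k" | "z k < y k" by linarith
  thus ?thesis
  proof cases
   case 1
   thus ?thesis using z yE by (intro bexI[of _ y]) (auto simp: q_def cube_def)
  next
   case 2
   have "\<exists>t>y k. t < z k \<and> g ((p k z)(k := z k)) - g ((p k z)(k := y k)) = (z k - y k) * d k ((p k z)(k := t))"
    by (rule MVT2[OF 2]) (rule D,use 2 in auto)
   then obtain t where t: "y k < t" "t < z k" "g (p (Suc k) z) - g (p k z) = (z k - y k) * d k ((p k z)(k := t))"
    using pk by metis
   hence "q k z = d k ((p k z)(k := t))" using 2 by (simp add: q_def)
   moreover have "(p k z)(k := t) \<in> cube m y s" by (rule seg) (use z t in auto)
   ultimately show ?thesis by blast
  next
   case 3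
   have "\<exists>t>z k. t < y k \<and> g ((p k z)(k := y k)) - g ((p k z)(k := z k)) = (y k - z k) * d k ((p k z)(k := t))"
    by (rule MVT2[OF 3]) (rule D,use 3 in auto)
   then obtain t where t: "z k < t" "t < y k" "g (p k z) - g (p (Suc k) z) = (y k - z k) * d k ((p k z)(k := t))"
    using pk by metis
   hence "q k z = d k ((p k z)(k := t))" using 3 by (simp add: q_def field_simps)
   moreover have "(p k z)(k := t) \<in> cube m y s" by (rule seg) (use z t in auto)
   ultimately show ?thesis by blast
  qed
 qed
 show ?thesis
 proof
  show "r > 0" by fact
  fix z assume z: "z \<in> cube m y r"
  have "(\<Sum>k<m. q k z * (z k - y k)) = (\<Sum>k<m. g (p (Suc k) z) - g (p k z))"
  proof (rule sum.cong[OF refl])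
   fix k
   have "p (Suc k) z = p k z" if "z k = y k"
    using that by (auto simp: p_def fun_eq_iff less_Suc_eq)
   thus "q k z * (z k - y k) = g (p (Suc k) z) - g (p k z)" by (auto simp: q_def)
  qed
  also have "\<dots> = g (p m z) - g (p 0 z)" by (rule sum_lessThan_telescope)
  also have "p m z = z" using z yE unfolding p_def cube_def Eu_iff by auto
  also have "p 0 z = y" by (auto simp: p_def)
  finally show "g z - g y = (\<Sum>k<m. q k z * (z k - y k))" by simp
 next
  fix k and e :: real assume k: "k < m" and e: "e > 0"
  obtain s where s: "s > 0" "\<forall>w\<in>cube m y s. \<bar>d k w - d k y\<bar> < e"
   using cont_cube[OF U y c[OF k] e] by blast
  have "\<bar>q k z - d k y\<bar> < e" if z: "z \<in> cube m y (min s r)" for z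
   using val[OF z k] s r by (force simp: cube_def)
  thus "\<exists>s>0. \<forall>z\<in>cube m y s. \<bar>q k z - d k y\<bar> < e"
   using s r by (intro exI[of _ "min s r"]) auto
 qed
qed

lemma curve_eventually_in:
 assumes U: "openin (Eucl m) U" and y: "y \<in> U"
  and lim: "!!j. j < m ==> ((\<lambda>t. \<gamma> t j) \<longlongrightarrow> y j) F" and E: "eventually (\<lambda>t. \<gamma> t \<in> Eu m) F"
 shows "eventually (\<lambda>t. \<gamma> t \<in> U) F"
proof -
 obtain e where e: "e > 0" "cube m y e \<subseteq> U" using U y unfolding openin_cube_iff by blast
 have "eventually (\<lambda>t. \<forall>j\<in>{..<m}. dist (\<gamma> t j) (y j) < e) F"
  by (rule eventually_ball_finite) (use lim e in "auto intro: tendstoD")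
 with E show ?thesis
  by eventually_elim (use e in "auto simp: cube_def dist_real_def")
qed

text \<open>Dividing the identity of \<open>caratheodory_partial\<close> at
  \<open>z = \<gamma> t\<close> by \<open>t - s\<close> leaves the difference quotients of the
  components of \<open>\<gamma>\<close>, weighted by coefficients that tend to the partial
  derivatives of \<open>g\<close>.\<close>

lemma deriv_along_curve:
 assumes U: "openin (Eucl m) U" and y: "y \<in> U"
  and d: "!!k x. k < m ==> x \<in> U ==> ((\<lambda>t. g (x(k := t))) has_real_derivative d k x) (at (x k))"
  and c: "!!k. k < m ==> continuous_map (subtopology (Eucl m) U) euclideanreal (d k)"
  and s: "\<gamma> s = y" and v: "!!j. j < m ==> ((\<lambda>t. \<gamma> t j) has_real_derivative v j) (at s)"
  and E: "eventually (\<lambda>t. \<gamma> t \<in> Eu m) (at s)"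
 shows "((\<lambda>t. g (\<gamma> t)) has_real_derivative (\<Sum>j<m. d j y * v j)) (at s)"
proof -
 obtain q r where r: "r > 0"
  and q: "!!z. z \<in> cube m y r ==> g z - g y = (\<Sum>k<m. q k z * (z k - y k))"
  and lq: "!!k e. k < m ==> e > 0 ==> \<exists>s>0. \<forall>z\<in>cube m y s. \<bar>q k z - d k y\<bar> < e"
  by (rule caratheodory_partial[OF U y d c]) auto
 have yE: "y \<in> Eu m" using y openin_subset[OF U] by blast
 have lim: "((\<lambda>t. \<gamma> t j) \<longlongrightarrow> y j) (at s)" if "j < m" for j
  using DERIV_isCont[OF v[OF that]] s by (simp add: isCont_def)
 have ev: "eventually (\<lambda>t. \<gamma> t \<in> cube m y e) (at s)" if "e > 0" for e
  by (rule curve_eventually_in[OF openin_cube _ lim E]) (use yE that in "auto simp: cube_def")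
 have ql: "((\<lambda>t. q j (\<gamma> t)) \<longlongrightarrow> d j y) (at s)" if j: "j < m" for j
 proof (rule tendstoI)
  fix e :: real assume "e > 0"
  then obtain \<delta> where \<delta>: "\<delta> > 0" "\<forall>z\<in>cube m y \<delta>. \<bar>q j z - d j y\<bar> < e" using lq[OF j] by blast
  show "eventually (\<lambda>t. dist (q j (\<gamma> t)) (d j y) < e) (at s)"
   using ev[OF \<delta>(1)] by eventually_elim (use \<delta> in "auto simp: dist_real_def")
 qed
 have "((\<lambda>t. \<Sum>j<m. q j (\<gamma> t) * ((\<gamma> t j - \<gamma> s j) / (t - s))) \<longlongrightarrow> (\<Sum>j<m. d j y * v j)) (at s)"
  by (intro tendsto_sum tendsto_mult ql) (use v in "auto simp: has_field_derivative_iff")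
 moreover have "eventually (\<lambda>t. (\<Sum>j<m. q j (\<gamma> t) * ((\<gamma> t j - \<gamma> s j) / (t - s))) = (g (\<gamma> t) - g (\<gamma> s)) / (t - s)) (at s)"
  using ev[OF r]
 proof eventually_elim
  case (elim t)
  show ?case using q[OF elim] s by (simp add: sum_divide_distrib)
 qed
 ultimately show ?thesis
  unfolding has_field_derivative_iff by (rule Lim_transform_eventually)
qed

subsection \<open>Functions of class C\<close>

lemma Ck_continuous: "Ck k n U f ==> continuous_map (subtopology (Eucl n) U) euclideanreal f"
 by (cases k) auto

lemma Ck_SucD: "Ck (Suc k) n U f ==> Ck k n U f"
proof (induction k arbitrary: f)
 case (Suc k)
 from Suc.prems obtain g where "continuous_map (subtopology (Eucl n) U) euclideanreal f"
  and g: "\<forall>i<n. (\<forall>x\<in>U. ((\<lambda>t. f (x(i := t))) has_real_derivative g i x) (at (x i))) \<and> Ck (Suc k) n U (g i)"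
  by (subst (asm) Ck.simps(2)) blast
 thus ?case using Suc.IH by (subst Ck.simps(2)) blast
qed simp

lemma Ck_subset: "Ck k n U f ==> U' \<subseteq> U ==> Ck k n U' f"
proof (induction k arbitrary: f)
 case 0
 thus ?case by (auto intro: continuous_map_from_subtopology_mono)
next
 case (Suc k)
 from Suc.prems obtain g where "continuous_map (subtopology (Eucl n) U) euclideanreal f"
  and g: "\<forall>i<n. (\<forall>x\<in>U. ((\<lambda>t. f (x(i := t))) has_real_derivative g i x) (at (x i))) \<and> Ck k n U (g i)"
  by auto
 hence "continuous_map (subtopology (Eucl n) U') euclideanreal f"
  using Suc.prems(2) by (auto intro: continuous_map_from_subtopology_mono)
 moreover have "\<forall>i<n. (\<forall>x\<in>U'. ((\<lambda>t. f (x(i := t))) has_real_derivative g i x) (at (x i))) \<and> Ck k n U' (g i)"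
  using g Suc by blast
 ultimately show ?case by auto
qed

lemma has_derivative_coordinate_cong:
 assumes U: "openin (Eucl n) U" and x: "x \<in> U" and k: "k < n" and eq: "!!y. y \<in> U ==> f y = f' y"
  and D: "((\<lambda>t. f (x(k := t))) has_real_derivative d) (at (x k))"
 shows "((\<lambda>t. f' (x(k := t))) has_real_derivative d) (at (x k))"
 by (rule has_field_derivative_transform_within_open[OF D open_line[OF U k]]) (use x eq in auto)

lemma Ck_const: "Ck k n U (\<lambda>x. c)"
proof (induction k arbitrary: c)
 case (Suc k)
 have "\<forall>i<n. (\<forall>x\<in>U. ((\<lambda>t. c) has_real_derivative 0) (at (x i))) \<and> Ck k n U (\<lambda>x. 0)"
  using Suc by auto
 thus ?case by (auto intro!: exI[of _ "\<lambda>i x. 0"])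
qed auto

lemma Ck_coordinate: "Ck k n U (\<lambda>x. x j)"
proof -
 have c: "continuous_map (subtopology (Eucl n) U) euclideanreal (\<lambda>x. x j)"
  by (intro continuous_map_from_subtopology cont_coord)
 show ?thesis
 proof (cases k)
  case (Suc l)
  have "((\<lambda>t. (x(i := t)) j) has_real_derivative (if i = j then 1 else 0)) (at (x i))" for i and x :: "nat => real"
   by (cases "i = j") auto
  thus ?thesis using Suc c by (auto intro!: exI[of _ "\<lambda>i x. if i = j then 1 else 0"] Ck_const)
 qed (use c in simp)
qed

lemma Ck_add: "Ck k n U f ==> Ck k n U g ==> Ck k n U (\<lambda>x. f x + g x)"
proof (induction k arbitrary: f g)
 case 0
 thus ?case by (auto intro: continuous_map_add)
next
 case (Suc k)
 from Suc.prems(1) obtain f' where f: "continuous_map (subtopology (Eucl n) U) euclideanreal f"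
  "!!i. i<n ==> (\<forall>x\<in>U. ((\<lambda>t. f (x(i := t))) has_real_derivative f' i x) (at (x i))) \<and> Ck k n U (f' i)"
  by auto
 from Suc.prems(2) obtain g' where g: "continuous_map (subtopology (Eucl n) U) euclideanreal g"
  "!!i. i<n ==> (\<forall>x\<in>U. ((\<lambda>t. g (x(i := t))) has_real_derivative g' i x) (at (x i))) \<and> Ck k n U (g' i)"
  by auto
 have "\<forall>i<n. (\<forall>x\<in>U. ((\<lambda>t. f (x(i := t)) + g (x(i := t))) has_real_derivative f' i x + g' i x) (at (x i)))
   \<and> Ck k n U (\<lambda>x. f' i x + g' i x)"
  using f(2) g(2) Suc.IH by (auto intro!: DERIV_add)
 thus ?case using f(1) g(1) by (auto intro!: continuous_map_add exI[of _ "\<lambda>i x. f' i x + g' i x"])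
qed

lemma Ck_mult: "Ck k n U f ==> Ck k n U g ==> Ck k n U (\<lambda>x. f x * g x)"
proof (induction k arbitrary: f g)
 case 0
 thus ?case by (auto intro: continuous_map_real_mult)
next
 case (Suc k)
 from Suc.prems(1) obtain f' where f: "continuous_map (subtopology (Eucl n) U) euclideanreal f"
  "!!i. i<n ==> (\<forall>x\<in>U. ((\<lambda>t. f (x(i := t))) has_real_derivative f' i x) (at (x i))) \<and> Ck k n U (f' i)"
  by auto
 from Suc.prems(2) obtain g' where g: "continuous_map (subtopology (Eucl n) U) euclideanreal g"
  "!!i. i<n ==> (\<forall>x\<in>U. ((\<lambda>t. g (x(i := t))) has_real_derivative g' i x) (at (x i))) \<and> Ck k n U (g' i)"
  by auto
 have "((\<lambda>t. f (x(i := t)) * g (x(i := t))) has_real_derivative f' i x * g x + g' i x * f x) (at (x i))"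
  if "i < n" "x \<in> U" for i x
  using DERIV_mult[OF f(2)[OF that(1),THEN conjunct1,rule_format,OF that(2)]
    g(2)[OF that(1),THEN conjunct1,rule_format,OF that(2)]] by simp
 moreover have "Ck k n U (\<lambda>x. f' i x * g x + g' i x * f x)" if "i < n" for i
  by (intro Ck_add Suc.IH) (use f(2)[OF that] g(2)[OF that] Suc.prems Ck_SucD in auto)
 ultimately show ?case using f(1) g(1)
  by (auto intro!: continuous_map_real_mult exI[of _ "\<lambda>i x. f' i x * g x + g' i x * f x"])
qed

lemma Ck_sum: "finite I ==> (!!i. i \<in> I ==> Ck k n U (f i)) ==> Ck k n U (\<lambda>x. \<Sum>i\<in>I. f i x)"
 by (induction I rule: finite_induct) (auto intro: Ck_const Ck_add)

text \<open>Induction on \<open>k\<close>: the chain rule along a coordinate line gives the partial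
  derivatives as sums of products, and these are of class \<open>k\<close> by the induction
  hypothesis applied to the partials of \<open>g\<close>. The coordinates from \<open>m\<close> on
  are set to 0 so that the inner map has values in \<open>\<real>\<^sup>m\<close>.\<close>

lemma Ck_compose:
 assumes U: "openin (Eucl n) U" and U': "openin (Eucl m) U'"
  and F: "!!j. j < m ==> Ck k n U (F j)"
  and FU: "!!x. x \<in> U ==> (\<lambda>j. if j < m then F j x else 0) \<in> U'"
  and g: "Ck k m U' g"
 shows "Ck k n U (\<lambda>x. g (\<lambda>j. if j < m then F j x else 0))"
proof -
 have cF: "continuous_map (subtopology (Eucl n) U) (subtopology (Eucl m) U') (\<lambda>x j. if j < m then F j x else 0)"
  if "!!j. j < m ==> continuous_map (subtopology (Eucl n) U) euclideanreal (F j)"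
  unfolding continuous_map_in_subtopology using that FU
  by (auto simp: continuous_map_componentwise_Euclidean_space[where f = "\<lambda>x j. F j x"])
 show ?thesis
  using F g
 proof (induction k arbitrary: g)
  case 0
  thus ?case
   using continuous_map_compose[OF cF,of euclideanreal g] by (simp add: o_def)
 next
  case (Suc k)
  let ?F = "\<lambda>x j. if j < m then F j x else 0"
  obtain d where cg: "continuous_map (subtopology (Eucl m) U') euclideanreal g"
   and d: "!!i. i<m ==> (\<forall>x\<in>U'. ((\<lambda>t. g (x(i := t))) has_real_derivative d i x) (at (x i))) \<and> Ck k m U' (d i)"
   using Suc.prems(2) by auto
  have "\<forall>j. \<exists>f'. j < m \<longrightarrow> (\<forall>i<n. (\<forall>x\<in>U. ((\<lambda>t. F j (x(i := t))) has_real_derivative f' i x) (at (x i))) \<and> Ck k n U (f' i))"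
   using Suc.prems(1) by auto
  then obtain f' where f': "!!j i. j < m ==> i<n ==> (\<forall>x\<in>U. ((\<lambda>t. F j (x(i := t))) has_real_derivative f' j i x) (at (x i))) \<and> Ck k n U (f' j i)"
   by metis
  have "((\<lambda>t. g (?F (x(i := t)))) has_real_derivative (\<Sum>j<m. d j (?F x) * f' j i x)) (at (x i))"
   if i: "i < n" and x: "x \<in> U" for i x
  proof (rule deriv_along_curve[OF U',where y = "?F x" and g = g and d = d and s = "x i" and \<gamma> = "\<lambda>t. ?F (x(i := t))"])
   show "?F x \<in> U'" using FU[OF x] .
   show "?F (x(i := x i)) = ?F x" by (simp only: fun_upd_triv)
   show "\<forall>\<^sub>F t in at (x i). ?F (x(i := t)) \<in> Eu m" by (auto simp: Eu_iff)
   show "((\<lambda>t. ?F (x(i := t)) j) has_real_derivative f' j i x) (at (x i))" if "j < m" for j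
    using f'[OF that i] x that by auto
  qed (use d Ck_continuous[of k m U'] in auto)
  moreover have "Ck k n U (\<lambda>x. \<Sum>j<m. d j (?F x) * f' j i x)" if i: "i < n" for i
   by (intro Ck_sum Ck_mult Suc.IH) (use Suc.prems(1) d f' i in "auto simp del: Ck.simps intro: Ck_SucD")
  moreover have "continuous_map (subtopology (Eucl n) U) euclideanreal (\<lambda>x. g (?F x))"
   using continuous_map_compose[OF cF cg] Suc.prems(1) by (auto simp: o_def)
  ultimately show ?case
   by (auto intro!: exI[of _ "\<lambda>i x. \<Sum>j<m. d j (?F x) * f' j i x"])
 qed
qed

subsection \<open>Smooth maps and Jacobians\<close>

lemma smooth_on_empty [simp]: "smooth_on n m {} F"
 by (simp add: smooth_on_def)

lemma smooth_on_subset: "smooth_on n m S F ==> T \<subseteq> S ==> smooth_on n m T F"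
 unfolding smooth_on_def
proof (intro allI impI ballI)
 fix i x assume A: "\<forall>i<m. \<forall>x\<in>S. \<exists>U g. openin (Eucl n) U \<and> x \<in> U \<and> (\<forall>k. Ck k n U g) \<and> (\<forall>y\<in>S \<inter> U. g y = F y i)"
  and T: "T \<subseteq> S" and i: "i < m" and x: "x \<in> T"
 obtain U g where "openin (Eucl n) U" "x \<in> U" "\<forall>k. Ck k n U g" "\<forall>y\<in>S \<inter> U. g y = F y i"
  using A[rule_format,OF i subsetD[OF T x]] by blast
 thus "\<exists>U g. openin (Eucl n) U \<and> x \<in> U \<and> (\<forall>k. Ck k n U g) \<and> (\<forall>y\<in>T \<inter> U. g y = F y i)"
  using T by (intro exI[of _ U] exI[of _ g]) auto
qed

lemma smooth_on_cong: "smooth_on n m S F ==> (!!x. x \<in> S ==> F x = G x) ==> smooth_on n m S G"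
 unfolding smooth_on_def by (metis IntD1)

lemma smooth_on_local:
 assumes "!!x. x \<in> S ==> \<exists>U. openin (Eucl n) U \<and> x \<in> U \<and> smooth_on n m (S \<inter> U) F"
 shows "smooth_on n m S F"
 unfolding smooth_on_def
proof (intro allI impI ballI)
 fix i x assume i: "i < m" and x: "x \<in> S"
 obtain U where U: "openin (Eucl n) U" "x \<in> U" "smooth_on n m (S \<inter> U) F" using assms x by blast
 then obtain V g where V: "openin (Eucl n) V" "x \<in> V" "\<forall>k. Ck k n V g" "\<forall>y\<in>(S \<inter> U) \<inter> V. g y = F y i"
  unfolding smooth_on_def using i x by (meson IntI)
 show "\<exists>U g. openin (Eucl n) U \<and> x \<in> U \<and> (\<forall>k. Ck k n U g) \<and> (\<forall>y\<in>S \<inter> U. g y = F y i)"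
  by (rule exI[of _ "U \<inter> V"],rule exI[of _ g]) (use U V Ck_subset[OF V(3)[rule_format]] in auto)
qed

text \<open>For maps that drop, insert or interchange coordinates: \<open>\<sigma> i\<close> is the
  source of the i-th component, and the required extension is a coordinate function on all of
  \<open>\<real>\<^sup>n\<close>.\<close>

lemma smooth_on_coordinates:
 assumes S: "S \<subseteq> Eu n" and F: "!!i x. i < m ==> x \<in> S ==> F x i = x (\<sigma> i)"
 shows "smooth_on n m S F"
 unfolding smooth_on_def
proof (intro allI impI ballI)
 fix i x assume i: "i < m" and x: "x \<in> S"
 thus "\<exists>U g. openin (Eucl n) U \<and> x \<in> U \<and> (\<forall>k. Ck k n U g) \<and> (\<forall>y\<in>S \<inter> U. g y = F y i)"
  using S F by (intro exI[of _ "Eu n"] exI[of _ "\<lambda>y. y (\<sigma> i)"]) (auto intro: Ck_coordinate)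
qed

lemma smooth_on_componentwise:
 "smooth_on n m S F \<longleftrightarrow> (\<forall>i<m. smooth_on n 1 S (\<lambda>x j. F x i))"
 by (simp add: smooth_on_def)

text \<open>Smoothness means local extendability. The components of \<open>F\<close> are first
  extended to a common neighbourhood \<open>U0\<close> of \<open>x\<close>, which is then shrunk to
  \<open>U1\<close>, where the extended map lands in the domain of an extension of
  \<open>G\<close>.\<close>

lemma smooth_on_compose:
 assumes F: "smooth_on n m S F" and G: "smooth_on m l T G"
  and S: "S \<subseteq> Eu n" and FS: "!!x. x \<in> S ==> F x \<in> T" and T: "T \<subseteq> Eu m"
 shows "smooth_on n l S (\<lambda>x. G (F x))"
 unfolding smooth_on_def
proof (intro allI impI ballI)
 fix i x assume i: "i < l" and x: "x \<in> S"
 obtain U' g where U': "openin (Eucl m) U'" "F x \<in> U'" "!!k. Ck k m U' g" "!!y. y\<in>T \<inter> U' ==> g y = G y i"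
  using G[unfolded smooth_on_def,rule_format,OF i FS[OF x]] by blast
 have "\<forall>j. \<exists>U f. j < m \<longrightarrow> openin (Eucl n) U \<and> x \<in> U \<and> (\<forall>k. Ck k n U f) \<and> (\<forall>y\<in>S \<inter> U. f y = F y j)"
 proof
  fix j
  show "\<exists>U f. j < m \<longrightarrow> openin (Eucl n) U \<and> x \<in> U \<and> (\<forall>k. Ck k n U f) \<and> (\<forall>y\<in>S \<inter> U. f y = F y j)"
  proof (cases "j < m")
   case True
   from F[unfolded smooth_on_def,rule_format,OF True x] show ?thesis by blast
  qed auto
 qed
 then obtain U f where U: "!!j. j < m ==> openin (Eucl n) (U j) \<and> x \<in> U j \<and> (\<forall>k. Ck k n (U j) (f j)) \<and> (\<forall>y\<in>S \<inter> U j. f j y = F y j)"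
  by metis
 define U0 where "U0 = Eu n \<inter> (\<Inter>j\<in>{..<m}. U j)"
 have U0: "openin (Eucl n) U0"
  unfolding U0_def by (rule openin_Int_Inter) (use U in auto)
 have xU0: "x \<in> U0" using U x S by (auto simp: U0_def)
 let ?F = "\<lambda>y j. if j < m then f j y else 0"
 have Ckf: "Ck k n U0 (f j)" if "j < m" for j k
  using U[OF that] by (rule_tac Ck_subset[where U = "U j"]) (auto simp: U0_def that)
 have FF: "?F y = F y" if "y \<in> S \<inter> U0" for y
 proof
  fix j
  have "F y \<in> Eu m" using FS T that by blast
  thus "?F y j = F y j" using U[of j] that by (auto simp: Eu_iff U0_def)
 qed
 have cF: "continuous_map (subtopology (Eucl n) U0) (Eucl m) ?F"
  by (subst continuous_map_componentwise_Euclidean_space[where f = "\<lambda>x j. f j x"])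
    (use Ck_continuous[OF Ckf[of _ 0]] in auto)
 define U1 where "U1 = {y \<in> U0. ?F y \<in> U'}"
 have "openin (subtopology (Eucl n) U0) {y \<in> topspace (subtopology (Eucl n) U0). ?F y \<in> U'}"
  by (rule openin_continuous_map_preimage[OF cF U'(1)])
 moreover have "{y \<in> topspace (subtopology (Eucl n) U0). ?F y \<in> U'} = U1"
  using openin_subset[OF U0] by (auto simp: U1_def)
 ultimately have U1: "openin (Eucl n) U1" using U0 openin_trans_full by metis
 show "\<exists>U g. openin (Eucl n) U \<and> x \<in> U \<and> (\<forall>k. Ck k n U g) \<and> (\<forall>y\<in>S \<inter> U. g y = G (F y) i)"
 proof (intro exI[of _ U1] exI[of _ "\<lambda>y. g (?F y)"] conjI allI ballI)
  show "x \<in> U1" using FF[of x] xU0 x U' by (auto simp: U1_def)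
  show "Ck k n U1 (\<lambda>y. g (?F y))" for k
   by (rule Ck_compose[OF U1 U'(1) _ _ U'(3)]) (use Ckf in "auto intro: Ck_subset simp: U1_def")
  fix y assume y: "y \<in> S \<inter> U1"
  hence "?F y = F y" "F y \<in> U'" using FF[of y] by (auto simp: U1_def)
  thus "g (?F y) = G (F y) i" using U'(4)[of "F y"] FS[of y] y by simp
 qed (rule U1)
qed

section \<open>Locality and multiplicativity of Jacobian determinants\<close>

lemma vderiv_cong:
 assumes N: "open N" "a \<in> N" and AB: "A \<inter> N = B \<inter> N" and a: "a \<in> A"
  and eq: "!!t. t \<in> A \<inter> N ==> f t = g t"
 shows "vector_derivative f (at a within A) = vector_derivative g (at a within B)"
proof -
 have "at a within A = at a within B"
  by (rule at_within_nhd[OF N(2,1)]) (use AB in auto)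
 moreover have "vector_derivative f (at a within A) = vector_derivative g (at a within A)"
 proof (rule vector_derivative_cong_eq)
  show "eventually (\<lambda>t. t \<in> A \<longrightarrow> f t = g t) (nhds a)"
   using eventually_nhds_in_open[OF N] by eventually_elim (use eq in auto)
 qed (use a in auto)
 ultimately show ?thesis by simp
qed

text \<open>The entries are derivatives along lines within the domain, and a coordinate line meets
  the open set \<open>U\<close> in an open neighbourhood of the point. This lets domains of
  coordinate expressions be shrunk and replaced.\<close>

lemma jacobian_det_cong:
 assumes U: "openin (Eucl n) U" and x: "x \<in> U" "x \<in> S"
  and ST: "S \<inter> U = T \<inter> U" and eq: "!!y. y \<in> S \<inter> U ==> F y = G y"
 shows "jacobian_det n S F x = jacobian_det n T G x"
proof -
 have "vector_derivative (\<lambda>t. F (x(k := t)) i) (at (x k) within {t. x(k := t) \<in> S}) =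
    vector_derivative (\<lambda>t. G (x(k := t)) i) (at (x k) within {t. x(k := t) \<in> T})" if "k < n" for i k
 proof (rule vderiv_cong[OF open_line[OF U that,of x]])
  show "F (x(k := t)) i = G (x(k := t)) i" if "t \<in> {t. x(k := t) \<in> S} \<inter> {t. x(k := t) \<in> U}" for t
   using eq[of "x(k := t)"] that by (simp del: fun_upd_apply)
 qed (use x ST in auto)
 thus ?thesis unfolding jacobian_det_def
  by (intro arg_cong[where f = Determinant.det] eq_matI) auto
qed

lemma smooth_on_partial:
 assumes F: "smooth_on n m S F" and S: "openin (Eucl n) S" and x: "x \<in> S" and k: "k < n" and i: "i < m"
 shows "((\<lambda>t. F (x(k := t)) i) has_real_derivative
   vector_derivative (\<lambda>t. F (x(k := t)) i) (at (x k) within {t. x(k := t) \<in> S})) (at (x k))"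
proof -
 obtain U g where U: "openin (Eucl n) U" "x \<in> U" "!!k. Ck k n U g" "!!y. y\<in>S \<inter> U ==> g y = F y i"
  using F[unfolded smooth_on_def,rule_format,OF i x] by blast
 obtain d where "((\<lambda>t. g (x(k := t))) has_real_derivative d) (at (x k))"
  using U(3)[of "Suc 0"] k U(2) by auto
 hence D: "((\<lambda>t. F (x(k := t)) i) has_real_derivative d) (at (x k))"
  by (rule has_derivative_coordinate_cong[OF openin_Int[OF S U(1)],rotated -1]) (use x U k in auto)
 have "at (x k) within {t. x(k := t) \<in> S} = at (x k)"
  by (rule at_within_open[OF _ open_line[OF S k]]) (use x in auto)
 moreover have "vector_derivative (\<lambda>t. F (x(k := t)) i) (at (x k)) = d"
  using D by (intro vector_derivative_at) (simp add: has_real_derivative_iff_has_vector_derivative)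
 ultimately show ?thesis using D by simp
qed

text \<open>The Jacobian matrices multiply by the chain rule. Near \<open>F x\<close> the map
  \<open>G\<close> is replaced by a smooth extension \<open>g\<close>, whose partial derivatives at
  \<open>F x\<close> are those of \<open>G\<close> because \<open>T\<close> is open.\<close>

lemma jacobian_det_compose:
 assumes S: "openin (Eucl n) S" and T: "openin (Eucl n) T"
  and F: "smooth_on n n S F" and G: "smooth_on n n T G" and FS: "!!x. x \<in> S ==> F x \<in> T" and x: "x \<in> S"
 shows "jacobian_det n S (\<lambda>x. G (F x)) x = jacobian_det n T G (F x) * jacobian_det n S F x"
proof -
 let ?D = "\<lambda>S F x i k. vector_derivative (\<lambda>t. F (x(k := t)) i) (at (x k) within {t. x(k := t) \<in> S}) :: real"
 have entry: "?D S (\<lambda>x. G (F x)) x i k = (\<Sum>j<n. ?D T G (F x) i j * ?D S F x j k)" if i: "i < n" and k: "k < n" for i k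
 proof -
  obtain U g where U: "openin (Eucl n) U" "F x \<in> U" "!!k. Ck k n U g" "!!y. y\<in>T \<inter> U ==> g y = G y i"
   using G[unfolded smooth_on_def,rule_format,OF i FS[OF x]] by blast
  have TU: "openin (Eucl n) (T \<inter> U)" using T U by blast
  have yTU: "F x \<in> T \<inter> U" using FS x U by blast
  obtain d where d: "!!j. j<n ==> (\<forall>x\<in>U. ((\<lambda>t. g (x(j := t))) has_real_derivative d j x) (at (x j))) \<and> Ck 0 n U (d j)"
   using U(3)[of "Suc 0"] by auto
  have dG: "d j (F x) = ?D T G (F x) i j" if j: "j < n" for j
  proof -
   have "((\<lambda>t. G ((F x)(j := t)) i) has_real_derivative d j (F x)) (at (F x j))"
    by (rule has_derivative_coordinate_cong[OF TU yTU j,where f = g]) (use U d[OF j] in auto)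
   thus ?thesis using smooth_on_partial[OF G T FS[OF x] j i] DERIV_unique by blast
  qed
  have Fk: "((\<lambda>t. F (x(k := t)) j) has_real_derivative ?D S F x j k) (at (x k))" if "j < n" for j
   by (rule smooth_on_partial[OF F S x k that])
  have evS: "\<forall>\<^sub>F t in at (x k). x(k := t) \<in> S"
   using eventually_at_in_open'[OF open_line[OF S k,of x],of "x k"] x by simp
  hence E: "\<forall>\<^sub>F t in at (x k). F (x(k := t)) \<in> Eu n"
   by eventually_elim (use FS openin_subset[OF T] in auto)
  have "((\<lambda>t. g (F (x(k := t)))) has_real_derivative (\<Sum>j<n. d j (F x) * ?D S F x j k)) (at (x k))"
   by (rule deriv_along_curve[OF TU yTU _ _ _ Fk E])
     (use d in "auto simp del: fun_upd_apply intro: continuous_map_from_subtopology_mono")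
  moreover have "\<forall>\<^sub>F t in nhds (x k). g (F (x(k := t))) = G (F (x(k := t))) i"
  proof -
   have "\<forall>\<^sub>F t in at (x k). F (x(k := t)) \<in> T \<inter> U"
   proof (rule curve_eventually_in[OF TU yTU _ E])
    show "((\<lambda>t. F (x(k := t)) j) \<longlongrightarrow> F x j) (at (x k))" if "j < n" for j
     using DERIV_isCont[OF Fk[OF that]] by (simp add: isCont_def)
   qed
   hence "\<forall>\<^sub>F t in at (x k). g (F (x(k := t))) = G (F (x(k := t))) i"
    by eventually_elim (use U in auto)
   thus ?thesis using U(4)[OF yTU] by (simp add: eventually_nhds_conv_at)
  qed
  ultimately have "((\<lambda>t. G (F (x(k := t))) i) has_real_derivative (\<Sum>j<n. d j (F x) * ?D S F x j k)) (at (x k))"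
   by (rule iffD1[OF DERIV_cong_ev[OF refl _ refl],rotated])
  hence "((\<lambda>t. G (F (x(k := t))) i) has_vector_derivative (\<Sum>j<n. d j (F x) * ?D S F x j k)) (at (x k))"
   by (simp add: has_real_derivative_iff_has_vector_derivative)
  moreover have "at (x k) within {t. x(k := t) \<in> S} = at (x k)"
   by (rule at_within_open[OF _ open_line[OF S k]]) (use x in auto)
  ultimately show ?thesis using dG by (simp add: vector_derivative_at)
 qed
 have "Matrix.mat n n (\<lambda>(i,k). ?D S (\<lambda>x. G (F x)) x i k) =
    Matrix.mat n n (\<lambda>(i,k). ?D T G (F x) i k) * Matrix.mat n n (\<lambda>(i,k). ?D S F x i k)"
  by (rule eq_matI) (auto simp: entry scalar_prod_def lessThan_atLeast0)
 thus ?thesis unfolding jacobian_det_def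
  by (simp add: Determinant.det_mult[where n = n])
qed

section \<open>Charts and locally oriented diffeomorphisms\<close>

abbreviation EH :: "(nat => real) set => nat => (nat => real) topology"
 where "EH H n \<equiv> subtopology (Eucl n) H"

abbreviation mf_pts :: "'a omanifold => 'a set"
 where "mf_pts X \<equiv> topspace (mf_top X)"

text \<open>A homeomorphism onto an open subset of \<open>H \<inter> \<real>\<^sup>n\<close>,
  expressed by images and preimages of open sets, so that products, restrictions and transports need
  no nested subtopologies. \<open>gchart_homeomorphic\<close> compares it with the clause in
  \<open>manifold_modelled_on\<close>.\<close>

definition gchart :: "(nat => real) set => nat => 'a topology => 'a chart => bool"
 where "gchart H n T = (\<lambda>(U,f,s). openin T U \<and> inj_on f U \<and>
  (\<forall>V. openin T V \<and> V \<subseteq> U \<longrightarrow> openin (EH H n) (f ` V)) \<and>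
  (\<forall>Q. openin (EH H n) Q \<longrightarrow> openin T {p \<in> U. f p \<in> Q}) \<and> s \<in> {1,-1})"

text \<open>The smoothness and orientation conditions for a single pair of charts, source and target
  having the same dimension \<open>n\<close>.\<close>

definition oloc :: "nat => ('a => 'b) => 'a chart => 'b chart => bool"
 where "oloc n h c c' \<longleftrightarrow> smooth_on n n (chart_rep_dom c c' h) (chart_rep c c' h) \<and>
  (\<forall>x\<in>chart_rep_dom c c' h.
    sgn (jacobian_det n (chart_rep_dom c c' h) (chart_rep c c' h) x) = snd (snd c) * snd (snd c'))"

lemma rep_apply: "inj_on f U ==> p \<in> U ==> chart_rep (U,f,s) (U',f',s') h (f p) = f' (h p)"
 by (simp add: chart_rep_def)

lemma rep_dom_eq: "chart_rep_dom (U,f,s) (U',f',s') h = f ` {p \<in> U. h p \<in> U'}"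
 by (simp add: chart_rep_dom_def)

lemma gchart_homeomorphic:
 "gchart H n T (U,f,s) \<longleftrightarrow> openin T U \<and> openin (EH H n) (f ` U) \<and>
   homeomorphic_map (subtopology T U) (subtopology (Eucl n) (f ` U)) f \<and> s \<in> {1,-1}"
proof
 assume g: "gchart H n T (U,f,s)"
 hence U: "openin T U" and inj: "inj_on f U" and op: "!!V. openin T V ==> V \<subseteq> U ==> openin (EH H n) (f ` V)"
  and co: "!!Q. openin (EH H n) Q ==> openin T {p \<in> U. f p \<in> Q}" and e: "s \<in> {1,-1}"
  by (auto simp: gchart_def)
 have im: "openin (EH H n) (f ` U)" using op U by blast
 have sub: "f ` U \<subseteq> Eu n" "f ` U \<subseteq> H" using openin_subset[OF im] by auto
 have eq: "subtopology (Eucl n) (f ` U) = subtopology (EH H n) (f ` U)"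
  using sub by (simp add: subtopology_subtopology Int_absorb1)
 have UT: "U \<subseteq> topspace T" using U openin_subset by blast
 have "homeomorphic_map (subtopology T U) (subtopology (EH H n) (f ` U)) f"
 proof (rule bijective_open_imp_homeomorphic_map)
  show "continuous_map (subtopology T U) (subtopology (EH H n) (f ` U)) f"
   unfolding continuous_map_def
  proof (intro conjI allI impI)
   fix Q assume Q: "openin (subtopology (EH H n) (f ` U)) Q"
   have "{x \<in> topspace (subtopology T U). f x \<in> Q} = {p \<in> U. f p \<in> Q}" using UT by auto
   thus "openin (subtopology T U) {x \<in> topspace (subtopology T U). f x \<in> Q}"
    using Q co by (auto simp: openin_open_subtopology[OF im] openin_open_subtopology[OF U])
  qed (use sub UT in auto)
  show "open_map (subtopology T U) (subtopology (EH H n) (f ` U)) f"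
   unfolding open_map_def openin_open_subtopology[OF im] openin_open_subtopology[OF U]
   using op by blast
 qed (use UT sub inj in "auto simp: Int_absorb1")
 thus "openin T U \<and> openin (EH H n) (f ` U) \<and>
   homeomorphic_map (subtopology T U) (subtopology (Eucl n) (f ` U)) f \<and> s \<in> {1,-1}"
  using U im e eq by simp
next
 assume A: "openin T U \<and> openin (EH H n) (f ` U) \<and>
   homeomorphic_map (subtopology T U) (subtopology (Eucl n) (f ` U)) f \<and> s \<in> {1,-1}"
 hence U: "openin T U" and im: "openin (EH H n) (f ` U)"
  and h: "homeomorphic_map (subtopology T U) (subtopology (Eucl n) (f ` U)) f" by auto
 have UT: "U \<subseteq> topspace T" using U openin_subset by blast
 have sub: "f ` U \<subseteq> Eu n" "f ` U \<subseteq> H" using openin_subset[OF im] by auto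
 have eq: "subtopology (Eucl n) (f ` U) = subtopology (EH H n) (f ` U)"
  using sub by (simp add: subtopology_subtopology Int_absorb1)
 note h = h[unfolded eq]
 have "inj_on f U" using homeomorphic_imp_injective_map[OF h] UT by (simp add: Int_absorb1)
 moreover have "openin (EH H n) (f ` V)" if "openin T V" "V \<subseteq> U" for V
  using homeomorphic_imp_open_map[OF h] that
  unfolding open_map_def openin_open_subtopology[OF im] openin_open_subtopology[OF U] by blast
 moreover have "openin T {p \<in> U. f p \<in> Q}" if Q: "openin (EH H n) Q" for Q
 proof -
  have "openin (subtopology (EH H n) (f ` U)) (Q \<inter> f ` U)"
   using Q im by (simp add: openin_open_subtopology[OF im] openin_Int)
  hence "openin (subtopology T U) {p \<in> topspace (subtopology T U). f p \<in> Q \<inter> f ` U}"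
   using homeomorphic_imp_continuous_map[OF h] by (rule openin_continuous_map_preimage[rotated])
  moreover have "{p \<in> topspace (subtopology T U). f p \<in> Q \<inter> f ` U} = {p \<in> U. f p \<in> Q}"
   using UT by auto
  ultimately show ?thesis using openin_open_subtopology[OF U] by metis
 qed
 ultimately show "gchart H n T (U,f,s)" using A by (auto simp: gchart_def)
qed

lemma gchartD:
 assumes "gchart H n T (U,f,s)"
 shows "openin T U" "U \<subseteq> topspace T" "inj_on f U" "f ` U \<subseteq> Eu n" "f ` U \<subseteq> H" "s \<in> {1,-1}" "openin (EH H n) (f ` U)"
proof -
 show *: "openin T U" "inj_on f U" "s \<in> {1,-1}" "openin (EH H n) (f ` U)" using assms by (auto simp: gchart_def)
 show "f ` U \<subseteq> Eu n" "f ` U \<subseteq> H" using openin_subset[OF *(4)] by auto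
 show "U \<subseteq> topspace T" using *(1) openin_subset by blast
qed

lemma gchart_image: "gchart H n T (U,f,s) ==> openin T V ==> V \<subseteq> U ==> openin (EH H n) (f ` V)"
 by (auto simp: gchart_def)

lemma gchart_preimage: "gchart H n T (U,f,s) ==> openin (EH H n) Q ==> openin T {p \<in> U. f p \<in> Q}"
 by (auto simp: gchart_def)

lemma gchart_dom:
 assumes g: "gchart H n T (U,f,s)" and h: "continuous_map T T' h" and U': "openin T' U'"
 shows "openin (EH H n) (f ` {p \<in> U. h p \<in> U'})"
proof -
 have "openin T (U \<inter> {p \<in> topspace T. h p \<in> U'})"
  by (intro openin_Int gchartD(1)[OF g] openin_continuous_map_preimage[OF h U'])
 moreover have "U \<inter> {p \<in> topspace T. h p \<in> U'} = {p \<in> U. h p \<in> U'}" using gchartD(2)[OF g] by auto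
 ultimately show ?thesis by (intro gchart_image[OF g]) auto
qed

lemma gchart_restrict:
 assumes "gchart H n T (U,f,s)" "openin T V" shows "gchart H n T (U \<inter> V,f,s)"
proof -
 have "{p \<in> U \<inter> V. f p \<in> Q} = {p \<in> U. f p \<in> Q} \<inter> V" for Q by auto
 thus ?thesis using assms inj_on_subset[of f U "U \<inter> V"] by (simp add: gchart_def openin_Int)
qed

lemma manifold_iff:
 "manifold_modelled_on H X \<longleftrightarrow> Hausdorff_space (mf_top X) \<and> second_countable (mf_top X) \<and>
  mf_pts X = (\<Union>c\<in>mf_charts X. fst c) \<and> (\<forall>c\<in>mf_charts X. gchart H (mf_dim X) (mf_top X) c) \<and>
  (\<forall>c\<in>mf_charts X. \<forall>c'\<in>mf_charts X. oloc (mf_dim X) id c c')"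
proof -
 have "(\<forall>(U,f,s)\<in>mf_charts X.
    openin (mf_top X) U \<and>
    openin (subtopology (Eucl (mf_dim X)) H) (f ` U) \<and>
    homeomorphic_map (subtopology (mf_top X) U)
     (subtopology (Eucl (mf_dim X)) (f ` U)) f \<and>
    s \<in> {1,-1}) \<longleftrightarrow> (\<forall>c\<in>mf_charts X. gchart H (mf_dim X) (mf_top X) c)"
  by (intro ball_cong refl) (simp add: gchart_homeomorphic split: prod.split)
 moreover have "(\<Union>(U,f,s)\<in>mf_charts X. U) = (\<Union>c\<in>mf_charts X. fst c)" by auto
 moreover have "smooth_in_charts X X id \<and> orientation_preserving X X id \<longleftrightarrow>
   (\<forall>c\<in>mf_charts X. \<forall>c'\<in>mf_charts X. oloc (mf_dim X) id c c')"
  unfolding smooth_in_charts_def orientation_preserving_def oloc_def by (simp add: ball_conj_distrib)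
 ultimately show ?thesis unfolding manifold_modelled_on_def by (simp only: )
qed

lemma manifoldD:
 assumes "manifold_modelled_on H X"
 shows "Hausdorff_space (mf_top X)" "second_countable (mf_top X)"
  "!!p. p \<in> mf_pts X ==> \<exists>U f s. (U,f,s) \<in> mf_charts X \<and> p \<in> U"
  "!!c. c \<in> mf_charts X ==> gchart H (mf_dim X) (mf_top X) c"
  "!!c c'. c \<in> mf_charts X ==> c' \<in> mf_charts X ==> oloc (mf_dim X) id c c'"
  "!!c c'. c \<in> mf_charts X ==> c' \<in> mf_charts X ==> oloc (mf_dim X) (\<lambda>x. x) c c'"
proof -
 show "\<exists>U f s. (U,f,s) \<in> mf_charts X \<and> p \<in> U" if p: "p \<in> mf_pts X" for p
 proof -
  obtain c where "c \<in> mf_charts X" "p \<in> fst c" using assms p unfolding manifold_iff by blast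
  thus ?thesis by (metis prod.collapse)
 qed
qed (use assms in "auto simp: manifold_iff id_def")

text \<open>If a map \<open>a\<close> of points matches the two pairs of charts, both pairs have the
  same coordinate expression, only on a smaller domain. That domain is open in the model space, so
  derivatives within it are derivatives within the larger one.\<close>

lemma oloc_transfer:
 assumes o: "oloc n k' (U1',f1',s1) (U2',f2',s2)"
  and inj: "inj_on f1 U1" "inj_on f1' U1'"
  and a: "!!p. p \<in> U1 ==> k p \<in> U2 ==>
    a p \<in> U1' \<and> f1 p = f1' (a p) \<and> k' (a p) \<in> U2' \<and> f2 (k p) = f2' (k' (a p))"
  and op: "openin (EH H n) (f1 ` {p\<in>U1. k p \<in> U2})" and sub: "f1' ` U1' \<subseteq> H"
 shows "oloc n k (U1,f1,s1) (U2,f2,s2)"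
proof -
 let ?c1 = "(U1,f1,s1)" and ?c2 = "(U2,f2,s2)" and ?c1' = "(U1',f1',s1)" and ?c2' = "(U2',f2',s2)"
 let ?D = "f1 ` {p\<in>U1. k p \<in> U2}" and ?D' = "f1' ` {p\<in>U1'. k' p \<in> U2'}"
 obtain Q where Q: "openin (Eucl n) Q" "?D = Q \<inter> H" using op unfolding openin_subtopology by blast
 have DD: "?D \<subseteq> ?D'" using a by force
 have eq: "chart_rep ?c1' ?c2' k' x = chart_rep ?c1 ?c2 k x" if x: "x \<in> ?D" for x
 proof -
  obtain p where p: "p \<in> U1" "k p \<in> U2" "x = f1 p" using x by blast
  have "chart_rep ?c1 ?c2 k x = f2 (k p)" using p inj by (simp add: rep_apply)
  moreover have "chart_rep ?c1' ?c2' k' x = f2' (k' (a p))" using a[OF p(1,2)] p inj by (simp add: rep_apply)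
  ultimately show ?thesis using a[OF p(1,2)] by simp
 qed
 have "smooth_on n n ?D (chart_rep ?c1 ?c2 k)"
  by (rule smooth_on_cong[OF smooth_on_subset[OF _ DD] eq]) (use o in "simp add: oloc_def rep_dom_eq")
 moreover have "sgn (jacobian_det n ?D (chart_rep ?c1 ?c2 k) x) = s1 * s2" if x: "x \<in> ?D" for x
 proof -
  have xO: "x \<in> Q" using Q x by blast
  have HO: "?D' \<inter> Q \<subseteq> ?D" using Q(2) sub by blast
  have "jacobian_det n ?D (chart_rep ?c1 ?c2 k) x = jacobian_det n ?D' (chart_rep ?c1' ?c2' k') x"
   by (rule jacobian_det_cong[OF Q(1)]) (use x xO DD HO eq in auto)
  thus ?thesis using o DD x by (auto simp: oloc_def rep_dom_eq)
 qed
 ultimately show ?thesis by (simp add: oloc_def rep_dom_eq)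
qed

lemma oloc_cong:
 assumes o: "oloc n h (U,f,s) c'" and eq: "!!p. p \<in> U ==> h p = h' p" and inj: "inj_on f U" and E: "f ` U \<subseteq> Eu n"
 shows "oloc n h' (U,f,s) c'"
proof -
 obtain U' f' s' where c': "c' = (U',f',s')" using prod_cases3 by blast
 have D: "chart_rep_dom (U,f,s) c' h = chart_rep_dom (U,f,s) c' h'"
  unfolding c' rep_dom_eq using eq by (intro image_cong) auto
 have r: "chart_rep (U,f,s) c' h x = chart_rep (U,f,s) c' h' x" if "x \<in> chart_rep_dom (U,f,s) c' h" for x
  using that inj eq unfolding c' rep_dom_eq by (auto simp: rep_apply)
 have sub: "chart_rep_dom (U,f,s) c' h \<subseteq> Eu n" using E unfolding c' rep_dom_eq by auto
 have "jacobian_det n (chart_rep_dom (U,f,s) c' h) (chart_rep (U,f,s) c' h) x =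
   jacobian_det n (chart_rep_dom (U,f,s) c' h) (chart_rep (U,f,s) c' h') x"
  if "x \<in> chart_rep_dom (U,f,s) c' h" for x
  by (rule jacobian_det_cong[OF openin_topspace]) (use that sub r in auto)
 thus ?thesis using o smooth_on_cong[OF _ r,of n n "chart_rep_dom (U,f,s) c' h"] unfolding oloc_def D[symmetric] by auto
qed

lemma oloc_restrict:
 assumes o: "oloc n k (U,f,s) (U2,f2,s2)" and gc: "gchart H n T (U,f,s)"
  and V: "openin T V" and op: "openin T {p\<in>U. k p \<in> U2}"
 shows "oloc n k (U \<inter> V,f,s) (U2,f2,s2)"
proof (rule oloc_transfer[OF o,where a = "\<lambda>p. p" and H = H])
 have "{p \<in> U \<inter> V. k p \<in> U2} = {p\<in>U. k p \<in> U2} \<inter> V" by auto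
 thus "openin (EH H n) (f ` {p \<in> U \<inter> V. k p \<in> U2})"
  using op V by (auto intro!: gchart_image[OF gc])
qed (use gchartD[OF gc] in "auto intro: inj_on_subset")

text \<open>Shrinking a chart does not change the coordinate expression, nor its derivatives, since
  the smaller domain is open in the model space.\<close>

lemma oloc_local:
 assumes gc: "gchart H n T (U,f,s)" and op: "openin T {p\<in>U. k p \<in> U2}"
  and loc: "!!p. p \<in> U ==> k p \<in> U2 ==> \<exists>V. openin T V \<and> p \<in> V \<and> oloc n k (U \<inter> V,f,s) (U2,f2,s2)"
 shows "oloc n k (U,f,s) (U2,f2,s2)"
proof -
 let ?D = "f ` {p\<in>U. k p \<in> U2}" and ?r = "chart_rep (U,f,s) (U2,f2,s2) k"
 note inj = gchartD(3)[OF gc]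
 have key: "\<exists>Q. openin (Eucl n) Q \<and> x \<in> Q \<and> smooth_on n n (?D \<inter> Q) ?r \<and>
   sgn (jacobian_det n ?D ?r x) = s * s2" if x: "x \<in> ?D" for x
 proof -
  obtain p where p: "p \<in> U" "k p \<in> U2" "x = f p" using x by blast
  obtain V where V: "openin T V" "p \<in> V" "oloc n k (U \<inter> V,f,s) (U2,f2,s2)" using loc p by blast
  let ?DV = "f ` {p\<in>U \<inter> V. k p \<in> U2}" and ?rV = "chart_rep (U \<inter> V,f,s) (U2,f2,s2) k"
  have "{p \<in> U \<inter> V. k p \<in> U2} = {p\<in>U. k p \<in> U2} \<inter> V" by auto
  hence "openin (EH H n) ?DV" using op V by (auto intro!: gchart_image[OF gc])
  then obtain Q where Q: "openin (Eucl n) Q" "?DV = Q \<inter> H" unfolding openin_subtopology by blast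
  have DO: "?D \<inter> Q = ?DV" using Q(2) gchartD(5)[OF gc] by auto
  have xDV: "x \<in> ?DV" using p V by auto
  have eq: "?rV y = ?r y" if "y \<in> ?DV" for y
   using that inj inj_on_subset[OF inj,of "U \<inter> V"] by (auto simp: rep_apply)
  have "smooth_on n n (?D \<inter> Q) ?r"
   unfolding DO by (rule smooth_on_cong[OF _ eq]) (use V(3) in "simp add: oloc_def rep_dom_eq")
  moreover have "jacobian_det n ?D ?r x = jacobian_det n ?DV ?rV x"
   by (rule jacobian_det_cong[OF Q(1)]) (use xDV Q(2) DO eq x in auto)
  ultimately show ?thesis using Q xDV V(3) by (auto simp: oloc_def rep_dom_eq)
 qed
 hence "smooth_on n n ?D ?r" by (intro smooth_on_local) blast
 thus ?thesis using key unfolding oloc_def rep_dom_eq by auto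
qed

text \<open>The sign \<open>s'\<close> of the middle chart enters twice and cancels. The domains are
  open in \<open>\<real>\<^sup>n\<close>, where the chain rule for Jacobians applies.\<close>

lemma oloc_compose:
 assumes h: "oloc n h (U,f,s) (U',f',s')" and g: "oloc n g (U',f',s') (U'',f'',s'')"
  and inj: "inj_on f U" "inj_on f' U'" and hU: "h ` U \<subseteq> U'"
  and op: "openin (Eucl n) (f ` {p\<in>U. g (h p) \<in> U''})" "openin (Eucl n) (f' ` {p\<in>U'. g p \<in> U''})"
  and e: "s' \<in> {1,-1}"
 shows "oloc n (\<lambda>p. g (h p)) (U,f,s) (U'',f'',s'')"
proof -
 let ?D = "f ` {p\<in>U. g (h p) \<in> U''}" and ?D' = "f' ` {p\<in>U'. g p \<in> U''}" and ?Dh = "f ` {p\<in>U. h p \<in> U'}"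
 let ?rh = "chart_rep (U,f,s) (U',f',s') h" and ?rg = "chart_rep (U',f',s') (U'',f'',s'') g"
  and ?r = "chart_rep (U,f,s) (U'',f'',s'') (\<lambda>p. g (h p))"
 have sub: "?D \<subseteq> ?Dh" using hU by auto
 have into: "?rh x \<in> ?D'" if "x \<in> ?D" for x
  using that hU inj by (auto simp: rep_apply)
 have eq: "?rg (?rh x) = ?r x" if "x \<in> ?D" for x
  using that hU inj by (auto simp: rep_apply image_subset_iff)
 have sh: "smooth_on n n ?D ?rh" using h smooth_on_subset[OF _ sub] by (auto simp: oloc_def rep_dom_eq)
 have sg: "smooth_on n n ?D' ?rg" using g by (auto simp: oloc_def rep_dom_eq)
 have "smooth_on n n ?D ?r"
  by (rule smooth_on_cong[OF smooth_on_compose[OF sh sg _ into] eq]) (use op[THEN openin_subset] in auto)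
 moreover have "sgn (jacobian_det n ?D ?r x) = s * s''" if x: "x \<in> ?D" for x
 proof -
  have xE: "x \<in> Eu n" using openin_subset[OF op(1)] x by blast
  have "jacobian_det n ?D ?r x = jacobian_det n ?D (\<lambda>x. ?rg (?rh x)) x"
   by (rule jacobian_det_cong[OF openin_topspace xE x]) (use eq in auto)
  also have "\<dots> = jacobian_det n ?D' ?rg (?rh x) * jacobian_det n ?D ?rh x"
   by (rule jacobian_det_compose[OF op sh sg into x])
  also have "jacobian_det n ?D ?rh x = jacobian_det n ?Dh ?rh x"
   by (rule jacobian_det_cong[OF op(1) x x]) (use sub in auto)
  finally have "sgn (jacobian_det n ?D ?r x) = (s' * s'') * (s * s')"
   using h g into[OF x] sub x by (auto simp: oloc_def rep_dom_eq sgn_mult)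
  thus ?thesis using e by auto
 qed
 ultimately show ?thesis by (simp add: oloc_def rep_dom_eq)
qed

lemma jacobian_det_coord:
 assumes S: "openin (Eucl n) S" and x: "x \<in> S" and F: "!!y i. y \<in> S ==> i < n ==> F y i = y (\<sigma> i)"
 shows "jacobian_det n S F x = Determinant.det (Matrix.mat n n (\<lambda>(i,k). if \<sigma> i = k then 1 else 0))"
 unfolding jacobian_det_def
proof (rule arg_cong[where f = Determinant.det],rule eq_matI)
 fix i k assume ik: "i < dim_row (Matrix.mat n n (\<lambda>(i,k). if \<sigma> i = k then 1 else 0 :: real))"
  "k < dim_col (Matrix.mat n n (\<lambda>(i,k). if \<sigma> i = k then 1 else 0 :: real))"
 have k: "k < n" and i: "i < n" using ik by auto
 have "vector_derivative (\<lambda>t. F (x(k := t)) i) (at (x k) within {t. x(k := t) \<in> S}) =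
    vector_derivative (\<lambda>t. (x(k := t)) (\<sigma> i)) (at (x k) within {t. x(k := t) \<in> S})"
  by (rule vderiv_cong[OF open_line[OF S k,of x]])
    (use x F i in "simp_all del: fun_upd_apply")
 also have "\<dots> = vector_derivative (\<lambda>t. (x(k := t)) (\<sigma> i)) (at (x k))"
  by (subst at_within_open[OF _ open_line[OF S k]]) (use x in auto)
 also have "\<dots> = (if \<sigma> i = k then 1 else 0)"
  by (rule vector_derivative_at) (cases "\<sigma> i = k"; auto intro!: derivative_eq_intros)
 finally show "Matrix.mat n n (\<lambda>(i,k). vector_derivative (\<lambda>t. F (x(k := t)) i) (at (x k) within {t. x(k := t) \<in> S})) $$ (i,k) =
   Matrix.mat n n (\<lambda>(i,k). if \<sigma> i = k then 1 else 0) $$ (i,k)"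
  using i k by simp
qed auto

lemma jacobian_det_id:
 assumes S: "openin (Eucl n) S" and x: "x \<in> S" and F: "!!y. y \<in> S ==> F y = y"
 shows "jacobian_det n S F x = 1"
proof -
 have "jacobian_det n S F x = Determinant.det (Matrix.mat n n (\<lambda>(i,k). if i = k then 1 else 0))"
  by (rule jacobian_det_coord[OF S x]) (use F in auto)
 also have "Matrix.mat n n (\<lambda>(i,k). if i = k then 1 else 0) = (1\<^sub>m n :: real mat)" by (auto simp: one_mat_def)
 finally show ?thesis by simp
qed

subsection \<open>Oriented diffeomorphisms\<close>

definition omap :: "'a omanifold => 'b omanifold => ('a => 'b) => bool"
 where "omap X Y h \<longleftrightarrow> continuous_map (mf_top X) (mf_top Y) h \<and>
  (\<forall>c\<in>mf_charts X. \<forall>c'\<in>mf_charts Y. oloc (mf_dim X) h c c')"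

text \<open>The inverse is part of the data and is asked to preserve orientation too. This makes the
  notion symmetric and lets compositions be written down explicitly; nothing is asked outside the
  point sets.\<close>

definition odiff :: "'a omanifold => 'b omanifold => ('a => 'b) => ('b => 'a) => bool"
 where "odiff X Y h g \<longleftrightarrow> mf_dim X = mf_dim Y \<and> omap X Y h \<and> omap Y X g \<and>
  (\<forall>p\<in>mf_pts X. g (h p) = p) \<and> (\<forall>q\<in>mf_pts Y. h (g q) = q)"

lemma odiff_sym: "odiff X Y h g ==> odiff Y X g h"
 by (auto simp: odiff_def)

lemma omap_id: "manifold_modelled_on H X ==> omap X X (\<lambda>x. x)"
 by (auto simp: omap_def manifoldD)

lemma odiff_id: "manifold_modelled_on H X ==> odiff X X (\<lambda>x. x) (\<lambda>x. x)"
 by (auto simp: odiff_def omap_id)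

lemma omap_cong:
 assumes h: "omap X Y h" and X: "manifold_modelled_on H X" and eq: "!!p. p \<in> mf_pts X ==> h p = h' p"
 shows "omap X Y h'"
 unfolding omap_def
proof (intro conjI ballI)
 show "continuous_map (mf_top X) (mf_top Y) h'"
  using h continuous_map_eq eq unfolding omap_def by blast
 fix c c' assume c: "c \<in> mf_charts X" "c' \<in> mf_charts Y"
 obtain U f s where ce: "c = (U,f,s)" using prod_cases3 by blast
 note gc = gchartD[OF manifoldD(4)[OF X c(1),unfolded ce]]
 show "oloc (mf_dim X) h' c c'" unfolding ce
  by (rule oloc_cong[of _ h]) (use h c ce gc eq in "auto simp: omap_def")
qed

text \<open>A chart of \<open>Y\<close> through \<open>h p\<close> is available only locally, so the
  claim is tested near each \<open>p\<close>, on the preimage of such a chart.\<close>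

lemma omap_compose:
 assumes X: "omanif X" and Y: "omanif Y" and Z: "omanif Z"
  and d: "mf_dim X = mf_dim Y" and h: "omap X Y h" and g: "omap Y Z g"
 shows "omap X Z (\<lambda>p. g (h p))"
 unfolding omap_def
proof (intro conjI ballI)
 note X = X[unfolded oriented_manifold_def] and Y = Y[unfolded oriented_manifold_def] and Z = Z[unfolded oriented_manifold_def]
 have ch: "continuous_map (mf_top X) (mf_top Y) h" and cg: "continuous_map (mf_top Y) (mf_top Z) g"
  using h g by (auto simp: omap_def)
 show cgh: "continuous_map (mf_top X) (mf_top Z) (\<lambda>p. g (h p))"
  using continuous_map_compose[OF ch cg] by (simp add: o_def)
 fix c c'' assume c: "c \<in> mf_charts X" "c'' \<in> mf_charts Z"
 obtain U f s where ce: "c = (U,f,s)" using prod_cases3 by blast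
 obtain U'' f'' s'' where ce'': "c'' = (U'',f'',s'')" using prod_cases3 by blast
 let ?n = "mf_dim X"
 note gcX = manifoldD(4)[OF X c(1),unfolded ce] and gcZ = manifoldD(4)[OF Z c(2),unfolded ce'']
 show "oloc ?n (\<lambda>p. g (h p)) c c''" unfolding ce ce''
 proof (rule oloc_local[OF gcX])
  have op2: "openin (mf_top X) {p \<in> mf_pts X. g (h p) \<in> U''}"
   by (rule openin_continuous_map_preimage[OF cgh gchartD(1)[OF gcZ]])
  have U2: "{p \<in> V. g (h p) \<in> U''} = V \<inter> {p \<in> mf_pts X. g (h p) \<in> U''}" if "openin (mf_top X) V" for V
   using openin_subset[OF that] by auto
  show "openin (mf_top X) {p \<in> U. g (h p) \<in> U''}"
   unfolding U2[OF gchartD(1)[OF gcX]] by (rule openin_Int[OF gchartD(1)[OF gcX] op2])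
  fix p assume p: "p \<in> U" "g (h p) \<in> U''"
  have "h p \<in> mf_pts Y" using p gchartD(2)[OF gcX] continuous_map_image_subset_topspace[OF ch] by (meson image_subset_iff subsetD)
  then obtain U' f' s' where c': "(U',f',s') \<in> mf_charts Y" "h p \<in> U'" using manifoldD(3)[OF Y] by blast
  note gcY = manifoldD(4)[OF Y c'(1)]
  define V where "V = {p \<in> mf_pts X. h p \<in> U'}"
  have V: "openin (mf_top X) V" unfolding V_def by (rule openin_continuous_map_preimage[OF ch gchartD(1)[OF gcY]])
  have hV: "{p \<in> U. h p \<in> U'} = U \<inter> V" using gchartD(2)[OF gcX] by (auto simp: V_def)
  have "oloc ?n (\<lambda>p. g (h p)) (U \<inter> V,f,s) (U'',f'',s'')"
  proof (rule oloc_compose[where g = g and h = h and U' = U' and f' = f' and s' = s'])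
   show "oloc ?n h (U \<inter> V,f,s) (U',f',s')"
    by (rule oloc_restrict[OF _ gcX V]) (use h c(1) c'(1) ce hV V gchartD(1)[OF gcX] in "auto simp: omap_def")
   show "oloc ?n g (U',f',s') (U'',f'',s'')"
    using g c(2) c'(1) ce'' d by (auto simp: omap_def)
   show "inj_on f (U \<inter> V)" "inj_on f' U'" "h ` (U \<inter> V) \<subseteq> U'" "s' \<in> {1,-1}"
    using gchartD[OF gcX] gchartD[OF gcY] by (auto intro: inj_on_subset simp: V_def)
   have "openin (mf_top X) {p \<in> U \<inter> V. g (h p) \<in> U''}"
    using U2[of "U \<inter> V"] gchartD(1)[OF gcX] V op2 by (simp add: openin_Int)
   thus "openin (Eucl ?n) (f ` {p \<in> U \<inter> V. g (h p) \<in> U''})"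
    using gchart_image[OF gcX] by (auto simp: subtopology_UNIV)
   show "openin (Eucl ?n) (f' ` {p \<in> U'. g p \<in> U''})"
    using gchart_dom[OF gcY cg gchartD(1)[OF gcZ]] d by (simp add: subtopology_UNIV)
  qed
  thus "\<exists>V. openin (mf_top X) V \<and> p \<in> V \<and> oloc ?n (\<lambda>p. g (h p)) (U \<inter> V,f,s) (U'',f'',s'')"
   using V hV p c' by blast
 qed
qed

lemma odiff_trans:
 assumes "omanif X" "omanif Y" "omanif Z" "odiff X Y h g" "odiff Y Z h' g'"
 shows "odiff X Z (\<lambda>p. h' (h p)) (\<lambda>q. g (g' q))"
proof -
 have "continuous_map (mf_top X) (mf_top Y) h" "continuous_map (mf_top Z) (mf_top Y) g'"
  using assms by (auto simp: odiff_def omap_def)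
 hence "\<forall>p\<in>mf_pts X. h p \<in> mf_pts Y" "\<forall>q\<in>mf_pts Z. g' q \<in> mf_pts Y"
  by (auto dest: continuous_map_image_subset_topspace)
 thus ?thesis using assms omap_compose[of X Y Z h h'] omap_compose[of Z Y X g' g] by (auto simp: odiff_def)
qed

lemma odiff_imp_oriented_diffeo:
 assumes X: "omanif X" and Y: "omanif Y" and hg: "odiff X Y h g"
 shows "oriented_diffeo X Y h"
proof -
 have d: "mf_dim X = mf_dim Y" and h: "omap X Y h" and g: "omap Y X g"
  and gh: "!!p. p\<in>mf_pts X ==> g (h p) = p" and hg: "!!q. q\<in>mf_pts Y ==> h (g q) = q"
  using hg by (auto simp: odiff_def)
 have "homeomorphic_maps (mf_top X) (mf_top Y) h g"
  using h g gh hg by (auto simp: homeomorphic_maps_def omap_def)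
 hence hom: "homeomorphic_map (mf_top X) (mf_top Y) h" using homeomorphic_map_maps by blast
 have gY: "g q \<in> mf_pts X" if "q \<in> mf_pts Y" for q
  using g that unfolding omap_def by (blast dest: continuous_map_image_subset_topspace)
 have inj: "inj_on h (mf_pts X)" using gh by (rule inj_on_inverseI)
 have "g q = inv_into (mf_pts X) h q" if "q \<in> mf_pts Y" for q
  using inv_into_f_f[OF inj gY[OF that]] hg[OF that] by simp
 hence "omap Y X (inv_into (mf_pts X) h)"
  using omap_cong[OF g Y[unfolded oriented_manifold_def]] by blast
 thus ?thesis using hom h d
  unfolding oriented_diffeo_def omap_def oloc_def smooth_in_charts_def orientation_preserving_def by auto
qed

text \<open>By definition only \<open>h\<close> is known to preserve orientation. For the inverse
  this follows because the two Jacobians multiply to 1.\<close>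

lemma oriented_diffeo_imp_odiff:
 assumes X: "omanif X" and Y: "omanif Y" and hd: "oriented_diffeo X Y h"
 obtains g where "odiff X Y h g"
proof -
 let ?g = "inv_into (mf_pts X) h" and ?n = "mf_dim X"
 note X = X[unfolded oriented_manifold_def] and Y = Y[unfolded oriented_manifold_def]
 have d: "mf_dim X = mf_dim Y" and hom: "homeomorphic_map (mf_top X) (mf_top Y) h"
  using hd by (auto simp: oriented_diffeo_def)
 have ol: "oloc ?n h c c'" if "c \<in> mf_charts X" "c' \<in> mf_charts Y" for c c'
  using hd that unfolding oriented_diffeo_def oloc_def smooth_in_charts_def orientation_preserving_def by auto
 have ch: "continuous_map (mf_top X) (mf_top Y) h" and inj: "inj_on h (mf_pts X)" and im: "h ` mf_pts X = mf_pts Y"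
  and om: "open_map (mf_top X) (mf_top Y) h"
  using hom by (auto simp: homeomorphic_eq_everything_map)
 have gh: "?g (h p) = p" if "p \<in> mf_pts X" for p using inj that by simp
 have hg: "h (?g q) = q" "?g q \<in> mf_pts X" if "q \<in> mf_pts Y" for q
  using that im by (auto simp: f_inv_into_f inv_into_into)
 have cg: "continuous_map (mf_top Y) (mf_top X) ?g"
  unfolding continuous_map_def
 proof (intro conjI allI impI)
  fix U assume U: "openin (mf_top X) U"
  have "{q \<in> mf_pts Y. ?g q \<in> U} = h ` U"
  proof (intro equalityI subsetI)
   fix q assume q: "q \<in> {q \<in> mf_pts Y. ?g q \<in> U}"
   hence "q = h (?g q)" using hg by simp
   thus "q \<in> h ` U" using q by blast
  next
   fix q assume "q \<in> h ` U"
   then obtain p where p: "p \<in> U" "q = h p" by blast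
   thus "q \<in> {q \<in> mf_pts Y. ?g q \<in> U}" using gh[of p] openin_subset[OF U] im by auto
  qed
  thus "openin (mf_top Y) {q \<in> mf_pts Y. ?g q \<in> U}" using om U by (auto simp: open_map_def)
 qed (use hg in auto)
 have "oloc ?n ?g c' c" if c: "c \<in> mf_charts X" "c' \<in> mf_charts Y" for c c'
 proof -
  obtain U f t where ce: "c = (U,f,t)" using prod_cases3 by blast
  obtain U' f' t' where ce': "c' = (U',f',t')" using prod_cases3 by blast
  note gcX = manifoldD(4)[OF X c(1),unfolded ce] and gcY = manifoldD(4)[OF Y c(2),unfolded ce']
  note gX = gchartD[OF gcX] and gY = gchartD[OF gcY]
  let ?D1 = "f' ` {q \<in> U'. ?g q \<in> U}" and ?D2 = "f ` {p \<in> U. h p \<in> U'}"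
  let ?r1 = "chart_rep c' c ?g" and ?r2 = "chart_rep c c' h"
  have o1: "openin (Eucl ?n) ?D1" using gchart_dom[OF gcY cg gX(1)] d by (simp add: subtopology_UNIV)
  have o2: "openin (Eucl ?n) ?D2" using gchart_dom[OF gcX ch gY(1)] by (simp add: subtopology_UNIV)
  have into: "?r1 x \<in> ?D2" and inv: "?r2 (?r1 x) = x" if x: "x \<in> ?D1" for x
  proof -
   obtain q where q: "q \<in> U'" "?g q \<in> U" "x = f' q" using x by blast
   have "?r1 x = f (?g q)" unfolding ce ce' q(3) by (rule rep_apply[OF gY(3) q(1)])
   moreover have "h (?g q) = q" using hg q gY(2) by blast
   ultimately show "?r1 x \<in> ?D2" "?r2 (?r1 x) = x"
    unfolding ce ce' using q rep_apply[OF gX(3) q(2),of t U' f' t' h] by auto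
  qed
  have s1: "smooth_on ?n ?n ?D1 ?r1"
  proof -
   have "smooth_on (mf_dim Y) ?n (chart_rep_dom c' c ?g) ?r1"
    using hd c unfolding oriented_diffeo_def smooth_in_charts_def by blast
   thus ?thesis by (simp add: ce ce' rep_dom_eq d)
  qed
  have s2: "smooth_on ?n ?n ?D2 ?r2"
   using ol[OF c] unfolding oloc_def ce ce' rep_dom_eq by auto
  have "sgn (jacobian_det ?n ?D1 ?r1 x) = t' * t" if x: "x \<in> ?D1" for x
  proof -
   have "jacobian_det ?n ?D2 ?r2 (?r1 x) * jacobian_det ?n ?D1 ?r1 x = 1"
    by (rule trans[OF jacobian_det_compose[OF o1 o2 s1 s2 into x,symmetric] jacobian_det_id[OF o1 x inv]])
   hence "sgn (jacobian_det ?n ?D2 ?r2 (?r1 x)) * sgn (jacobian_det ?n ?D1 ?r1 x) = 1"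
    by (simp only: sgn_mult[symmetric] sgn_one)
   moreover have "sgn (jacobian_det ?n ?D2 ?r2 (?r1 x)) = t * t'"
    using ol[OF c] into[OF x] unfolding oloc_def ce ce' rep_dom_eq by auto
   ultimately show ?thesis using gX(6) gY(6) by auto
  qed
  thus ?thesis using s1 unfolding oloc_def ce ce' rep_dom_eq by auto
 qed
 hence "odiff X Y h ?g"
  using d ch cg ol gh hg by (auto simp: odiff_def omap_def)
 thus ?thesis using that by blast
qed

text \<open>The main tool for exhibiting diffeomorphisms. If each chart of \<open>X\<close> is the
  pull-back along \<open>h\<close> of a chart of \<open>Y\<close> with the same sign, then
  \<open>h\<close> is the identity in these coordinates, and it is a homeomorphism because charts
  determine the topologies. Arbitrary pairs of charts are then handled by the transitions of
  \<open>Y\<close>.\<close>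

lemma odiff_match:
 assumes X: "!!c. c \<in> mf_charts X ==> gchart UNIV (mf_dim X) (mf_top X) c"
  and cov: "mf_pts X = (\<Union>c\<in>mf_charts X. fst c)"
  and Y: "omanif Y" and d: "mf_dim X = mf_dim Y"
  and m: "!!U f s. (U,f,s) \<in> mf_charts X ==> \<exists>U' f'. (U',f',s) \<in> mf_charts Y \<and> (\<forall>p\<in>U. h p \<in> U' \<and> f p = f' (h p))"
  and g: "!!q. q \<in> mf_pts Y ==> g q \<in> mf_pts X" and gh: "!!p. p \<in> mf_pts X ==> g (h p) = p"
  and hg: "!!q. q \<in> mf_pts Y ==> h (g q) = q"
 shows "odiff X Y h g"
proof -
 note Y = Y[unfolded oriented_manifold_def]
 let ?n = "mf_dim X"
 have inj: "inj_on h (mf_pts X)" using gh by (rule inj_on_inverseI)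
 have hY: "h p \<in> mf_pts Y" if "p \<in> mf_pts X" for p
 proof -
  obtain U f s where c: "(U,f,s) \<in> mf_charts X" "p \<in> U" using cov \<open>p \<in> mf_pts X\<close> by auto
  then obtain U' f' where "(U',f',s) \<in> mf_charts Y" "h p \<in> U'" using m by blast
  thus ?thesis using gchartD(2)[OF manifoldD(4)[OF Y]] by blast
 qed
 have img: "openin (mf_top Y) (h ` V)" if V: "openin (mf_top X) V" "V \<subseteq> U" "(U,f,s) \<in> mf_charts X" for U V f s
 proof -
  obtain U' f' where c': "(U',f',s) \<in> mf_charts Y" and a: "!!p. p\<in>U ==> h p \<in> U' \<and> f p = f' (h p)" using m[OF V(3)] by blast
  note gcY = manifoldD(4)[OF Y c'] and gcX = X[OF V(3)]
  \<comment> \<open>In the matching charts the image has the same coordinates as \<open>V\<close>,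
    and those form an open set.\<close>
  have "h ` V = {q \<in> U'. f' q \<in> f ` V}"
  proof (intro equalityI subsetI)
   fix q assume "q \<in> {q \<in> U'. f' q \<in> f ` V}"
   then obtain p where p: "p \<in> V" "f' q = f p" "q \<in> U'" by auto
   hence "f' q = f' (h p)" "h p \<in> U'" using a V(2) by auto
   hence "q = h p" using gchartD(3)[OF gcY] p by (auto dest: inj_onD)
   thus "q \<in> h ` V" using p by blast
  next
   fix q assume "q \<in> h ` V"
   then obtain p where p: "p \<in> V" "q = h p" by blast
   hence "q \<in> U'" "f' q = f p" using a[of p] V(2) by auto
   thus "q \<in> {q \<in> U'. f' q \<in> f ` V}" using p by simp
  qed
  moreover have "openin (mf_top Y) {q \<in> U'. f' q \<in> f ` V}"
   by (rule gchart_preimage[OF gcY]) (use gchart_image[OF gcX V(1,2)] d in simp)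
  ultimately show ?thesis by simp
 qed
 have ch: "continuous_map (mf_top X) (mf_top Y) h"
  unfolding continuous_map_def
 proof (intro conjI allI impI)
  show "h \<in> mf_pts X \<rightarrow> mf_pts Y" using hY by blast
  fix V assume V: "openin (mf_top Y) V"
  have "openin (mf_top X) {p \<in> U. h p \<in> V}" if c: "(U,f,s) \<in> mf_charts X" for U f s
  proof -
   obtain U' f' where c': "(U',f',s) \<in> mf_charts Y" and a: "!!p. p\<in>U ==> h p \<in> U' \<and> f p = f' (h p)" using m[OF c] by blast
   note gcY = manifoldD(4)[OF Y c'] and gcX = X[OF c]
   have "{p \<in> U. h p \<in> V} = {p \<in> U. f p \<in> f' ` (U' \<inter> V)}"
   proof (intro equalityI subsetI)
    fix p assume "p \<in> {p \<in> U. f p \<in> f' ` (U' \<inter> V)}"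
    then obtain q where q: "p \<in> U" "f p = f' q" "q \<in> U'" "q \<in> V" by auto
    hence "h p = q" using a[of p] inj_onD[OF gchartD(3)[OF gcY],of "h p" q] by simp
    thus "p \<in> {p \<in> U. h p \<in> V}" using q by simp
   qed (use a in auto)
   moreover have "openin (EH UNIV ?n) (f' ` (U' \<inter> V))"
    using gchart_image[OF gcY,of "U' \<inter> V"] V gchartD(1)[OF gcY] d by auto
   ultimately show ?thesis using gchart_preimage[OF gcX] by simp
  qed
  hence "openin (mf_top X) (\<Union>c\<in>mf_charts X. {p \<in> fst c. h p \<in> V})" by (intro openin_Union) auto
  moreover have "(\<Union>c\<in>mf_charts X. {p \<in> fst c. h p \<in> V}) = {p \<in> mf_pts X. h p \<in> V}" using cov by auto
  ultimately show "openin (mf_top X) {p \<in> mf_pts X. h p \<in> V}" by simp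
 qed
 have cg: "continuous_map (mf_top Y) (mf_top X) g"
  unfolding continuous_map_def
 proof (intro conjI allI impI)
  show "g \<in> mf_pts Y \<rightarrow> mf_pts X" using g by blast
  fix V assume V: "openin (mf_top X) V"
  have "openin (mf_top Y) (h ` (V \<inter> fst c))" if "c \<in> mf_charts X" for c
  proof -
   obtain U f s where c: "c = (U,f,s)" using prod_cases3 by blast
   show ?thesis using img[of "V \<inter> U" U f s] V that gchartD(1)[OF X[OF that[unfolded c]]] unfolding c by auto
  qed
  hence "openin (mf_top Y) (\<Union>c\<in>mf_charts X. h ` (V \<inter> fst c))" by (intro openin_Union) auto
  moreover have "(\<Union>c\<in>mf_charts X. h ` (V \<inter> fst c)) = h ` V"
  proof -
   have "(\<Union>c\<in>mf_charts X. V \<inter> fst c) = V" using cov openin_subset[OF V] by auto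
   thus ?thesis by (metis image_UN)
  qed
  moreover have "h ` V = {q \<in> mf_pts Y. g q \<in> V}"
  proof (intro equalityI subsetI)
   fix q assume q: "q \<in> {q \<in> mf_pts Y. g q \<in> V}"
   hence "q = h (g q)" using hg by simp
   thus "q \<in> h ` V" using q by blast
  qed (use hY gh openin_subset[OF V] in auto)
  ultimately show "openin (mf_top Y) {q \<in> mf_pts Y. g q \<in> V}" by simp
 qed
 have oh: "oloc ?n h c c1" if c: "c \<in> mf_charts X" "c1 \<in> mf_charts Y" for c c1
 proof -
  obtain U f s where ce: "c = (U,f,s)" using prod_cases3 by blast
  obtain U1 f1 s1 where ce1: "c1 = (U1,f1,s1)" using prod_cases3 by blast
  obtain U' f' where c': "(U',f',s) \<in> mf_charts Y" and a: "!!p. p\<in>U ==> h p \<in> U' \<and> f p = f' (h p)" using m[OF c(1)[unfolded ce]] by blast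
  note gcY = manifoldD(4)[OF Y c'] and gcX = X[OF c(1),unfolded ce] and gc1 = manifoldD(4)[OF Y c(2),unfolded ce1]
  show ?thesis unfolding ce ce1
  proof (rule oloc_transfer[where k' = "\<lambda>x. x" and a = h and H = UNIV])
   show "oloc ?n (\<lambda>x. x) (U',f',s) (U1,f1,s1)" using manifoldD(6)[OF Y c' c(2)] d ce1 by simp
   show "openin (EH UNIV ?n) (f ` {p \<in> U. h p \<in> U1})" by (rule gchart_dom[OF gcX ch gchartD(1)[OF gc1]])
  qed (use gchartD[OF gcX] gchartD[OF gcY] a in auto)
 qed
 have og: "oloc ?n g c1 c" if c: "c \<in> mf_charts X" "c1 \<in> mf_charts Y" for c c1
 proof -
  obtain U f s where ce: "c = (U,f,s)" using prod_cases3 by blast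
  obtain U1 f1 s1 where ce1: "c1 = (U1,f1,s1)" using prod_cases3 by blast
  obtain U' f' where c': "(U',f',s) \<in> mf_charts Y" and a: "!!p. p\<in>U ==> h p \<in> U' \<and> f p = f' (h p)" using m[OF c(1)[unfolded ce]] by blast
  note gcY = manifoldD(4)[OF Y c'] and gcX = X[OF c(1),unfolded ce] and gc1 = manifoldD(4)[OF Y c(2),unfolded ce1]
  show ?thesis unfolding ce ce1
  proof (rule oloc_transfer[where k' = "\<lambda>x. x" and a = "\<lambda>x. x" and H = UNIV])
   show "oloc ?n (\<lambda>x. x) (U1,f1,s1) (U',f',s)" using manifoldD(6)[OF Y c(2) c'] d ce1 by simp
   show "openin (EH UNIV ?n) (f1 ` {p \<in> U1. g p \<in> U})" using gchart_dom[OF gc1 cg gchartD(1)[OF gcX]] d by simp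
   fix q assume q: "q \<in> U1" "g q \<in> U"
   hence "q \<in> mf_pts Y" using gchartD(2)[OF gc1] by blast
   thus "q \<in> U1 \<and> f1 q = f1 q \<and> q \<in> U' \<and> f (g q) = f' q" using a[OF q(2)] hg q by simp
  qed (use gchartD[OF gc1] in auto)
 qed
 show ?thesis unfolding odiff_def omap_def using d ch cg oh og gh hg by auto
qed

lemma odiff_match':
 assumes X: "omanif X" and Y: "omanif Y" and d: "mf_dim X = mf_dim Y"
  and m: "!!U f s. (U,f,s) \<in> mf_charts X ==> \<exists>U' f'. (U',f',s) \<in> mf_charts Y \<and> (\<forall>p\<in>U. h p \<in> U' \<and> f p = f' (h p))"
  and g: "!!q. q \<in> mf_pts Y ==> g q \<in> mf_pts X" and gh: "!!p. p \<in> mf_pts X ==> g (h p) = p"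
  and hg: "!!q. q \<in> mf_pts Y ==> h (g q) = q"
 shows "odiff X Y h g"
 by (rule odiff_match) (use assms X[unfolded oriented_manifold_def manifold_iff] in auto)

text \<open>A matching of charts also transfers the compatibility of transitions from
  \<open>Y\<close> to \<open>X\<close>. For \<open>X\<close> there remain the topological clauses
  and the single charts.\<close>

lemma manifold_match:
 assumes Y: "manifold_modelled_on H Y" and d: "mf_dim X = mf_dim Y"
  and T: "Hausdorff_space (mf_top X)" "second_countable (mf_top X)" and cov: "mf_pts X = (\<Union>c\<in>mf_charts X. fst c)"
  and X: "!!c. c \<in> mf_charts X ==> gchart H (mf_dim X) (mf_top X) c"
  and m: "!!U f s. (U,f,s) \<in> mf_charts X ==> \<exists>U' f'. (U',f',s) \<in> mf_charts Y \<and> (\<forall>p\<in>U. a p \<in> U' \<and> f p = f' (a p))"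
 shows "manifold_modelled_on H X"
 unfolding manifold_iff
proof (intro conjI T cov ballI X)
 fix c1 c2 assume c: "c1 \<in> mf_charts X" "c2 \<in> mf_charts X"
 obtain U1 f1 s1 where ce1: "c1 = (U1,f1,s1)" using prod_cases3 by blast
 obtain U2 f2 s2 where ce2: "c2 = (U2,f2,s2)" using prod_cases3 by blast
 obtain U1' f1' where c1': "(U1',f1',s1) \<in> mf_charts Y" and a1: "!!p. p\<in>U1 ==> a p \<in> U1' \<and> f1 p = f1' (a p)" using m[OF c(1)[unfolded ce1]] by blast
 obtain U2' f2' where c2': "(U2',f2',s2) \<in> mf_charts Y" and a2: "!!p. p\<in>U2 ==> a p \<in> U2' \<and> f2 p = f2' (a p)" using m[OF c(2)[unfolded ce2]] by blast
 note gc1 = X[OF c(1),unfolded ce1] and gc2 = X[OF c(2),unfolded ce2] and gc1' = manifoldD(4)[OF Y c1']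
 show "oloc (mf_dim X) id c1 c2" unfolding ce1 ce2
 proof (rule oloc_transfer[where k' = id and a = a and H = H])
  show "oloc (mf_dim X) id (U1',f1',s1) (U2',f2',s2)" using manifoldD(5)[OF Y c1' c2'] d by simp
  have "{p \<in> U1. id p \<in> U2} = U1 \<inter> U2" by auto
  thus "openin (EH H (mf_dim X)) (f1 ` {p \<in> U1. id p \<in> U2})"
   using gchartD(1)[OF gc1] gchartD(1)[OF gc2] by (auto intro!: gchart_image[OF gc1])
 qed (use gchartD[OF gc1] gchartD[OF gc1'] a1 a2 in auto)
qed

section \<open>Constructions of manifolds\<close>

subsection \<open>Products\<close>

definition seq_cat :: "nat => (nat => real) => (nat => real) => nat => real"
 where "seq_cat n x y = (\<lambda>i. if i < n then x i else y (i - n))"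

definition seq_take :: "nat => (nat => real) => nat => real"
 where "seq_take n x = (\<lambda>i. if i < n then x i else 0)"

definition seq_drop :: "nat => (nat => real) => nat => real"
 where "seq_drop n x = (\<lambda>i. x (n + i))"

lemma seq_cat_in_Eu: "y \<in> Eu m ==> seq_cat n x y \<in> Eu (n + m)"
 by (simp add: seq_cat_def Eu_iff)

lemma seq_cat_take_drop [simp]: "seq_cat n (seq_take n z) (seq_drop n z) = z"
 by (auto simp: seq_cat_def seq_take_def seq_drop_def)

lemma seq_take_cat: "x \<in> Eu n ==> seq_take n (seq_cat n x y) = x"
 by (auto simp: seq_cat_def seq_take_def Eu_iff)

lemma seq_drop_cat [simp]: "seq_drop n (seq_cat n x y) = y"
 by (auto simp: seq_cat_def seq_drop_def)

lemma seq_cat_eq_iff: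
 "x \<in> Eu n ==> x' \<in> Eu n ==> seq_cat n x y = seq_cat n x' y' \<longleftrightarrow> x = x' \<and> y = y'"
 by (metis seq_take_cat seq_drop_cat)

lemma cont_seq_take: "continuous_map (Eucl (n + m)) (Eucl n) (seq_take n)"
 unfolding seq_take_def
 by (subst continuous_map_componentwise_Euclidean_space[where f = "\<lambda>x i. x i"]) (auto intro: cont_coord)

lemma cont_seq_drop: "continuous_map (Eucl (n + m)) (Eucl m) (seq_drop n)"
proof -
 have "continuous_map (Eucl (n + m)) (Eucl m) (\<lambda>x i. if i < m then x (n + i) else 0)"
  by (subst continuous_map_componentwise_Euclidean_space[where f = "\<lambda>x i. x (n + i)"]) (auto intro: cont_coord)
 thus ?thesis by (rule continuous_map_eq) (auto simp: seq_drop_def Eu_iff)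
qed

lemma inj_on_seq_cat:
 assumes inj: "inj_on f U" "inj_on f' U'" and E: "f ` U \<subseteq> Eu n"
 shows "inj_on (\<lambda>(p,q). seq_cat n (f p) (f' q)) (U \<times> U')"
proof (rule inj_onI,clarify)
 fix p q p' q' assume A: "p \<in> U" "q \<in> U'" "p' \<in> U" "q' \<in> U'" "seq_cat n (f p) (f' q) = seq_cat n (f p') (f' q')"
 have "f p \<in> Eu n" "f p' \<in> Eu n" using A E by auto
 hence "f p = f p' \<and> f' q = f' q'" using A(5) seq_cat_eq_iff by blast
 thus "p = p' \<and> q = q'" using A inj by (auto dest: inj_onD)
qed

text \<open>Membership in \<open>H\<close> depends on the first \<open>n\<close> coordinates only.
  One statement thus covers products of manifolds without boundary (\<open>H = UNIV\<close>) and
  products whose first factor has a boundary (\<open>H = half_space\<close>).\<close>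

lemma gchart_prod:
 assumes g: "gchart H n T (U,f,s)" and g': "gchart UNIV m T' (U',f',s')"
  and H: "!!z. z \<in> Eu (n + m) ==> z \<in> H \<longleftrightarrow> seq_take n z \<in> H"
 shows "gchart H (n + m) (prod_topology T T') (U \<times> U',\<lambda>(p,q). seq_cat n (f p) (f' q),s * s')"
proof -
 let ?\<Phi> = "\<lambda>(p,q). seq_cat n (f p) (f' q)"
 note gD = gchartD[OF g] and gD' = gchartD[OF g']
 have phiE: "f p \<in> Eu n" "f p \<in> H" if "p \<in> U" for p using gD that by auto
 have phiE': "f' q \<in> Eu m" if "q \<in> U'" for q using gD' that by auto
 have inj: "inj_on ?\<Phi> (U \<times> U')" by (rule inj_on_seq_cat[OF gD(3) gD'(3) gD(4)])
 have img: "openin (EH H (n + m)) (?\<Phi> ` W)" if W: "openin (prod_topology T T') W" "W \<subseteq> U \<times> U'" for W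
 proof (subst openin_subopen,intro ballI)
  fix z assume "z \<in> ?\<Phi> ` W"
  then obtain p q where pq: "(p,q) \<in> W" "z = ?\<Phi> (p,q)" by auto
  then obtain A B where AB: "openin T A" "openin T' B" "p \<in> A" "q \<in> B" "A \<times> B \<subseteq> W"
   using W(1)[unfolded openin_prod_topology_alt,rule_format,OF pq(1)] by blast
  have sub: "A \<subseteq> U" "B \<subseteq> U'" using AB W(2) by auto
  obtain Q where Q: "openin (Eucl n) Q" "f ` A = Q \<inter> H"
   using gchart_image[OF g AB(1) sub(1)] unfolding openin_subtopology by blast
  have Q': "openin (Eucl m) (f' ` B)"
   using gchart_image[OF g' AB(2) sub(2)] by simp
  let ?R = "{z \<in> Eu (n + m). seq_take n z \<in> Q} \<inter> {z \<in> Eu (n + m). seq_drop n z \<in> f' ` B}"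
  have "openin (Eucl (n + m)) ?R"
   by (intro openin_Int openin_continuous_map_preimage[OF cont_seq_take Q(1)]
     openin_continuous_map_preimage[OF cont_seq_drop Q'])
  hence "openin (EH H (n + m)) (?R \<inter> H)" by (auto simp: openin_subtopology)
  moreover have "?R \<inter> H \<subseteq> ?\<Phi> ` W"
  proof
   fix w assume w: "w \<in> ?R \<inter> H"
   hence "seq_take n w \<in> f ` A" using H[of w] Q(2) by auto
   then obtain p' q' where "p' \<in> A" "seq_take n w = f p'" "q' \<in> B" "seq_drop n w = f' q'" using w by auto
   hence "w = ?\<Phi> (p',q')" "(p',q') \<in> W" using seq_cat_take_drop[of n w] AB(5) by auto
   thus "w \<in> ?\<Phi> ` W" by blast
  qed
  moreover have "z \<in> ?R \<inter> H"
  proof -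
   have pU: "p \<in> U" "q \<in> U'" using AB sub by auto
   have zE: "z \<in> Eu (n + m)" using pq phiE'[OF pU(2)] by (simp add: seq_cat_in_Eu)
   have t: "seq_take n z = f p" using pq phiE[OF pU(1)] by (simp add: seq_take_cat)
   have "f p \<in> Q" using Q(2) AB(3) by blast
   thus ?thesis using zE t H[OF zE] phiE[OF pU(1)] AB(4) pq by auto
  qed
  ultimately show "\<exists>T. openin (EH H (n + m)) T \<and> z \<in> T \<and> T \<subseteq> ?\<Phi> ` W" by blast
 qed
 have pre: "openin (prod_topology T T') {x \<in> U \<times> U'. ?\<Phi> x \<in> R}" if R: "openin (EH H (n + m)) R" for R
  unfolding openin_prod_topology_alt
 proof (intro allI impI)
  fix p q assume "(p,q) \<in> {x \<in> U \<times> U'. ?\<Phi> x \<in> R}"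
  hence pq: "p \<in> U" "q \<in> U'" "seq_cat n (f p) (f' q) \<in> R" by auto
  obtain Q where Q: "openin (Eucl (n + m)) Q" "R = Q \<inter> H" using R unfolding openin_subtopology by blast
  obtain e where e: "e > 0" "cube (n + m) (seq_cat n (f p) (f' q)) e \<subseteq> Q"
   using Q pq(3) unfolding openin_cube_iff by blast
  let ?A = "{p' \<in> U. f p' \<in> cube n (f p) e \<inter> H}" and ?B = "{q' \<in> U'. f' q' \<in> cube m (f' q) e}"
  have "openin T ?A" by (rule gchart_preimage[OF g]) (use openin_cube in "auto simp: openin_subtopology")
  moreover have "openin T' ?B" by (rule gchart_preimage[OF g']) (simp add: openin_cube)
  moreover have "p \<in> ?A" "q \<in> ?B" using pq e phiE phiE' by (auto simp: cube_def)
  moreover have "?A \<times> ?B \<subseteq> {x \<in> U \<times> U'. ?\<Phi> x \<in> R}"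
  proof (rule subsetI)
   fix w assume "w \<in> ?A \<times> ?B"
   then obtain p' q' where w: "w = (p',q')" and a: "p' \<in> U" "f p' \<in> cube n (f p) e" "f p' \<in> H" "q' \<in> U'" "f' q' \<in> cube m (f' q) e"
    by auto
   let ?z = "seq_cat n (f p') (f' q')"
   have zE: "?z \<in> Eu (n + m)" using phiE'[OF a(4)] by (simp add: seq_cat_in_Eu)
   moreover have "\<bar>?z i - seq_cat n (f p) (f' q) i\<bar> < e" if "i < n + m" for i
    using a(2,5) that by (auto simp: cube_def seq_cat_def)
   ultimately have "?z \<in> Q" using e by (auto simp: cube_def)
   moreover have "?z \<in> H" using H[OF zE] a phiE by (simp add: seq_take_cat)
   ultimately show "w \<in> {x \<in> U \<times> U'. ?\<Phi> x \<in> R}" using Q a w by simp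
  qed
  ultimately show "\<exists>A B. openin T A \<and> openin T' B \<and> p \<in> A \<and> q \<in> B \<and> A \<times> B \<subseteq> {x \<in> U \<times> U'. ?\<Phi> x \<in> R}"
   by blast
 qed
 have "openin (prod_topology T T') (U \<times> U')" using gD(1) gD'(1) by (simp add: openin_prod_Times_iff)
 thus ?thesis using inj img pre gD(6) gD'(6) unfolding gchart_def by auto
qed

text \<open>The matrix is block triangular. The block that is shown to vanish contains the
  derivatives of the first component along the second factor: there \<open>D2\<close> is open, so
  the derivative of a constant within it is really 0, whereas along a line that meets the domain in
  an isolated point it would be arbitrary. The opposite block does not affect the
  determinant.\<close>

lemma jacobian_det_block:
 assumes D2: "openin (Eucl m) D2" and x: "x \<in> D1" "D1 \<subseteq> Eu n" and y: "y \<in> D2"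
  and D: "D = {z \<in> Eu (n + m). seq_take n z \<in> D1 \<and> seq_drop n z \<in> D2}"
  and r: "!!x y. x \<in> D1 ==> y \<in> D2 ==> r (seq_cat n x y) = seq_cat n (r1 x) (r2 y)"
 shows "jacobian_det (n + m) D r (seq_cat n x y) = jacobian_det n D1 r1 x * jacobian_det m D2 r2 y"
proof -
 let ?z = "seq_cat n x y"
 let ?D = "\<lambda>S F x i k. vector_derivative (\<lambda>t. F (x(k := t)) i) (at (x k) within {t. x(k := t) \<in> S}) :: real"
 let ?J = "\<lambda>n m S F x. Matrix.mat n m (\<lambda>(i,k). ?D S F x i k)"
 have D2E: "D2 \<subseteq> Eu m" using openin_subset[OF D2] .
 have mem: "seq_cat n x' y' \<in> D \<longleftrightarrow> x' \<in> D1 \<and> y' \<in> D2" if "x' \<in> Eu n" for x' y'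
  using that D2E seq_cat_in_Eu[of y' m n x'] by (auto simp: D seq_take_cat)
 have xE: "x \<in> Eu n" and yE: "y \<in> Eu m" using x y D2E by auto
 have up1: "?z(k := t) = seq_cat n (x(k := t)) y" if "k < n" for k t
  using that by (auto simp: seq_cat_def)
 have up2: "?z(n + k := t) = seq_cat n x (y(k := t))" for k t
  by (rule ext) (auto simp: seq_cat_def)
 have xkE: "x(k := t) \<in> Eu n" if "k < n" for k t using xE that by (auto simp: Eu_iff)
 have z1: "?z k = x k" if "k < n" for k using that by (simp add: seq_cat_def)
 have z2: "?z (n + k) = y k" for k by (simp add: seq_cat_def)
 have e1: "?D D r ?z i k = ?D D1 r1 x i k" if "i < n" "k < n" for i k
  unfolding up1[OF that(2)] z1[OF that(2)]
  by (rule vderiv_cong[OF open_UNIV UNIV_I])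
    (use that xkE[OF that(2)] x y mem r in \<open>auto simp: seq_cat_def[of n "r1 _"] simp del: fun_upd_apply\<close>)
 have e2: "?D D r ?z (n + i) (n + k) = ?D D2 r2 y i k" if "i < m" "k < m" for i k
  unfolding up2 z2
  by (rule vderiv_cong[OF open_UNIV UNIV_I])
    (use that x xE y mem r in \<open>auto simp: seq_cat_def[of n "r1 _"] simp del: fun_upd_apply\<close>)
 have e3: "?D D r ?z i (n + k) = 0" if "i < n" "k < m" for i k
 proof -
  have "?D D r ?z i (n + k) = vector_derivative (\<lambda>t. r1 x i) (at (y k) within {t. y(k := t) \<in> D2})"
   unfolding up2 z2
   by (rule vderiv_cong[OF open_UNIV UNIV_I])
     (use that x xE y mem r in \<open>auto simp: seq_cat_def[of n "r1 _"] simp del: fun_upd_apply\<close>)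
  also have "\<dots> = 0"
   by (subst at_within_open[OF _ open_line[OF D2 that(2)]]) (use y in auto)
  finally show ?thesis .
 qed
 have "?J (n + m) (n + m) D r ?z =
   four_block_mat (?J n n D1 r1 x) (0\<^sub>m n m) (Matrix.mat m n (\<lambda>(i,k). ?D D r ?z (n + i) k)) (?J m m D2 r2 y)"
 proof (rule eq_matI,goal_cases)
  case (1 i k)
  hence ik: "i < n + m" "k < n + m" by auto
  consider "i < n" "k < n" | "i < n" "k \<ge> n" | "i \<ge> n" "k < n" | "i \<ge> n" "k \<ge> n" by linarith
  thus ?case
  proof cases
   case 1
   thus ?thesis using e1[of i k] by simp
  next
   case 2
   then obtain k' where "k = n + k'" using le_Suc_ex by blast
   thus ?thesis using 2 ik e3[of i k'] by simp
  next
   case 3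
   then obtain i' where "i = n + i'" using le_Suc_ex by blast
   thus ?thesis using 3 ik by simp
  next
   case 4
   then obtain i' k' where "i = n + i'" "k = n + k'" using le_Suc_ex by meson
   thus ?thesis using ik e2[of i' k'] by simp
  qed
 qed auto
 thus ?thesis unfolding jacobian_det_def
  by (simp add: det_four_block_mat_upper_right_zero[of _ n _ m])
qed

lemma oloc_prod:
 assumes o1: "oloc n h1 (U1,f1,t1) (U1',f1',t1')" and o2: "oloc m h2 (U2,f2,t2) (U2',f2',t2')"
  and inj: "inj_on f1 U1" "inj_on f2 U2" and E: "f1 ` U1 \<subseteq> Eu n"
  and op: "openin (Eucl m) (f2 ` {q \<in> U2. h2 q \<in> U2'})"
 shows "oloc (n + m) (\<lambda>(p,q). (h1 p,h2 q))
  (U1 \<times> U2,\<lambda>(p,q). seq_cat n (f1 p) (f2 q),t1 * t2)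
  (U1' \<times> U2',\<lambda>(p,q). seq_cat n (f1' p) (f2' q),t1' * t2')"
proof -
 let ?c = "(U1 \<times> U2,\<lambda>(p,q). seq_cat n (f1 p) (f2 q),t1 * t2)"
 let ?c' = "(U1' \<times> U2',\<lambda>(p,q). seq_cat n (f1' p) (f2' q),t1' * t2')"
 let ?h = "\<lambda>(p,q). (h1 p,h2 q)"
 define D1 where "D1 = f1 ` {p \<in> U1. h1 p \<in> U1'}"
 define D2 where "D2 = f2 ` {q \<in> U2. h2 q \<in> U2'}"
 define r1 where "r1 = chart_rep (U1,f1,t1) (U1',f1',t1') h1"
 define r2 where "r2 = chart_rep (U2,f2,t2) (U2',f2',t2') h2"
 define r where "r = chart_rep ?c ?c' ?h"
 define D where "D = {z \<in> Eu (n + m). seq_take n z \<in> D1 \<and> seq_drop n z \<in> D2}"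
 have op2: "openin (Eucl m) D2" using op by (simp add: D2_def)
 have D2E: "D2 \<subseteq> Eu m" using openin_subset[OF op2] .
 have D1E: "D1 \<subseteq> Eu n" using E by (auto simp: D1_def)
 have dom: "chart_rep_dom ?c ?c' ?h = D"
 proof (intro equalityI subsetI)
  fix z assume "z \<in> chart_rep_dom ?c ?c' ?h"
  then obtain p q where pq: "p \<in> U1" "q \<in> U2" "h1 p \<in> U1'" "h2 q \<in> U2'" "z = seq_cat n (f1 p) (f2 q)"
   unfolding rep_dom_eq by auto
  hence "f1 p \<in> D1" "f2 q \<in> D2" by (auto simp: D1_def D2_def)
  thus "z \<in> D" using D1E D2E by (auto simp: D_def pq(5) seq_take_cat seq_cat_in_Eu subset_iff)
 next
  fix z assume z: "z \<in> D"
  then obtain p q where pq: "p \<in> U1" "q \<in> U2" "h1 p \<in> U1'" "h2 q \<in> U2'" "seq_take n z = f1 p" "seq_drop n z = f2 q"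
   unfolding D_def D1_def D2_def by auto
  hence "z = seq_cat n (f1 p) (f2 q)" using seq_cat_take_drop[of n z] by simp
  thus "z \<in> chart_rep_dom ?c ?c' ?h" unfolding rep_dom_eq using pq by force
 qed
 note injP = inj_on_seq_cat[OF inj E]
 have req: "r (seq_cat n x y) = seq_cat n (r1 x) (r2 y)" if xy: "x \<in> D1" "y \<in> D2" for x y
 proof -
  obtain p q where pq: "p \<in> U1" "q \<in> U2" "h1 p \<in> U1'" "h2 q \<in> U2'" "x = f1 p" "y = f2 q"
   using xy unfolding D1_def D2_def by auto
  have "r1 x = f1' (h1 p)" "r2 y = f2' (h2 q)"
   unfolding r1_def r2_def using pq inj by (simp_all add: rep_apply)
  moreover have "r (seq_cat n x y) = seq_cat n (f1' (h1 p)) (f2' (h2 q))"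
   unfolding r_def using rep_apply[OF injP,of "(p,q)" "t1 * t2" "U1' \<times> U2'" "\<lambda>(p,q). seq_cat n (f1' p) (f2' q)" "t1' * t2'" ?h] pq by simp
  ultimately show ?thesis by simp
 qed
 have rz: "r z = seq_cat n (r1 (seq_take n z)) (r2 (seq_drop n z))" if "z \<in> D" for z
  using req[of "seq_take n z" "seq_drop n z"] that by (simp add: D_def)
 have s1: "smooth_on n n D1 r1" and s2: "smooth_on m m D2 r2"
  using o1 o2 by (auto simp: oloc_def rep_dom_eq D1_def D2_def r1_def r2_def)
 have DE: "D \<subseteq> Eu (n + m)" by (auto simp: D_def)
 have "smooth_on (n + m) 1 D (\<lambda>z j. r z i)" if i: "i < n + m" for i
 proof (cases "i < n")
  case True
  have st: "smooth_on (n + m) n D (seq_take n)"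
   by (rule smooth_on_coordinates[OF DE,where \<sigma> = id]) (auto simp: seq_take_def)
  have "smooth_on n 1 D1 (\<lambda>x j. r1 x i)" using s1 True smooth_on_componentwise by blast
  from smooth_on_compose[OF st this DE _ D1E] have "smooth_on (n + m) 1 D (\<lambda>z j. r1 (seq_take n z) i)"
   by (auto simp: D_def)
  thus ?thesis by (rule smooth_on_cong) (use rz True in "simp add: seq_cat_def")
 next
  case False
  have st: "smooth_on (n + m) m D (seq_drop n)"
   by (rule smooth_on_coordinates[OF DE,where \<sigma> = "(+) n"]) (auto simp: seq_drop_def)
  have "i - n < m" using i False by linarith
  hence "smooth_on m 1 D2 (\<lambda>x j. r2 x (i - n))" using s2 smooth_on_componentwise by blast
  from smooth_on_compose[OF st this DE _ D2E] have "smooth_on (n + m) 1 D (\<lambda>z j. r2 (seq_drop n z) (i - n))"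
   by (auto simp: D_def)
  thus ?thesis by (rule smooth_on_cong) (use rz False in "simp add: seq_cat_def")
 qed
 hence sm: "smooth_on (n + m) (n + m) D r" using smooth_on_componentwise by blast
 have "sgn (jacobian_det (n + m) D r z) = (t1 * t2) * (t1' * t2')" if z: "z \<in> D" for z
 proof -
  have d: "seq_take n z \<in> D1" "seq_drop n z \<in> D2" using z by (auto simp: D_def)
  have "jacobian_det (n + m) D r z = jacobian_det n D1 r1 (seq_take n z) * jacobian_det m D2 r2 (seq_drop n z)"
   using jacobian_det_block[where r = r and ?r1.0 = r1 and ?r2.0 = r2,OF op2 d(1) D1E d(2) D_def req] by simp
  moreover have "sgn (jacobian_det n D1 r1 (seq_take n z)) = t1 * t1'"
   using o1 d(1) by (auto simp: oloc_def rep_dom_eq D1_def r1_def)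
  moreover have "sgn (jacobian_det m D2 r2 (seq_drop n z)) = t2 * t2'"
   using o2 d(2) by (auto simp: oloc_def rep_dom_eq D2_def r2_def)
  ultimately show ?thesis by (simp add: sgn_mult)
 qed
 thus ?thesis using sm unfolding oloc_def dom r_def[symmetric] by auto
qed

lemma mf_prod_simps:
 "mf_top (mf_prod X Y) = prod_topology (mf_top X) (mf_top Y)"
 "mf_dim (mf_prod X Y) = mf_dim X + mf_dim Y"
 "mf_pts (mf_prod X Y) = mf_pts X \<times> mf_pts Y"
 by (auto simp: mf_prod_def)

lemma mf_charts_prod_iff:
 "c \<in> mf_charts (mf_prod X Y) \<longleftrightarrow> (\<exists>U f s U' f' s'. (U,f,s) \<in> mf_charts X \<and> (U',f',s') \<in> mf_charts Y \<and>
  c = (U \<times> U',\<lambda>(p,q). seq_cat (mf_dim X) (f p) (f' q),s * s'))"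
proof
 assume "c \<in> mf_charts (mf_prod X Y)"
 then obtain c1 c2 where "c1 \<in> mf_charts X" "c2 \<in> mf_charts Y" and c: "c = (\<lambda>((U,f,s),(U',f',s')).
    (U \<times> U',\<lambda>(p,q) i. if i < mf_dim X then f p i else f' q (i - mf_dim X),s * s')) (c1,c2)"
 proof -
  have "c \<in> (\<lambda>((U,f,s),(U',f',s')).
    (U \<times> U',\<lambda>(p,q) i. if i < mf_dim X then f p i else f' q (i - mf_dim X),s * s')) ` (mf_charts X \<times> mf_charts Y)"
   using \<open>c \<in> mf_charts (mf_prod X Y)\<close> by (simp add: mf_prod_def)
  then obtain z where z: "z \<in> mf_charts X \<times> mf_charts Y" and c: "c = (\<lambda>((U,f,s),(U',f',s')).
    (U \<times> U',\<lambda>(p,q) i. if i < mf_dim X then f p i else f' q (i - mf_dim X),s * s')) z" by (rule imageE)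
  show thesis by (rule that[of "fst z" "snd z"]) (use z c in "simp_all add: mem_Times_iff")
 qed
 moreover obtain U f s where "c1 = (U,f,s)" using prod_cases3 by blast
 moreover obtain U' f' s' where "c2 = (U',f',s')" using prod_cases3 by blast
 ultimately have "(U,f,s) \<in> mf_charts X \<and> (U',f',s') \<in> mf_charts Y \<and>
  c = (U \<times> U',\<lambda>(p,q). seq_cat (mf_dim X) (f p) (f' q),s * s')" by (simp add: seq_cat_def)
 thus "\<exists>U f s U' f' s'. (U,f,s) \<in> mf_charts X \<and> (U',f',s') \<in> mf_charts Y \<and>
  c = (U \<times> U',\<lambda>(p,q). seq_cat (mf_dim X) (f p) (f' q),s * s')" by blast
next
 assume "\<exists>U f s U' f' s'. (U,f,s) \<in> mf_charts X \<and> (U',f',s') \<in> mf_charts Y \<and>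
  c = (U \<times> U',\<lambda>(p,q). seq_cat (mf_dim X) (f p) (f' q),s * s')"
 then obtain U f s U' f' s' where 1: "(U,f,s) \<in> mf_charts X" "(U',f',s') \<in> mf_charts Y"
  "c = (U \<times> U',\<lambda>(p,q). seq_cat (mf_dim X) (f p) (f' q),s * s')" by blast
 show "c \<in> mf_charts (mf_prod X Y)"
  unfolding mf_prod_def
  by (simp add: image_iff) (rule bexI[OF _ 1(1)],rule bexI[OF _ 1(2)],simp add: 1(3) seq_cat_def)
qed

lemma sec_count_prod_topology:
 assumes "second_countable X" "second_countable Y" shows "second_countable (prod_topology X Y)"
proof -
 obtain A where A: "countable A" "\<forall>V\<in>A. openin X V" "\<forall>U x. openin X U \<and> x \<in> U \<longrightarrow> (\<exists>V\<in>A. x \<in> V \<and> V \<subseteq> U)"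
  using assms(1) unfolding second_countable_def by blast
 obtain B where B: "countable B" "\<forall>V\<in>B. openin Y V" "\<forall>U x. openin Y U \<and> x \<in> U \<longrightarrow> (\<exists>V\<in>B. x \<in> V \<and> V \<subseteq> U)"
  using assms(2) unfolding second_countable_def by blast
 show ?thesis unfolding second_countable_def
 proof (intro exI[of _ "(\<lambda>(a,b). a \<times> b) ` (A \<times> B)"] conjI ballI allI impI)
  show "countable ((\<lambda>(a,b). a \<times> b) ` (A \<times> B))" using A B by blast
  show "openin (prod_topology X Y) V" if "V \<in> (\<lambda>(a,b). a \<times> b) ` (A \<times> B)" for V
   using that A B by (auto simp: openin_prod_Times_iff)
  fix U z assume "openin (prod_topology X Y) U \<and> z \<in> U"
  hence U: "openin (prod_topology X Y) U" and z: "(fst z,snd z) \<in> U" by auto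
  obtain a b where ab: "openin X a" "openin Y b" "fst z \<in> a" "snd z \<in> b" "a \<times> b \<subseteq> U"
   using U[unfolded openin_prod_topology_alt,rule_format,OF z] by blast
  obtain a' where "a' \<in> A" "fst z \<in> a'" "a' \<subseteq> a" using A(3) ab by blast
  moreover obtain b' where "b' \<in> B" "snd z \<in> b'" "b' \<subseteq> b" using B(3) ab by blast
  ultimately show "\<exists>V\<in>(\<lambda>(a,b). a \<times> b) ` (A \<times> B). z \<in> V \<and> V \<subseteq> U"
   by (intro bexI[of _ "a' \<times> b'"]) (use ab(5) in "auto simp: mem_Times_iff")
 qed
qed

lemma oloc_mf_prod:
 assumes X: "manifold_modelled_on H X" and Y: "omanif Y"
  and h1: "omap X X' h1" and h2: "omap Y Y' h2" and d: "mf_dim X = mf_dim X'"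
  and Y'o: "!!c. c \<in> mf_charts Y' ==> openin (mf_top Y') (fst c)"
  and c: "c \<in> mf_charts (mf_prod X Y)" and c': "c' \<in> mf_charts (mf_prod X' Y')"
 shows "oloc (mf_dim X + mf_dim Y) (\<lambda>(p,q). (h1 p,h2 q)) c c'"
proof -
 obtain U1 f1 s1 U2 f2 s2 where 1: "(U1,f1,s1) \<in> mf_charts X" "(U2,f2,s2) \<in> mf_charts Y"
  "c = (U1 \<times> U2,\<lambda>(p,q). seq_cat (mf_dim X) (f1 p) (f2 q),s1 * s2)"
  using c unfolding mf_charts_prod_iff by blast
 obtain U1' f1' s1' U2' f2' s2' where 2: "(U1',f1',s1') \<in> mf_charts X'" "(U2',f2',s2') \<in> mf_charts Y'"
  "c' = (U1' \<times> U2',\<lambda>(p,q). seq_cat (mf_dim X') (f1' p) (f2' q),s1' * s2')"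
  using c' unfolding mf_charts_prod_iff by blast
 note g1 = manifoldD(4)[OF X 1(1)] and g2 = manifoldD(4)[OF Y[unfolded oriented_manifold_def] 1(2)]
 have "continuous_map (mf_top Y) (mf_top Y') h2" using h2 by (simp add: omap_def)
 hence "openin (mf_top Y) (U2 \<inter> {q \<in> mf_pts Y. h2 q \<in> U2'})"
  using Y'o[OF 2(2)] by (intro openin_Int gchartD(1)[OF g2] openin_continuous_map_preimage) auto
 moreover have "U2 \<inter> {q \<in> mf_pts Y. h2 q \<in> U2'} = {q \<in> U2. h2 q \<in> U2'}" using gchartD(2)[OF g2] by auto
 ultimately have op: "openin (Eucl (mf_dim Y)) (f2 ` {q \<in> U2. h2 q \<in> U2'})"
  using gchart_image[OF g2,of "{q \<in> U2. h2 q \<in> U2'}"] by auto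
 show ?thesis unfolding 1(3) 2(3) d[symmetric]
  by (rule oloc_prod[OF _ _ _ _ _ op])
    (use h1 h2 1 2 gchartD[OF g1] gchartD[OF g2] in "auto simp: omap_def")
qed

lemma manifold_prod:
 assumes X: "manifold_modelled_on H X" and Y: "omanif Y"
  and H: "!!z. z \<in> Eu (mf_dim X + mf_dim Y) ==> z \<in> H \<longleftrightarrow> seq_take (mf_dim X) z \<in> H"
 shows "manifold_modelled_on H (mf_prod X Y)"
 unfolding manifold_iff
proof (intro conjI ballI)
 note Y' = Y[unfolded oriented_manifold_def]
 show "Hausdorff_space (mf_top (mf_prod X Y))" "second_countable (mf_top (mf_prod X Y))"
  using manifoldD[OF X] manifoldD[OF Y'] by (auto simp: mf_prod_simps Hausdorff_space_prod_topology sec_count_prod_topology)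
 have gc: "gchart H (mf_dim (mf_prod X Y)) (mf_top (mf_prod X Y)) c" if c: "c \<in> mf_charts (mf_prod X Y)" for c
 proof -
  obtain U1 f1 s1 U2 f2 s2 where 1: "(U1,f1,s1) \<in> mf_charts X" "(U2,f2,s2) \<in> mf_charts Y"
   "c = (U1 \<times> U2,\<lambda>(p,q). seq_cat (mf_dim X) (f1 p) (f2 q),s1 * s2)"
   using c unfolding mf_charts_prod_iff by blast
  show ?thesis unfolding 1(3) mf_prod_simps
   by (rule gchart_prod[OF manifoldD(4)[OF X 1(1)] manifoldD(4)[OF Y' 1(2)] H])
 qed
 thus "gchart H (mf_dim (mf_prod X Y)) (mf_top (mf_prod X Y)) c" if "c \<in> mf_charts (mf_prod X Y)" for c
  using that .
 show "mf_pts (mf_prod X Y) = (\<Union>c\<in>mf_charts (mf_prod X Y). fst c)"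
 proof (intro equalityI subsetI)
  fix z assume "z \<in> mf_pts (mf_prod X Y)"
  then obtain p q where pq: "z = (p,q)" "p \<in> mf_pts X" "q \<in> mf_pts Y" by (auto simp: mf_prod_simps)
  obtain U f s where "(U,f,s) \<in> mf_charts X" "p \<in> U" using manifoldD(3)[OF X pq(2)] by blast
  moreover obtain U' f' s' where "(U',f',s') \<in> mf_charts Y" "q \<in> U'" using manifoldD(3)[OF Y' pq(3)] by blast
  ultimately have "(U \<times> U',\<lambda>(p,q). seq_cat (mf_dim X) (f p) (f' q),s * s') \<in> mf_charts (mf_prod X Y)" "z \<in> U \<times> U'"
   using pq(1) unfolding mf_charts_prod_iff by blast+
  thus "z \<in> (\<Union>c\<in>mf_charts (mf_prod X Y). fst c)" by force
 next
  fix z assume "z \<in> (\<Union>c\<in>mf_charts (mf_prod X Y). fst c)"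
  then obtain U f s where c: "(U,f,s) \<in> mf_charts (mf_prod X Y)" "z \<in> U" by auto
  thus "z \<in> mf_pts (mf_prod X Y)" using gchartD(2)[OF gc[OF c(1)]] by blast
 qed
 show "oloc (mf_dim (mf_prod X Y)) id c c'" if "c \<in> mf_charts (mf_prod X Y)" "c' \<in> mf_charts (mf_prod X Y)" for c c'
 proof -
  have "openin (mf_top Y) (fst c)" if "c \<in> mf_charts Y" for c
   using manifoldD(4)[OF Y' that] gchartD(1) by (metis prod.collapse)
  hence "oloc (mf_dim X + mf_dim Y) (\<lambda>(p,q). (p,q)) c c'"
   using oloc_mf_prod[OF X Y omap_id[OF X] omap_id[OF Y'] refl _ that] by auto
  thus ?thesis by (simp add: mf_prod_simps case_prod_unfold id_def)
 qed
qed

lemma omanif_prod: "omanif X ==> omanif Y ==> omanif (mf_prod X Y)"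
 using manifold_prod[of UNIV X Y] by (simp add: oriented_manifold_def)

lemma bmanif_prod:
 assumes "oriented_manifold_with_boundary X" "omanif Y"
 shows "oriented_manifold_with_boundary (mf_prod X Y)"
 using assms manifold_prod[of half_space X Y]
 by (simp add: oriented_manifold_with_boundary_def mf_prod_simps half_space_def seq_take_def)

lemma openin_chart: "manifold_modelled_on H Y ==> c \<in> mf_charts Y ==> openin (mf_top Y) (fst c)"
 using manifoldD(4)[of H Y c] gchartD(1) by (metis prod.collapse)

lemma omap_prod:
 assumes X: "omanif X" and Y: "omanif Y" and Y': "omanif Y'"
  and h1: "omap X X' h1" and h2: "omap Y Y' h2" and d: "mf_dim X = mf_dim X'"
 shows "omap (mf_prod X Y) (mf_prod X' Y') (\<lambda>(p,q). (h1 p,h2 q))"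
 unfolding omap_def mf_prod_simps
proof (intro conjI ballI)
 show "continuous_map (prod_topology (mf_top X) (mf_top Y)) (prod_topology (mf_top X') (mf_top Y')) (\<lambda>(p,q). (h1 p,h2 q))"
  using h1 h2 by (simp add: omap_def continuous_map_prod_top)
qed (use oloc_mf_prod[OF X[unfolded oriented_manifold_def] Y h1 h2 d openin_chart[OF Y'[unfolded oriented_manifold_def]]] in auto)

lemma odiff_prod:
 assumes X: "omanif X" "omanif X'" and Y: "omanif Y" "omanif Y'"
  and hg: "odiff X X' h1 g1" "odiff Y Y' h2 g2"
 shows "odiff (mf_prod X Y) (mf_prod X' Y') (\<lambda>(p,q). (h1 p,h2 q)) (\<lambda>(p,q). (g1 p,g2 q))"
proof -
 have "omap (mf_prod X Y) (mf_prod X' Y') (\<lambda>(p,q). (h1 p,h2 q))"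
  by (rule omap_prod) (use assms in "auto simp: odiff_def")
 moreover have "omap (mf_prod X' Y') (mf_prod X Y) (\<lambda>(p,q). (g1 p,g2 q))"
  by (rule omap_prod) (use assms in "auto simp: odiff_def")
 ultimately show ?thesis using hg by (auto simp: odiff_def mf_prod_simps)
qed

subsection \<open>Disjoint unions\<close>

lemma topspace_coproduct [simp]: "topspace (coproduct_topology X Y) = Inl ` topspace X \<union> Inr ` topspace Y"
proof (intro equalityI)
 have o: "openin X (Inl -` topspace (coproduct_topology X Y))" "openin Y (Inr -` topspace (coproduct_topology X Y))"
  using openin_topspace[of "coproduct_topology X Y"] unfolding openin_coproduct_topology by auto
 show "topspace (coproduct_topology X Y) \<subseteq> Inl ` topspace X \<union> Inr ` topspace Y"
 proof
  fix z assume z: "z \<in> topspace (coproduct_topology X Y)"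
  show "z \<in> Inl ` topspace X \<union> Inr ` topspace Y"
   using z openin_subset[OF o(1)] openin_subset[OF o(2)] by (cases z) auto
 qed
 have "Inl -` (Inl ` topspace X \<union> Inr ` topspace Y) = topspace X" "Inr -` (Inl ` topspace X \<union> Inr ` topspace Y) = topspace Y" by auto
 hence "openin (coproduct_topology X Y) (Inl ` topspace X \<union> Inr ` topspace Y)"
  unfolding openin_coproduct_topology by simp
 thus "Inl ` topspace X \<union> Inr ` topspace Y \<subseteq> topspace (coproduct_topology X Y)" by (rule openin_subset)
qed

lemma vimage_Inl_Inr [simp]: "Inl -` (Inr ` A) = {}" "Inr -` (Inl ` A) = {}" "Inl -` (Inl ` B) = B" "Inr -` (Inr ` C) = C"
 by auto

lemma openin_coproduct_image [simp]:
 "openin (coproduct_topology X Y) (Inl ` U) \<longleftrightarrow> openin X U"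
 "openin (coproduct_topology X Y) (Inr ` V) \<longleftrightarrow> openin Y V"
 by (simp_all add: openin_coproduct_topology)

lemma cont_Inl: "continuous_map X (coproduct_topology X Y) Inl"
 and cont_Inr: "continuous_map Y (coproduct_topology X Y) Inr"
proof -
 have "openin X {x \<in> topspace X. Inl x \<in> S}" "openin Y {x \<in> topspace Y. Inr x \<in> S}" if "openin (coproduct_topology X Y) S" for S
 proof -
  have o: "openin X (Inl -` S)" "openin Y (Inr -` S)" using that by (auto simp: openin_coproduct_topology)
  have "{x \<in> topspace X. Inl x \<in> S} = Inl -` S" "{x \<in> topspace Y. Inr x \<in> S} = Inr -` S"
   using o[THEN openin_subset] by auto
  thus "openin X {x \<in> topspace X. Inl x \<in> S}" "openin Y {x \<in> topspace Y. Inr x \<in> S}" using o by auto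
 qed
 thus "continuous_map X (coproduct_topology X Y) Inl" "continuous_map Y (coproduct_topology X Y) Inr"
  by (auto simp: continuous_map_def topspace_coproduct)
qed

lemma cont_case_sum:
 assumes f: "continuous_map X Z f" and g: "continuous_map Y Z g"
 shows "continuous_map (coproduct_topology X Y) Z (case_sum f g)"
 unfolding continuous_map_def openin_coproduct_topology
proof (intro conjI allI impI)
 show "case_sum f g \<in> topspace (coproduct_topology X Y) \<rightarrow> topspace Z"
  using f g by (auto simp: continuous_map_def topspace_coproduct)
 fix U assume U: "openin Z U"
 have "Inl -` {x \<in> topspace (coproduct_topology X Y). case_sum f g x \<in> U} = {x \<in> topspace X. f x \<in> U}"
  "Inr -` {x \<in> topspace (coproduct_topology X Y). case_sum f g x \<in> U} = {x \<in> topspace Y. g x \<in> U}"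
  by (auto simp: topspace_coproduct)
 thus "openin X (Inl -` {x \<in> topspace (coproduct_topology X Y). case_sum f g x \<in> U})"
  "openin Y (Inr -` {x \<in> topspace (coproduct_topology X Y). case_sum f g x \<in> U})"
  using f g U by (auto simp: continuous_map_def)
qed

lemma Hausdorff_coproduct:
 assumes "Hausdorff_space X" "Hausdorff_space Y" shows "Hausdorff_space (coproduct_topology X Y)"
 unfolding Hausdorff_space_def topspace_coproduct
proof (intro allI impI)
 fix x y assume A: "x \<in> Inl ` topspace X \<union> Inr ` topspace Y \<and> y \<in> Inl ` topspace X \<union> Inr ` topspace Y \<and> x \<noteq> y"
 have LR: "openin (coproduct_topology X Y) (Inl ` topspace X)" "openin (coproduct_topology X Y) (Inr ` topspace Y)" by auto
 consider a b where "x = Inl a" "y = Inl b" "a \<in> topspace X" "b \<in> topspace X" "a \<noteq> b"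
  | a b where "x = Inr a" "y = Inr b" "a \<in> topspace Y" "b \<in> topspace Y" "a \<noteq> b"
  | "x \<in> Inl ` topspace X" "y \<in> Inr ` topspace Y" | "y \<in> Inl ` topspace X" "x \<in> Inr ` topspace Y"
  using A by (cases x; cases y) auto
 thus "\<exists>U V. openin (coproduct_topology X Y) U \<and> openin (coproduct_topology X Y) V \<and> x \<in> U \<and> y \<in> V \<and> disjnt U V"
 proof cases
  case 1
  then obtain U V where "openin X U" "openin X V" "a \<in> U" "b \<in> V" "disjnt U V"
   using assms(1) unfolding Hausdorff_space_def by blast
  thus ?thesis using 1 by (intro exI[of _ "Inl ` U"] exI[of _ "Inl ` V"]) (auto simp: disjnt_def)
 next
  case 2
  then obtain U V where "openin Y U" "openin Y V" "a \<in> U" "b \<in> V" "disjnt U V"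
   using assms(2) unfolding Hausdorff_space_def by blast
  thus ?thesis using 2 by (intro exI[of _ "Inr ` U"] exI[of _ "Inr ` V"]) (auto simp: disjnt_def)
 next
  case 3
  thus ?thesis using LR by (intro exI[of _ "Inl ` topspace X"] exI[of _ "Inr ` topspace Y"]) (auto simp: disjnt_def)
 next
  case 4
  thus ?thesis using LR by (intro exI[of _ "Inr ` topspace Y"] exI[of _ "Inl ` topspace X"]) (auto simp: disjnt_def)
 qed
qed

lemma sec_count_coproduct:
 assumes "second_countable X" "second_countable Y" shows "second_countable (coproduct_topology X Y)"
proof -
 obtain A where A: "countable A" "\<forall>V\<in>A. openin X V" "\<forall>U x. openin X U \<and> x \<in> U \<longrightarrow> (\<exists>V\<in>A. x \<in> V \<and> V \<subseteq> U)"
  using assms(1) unfolding second_countable_def by blast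
 obtain B where B: "countable B" "\<forall>V\<in>B. openin Y V" "\<forall>U x. openin Y U \<and> x \<in> U \<longrightarrow> (\<exists>V\<in>B. x \<in> V \<and> V \<subseteq> U)"
  using assms(2) unfolding second_countable_def by blast
 show ?thesis unfolding second_countable_def
 proof (intro exI[of _ "(`) Inl ` A \<union> (`) Inr ` B"] conjI ballI allI impI)
  show "countable ((`) Inl ` A \<union> (`) Inr ` B)" using A B by blast
  show "openin (coproduct_topology X Y) V" if "V \<in> (`) Inl ` A \<union> (`) Inr ` B" for V
   using that A B by auto
  fix U z assume U: "openin (coproduct_topology X Y) U \<and> z \<in> U"
  hence o: "openin X (Inl -` U)" "openin Y (Inr -` U)" by (auto simp: openin_coproduct_topology)
  show "\<exists>V\<in>(`) Inl ` A \<union> (`) Inr ` B. z \<in> V \<and> V \<subseteq> U"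
  proof (cases z)
   case (Inl a)
   then obtain V where "V \<in> A" "a \<in> V" "V \<subseteq> Inl -` U" using A(3) o U by blast
   thus ?thesis using Inl by (intro bexI[of _ "Inl ` V"]) auto
  next
   case (Inr a)
   then obtain V where "V \<in> B" "a \<in> V" "V \<subseteq> Inr -` U" using B(3) o U by blast
   thus ?thesis using Inr by (intro bexI[of _ "Inr ` V"]) auto
  qed
 qed
qed

lemma compact_space_coproduct:
 assumes "compact_space X" "compact_space Y" shows "compact_space (coproduct_topology X Y)"
 unfolding compact_space_def topspace_coproduct
 by (intro compactin_Un image_compactin[OF _ cont_Inl] image_compactin[OF _ cont_Inr])
   (use assms in "auto simp: compact_space_def")

lemma mf_sum_simps:
 "mf_top (mf_sum X Y) = coproduct_topology (mf_top X) (mf_top Y)" "mf_dim (mf_sum X Y) = mf_dim X"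
 "mf_pts (mf_sum X Y) = Inl ` mf_pts X \<union> Inr ` mf_pts Y"
 by (auto simp: mf_sum_def topspace_coproduct)

lemma mf_charts_sum: "mf_charts (mf_sum X Y) = (\<lambda>(U,f,s). (Inl ` U,f \<circ> projl,s)) ` mf_charts X \<union>
  (\<lambda>(U,f,s). (Inr ` U,f \<circ> projr,s)) ` mf_charts Y"
 by (simp add: mf_sum_def)

lemma mf_charts_sum_cases:
 assumes "c \<in> mf_charts (mf_sum X Y)"
 obtains U f s where "(U,f,s) \<in> mf_charts X" "c = (Inl ` U,f \<circ> projl,s)"
  | U f s where "(U,f,s) \<in> mf_charts Y" "c = (Inr ` U,f \<circ> projr,s)"
 using assms unfolding mf_charts_sum by (elim UnE imageE) auto

lemma mf_charts_sumI:
 "(U,f,s) \<in> mf_charts X ==> (Inl ` U,f \<circ> projl,s) \<in> mf_charts (mf_sum X Y)"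
 "(U',f',s) \<in> mf_charts Y ==> (Inr ` U',f' \<circ> projr,s) \<in> mf_charts (mf_sum X Y)"
 unfolding mf_charts_sum by (force simp: image_iff)+

lemma gchart_Inl:
 assumes g: "gchart H n X (U,f,s)" shows "gchart H n (coproduct_topology X Y) (Inl ` U,f \<circ> projl,s)"
proof -
 have "openin (EH H n) ((f \<circ> projl) ` V)" if V: "openin (coproduct_topology X Y) V" "V \<subseteq> Inl ` U" for V
 proof -
  have "(f \<circ> projl) ` V = f ` (Inl -` V)" using V(2) by (force simp: image_iff)
  moreover have "openin X (Inl -` V)" "Inl -` V \<subseteq> U" using V by (auto simp: openin_coproduct_topology)
  ultimately show ?thesis using gchart_image[OF g] by simp
 qed
 moreover have "openin (coproduct_topology X Y) {p \<in> Inl ` U. (f \<circ> projl) p \<in> Q}" if Q: "openin (EH H n) Q" for Q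
 proof -
  have eq: "{p \<in> Inl ` U. (f \<circ> projl) p \<in> Q} = Inl ` {p \<in> U. f p \<in> Q}" by auto
  show ?thesis unfolding eq using gchart_preimage[OF g Q] by simp
 qed
 moreover have "inj_on (f \<circ> projl) (Inl ` U)" using gchartD(3)[OF g] by (auto simp: inj_on_def)
 ultimately show ?thesis using gchartD(1,6)[OF g] unfolding gchart_def by auto
qed

lemma gchart_Inr:
 assumes g: "gchart H n Y (U,f,s)" shows "gchart H n (coproduct_topology X Y) (Inr ` U,f \<circ> projr,s)"
proof -
 have "openin (EH H n) ((f \<circ> projr) ` V)" if V: "openin (coproduct_topology X Y) V" "V \<subseteq> Inr ` U" for V
 proof -
  have "(f \<circ> projr) ` V = f ` (Inr -` V)" using V(2) by (force simp: image_iff)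
  moreover have "openin Y (Inr -` V)" "Inr -` V \<subseteq> U" using V by (auto simp: openin_coproduct_topology)
  ultimately show ?thesis using gchart_image[OF g] by simp
 qed
 moreover have "openin (coproduct_topology X Y) {p \<in> Inr ` U. (f \<circ> projr) p \<in> Q}" if Q: "openin (EH H n) Q" for Q
 proof -
  have eq: "{p \<in> Inr ` U. (f \<circ> projr) p \<in> Q} = Inr ` {p \<in> U. f p \<in> Q}" by auto
  show ?thesis unfolding eq using gchart_preimage[OF g Q] by simp
 qed
 moreover have "inj_on (f \<circ> projr) (Inr ` U)" using gchartD(3)[OF g] by (auto simp: inj_on_def)
 ultimately show ?thesis using gchartD(1,6)[OF g] unfolding gchart_def by auto
qed

lemma oloc_empty:
 assumes "{p \<in> U. h p \<in> U'} = {}" shows "oloc n h (U,f,s) (U',f',s')"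
 unfolding oloc_def rep_dom_eq assms by simp

lemma oloc_sum:
 assumes X: "manifold_modelled_on H X" and Y: "manifold_modelled_on H Y" and d: "mf_dim X = mf_dim Y"
  and h1: "omap X X' h1" and h2: "omap Y Y' h2"
  and o': "!!c. c \<in> mf_charts X' ==> openin (mf_top X') (fst c)" "!!c. c \<in> mf_charts Y' ==> openin (mf_top Y') (fst c)"
  and c: "c \<in> mf_charts (mf_sum X Y)" and c': "c' \<in> mf_charts (mf_sum X' Y')"
 shows "oloc (mf_dim X) (map_sum h1 h2) c c'"
 using c
proof (cases rule: mf_charts_sum_cases)
 case (1 U f s)
 note g = manifoldD(4)[OF X 1(1)] note gD = gchartD[OF g]
 show ?thesis using c'
 proof (cases rule: mf_charts_sum_cases)
  case (1 U' f' s')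
  show ?thesis unfolding \<open>c = _\<close> 1(2)
  proof (rule oloc_transfer[where k' = h1 and a = projl and U1' = U and f1' = f and U2' = U' and f2' = f' and H = H])
   show "oloc (mf_dim X) h1 (U,f,s) (U',f',s')" using h1 1 \<open>(U,f,s) \<in> mf_charts X\<close> by (auto simp: omap_def)
   have "continuous_map (mf_top X) (mf_top X') h1" using h1 by (simp add: omap_def)
   hence "openin (mf_top X) (U \<inter> {p \<in> mf_pts X. h1 p \<in> U'})"
    using o'(1)[OF 1(1)] gD(1) by (intro openin_Int openin_continuous_map_preimage) auto
   moreover have "(f \<circ> projl) ` {p \<in> Inl ` U. map_sum h1 h2 p \<in> Inl ` U'} = f ` (U \<inter> {p \<in> mf_pts X. h1 p \<in> U'})"
    using gD(2) by (force simp: image_iff)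
   ultimately show "openin (EH H (mf_dim X)) ((f \<circ> projl) ` {p \<in> Inl ` U. map_sum h1 h2 p \<in> Inl ` U'})"
    using gchart_image[OF g] by simp
  qed (use gD in "auto simp: inj_on_def")
 next
  case (2 U' f' s')
  show ?thesis unfolding \<open>c = _\<close> 2(2) by (rule oloc_empty) auto
 qed
next
 case (2 U f s)
 note g = manifoldD(4)[OF Y 2(1)] note gD = gchartD[OF g]
 show ?thesis using c'
 proof (cases rule: mf_charts_sum_cases)
  case (2 U' f' s')
  show ?thesis unfolding \<open>c = _\<close> 2(2) d
  proof (rule oloc_transfer[where k' = h2 and a = projr and U1' = U and f1' = f and U2' = U' and f2' = f' and H = H])
   show "oloc (mf_dim Y) h2 (U,f,s) (U',f',s')" using h2 2 \<open>(U,f,s) \<in> mf_charts Y\<close> by (auto simp: omap_def)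
   have "continuous_map (mf_top Y) (mf_top Y') h2" using h2 by (simp add: omap_def)
   hence "openin (mf_top Y) (U \<inter> {p \<in> mf_pts Y. h2 p \<in> U'})"
    using o'(2)[OF 2(1)] gD(1) by (intro openin_Int openin_continuous_map_preimage) auto
   moreover have "(f \<circ> projr) ` {p \<in> Inr ` U. map_sum h1 h2 p \<in> Inr ` U'} = f ` (U \<inter> {p \<in> mf_pts Y. h2 p \<in> U'})"
    using gD(2) by (force simp: image_iff)
   ultimately show "openin (EH H (mf_dim Y)) ((f \<circ> projr) ` {p \<in> Inr ` U. map_sum h1 h2 p \<in> Inr ` U'})"
    using gchart_image[OF g] by simp
  qed (use gD in "auto simp: inj_on_def")
 next
  case (1 U' f' s')
  show ?thesis unfolding \<open>c = _\<close> 1(2) by (rule oloc_empty) auto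
 qed
qed

lemma manifold_sum:
 assumes X: "manifold_modelled_on H X" and Y: "manifold_modelled_on H Y" and d: "mf_dim X = mf_dim Y"
 shows "manifold_modelled_on H (mf_sum X Y)"
 unfolding manifold_iff
proof (intro conjI ballI)
 show "Hausdorff_space (mf_top (mf_sum X Y))" "second_countable (mf_top (mf_sum X Y))"
  using manifoldD[OF X] manifoldD[OF Y] by (auto simp: mf_sum_simps Hausdorff_coproduct sec_count_coproduct)
 have gc: "gchart H (mf_dim X) (mf_top (mf_sum X Y)) c" if "c \<in> mf_charts (mf_sum X Y)" for c
  using that
 proof (cases rule: mf_charts_sum_cases)
  case (1 U f s)
  thus ?thesis using gchart_Inl manifoldD(4)[OF X 1(1)] by (simp add: mf_sum_simps)
 next
  case (2 U f s)
  thus ?thesis using gchart_Inr manifoldD(4)[OF Y 2(1)] d by (simp add: mf_sum_simps)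
 qed
 thus "gchart H (mf_dim (mf_sum X Y)) (mf_top (mf_sum X Y)) c" if "c \<in> mf_charts (mf_sum X Y)" for c
  using that by (simp add: mf_sum_simps)
 show "mf_pts (mf_sum X Y) = (\<Union>c\<in>mf_charts (mf_sum X Y). fst c)"
 proof (intro equalityI subsetI)
  fix z assume z: "z \<in> mf_pts (mf_sum X Y)"
  then consider p where "z = Inl p" "p \<in> mf_pts X" | p where "z = Inr p" "p \<in> mf_pts Y" by (auto simp: mf_sum_simps)
  thus "z \<in> (\<Union>c\<in>mf_charts (mf_sum X Y). fst c)"
  proof cases
   case 1
   then obtain U f s where u: "(U,f,s) \<in> mf_charts X" "p \<in> U" using manifoldD(3)[OF X] by blast
   show ?thesis using mf_charts_sumI(1)[OF u(1),of Y] u(2) 1 by force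
  next
   case 2
   then obtain U f s where u: "(U,f,s) \<in> mf_charts Y" "p \<in> U" using manifoldD(3)[OF Y] by blast
   show ?thesis using mf_charts_sumI(2)[OF u(1),of X] u(2) 2 by force
  qed
 next
  fix z assume "z \<in> (\<Union>c\<in>mf_charts (mf_sum X Y). fst c)"
  then obtain U f s where c: "(U,f,s) \<in> mf_charts (mf_sum X Y)" "z \<in> U" by auto
  thus "z \<in> mf_pts (mf_sum X Y)" using gchartD(2)[OF gc[OF c(1)]] by blast
 qed
 show "oloc (mf_dim (mf_sum X Y)) id c c'" if "c \<in> mf_charts (mf_sum X Y)" "c' \<in> mf_charts (mf_sum X Y)" for c c'
 proof -
  have "map_sum (\<lambda>x. x) (\<lambda>x. x) = (id :: 'a + 'b => _)" by (rule ext) (simp add: sum.map_ident)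
  thus ?thesis
   using oloc_sum[OF X Y d omap_id[OF X] omap_id[OF Y] openin_chart[OF X] openin_chart[OF Y] that]
   by (simp add: mf_sum_simps)
 qed
qed

lemma omanif_sum:
 "omanif X ==> omanif Y ==> mf_dim X = mf_dim Y ==> omanif (mf_sum X Y)"
 by (simp add: oriented_manifold_def manifold_sum)

lemma omap_sum:
 assumes X: "omanif X" and Y: "omanif Y" and X': "omanif X'" and Y': "omanif Y'"
  and d: "mf_dim X = mf_dim Y" and h1: "omap X X' h1" and h2: "omap Y Y' h2"
 shows "omap (mf_sum X Y) (mf_sum X' Y') (map_sum h1 h2)"
 unfolding omap_def mf_sum_simps
proof (intro conjI ballI)
 have "continuous_map (mf_top X) (coproduct_topology (mf_top X') (mf_top Y')) (Inl \<circ> h1)"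
  "continuous_map (mf_top Y) (coproduct_topology (mf_top X') (mf_top Y')) (Inr \<circ> h2)"
  using h1 h2 cont_Inl cont_Inr by (auto simp: omap_def intro!: continuous_map_compose)
 from cont_case_sum[OF this]
 show "continuous_map (coproduct_topology (mf_top X) (mf_top Y)) (coproduct_topology (mf_top X') (mf_top Y')) (map_sum h1 h2)"
  by (rule continuous_map_eq) (auto split: sum.split)
qed (rule oloc_sum[OF X[unfolded oriented_manifold_def] Y[unfolded oriented_manifold_def] d h1 h2
   openin_chart[OF X'[unfolded oriented_manifold_def]] openin_chart[OF Y'[unfolded oriented_manifold_def]]])

lemma odiff_sum:
 assumes X: "omanif X" "omanif X'" and Y: "omanif Y" "omanif Y'"
  and d: "mf_dim X = mf_dim Y" and hg: "odiff X X' h1 g1" "odiff Y Y' h2 g2"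
 shows "odiff (mf_sum X Y) (mf_sum X' Y') (map_sum h1 h2) (map_sum g1 g2)"
proof -
 have "omap (mf_sum X Y) (mf_sum X' Y') (map_sum h1 h2)"
  by (rule omap_sum) (use assms in "auto simp: odiff_def")
 moreover have "omap (mf_sum X' Y') (mf_sum X Y) (map_sum g1 g2)"
  by (rule omap_sum) (use assms in "auto simp: odiff_def")
 ultimately show ?thesis using hg by (auto simp: odiff_def mf_sum_simps)
qed

subsection \<open>Transport along injections, open submanifolds, reversed orientation\<close>

text \<open>For injective \<open>e\<close> this is the topology that makes \<open>e\<close> a
  homeomorphism onto its image. It serves to move a manifold to another type of points, in the end
  to \<open>pts\<close>.\<close>

definition img_topology :: "('a => 'b) => 'a topology => 'b topology"
 where "img_topology e T = topology (\<lambda>S. S \<subseteq> e ` topspace T \<and> openin T {p \<in> topspace T. e p \<in> S})"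

definition mf_image :: "('a => 'b) => 'a omanifold => 'b omanifold"
 where "mf_image e X = \<lparr>mf_top = img_topology e (mf_top X),mf_dim = mf_dim X,
  mf_charts = (\<lambda>(U,f,s). (e ` U,f \<circ> inv_into UNIV e,s)) ` mf_charts X\<rparr>"

lemma openin_img_topology:
 "openin (img_topology e T) S \<longleftrightarrow> S \<subseteq> e ` topspace T \<and> openin T {p \<in> topspace T. e p \<in> S}"
proof -
 have "{p \<in> topspace T. e p \<in> A \<inter> B} = {p \<in> topspace T. e p \<in> A} \<inter> {p \<in> topspace T. e p \<in> B}" for A B by auto
 moreover have "{p \<in> topspace T. e p \<in> \<Union>K} = (\<Union>A\<in>K. {p \<in> topspace T. e p \<in> A})" for K by auto
 ultimately have "istopology (\<lambda>S. S \<subseteq> e ` topspace T \<and> openin T {p \<in> topspace T. e p \<in> S})"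
  unfolding istopology_def by (auto intro!: openin_Union)
 thus ?thesis by (simp add: img_topology_def topology_inverse')
qed

lemma openin_img_topology_image:
 assumes "inj e" "U \<subseteq> topspace T" shows "openin (img_topology e T) (e ` U) \<longleftrightarrow> openin T U"
proof -
 have "{p \<in> topspace T. e p \<in> e ` U} = U" using assms by (auto dest: injD)
 thus ?thesis using assms by (auto simp: openin_img_topology)
qed

lemma topspace_img_topology [simp]: "topspace (img_topology e T) = e ` topspace T"
proof (intro equalityI)
 show "topspace (img_topology e T) \<subseteq> e ` topspace T"
  using openin_topspace[of "img_topology e T"] unfolding openin_img_topology by blast
 have "{p \<in> topspace T. e p \<in> e ` topspace T} = topspace T" by auto
 hence "openin (img_topology e T) (e ` topspace T)" by (simp add: openin_img_topology)
 thus "e ` topspace T \<subseteq> topspace (img_topology e T)" by (rule openin_subset)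
qed

lemma homeomorphic_map_img_topology:
 assumes e: "inj e" shows "homeomorphic_map T (img_topology e T) e"
proof (rule bijective_open_imp_homeomorphic_map)
 show "continuous_map T (img_topology e T) e"
  unfolding continuous_map_def topspace_img_topology by (auto simp: openin_img_topology)
 show "open_map T (img_topology e T) e"
  unfolding open_map_def using openin_img_topology_image[OF e] openin_subset by blast
qed (use e in "auto simp: topspace_img_topology intro: inj_on_subset")

lemma mf_image_simps:
 "mf_top (mf_image e X) = img_topology e (mf_top X)" "mf_dim (mf_image e X) = mf_dim X"
 "mf_pts (mf_image e X) = e ` mf_pts X"
 by (auto simp: mf_image_def topspace_img_topology)

lemma mf_charts_image_iff: "(U',f',s) \<in> mf_charts (mf_image e X) \<longleftrightarrow>
  (\<exists>U f. (U,f,s) \<in> mf_charts X \<and> U' = e ` U \<and> f' = f \<circ> inv_into UNIV e)"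
 by (force simp: mf_image_def image_iff)

lemma sec_count_homeomorphic_map:
 assumes "homeomorphic_map X Y f" "second_countable X" shows "second_countable Y"
 using second_countable_open_map_image[of X Y f] assms by (simp add: homeomorphic_eq_everything_map)

lemma gchart_img:
 assumes e: "inj e" and g: "gchart H n T (U,f,s)"
 shows "gchart H n (img_topology e T) (e ` U,f \<circ> inv_into UNIV e,s)"
proof -
 note gD = gchartD[OF g]
 have inv: "inv_into UNIV e (e p) = p" for p using e by simp
 have "openin (EH H n) ((f \<circ> inv_into UNIV e) ` V)" if V: "openin (img_topology e T) V" "V \<subseteq> e ` U" for V
 proof -
  let ?V = "{p \<in> topspace T. e p \<in> V}"
  have "V = e ` ?V" using V gD(2) by auto
  hence "(f \<circ> inv_into UNIV e) ` V = (f \<circ> inv_into UNIV e) ` e ` ?V" by simp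
  also have "\<dots> = f ` ?V" by (simp add: image_image inv)
  finally have "(f \<circ> inv_into UNIV e) ` V = f ` ?V" .
  moreover have "openin T ?V" "?V \<subseteq> U" using V e by (auto simp: openin_img_topology dest: injD)
  ultimately show ?thesis using gchart_image[OF g] by simp
 qed
 moreover have "openin (img_topology e T) {p \<in> e ` U. (f \<circ> inv_into UNIV e) p \<in> Q}" if Q: "openin (EH H n) Q" for Q
 proof -
  have "{p \<in> e ` U. (f \<circ> inv_into UNIV e) p \<in> Q} = e ` {p \<in> U. f p \<in> Q}" by (auto simp: inv)
  moreover have "{p \<in> U. f p \<in> Q} \<subseteq> topspace T" using gD(2) by auto
  ultimately show ?thesis using gchart_preimage[OF g Q] openin_img_topology_image[OF e] by metis
 qed
 moreover have "inj_on (f \<circ> inv_into UNIV e) (e ` U)" using gD(3) by (auto simp: inj_on_def inv)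
 moreover have "openin (img_topology e T) (e ` U)" using gD openin_img_topology_image[OF e] by metis
 ultimately show ?thesis using gD(6) unfolding gchart_def by auto
qed

lemma manifold_image:
 assumes e: "inj e" and X: "manifold_modelled_on H X" shows "manifold_modelled_on H (mf_image e X)"
proof (rule manifold_match[OF X,where a = "inv_into UNIV e"])
 note h = homeomorphic_map_img_topology[OF e,of "mf_top X"]
 show "Hausdorff_space (mf_top (mf_image e X))"
  unfolding mf_image_simps using homeomorphic_Hausdorff_space homeomorphic_map_imp_homeomorphic_space[OF h] manifoldD(1)[OF X] by blast
 show "second_countable (mf_top (mf_image e X))"
  unfolding mf_image_simps using sec_count_homeomorphic_map[OF h manifoldD(2)[OF X]] .
 show "mf_pts (mf_image e X) = (\<Union>c\<in>mf_charts (mf_image e X). fst c)"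
 proof -
  have "mf_pts X = (\<Union>c\<in>mf_charts X. fst c)" using X by (simp add: manifold_iff)
  thus ?thesis by (auto simp: mf_image_simps mf_image_def image_iff topspace_img_topology) force+
 qed
 show "gchart H (mf_dim (mf_image e X)) (mf_top (mf_image e X)) c" if c: "c \<in> mf_charts (mf_image e X)" for c
 proof -
  obtain U' f' s where ce: "c = (U',f',s)" using prod_cases3 by blast
  obtain U f where u: "(U,f,s) \<in> mf_charts X" "U' = e ` U" "f' = f \<circ> inv_into UNIV e"
   using c unfolding ce mf_charts_image_iff by blast
  show ?thesis unfolding ce u(2,3) mf_image_simps by (rule gchart_img[OF e manifoldD(4)[OF X u(1)]])
 qed
 fix U' f' s assume "(U',f',s) \<in> mf_charts (mf_image e X)"
 then obtain U f where u: "(U,f,s) \<in> mf_charts X" "U' = e ` U" "f' = f \<circ> inv_into UNIV e"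
  unfolding mf_charts_image_iff by blast
 thus "\<exists>U'' f''. (U'',f'',s) \<in> mf_charts X \<and> (\<forall>p\<in>U'. inv_into UNIV e p \<in> U'' \<and> f' p = f'' (inv_into UNIV e p))"
  using e by (intro exI[of _ U] exI[of _ f]) auto
qed (simp add: mf_image_simps)

lemma omanif_image: "inj e ==> omanif X ==> omanif (mf_image e X)"
 by (simp add: oriented_manifold_def manifold_image)

lemma compact_space_image: "inj e ==> compact_space (mf_top X) ==> compact_space (mf_top (mf_image e X))"
 using homeomorphic_compact_space homeomorphic_map_imp_homeomorphic_space[OF homeomorphic_map_img_topology]
 unfolding mf_image_simps by blast

lemma cont_inv_img_topology:
 assumes e: "inj e" shows "continuous_map (img_topology e T) T (inv_into UNIV e)"
proof -
 have inv: "inv_into UNIV e (e p) = p" for p using e by simp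
 have "{x \<in> e ` topspace T. inv_into UNIV e x \<in> U} = e ` U" if "openin T U" for U
  using openin_subset[OF that] by (auto simp: inv)
 thus ?thesis using openin_img_topology_image[OF e openin_subset]
  unfolding continuous_map_def topspace_img_topology by (auto simp: inv simp del: inv_into_f_eq)
qed

lemma odiff_image:
 assumes e: "inj e" and X: "omanif X" shows "odiff X (mf_image e X) e (inv_into UNIV e)"
proof (rule odiff_match'[OF X omanif_image[OF e X]])
 fix U f s assume u: "(U,f,s) \<in> mf_charts X"
 show "\<exists>U' f'. (U',f',s) \<in> mf_charts (mf_image e X) \<and> (\<forall>p\<in>U. e p \<in> U' \<and> f p = f' (e p))"
  by (rule exI[of _ "e ` U"],rule exI[of _ "f \<circ> inv_into UNIV e"]) (use u e in "auto simp: mf_charts_image_iff")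
qed (use e in "auto simp: mf_image_simps")

section \<open>Open submanifolds\<close>

definition mf_restrict :: "'a omanifold => 'a set => 'a omanifold"
 where "mf_restrict X A = \<lparr>mf_top = subtopology (mf_top X) A,mf_dim = mf_dim X,
  mf_charts = (\<lambda>(U,f,s). (U \<inter> A,f,s)) ` mf_charts X\<rparr>"

lemma mf_restrict_simps:
 "mf_top (mf_restrict X A) = subtopology (mf_top X) A" "mf_dim (mf_restrict X A) = mf_dim X"
 "mf_pts (mf_restrict X A) = mf_pts X \<inter> A"
 by (auto simp: mf_restrict_def)

lemma mf_charts_restrict_iff: "(U',f,s) \<in> mf_charts (mf_restrict X A) \<longleftrightarrow>
  (\<exists>U. (U,f,s) \<in> mf_charts X \<and> U' = U \<inter> A)"
 by (force simp: mf_restrict_def image_iff)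

lemma manifold_restrict:
 assumes X: "manifold_modelled_on H X" and A: "openin (mf_top X) A"
 shows "manifold_modelled_on H (mf_restrict X A)"
proof (rule manifold_match[OF X,where a = "\<lambda>x. x"])
 show "Hausdorff_space (mf_top (mf_restrict X A))" "second_countable (mf_top (mf_restrict X A))"
  using manifoldD(1,2)[OF X] by (auto simp: mf_restrict_simps Hausdorff_space_subtopology second_countable_subtopology)
 have "mf_pts X = (\<Union>c\<in>mf_charts X. fst c)" using X by (simp add: manifold_iff)
 thus "mf_pts (mf_restrict X A) = (\<Union>c\<in>mf_charts (mf_restrict X A). fst c)"
  unfolding mf_restrict_def by auto
 show "gchart H (mf_dim (mf_restrict X A)) (mf_top (mf_restrict X A)) c" if c: "c \<in> mf_charts (mf_restrict X A)" for c
 proof -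
  obtain U' f s where ce: "c = (U',f,s)" using prod_cases3 by blast
  obtain U where u: "(U,f,s) \<in> mf_charts X" "U' = U \<inter> A" using c unfolding ce mf_charts_restrict_iff by blast
  note g = gchart_restrict[OF manifoldD(4)[OF X u(1)] A]
  have "{p \<in> U \<inter> A. f p \<in> Q} \<subseteq> A" for Q by auto
  thus ?thesis using g unfolding ce u(2) mf_restrict_simps gchart_def
   by (simp add: openin_open_subtopology[OF A])
 qed
 show "\<exists>U'' f''. (U'',f'',s) \<in> mf_charts X \<and> (\<forall>p\<in>U. p \<in> U'' \<and> f p = f'' p)"
  if "(U,f,s) \<in> mf_charts (mf_restrict X A)" for U f s
  using that unfolding mf_charts_restrict_iff by blast
qed (simp add: mf_restrict_simps)

text \<open>A partition into two open pieces exhibits \<open>X\<close> as a disjoint union; this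
  splits off one connected component at a time.\<close>

lemma odiff_restrict_sum:
 assumes X: "omanif X" and A: "openin (mf_top X) A" and B: "openin (mf_top X) B"
  and AB: "A \<inter> B = {}" "A \<union> B = mf_pts X"
 shows "odiff (mf_sum (mf_restrict X A) (mf_restrict X B)) X (case_sum (\<lambda>x. x) (\<lambda>x. x)) (\<lambda>x. if x \<in> A then Inl x else Inr x)"
proof (rule odiff_match'[OF _ X])
 show "omanif (mf_sum (mf_restrict X A) (mf_restrict X B))"
  using X manifold_restrict[OF _ A] manifold_restrict[OF _ B]
  by (intro omanif_sum) (auto simp: oriented_manifold_def mf_restrict_simps)
 fix U f s assume c: "(U,f,s) \<in> mf_charts (mf_sum (mf_restrict X A) (mf_restrict X B))"
 thus "\<exists>U' f'. (U',f',s) \<in> mf_charts X \<and>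
   (\<forall>p\<in>U. case_sum (\<lambda>x. x) (\<lambda>x. x) p \<in> U' \<and> f p = f' (case_sum (\<lambda>x. x) (\<lambda>x. x) p))"
 proof (cases rule: mf_charts_sum_cases)
  case (1 U1 f1 s1)
  then obtain U2 where "(U2,f1,s1) \<in> mf_charts X" "U1 = U2 \<inter> A" unfolding mf_charts_restrict_iff by blast
  thus ?thesis using 1 by (intro exI[of _ U2] exI[of _ f1]) auto
 next
  case (2 U1 f1 s1)
  then obtain U2 where "(U2,f1,s1) \<in> mf_charts X" "U1 = U2 \<inter> B" unfolding mf_charts_restrict_iff by blast
  thus ?thesis using 2 by (intro exI[of _ U2] exI[of _ f1]) auto
 qed
qed (use AB in "auto simp: mf_sum_simps mf_restrict_simps split: sum.splits")

section \<open>Reversal of orientation\<close>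

definition mf_neg :: "'a omanifold => 'a omanifold"
 where "mf_neg X = \<lparr>mf_top = mf_top X,mf_dim = mf_dim X,mf_charts = (\<lambda>(U,f,s). (U,f,-s)) ` mf_charts X\<rparr>"

lemma mf_neg_simps: "mf_top (mf_neg X) = mf_top X" "mf_dim (mf_neg X) = mf_dim X"
 by (auto simp: mf_neg_def)

lemma mf_charts_neg_iff: "(U,f,s) \<in> mf_charts (mf_neg X) \<longleftrightarrow> (U,f,- s) \<in> mf_charts X"
 unfolding mf_neg_def by (force simp: image_iff)

lemma manifold_neg:
 assumes X: "manifold_modelled_on H X" shows "manifold_modelled_on H (mf_neg X)"
 unfolding manifold_iff mf_neg_simps
proof (intro conjI ballI)
 show "Hausdorff_space (mf_top X)" "second_countable (mf_top X)" using manifoldD(1,2)[OF X] .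
 have "mf_pts X = (\<Union>c\<in>mf_charts X. fst c)" using X by (simp add: manifold_iff)
 thus "mf_pts X = (\<Union>c\<in>mf_charts (mf_neg X). fst c)" by (auto simp: mf_neg_def split: prod.splits)
 show "gchart H (mf_dim X) (mf_top X) c" if c: "c \<in> mf_charts (mf_neg X)" for c
 proof -
  obtain U f s where ce: "c = (U,f,s)" using prod_cases3 by blast
  have "gchart H (mf_dim X) (mf_top X) (U,f,- s)" using manifoldD(4)[OF X] c unfolding ce mf_charts_neg_iff .
  thus ?thesis unfolding ce gchart_def by auto
 qed
 show "oloc (mf_dim X) id c c'" if c: "c \<in> mf_charts (mf_neg X)" "c' \<in> mf_charts (mf_neg X)" for c c'
 proof -
  obtain U f s where ce: "c = (U,f,s)" using prod_cases3 by blast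
  obtain U' f' s' where ce': "c' = (U',f',s')" using prod_cases3 by blast
  \<comment> \<open>Both signs change, so the sign prescribed for the transition, their product,
    does not.\<close>
  have "oloc (mf_dim X) id (U,f,- s) (U',f',- s')"
   using manifoldD(5)[OF X] c unfolding ce ce' mf_charts_neg_iff by blast
  thus ?thesis unfolding ce ce' oloc_def rep_dom_eq chart_rep_def by simp
 qed
qed

lemma omanif_neg: "omanif X ==> omanif (mf_neg X)"
 by (simp add: oriented_manifold_def manifold_neg)

lemma manifold_empty: "manifold_modelled_on H (mf_empty j)"
 unfolding manifold_iff mf_empty_def
 by (auto simp: second_countable_discrete_topology Hausdorff_space_discrete_topology)

subsection \<open>Boundaries\<close>

text \<open>\<open>seq_cons\<close> is the inclusion of \<open>\<real>\<^sup>m\<close> as the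
  boundary hyperplane of the half-space, and \<open>seq_tl\<close> is the shift of coordinates that
  occurs in \<open>mf_boundary\<close>.\<close>

definition seq_cons :: "(nat => real) => nat => real"
 where "seq_cons y = (\<lambda>i. case i of 0 => 0 | Suc j => y j)"

definition seq_tl :: "(nat => real) => nat => real"
 where "seq_tl x = (\<lambda>i. x (Suc i))"

lemma seq_cons_simps [simp]: "seq_cons y 0 = 0" "seq_cons y (Suc i) = y i" "seq_tl (seq_cons y) = y"
 by (auto simp: seq_cons_def seq_tl_def)

lemma seq_cons_tl: "x 0 = 0 ==> seq_cons (seq_tl x) = x"
 by (auto simp: seq_cons_def seq_tl_def split: nat.splits)

lemma seq_cons_in_Eu [simp]: "seq_cons y \<in> Eu (Suc m) \<longleftrightarrow> y \<in> Eu m"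
proof
 assume "seq_cons y \<in> Eu (Suc m)"
 hence "seq_cons y (Suc i) = 0" if "i \<ge> m" for i using that unfolding Eu_iff by blast
 thus "y \<in> Eu m" by (simp add: Eu_iff)
qed (auto simp: Eu_iff seq_cons_def split: nat.splits)

lemma seq_tl_in_Eu: "x \<in> Eu (Suc m) ==> seq_tl x \<in> Eu m"
 by (simp add: Eu_iff seq_tl_def)

lemma cont_seq_cons: "continuous_map (Eucl m) (Eucl (Suc m)) seq_cons"
proof -
 have c: "continuous_map (Eucl m) euclideanreal (\<lambda>x. seq_cons x i)" for i
  by (cases i) (auto intro: cont_coord)
 have "continuous_map (Eucl m) (Eucl (Suc m)) (\<lambda>x i. if i < Suc m then seq_cons x i else 0)"
  by (subst continuous_map_componentwise_Euclidean_space[where f = seq_cons]) (use c in auto)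
 thus ?thesis by (rule continuous_map_eq) (auto simp: Eu_iff seq_cons_def split: nat.splits)
qed

lemma cont_seq_tl: "continuous_map (Eucl (Suc m)) (Eucl m) seq_tl"
proof -
 have "continuous_map (Eucl (Suc m)) (Eucl m) (\<lambda>x i. if i < m then seq_tl x i else 0)"
  by (subst continuous_map_componentwise_Euclidean_space[where f = seq_tl])
    (auto simp: seq_tl_def intro: cont_coord)
 thus ?thesis by (rule continuous_map_eq) (auto simp: Eu_iff seq_tl_def)
qed

section \<open>Transition maps at boundary points\<close>

lemma det_zero_row:
 assumes A: "A \<in> carrier_mat n n" and i: "i < n" and z: "!!k. k < n ==> A $$ (i,k) = (0 :: real)"
 shows "Determinant.det A = 0"
 unfolding det_def'[OF A]
proof (rule sum.neutral,intro ballI)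
 fix p assume "p \<in> {p. p permutes {0..<n}}"
 hence "p i < n" using i permutes_in_image[of p "{0..<n}" i] by auto
 hence "(\<Prod>i = 0..<n. A $$ (i,p i)) = 0" using i z by (intro prod_zero bexI[of _ i]) auto
 thus "signof p * (\<Prod>i = 0..<n. A $$ (i,p i)) = 0" by simp
qed

text \<open>Decreasing a coordinate never leaves the half-space, so along every coordinate line a
  point of \<open>D\<close> is a limit of other points of \<open>D\<close>. This makes derivatives
  within \<open>D\<close> unique.\<close>

lemma half_space_line_not_bot:
 assumes D: "openin (EH half_space n) D" and x: "x \<in> D" and k: "k < n"
 shows "at (x k) within {t. x(k := t) \<in> D} \<noteq> bot"
proof -
 obtain Q where Q: "openin (Eucl n) Q" "D = Q \<inter> half_space" using D unfolding openin_subtopology by blast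
 let ?L = "{t. x(k := t) \<in> Q}"
 have o: "open ?L" by (rule open_line[OF Q(1) k])
 have "x k \<in> ?L" using x Q by simp
 then obtain e where e: "e > 0" "!!t. dist t (x k) < e ==> t \<in> ?L" using o unfolding open_dist by blast
 have "{x k - e<..<x k} \<subseteq> {t. x(k := t) \<in> D}"
 proof
  fix t assume t: "t \<in> {x k - e<..<x k}"
  hence "x(k := t) \<in> Q" using e(2)[of t] by (auto simp: dist_real_def)
  moreover have "x(k := t) \<in> half_space" using x t Q(2) by (cases "k = 0") (auto simp: half_space_def)
  ultimately show "t \<in> {t. x(k := t) \<in> D}" using Q(2) by simp
 qed
 moreover have "at (x k) within {x k - e<..<x k} \<noteq> bot"
  using e(1) by (simp add: trivial_limit_within islimpt_greaterThanLessThan2)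
 ultimately show ?thesis by (metis at_le bot.extremum_uniqueI)
qed

text \<open>The boundary hyperplane is preserved, so in the first row of the Jacobian only the first
  entry can be nonzero. That entry \<open>a\<close> is nonnegative because \<open>r\<close> does not
  send points with negative first coordinate to points with positive first coordinate. The remaining
  block is the Jacobian on the boundary.\<close>

lemma jacobian_det_boundary:
 assumes D: "openin (EH half_space (Suc m)) D" and r: "smooth_on (Suc m) (Suc m) D r"
  and rH: "!!x. x \<in> D ==> r x \<in> half_space" and Db: "openin (Eucl m) Db" "Db = {y \<in> Eu m. seq_cons y \<in> D}"
  and r0: "!!y. y \<in> Db ==> r (seq_cons y) 0 = 0" and rb: "!!y. y \<in> Db ==> rb y = seq_tl (r (seq_cons y))"
  and y: "y \<in> Db"
 obtains a where "a \<ge> 0" "jacobian_det (Suc m) D r (seq_cons y) = a * jacobian_det m Db rb y"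
proof -
 let ?x = "seq_cons y"
 let ?D = "\<lambda>S F x i k. vector_derivative (\<lambda>t. F (x(k := t)) i) (at (x k) within {t. x(k := t) \<in> S}) :: real"
 let ?J = "\<lambda>n m S F x. Matrix.mat n m (\<lambda>(i,k). ?D S F x i k)"
 have xD: "?x \<in> D" using y Db by simp
 obtain Q where Q: "openin (Eucl (Suc m)) Q" "D = Q \<inter> half_space" using D unfolding openin_subtopology by blast
 have up: "?x(Suc k := t) = seq_cons (y(k := t))" for k t
  by (auto simp: seq_cons_def fun_eq_iff split: nat.splits)
 have yk: "y(k := t) \<in> Eu m" if "k < m" for k t using y Db(2) that by (auto simp: Eu_iff)
 have set: "{t. ?x(Suc k := t) \<in> D} = {t. y(k := t) \<in> Db}" if "k < m" for k
  unfolding up using Db(2) yk[OF that] by auto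
 have e1: "?D D r ?x (Suc i) (Suc k) = ?D Db rb y i k" if "k < m" for i k
  unfolding set[OF that] unfolding up seq_cons_simps
  by (rule vderiv_cong[OF open_UNIV UNIV_I])
    (use y rb in "auto simp: seq_tl_def simp del: fun_upd_apply")
 have e2: "?D D r ?x 0 (Suc k) = 0" if "k < m" for k
 proof -
  have "?D D r ?x 0 (Suc k) = vector_derivative (\<lambda>t. 0 :: real) (at (y k) within {t. y(k := t) \<in> Db})"
   unfolding set[OF that] unfolding up seq_cons_simps
   by (rule vderiv_cong[OF open_UNIV UNIV_I]) (use y r0 in auto)
  also have "\<dots> = 0"
   by (subst at_within_open[OF _ open_line[OF Db(1) that]]) (use y in auto)
  finally show ?thesis .
 qed
 have "?D D r ?x 0 0 \<ge> 0"
 proof -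
  obtain U g where U: "openin (Eucl (Suc m)) U" "?x \<in> U" "!!k. Ck k (Suc m) U g" "!!z. z\<in>D \<inter> U ==> g z = r z 0"
   using r[unfolded smooth_on_def,rule_format,OF _ xD,of 0] by blast
  obtain d where d: "\<forall>i<Suc m. \<forall>x\<in>U. ((\<lambda>t. g (x(i := t))) has_real_derivative d i x) (at (x i))"
   using U(3)[of "Suc 0"] by auto
  define a where "a = d 0 ?x"
  have a: "((\<lambda>t. g (?x(0 := t))) has_real_derivative a) (at (?x 0))"
   unfolding a_def using d U(2) by blast
  have QU: "openin (Eucl (Suc m)) (Q \<inter> U)" using Q U by blast
  have line: "open {t. ?x(0 := t) \<in> Q \<inter> U}" by (rule open_line[OF QU]) simp
  have mem: "?x(0 := t) \<in> D" if "t \<le> 0" "?x(0 := t) \<in> Q \<inter> U" for t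
   using that Q(2) by (simp add: half_space_def)
  have g0: "g ?x = 0" using U(4)[of ?x] U(2) xD r0[OF y] by simp
  \<comment> \<open>With a negative slope \<open>g\<close> would be positive slightly to the left of
    0, at points of \<open>D\<close>, where it is at most 0.\<close>
  have "a \<ge> 0"
  proof (rule ccontr)
   assume "\<not> a \<ge> 0"
   then obtain d where d: "d > 0" "!!h. h > 0 ==> h < d ==> g (?x(0 := 0)) < g (?x(0 := 0 - h))"
    using DERIV_neg_dec_left[OF a] by auto
   have "0 \<in> {t. ?x(0 := t) \<in> Q \<inter> U}" using xD Q(2) U(2) by (simp add: fun_upd_idem)
   then obtain e where e: "e > 0" "!!t. dist t 0 < e ==> ?x(0 := t) \<in> Q \<inter> U"
    using line unfolding open_dist by blast
   \<comment> \<open>Half the smaller radius keeps \<open>- h\<close> both in the range where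
     \<open>g\<close> decreases and in the range where the line stays in
     \<open>Q \<inter> U\<close>.\<close>
   define h where "h = min d e / 2"
   have h: "h > 0" "h < d" "h < e" using d(1) e(1) by (auto simp: h_def min_def)
   have QUh: "?x(0 := - h) \<in> Q \<inter> U" using e(2)[of "- h"] h by (simp add: dist_real_def del: fun_upd_apply)
   have m: "?x(0 := - h) \<in> D \<inter> U" using mem[OF _ QUh] QUh h by simp
   have "g (?x(0 := - h)) \<le> 0" using U(4)[OF m] rH[of "?x(0 := - h)"] m by (simp add: half_space_def)
   moreover have "g (?x(0 := 0)) = 0" using g0 by (simp add: fun_upd_idem)
   ultimately show False using d(2)[OF h(1,2)] by simp
  qed
  have nb: "at (?x 0) within {t. ?x(0 := t) \<in> D} \<noteq> bot" by (rule half_space_line_not_bot[OF D xD]) simp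
  \<comment> \<open>On \<open>D\<close> the extension \<open>g\<close> agrees with the first
    component of \<open>r\<close>, so the one-sided derivative of the latter is the two-sided
    derivative of \<open>g\<close>.\<close>
  have "?D D r ?x 0 0 = vector_derivative (\<lambda>t. g (?x(0 := t))) (at (?x 0) within {t. ?x(0 := t) \<in> D})"
  proof (rule vderiv_cong[OF line])
   show "?x 0 \<in> {t. ?x(0 := t) \<in> Q \<inter> U}" using xD Q(2) U(2) by (simp add: fun_upd_idem)
   show "?x 0 \<in> {t. ?x(0 := t) \<in> D}" using xD by (simp add: fun_upd_idem)
   show "r (?x(0 := t)) 0 = g (?x(0 := t))" if "t \<in> {t. ?x(0 := t) \<in> D} \<inter> {t. ?x(0 := t) \<in> Q \<inter> U}" for t
    using U(4)[of "?x(0 := t)"] that by (simp del: fun_upd_apply)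
  qed auto
  also have "\<dots> = a"
   by (rule vector_derivative_within[OF nb])
     (use a in "simp add: has_real_derivative_iff_has_vector_derivative has_vector_derivative_at_within")
  finally show ?thesis using \<open>a \<ge> 0\<close> by simp
 qed
 moreover have "jacobian_det (Suc m) D r ?x = ?D D r ?x 0 0 * jacobian_det m Db rb y"
 proof -
  have "?J (1 + m) (1 + m) D r ?x =
    four_block_mat (?J 1 1 D r ?x) (0\<^sub>m 1 m) (Matrix.mat m 1 (\<lambda>(i,k). ?D D r ?x (Suc i) k)) (?J m m Db rb y)"
  proof (rule eq_matI,goal_cases)
   case (1 i k)
   hence ik: "i < Suc m" "k < Suc m" by auto
   show ?case
    by (cases i; cases k) (use ik e1 e2 in auto)
  qed auto
  hence "Determinant.det (?J (1 + m) (1 + m) D r ?x) = Determinant.det (?J 1 1 D r ?x) * Determinant.det (?J m m Db rb y)"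
   by (simp add: det_four_block_mat_upper_right_zero[of _ 1 _ m])
  moreover have "Determinant.det (?J 1 1 D r ?x) = ?D D r ?x 0 0" by (subst det_single) auto
  ultimately show ?thesis unfolding jacobian_det_def by simp
 qed
 ultimately show ?thesis using that by blast
qed

text \<open>If \<open>p\<close> were interior in the second chart, the first coordinate of the
  transition to the first chart would have a local maximum 0 there. Its gradient would vanish and
  give the Jacobian a zero row, although the sign of the Jacobian is not 0.\<close>

lemma boundary_chart_invariant:
 assumes X: "manifold_modelled_on half_space X" and n: "0 < mf_dim X"
  and c: "(U,f,s) \<in> mf_charts X" "(U',f',s') \<in> mf_charts X" and p: "p \<in> U" "p \<in> U'" and z: "f p 0 = 0"
 shows "f' p 0 = 0"
proof (rule ccontr)
 assume nz: "f' p 0 \<noteq> 0"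
 let ?n = "mf_dim X"
 note g = manifoldD(4)[OF X c(1)] and g' = manifoldD(4)[OF X c(2)]
 note gD = gchartD[OF g] and gD' = gchartD[OF g']
 let ?D = "f' ` {q \<in> U'. id q \<in> U}" and ?r = "chart_rep (U',f',s') (U,f,s) id" and ?x = "f' p"
 have o: "oloc ?n id (U',f',s') (U,f,s)" using manifoldD(5)[OF X c(2,1)] .
 have xD: "?x \<in> ?D" using p by auto
 have "{q \<in> U'. id q \<in> U} = U' \<inter> U" by auto
 hence "openin (EH half_space ?n) ?D" using gD(1) gD'(1) by (auto intro!: gchart_image[OF g'])
 then obtain Q where Q: "openin (Eucl ?n) Q" "?D = Q \<inter> half_space" unfolding openin_subtopology by blast
 \<comment> \<open>The interior part of the domain; it is open in \<open>\<real>\<^sup>n\<close>, so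
   ordinary partial derivatives are available on it.\<close>
 define S where "S = Q \<inter> {z \<in> Eu ?n. z 0 \<in> {..<0}}"
 have S: "openin (Eucl ?n) S" unfolding S_def
  by (intro openin_Int Q(1) openin_continuous_map_preimage[OF cont_coord]) auto
 have SD: "S \<subseteq> ?D" using Q(2) by (auto simp: S_def half_space_def)
 have "?x 0 \<le> 0" using gD'(5) p(2) by (auto simp: half_space_def)
 hence xS: "?x \<in> S" using nz xD Q(2) gD'(4) p(2) by (auto simp: S_def)
 have sm: "smooth_on ?n ?n S ?r" using o smooth_on_subset[OF _ SD] by (auto simp: oloc_def rep_dom_eq)
 have rval: "?r (f' q) 0 \<le> 0" if "q \<in> U'" "q \<in> U" for q
  using gD(5) that by (auto simp: rep_apply[OF gD'(3)] half_space_def)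
 have rx: "?r ?x 0 = 0" using z p by (simp add: rep_apply[OF gD'(3)])
 have zero: "vector_derivative (\<lambda>t. ?r (?x(k := t)) 0) (at (?x k) within {t. ?x(k := t) \<in> S}) = 0" if k: "k < ?n" for k
 proof -
  have "open {t. ?x(k := t) \<in> S}" by (rule open_line[OF S k])
  moreover have "?x k \<in> {t. ?x(k := t) \<in> S}" using xS by simp
  ultimately obtain e where e: "e > 0" "!!t. dist t (?x k) < e ==> ?x(k := t) \<in> S" unfolding open_dist by blast
  show ?thesis
  proof (rule DERIV_local_max[OF smooth_on_partial[OF sm S xS k n] e(1)],intro allI impI)
   fix t assume t: "\<bar>?x k - t\<bar> < e"
   have "?x(k := t) \<in> ?D" using e(2)[of t] t SD by (auto simp: dist_real_def abs_minus_commute)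
   hence "?r (?x(k := t)) 0 \<le> 0" using rval by auto
   thus "?r (?x(k := t)) 0 \<le> ?r (?x(k := ?x k)) 0" using rx by simp
  qed
 qed
 have "jacobian_det ?n S ?r ?x = 0"
  unfolding jacobian_det_def by (rule det_zero_row[OF _ n]) (use zero n in auto)
 moreover have "jacobian_det ?n ?D ?r ?x = jacobian_det ?n S ?r ?x"
  by (rule jacobian_det_cong[OF S xS xD]) (use SD in auto)
 moreover have "sgn (jacobian_det ?n ?D ?r ?x) = s' * s" using o xD by (auto simp: oloc_def rep_dom_eq)
 ultimately show False using gD(6) gD'(6) by auto
qed

lemma bd_points_iff:
 assumes X: "oriented_manifold_with_boundary X" and c: "(U,f,s) \<in> mf_charts X" and p: "p \<in> U"
 shows "p \<in> boundary_points X \<longleftrightarrow> f p 0 = 0"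
proof
 assume "p \<in> boundary_points X"
 then obtain U' f' s' where "(U',f',s') \<in> mf_charts X" "p \<in> U'" "f' p 0 = 0" by (auto simp: boundary_points_def)
 thus "f p 0 = 0" using boundary_chart_invariant[of X U' f' s' U f s p] X c p
  by (auto simp: oriented_manifold_with_boundary_def)
next
 assume "f p 0 = 0"
 thus "p \<in> boundary_points X" using c p by (force simp: boundary_points_def)
qed

lemma mf_charts_boundary_iff: "(V,\<psi>,s) \<in> mf_charts (mf_boundary X) \<longleftrightarrow>
  (\<exists>U f. (U,f,s) \<in> mf_charts X \<and> V = U \<inter> boundary_points X \<and> \<psi> = (\<lambda>p. seq_tl (f p)))"
 by (force simp: mf_boundary_def seq_tl_def image_iff)

lemma mf_charts_boundaryE:
 assumes "c \<in> mf_charts (mf_boundary X)"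
 obtains U f s where "(U,f,s) \<in> mf_charts X" "c = (U \<inter> boundary_points X,\<lambda>p. seq_tl (f p),s)"
proof -
 obtain V \<psi> s where ce: "c = (V,\<psi>,s)" using prod_cases3 by blast
 obtain U f where "(U,f,s) \<in> mf_charts X" "V = U \<inter> boundary_points X" "\<psi> = (\<lambda>p. seq_tl (f p))"
  using assms unfolding ce mf_charts_boundary_iff by blast
 thus ?thesis using that ce by blast
qed

lemma bd_points_subset: "oriented_manifold_with_boundary X ==> boundary_points X \<subseteq> mf_pts X"
 unfolding oriented_manifold_with_boundary_def boundary_points_def
 using manifoldD(4) gchartD(2) by fastforce

lemma mf_boundary_simps:
 "mf_top (mf_boundary X) = subtopology (mf_top X) (boundary_points X)" "mf_dim (mf_boundary X) = mf_dim X - 1"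
 by (auto simp: mf_boundary_def)

lemma mf_pts_boundary: "oriented_manifold_with_boundary X ==> mf_pts (mf_boundary X) = boundary_points X"
 using bd_points_subset by (auto simp: mf_boundary_simps)

text \<open>At a boundary point the Jacobian of a transition of \<open>X\<close> is a nonnegative
  multiple of that of the boundary transition. As it does not vanish, the multiple is positive and
  the signs agree, so charts of the boundary may keep their signs.\<close>

lemma omanif_boundary:
 assumes X: "oriented_manifold_with_boundary X" shows "omanif (mf_boundary X)"
proof -
 obtain m where n: "mf_dim X = Suc m" using X gr0_implies_Suc by (auto simp: oriented_manifold_with_boundary_def)
 have X': "manifold_modelled_on half_space X" using X by (simp add: oriented_manifold_with_boundary_def)
 let ?B = "boundary_points X" and ?T = "subtopology (mf_top X) (boundary_points X)"
 have gc: "gchart UNIV m ?T (U \<inter> ?B,\<lambda>p. seq_tl (f p),t)"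
  and dom: "!!V. openin (mf_top X) V ==> V \<subseteq> U ==> (\<lambda>p. seq_tl (f p)) ` (V \<inter> ?B) = {y \<in> Eu m. seq_cons y \<in> f ` V}"
  if c: "(U,f,t) \<in> mf_charts X" for U f t
 proof -
  note g = manifoldD(4)[OF X' c,unfolded n] note gD = gchartD[OF g]
  have b: "p \<in> ?B \<longleftrightarrow> f p 0 = 0" if "p \<in> U" for p using bd_points_iff[OF X c that] .
  have phiE: "f p \<in> Eu (Suc m)" "f p \<in> half_space" if "p \<in> U" for p using gD that by auto
  show dom: "(\<lambda>p. seq_tl (f p)) ` (V \<inter> ?B) = {y \<in> Eu m. seq_cons y \<in> f ` V}"
   if V: "V \<subseteq> U" for V
  proof (intro equalityI subsetI)
   fix y assume "y \<in> (\<lambda>p. seq_tl (f p)) ` (V \<inter> ?B)"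
   then obtain p where p: "p \<in> V" "p \<in> ?B" "y = seq_tl (f p)" by blast
   hence "seq_cons y = f p" using b V seq_cons_tl by blast
   thus "y \<in> {y \<in> Eu m. seq_cons y \<in> f ` V}" using p V phiE(1) seq_tl_in_Eu by auto
  next
   fix y assume "y \<in> {y \<in> Eu m. seq_cons y \<in> f ` V}"
   then obtain p where p: "p \<in> V" "seq_cons y = f p" by blast
   hence "f p 0 = 0" "seq_tl (f p) = y" by (metis seq_cons_simps(1)) (metis p(2) seq_cons_simps(3))
   thus "y \<in> (\<lambda>p. seq_tl (f p)) ` (V \<inter> ?B)" using b V p by blast
  qed
  have img: "openin (EH UNIV m) ((\<lambda>p. seq_tl (f p)) ` V)" if V: "openin ?T V" "V \<subseteq> U \<inter> ?B" for V
  proof -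
   obtain V0 where V0: "openin (mf_top X) V0" "V = V0 \<inter> ?B" using V(1) unfolding openin_subtopology by blast
   have o: "openin (mf_top X) (V0 \<inter> U)" using V0 gD(1) by blast
   have "V = (V0 \<inter> U) \<inter> ?B" using V0(2) V(2) by blast
   hence eq: "(\<lambda>p. seq_tl (f p)) ` V = {y \<in> Eu m. seq_cons y \<in> f ` (V0 \<inter> U)}"
    using dom[of "V0 \<inter> U"] by simp
   obtain Q where Q: "openin (Eucl (Suc m)) Q" "f ` (V0 \<inter> U) = Q \<inter> half_space"
    using gchart_image[OF g o] unfolding openin_subtopology by blast
   have "{y \<in> Eu m. seq_cons y \<in> f ` (V0 \<inter> U)} = {y \<in> Eu m. seq_cons y \<in> Q}"
    unfolding Q(2) by (auto simp: half_space_def)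
   thus ?thesis using openin_continuous_map_preimage[OF cont_seq_cons Q(1)] eq by simp
  qed
  have pre: "openin ?T {p \<in> U \<inter> ?B. seq_tl (f p) \<in> Q}" if Q: "openin (EH UNIV m) Q" for Q
  proof -
   let ?Q = "{z \<in> Eu (Suc m). seq_tl z \<in> Q} \<inter> half_space"
   have "openin (Eucl (Suc m)) {z \<in> Eu (Suc m). seq_tl z \<in> Q}"
    using openin_continuous_map_preimage[OF cont_seq_tl] Q by simp
   hence "openin (EH half_space (Suc m)) ?Q" by (auto simp: openin_subtopology)
   hence "openin (mf_top X) {p \<in> U. f p \<in> ?Q}" by (rule gchart_preimage[OF g])
   moreover have "{p \<in> U \<inter> ?B. seq_tl (f p) \<in> Q} = {p \<in> U. f p \<in> ?Q} \<inter> ?B" using phiE by auto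
   ultimately show ?thesis by (auto simp: openin_subtopology)
  qed
  have "inj_on (\<lambda>p. seq_tl (f p)) (U \<inter> ?B)"
  proof (rule inj_onI)
   fix p q assume pq: "p \<in> U \<inter> ?B" "q \<in> U \<inter> ?B" "seq_tl (f p) = seq_tl (f q)"
   hence "f p = f q" using b seq_cons_tl by (metis IntD1 IntD2)
   thus "p = q" using gD(3) pq by (auto dest: inj_onD)
  qed
  moreover have "openin ?T (U \<inter> ?B)" using gD(1) by (auto simp: openin_subtopology)
  ultimately show "gchart UNIV m ?T (U \<inter> ?B,\<lambda>p. seq_tl (f p),t)"
   using img pre gD(6) unfolding gchart_def by auto
 qed
 have ol: "oloc m id (U \<inter> ?B,\<lambda>p. seq_tl (f p),t) (U' \<inter> ?B,\<lambda>p. seq_tl (f' p),t')"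
  if c: "(U,f,t) \<in> mf_charts X" and c': "(U',f',t') \<in> mf_charts X" for U f t U' f' t'
 proof -
  note g = manifoldD(4)[OF X' c,unfolded n] and g' = manifoldD(4)[OF X' c',unfolded n]
  note gD = gchartD[OF g] and gD' = gchartD[OF g'] and gb = gc[OF c]
  let ?D = "f ` {p \<in> U. id p \<in> U'}" and ?Db = "(\<lambda>p. seq_tl (f p)) ` {p \<in> U \<inter> ?B. id p \<in> U' \<inter> ?B}"
  let ?r = "chart_rep (U,f,t) (U',f',t') id"
  let ?rb = "chart_rep (U \<inter> ?B,\<lambda>p. seq_tl (f p),t) (U' \<inter> ?B,\<lambda>p. seq_tl (f' p),t') id"
  have s1: "{p \<in> U. id p \<in> U'} = U \<inter> U'" "{p \<in> U \<inter> ?B. id p \<in> U' \<inter> ?B} = (U \<inter> U') \<inter> ?B" by auto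
  have oU: "openin (mf_top X) (U \<inter> U')" using gD(1) gD'(1) by blast
  have Dbeq: "?Db = {y \<in> Eu m. seq_cons y \<in> ?D}" unfolding s1 using dom[OF c oU] by simp
  have oD: "openin (EH half_space (Suc m)) ?D" unfolding s1 using gchart_image[OF g oU] by simp
  have "openin ?T ((U \<inter> U') \<inter> ?B)" using oU by (auto simp: openin_subtopology)
  hence oDb: "openin (Eucl m) ?Db" unfolding s1 using gchart_image[OF gb] by auto
  have o: "oloc (Suc m) id (U,f,t) (U',f',t')" using manifoldD(5)[OF X' c c'] n by simp
  have sm: "smooth_on (Suc m) (Suc m) ?D ?r" using o by (simp add: oloc_def rep_dom_eq)
  have val: "?r (seq_cons y) 0 = 0 \<and> ?rb y = seq_tl (?r (seq_cons y))" if "y \<in> ?Db" for y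
  proof -
   from that obtain p where p: "p \<in> U" "p \<in> U'" "p \<in> ?B" "y = seq_tl (f p)" by auto
   have "f p 0 = 0" "f' p 0 = 0"
    using bd_points_iff[OF X c p(1)] bd_points_iff[OF X c' p(2)] p(3) by auto
   moreover have "?rb (seq_tl (f p)) = seq_tl (f' (id p))"
    by (rule rep_apply[OF gchartD(3)[OF gb]]) (use p in auto)
   ultimately show ?thesis using p rep_apply[OF gD(3) p(1),of t U' f' t' id] by (simp add: seq_cons_tl)
  qed
  have rH: "?r x \<in> half_space" if "x \<in> ?D" for x
   using that gD'(5) by (auto simp: rep_apply[OF gD(3)])
  have DbE: "?Db \<subseteq> Eu m" using openin_subset[OF oDb] .
  \<comment> \<open>Coordinate \<open>m\<close> of a point of \<open>\<real>\<^sup>m\<close>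
    vanishes, so it can serve as the prepended zero.\<close>
  have sc: "smooth_on m (Suc m) ?Db seq_cons"
   by (rule smooth_on_coordinates[OF DbE,where \<sigma> = "\<lambda>i. case i of 0 => m | Suc j => j"])
     (use DbE in "auto simp: Eu_iff split: nat.splits")
  have st: "smooth_on (Suc m) m (Eu (Suc m)) seq_tl"
   by (rule smooth_on_coordinates[where \<sigma> = Suc]) (auto simp: seq_tl_def)
  have DE: "?D \<subseteq> Eu (Suc m)" using openin_subset[OF oD] by auto
  have s2: "smooth_on m (Suc m) ?Db (\<lambda>y. ?r (seq_cons y))"
   by (rule smooth_on_compose[OF sc sm DbE _ DE]) (use Dbeq in blast)
  have rE: "?r (seq_cons y) \<in> Eu (Suc m)" if "y \<in> ?Db" for y
   using that Dbeq gD'(4) by (auto simp: rep_apply[OF gD(3)])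
  have s3: "smooth_on m m ?Db ?rb"
   by (rule smooth_on_cong[OF smooth_on_compose[OF s2 st DbE rE]]) (use val in auto)
  have "sgn (jacobian_det m ?Db ?rb y) = t * t'" if y: "y \<in> ?Db" for y
  proof -
   obtain a where a: "a \<ge> 0" "jacobian_det (Suc m) ?D ?r (seq_cons y) = a * jacobian_det m ?Db ?rb y"
    by (rule jacobian_det_boundary[OF oD sm rH oDb Dbeq,of ?rb y]) (use val y in auto)
   have "seq_cons y \<in> ?D" using y Dbeq by blast
   hence s: "sgn (jacobian_det (Suc m) ?D ?r (seq_cons y)) = t * t'"
    using o unfolding oloc_def rep_dom_eq snd_conv by blast
   hence "a \<noteq> 0" using gD(6) gD'(6) a(2) by auto
   hence "sgn a = 1" using a(1) by simp
   thus ?thesis using s a(2) by (simp add: sgn_mult)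
  qed
  thus ?thesis using s3 unfolding oloc_def rep_dom_eq by auto
 qed
 show ?thesis unfolding oriented_manifold_def manifold_iff mf_boundary_simps n diff_Suc_1
 proof (intro conjI ballI)
  show "Hausdorff_space ?T" "second_countable ?T"
   using manifoldD(1,2)[OF X'] by (auto simp: Hausdorff_space_subtopology second_countable_subtopology)
  have "mf_pts X = (\<Union>c\<in>mf_charts X. fst c)" using X' by (simp add: manifold_iff)
  thus "topspace ?T = (\<Union>c\<in>mf_charts (mf_boundary X). fst c)" unfolding mf_boundary_def by auto
  fix c assume c: "c \<in> mf_charts (mf_boundary X)"
  obtain U f t where 1: "(U,f,t) \<in> mf_charts X" "c = (U \<inter> ?B,\<lambda>p. seq_tl (f p),t)"
   by (rule mf_charts_boundaryE[OF c])
  show "gchart UNIV m ?T c" unfolding 1(2) by (rule gc[OF 1(1)])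
  fix c' assume c': "c' \<in> mf_charts (mf_boundary X)"
  obtain U' f' t' where 2: "(U',f',t') \<in> mf_charts X" "c' = (U' \<inter> ?B,\<lambda>p. seq_tl (f' p),t')"
   by (rule mf_charts_boundaryE[OF c'])
  show "oloc m id c c'" unfolding 1(2) 2(2) by (rule ol[OF 1(1) 2(1)])
 qed
qed

subsection \<open>The unit interval\<close>

definition unit_chart :: "real => real => real => nat => real"
 where "unit_chart s a t = (\<lambda>i. if i = 0 then s * (t - a) else 0)"

text \<open>The two charts have values at most 0: \<open>t \<mapsto> - t\<close> near 0 and
  \<open>t \<mapsto> t - 1\<close> near 1. The sign of each is its slope, which gives the standard
  orientation of the interval and the boundary signs -1 at 0 and 1 at 1.\<close>

definition mf_unit :: "real omanifold"
 where "mf_unit = \<lparr>mf_top = top_of_set {0..1},mf_dim = 1,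
  mf_charts = {({0..<1},unit_chart (-1) 0,-1),({0<..1},unit_chart 1 1,1)}\<rparr>"

lemma unit_chart_simps [simp]: "unit_chart s a t 0 = s * (t - a)" "unit_chart s a t \<in> Eu 1" "unit_chart s a t \<in> Eu (Suc 0)"
 by (auto simp: unit_chart_def Eu_iff)

lemma Eu_1_eqI: "x \<in> Eu 1 ==> y \<in> Eu 1 ==> x 0 = y 0 ==> x = y"
 by (auto simp: Eu_iff fun_eq_iff Suc_le_eq) (metis neq0_conv)

lemma unit_good_chart:
 assumes s: "s = 1 \<or> s = -1" and e: "l \<in> {1,-1}" and oS: "open S" and U: "U = {0..1} \<inter> S"
  and H: "!!t. t \<in> U ==> s * (t - a) \<le> 0" and bk: "!!x. x \<le> 0 ==> a + s * x \<in> S ==> a + s * x \<in> {0..1}"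
 shows "gchart half_space 1 (top_of_set {0..1}) (U,unit_chart s a,l)"
proof -
 have ss: "s * s = 1" using s by auto
 have inv: "a + s * (s * (t - a)) = t" for t using s by auto
 have inv': "s * (a + s * x - a) = x" for x using s by auto
 have inj: "inj_on (unit_chart s a) U"
 proof (rule inj_onI)
  fix t t' assume "unit_chart s a t = unit_chart s a t'"
  hence "s * (t - a) = s * (t' - a)" by (metis unit_chart_simps(1))
  thus "t = t'" using s by auto
 qed
 have img: "openin (EH half_space 1) (unit_chart s a ` V)" if V: "openin (top_of_set {0..1}) V" "V \<subseteq> U" for V
 proof -
  obtain V0 where V0: "open V0" "V = {0..1} \<inter> V0" using V(1) unfolding openin_open by blast
  let ?Q = "{x \<in> Eu 1. x 0 \<in> (\<lambda>x. a + s * x) -` (V0 \<inter> S)}"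
  have "open ((\<lambda>x. a + s * x) -` (V0 \<inter> S))"
   by (rule open_vimage) (use V0 oS in "auto intro!: continuous_intros")
  hence Q: "openin (Eucl 1) ?Q"
   by (intro openin_continuous_map_preimage[OF cont_coord]) auto
  have "unit_chart s a ` V = ?Q \<inter> half_space"
  proof (intro equalityI subsetI)
   fix x assume "x \<in> unit_chart s a ` V"
   then obtain t where t: "t \<in> V" "x = unit_chart s a t" by blast
   thus "x \<in> ?Q \<inter> half_space" using V V0 H[of t] U by (auto simp: inv half_space_def)
  next
   fix x assume x: "x \<in> ?Q \<inter> half_space"
   let ?t = "a + s * x 0"
   have t: "?t \<in> V0 \<inter> S" "x 0 \<le> 0" using x by (auto simp: half_space_def)
   hence "?t \<in> V" using bk[of "x 0"] V0(2) by blast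
   moreover have "x = unit_chart s a ?t" 
   proof (rule Eu_1_eqI)
    show "x \<in> Eu 1" using x by blast
    show "x 0 = unit_chart s a ?t 0" unfolding unit_chart_simps(1) inv' by (rule refl)
   qed simp
   ultimately show "x \<in> unit_chart s a ` V" by blast
  qed
  thus ?thesis using Q by (auto simp: openin_subtopology)
 qed
 have pre: "openin (top_of_set {0..1}) {t \<in> U. unit_chart s a t \<in> R}" if R: "openin (EH half_space 1) R" for R
 proof -
  obtain Q where Q: "openin (Eucl 1) Q" "R = Q \<inter> half_space" using R unfolding openin_subtopology by blast
  have "open {y. (unit_chart s a 0)(0 := y) \<in> Q}" by (rule open_line[OF Q(1)]) simp
  hence o: "open ((\<lambda>t. s * (t - a)) -` {y. (unit_chart s a 0)(0 := y) \<in> Q})"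
   by (rule open_vimage) (auto intro!: continuous_intros)
  have eq: "(unit_chart s a 0)(0 := s * (t - a)) = unit_chart s a t" for t by (auto simp: unit_chart_def)
  have "{t \<in> U. unit_chart s a t \<in> R} = {0..1} \<inter> (S \<inter> ((\<lambda>t. s * (t - a)) -` {y. (unit_chart s a 0)(0 := y) \<in> Q}))"
   using H U Q(2) by (auto simp: eq half_space_def simp del: fun_upd_apply)
  thus ?thesis by (simp only:) (rule openin_open_Int,intro open_Int oS o)
 qed
 have "openin (top_of_set {0..1}) U" unfolding U using oS by (rule openin_open_Int)
 thus ?thesis using inj img pre e unfolding gchart_def by auto
qed

text \<open>The transition is affine with slope \<open>s * s'\<close>, which is exactly the sign
  prescribed for it.\<close>

lemma unit_oloc:
 assumes s: "s = 1 \<or> s = -1" and s': "s' = 1 \<or> s' = -1" and inj: "inj_on (unit_chart s a) U"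
  and D: "openin (EH half_space 1) (unit_chart s a ` {t \<in> U. id t \<in> U'})"
 shows "oloc 1 id (U,unit_chart s a,s) (U',unit_chart s' a',s')"
proof -
 let ?D = "unit_chart s a ` {t \<in> U. id t \<in> U'}" and ?r = "chart_rep (U,unit_chart s a,s) (U',unit_chart s' a',s') id"
 have DE: "?D \<subseteq> Eu 1" by auto
 have r: "?r x 0 = s' * (a + s * x 0 - a')" if x: "x \<in> ?D" for x
 proof -
  obtain t where t: "t \<in> U" "t \<in> U'" "x = unit_chart s a t" using x by auto
  have "?r x = unit_chart s' a' (id t)" unfolding t(3) by (rule rep_apply[OF inj t(1)])
  moreover have "a + s * x 0 = t" using s t(3) by auto
  ultimately show ?thesis by simp
 qed
 have "smooth_on 1 1 ?D ?r"
  unfolding smooth_on_def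
 proof (intro allI impI ballI)
  fix i :: nat and x assume i: "i < 1" and x: "x \<in> ?D"
  have "Ck k 1 (Eu 1) (\<lambda>x. s' * (a + s * x 0 + - a'))" for k
   by (intro Ck_mult Ck_add Ck_const Ck_coordinate)
  thus "\<exists>U g. openin (Eucl 1) U \<and> x \<in> U \<and> (\<forall>k. Ck k 1 U g) \<and> (\<forall>y\<in>?D \<inter> U. g y = ?r y i)"
   by (intro exI[of _ "Eu 1"] exI[of _ "\<lambda>x. s' * (a + s * x 0 + - a')"]) (use i x DE r in auto)
 qed
 moreover have "jacobian_det 1 ?D ?r x = s * s'" if x: "x \<in> ?D" for x
 proof -
  have "vector_derivative (\<lambda>t. ?r (x(0 := t)) 0) (at (x 0) within {t. x(0 := t) \<in> ?D}) =
    vector_derivative (\<lambda>t. s' * (a + s * t - a')) (at (x 0) within {t. x(0 := t) \<in> ?D})"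
   by (rule vderiv_cong[OF open_UNIV UNIV_I refl]) (use x r in auto)
  also have "\<dots> = s * s'"
  proof (rule vector_derivative_within[OF half_space_line_not_bot[OF D x]])
   show "((\<lambda>t. s' * (a + s * t - a')) has_vector_derivative s * s') (at (x 0) within {t. x(0 := t) \<in> ?D})"
    unfolding has_real_derivative_iff_has_vector_derivative[symmetric] by (auto intro!: derivative_eq_intros)
  qed simp
  finally show ?thesis unfolding jacobian_det_def by (subst det_single) auto
 qed
 ultimately show ?thesis using s s' unfolding oloc_def rep_dom_eq by auto
qed

lemma unit_manifold: "oriented_manifold_with_boundary mf_unit"
proof -
 have g: "gchart half_space 1 (top_of_set {0..1}) c" if c: "c \<in> mf_charts mf_unit" for c
 proof -
  have "gchart half_space 1 (top_of_set {0..1}) ({0..<1},unit_chart (-1) 0,-1)"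
   by (rule unit_good_chart[where S = "{..<1}"]) auto
  moreover have "gchart half_space 1 (top_of_set {0..1}) ({0<..1},unit_chart 1 1,1)"
   by (rule unit_good_chart[where S = "{0<..}"]) auto
  ultimately show ?thesis using c by (auto simp: mf_unit_def)
 qed
 have ol: "oloc 1 id (U,unit_chart s a,s) (U',unit_chart s' a',s')"
  if c: "(U,unit_chart s a,s) \<in> mf_charts mf_unit" "(U',unit_chart s' a',s') \<in> mf_charts mf_unit" for U s a U' s' a'
 proof (rule unit_oloc)
  note gD = gchartD[OF g[OF c(1)]] and gD' = gchartD[OF g[OF c(2)]]
  show "s = 1 \<or> s = -1" "s' = 1 \<or> s' = -1" using gD(6) gD'(6) by auto
  show "inj_on (unit_chart s a) U" using gD(3) .
  have "{t \<in> U. id t \<in> U'} = U \<inter> U'" by auto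
  thus "openin (EH half_space 1) (unit_chart s a ` {t \<in> U. id t \<in> U'})"
   using gchart_image[OF g[OF c(1)] openin_Int[OF gD(1) gD'(1)]] by simp
 qed
 have "oloc 1 id c c'" if "c \<in> mf_charts mf_unit" "c' \<in> mf_charts mf_unit" for c c'
  using that ol by (auto simp: mf_unit_def)
 moreover have "second_countable (top_of_set {0..1::real})"
 proof (rule second_countable_subtopology)
  obtain B :: "real set set" where B: "countable B" "!!C. C \<in> B ==> open C" "!!S. open S ==> \<exists>U\<subseteq>B. S = \<Union>U"
   using univ_second_countable by blast
  have "\<exists>V\<in>B. x \<in> V \<and> V \<subseteq> S" if S: "open S" "x \<in> S" for S x
   using B(3)[OF S(1)] S(2) by auto
  thus "second_countable (euclidean :: real topology)"
   unfolding second_countable_def using B by (intro exI[of _ B]) auto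
 qed
 ultimately have "manifold_modelled_on half_space mf_unit"
  unfolding manifold_iff using g
  by (auto simp: mf_unit_def Hausdorff_space_subtopology)
 thus ?thesis by (simp add: oriented_manifold_with_boundary_def mf_unit_def)
qed

lemma compact_mf_unit: "compact_space (mf_top mf_unit)"
 by (simp add: mf_unit_def compact_space_subtopology)

subsection \<open>Canonical diffeomorphisms\<close>

lemma odiff_sum_commute:
 assumes "omanif X" "omanif Y" "mf_dim X = mf_dim Y"
 shows "odiff (mf_sum X Y) (mf_sum Y X) (case_sum Inr Inl) (case_sum Inr Inl)"
proof (rule odiff_match')
 fix U f s assume "(U,f,s) \<in> mf_charts (mf_sum X Y)"
 thus "\<exists>U' f'. (U',f',s) \<in> mf_charts (mf_sum Y X) \<and> (\<forall>p\<in>U. case_sum Inr Inl p \<in> U' \<and> f p = f' (case_sum Inr Inl p))"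
 proof (cases rule: mf_charts_sum_cases)
  case (1 V \<psi> \<delta>)
  thus ?thesis using mf_charts_sumI(2)[OF 1(1),of Y] by (intro exI[of _ "Inr ` V"] exI[of _ "\<psi> \<circ> projr"]) auto
 next
  case (2 V \<psi> \<delta>)
  thus ?thesis using mf_charts_sumI(1)[OF 2(1),of X] by (intro exI[of _ "Inl ` V"] exI[of _ "\<psi> \<circ> projl"]) auto
 qed
qed (use assms in "auto simp: omanif_sum mf_sum_simps")

lemma odiff_sum_assoc:
 assumes "omanif X" "omanif Y" "omanif Z" "mf_dim X = mf_dim Y" "mf_dim X = mf_dim Z"
 shows "odiff (mf_sum (mf_sum X Y) Z) (mf_sum X (mf_sum Y Z))
  (case_sum (case_sum Inl (Inr \<circ> Inl)) (Inr \<circ> Inr)) (case_sum (Inl \<circ> Inl) (case_sum (Inl \<circ> Inr) Inr))"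
  (is "odiff _ _ ?h ?g")
proof (rule odiff_match')
 fix U f s assume "(U,f,s) \<in> mf_charts (mf_sum (mf_sum X Y) Z)"
 thus "\<exists>U' f'. (U',f',s) \<in> mf_charts (mf_sum X (mf_sum Y Z)) \<and> (\<forall>p\<in>U. ?h p \<in> U' \<and> f p = f' (?h p))"
 proof (cases rule: mf_charts_sum_cases)
  case (1 V \<psi> \<delta>)
  from 1(1) show ?thesis
  proof (cases rule: mf_charts_sum_cases)
   case (1 V' \<psi>' \<delta>')
   thus ?thesis using \<open>(U,f,s) = _\<close> mf_charts_sumI(1)[OF 1(1),of "mf_sum Y Z"]
    by (intro exI[of _ "Inl ` V'"] exI[of _ "\<psi>' \<circ> projl"]) auto
  next
   case (2 V' \<psi>' \<delta>')
   thus ?thesis using \<open>(U,f,s) = _\<close> mf_charts_sumI(2)[OF mf_charts_sumI(1)[OF 2(1),of Z],of X]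
    by (intro exI[of _ "Inr ` Inl ` V'"] exI[of _ "(\<psi>' \<circ> projl) \<circ> projr"]) auto
  qed
 next
  case (2 V \<psi> \<delta>)
  thus ?thesis using mf_charts_sumI(2)[OF mf_charts_sumI(2)[OF 2(1),of Y],of X]
   by (intro exI[of _ "Inr ` Inr ` V"] exI[of _ "(\<psi> \<circ> projr) \<circ> projr"]) auto
 qed
qed (use assms in "auto simp: omanif_sum mf_sum_simps")

lemma odiff_sum_empty:
 assumes "omanif X" "mf_pts E = {}" "mf_charts E = {}" "omanif E" "mf_dim E = mf_dim X"
 shows "odiff X (mf_sum X E) Inl (case_sum (\<lambda>x. x) (\<lambda>_. undefined))"
proof (rule odiff_match')
 fix U f s assume "(U,f,s) \<in> mf_charts X"
 from mf_charts_sumI(1)[OF this,of E]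
 show "\<exists>U' f'. (U',f',s) \<in> mf_charts (mf_sum X E) \<and> (\<forall>p\<in>U. Inl p \<in> U' \<and> f p = f' (Inl p))"
  by (intro exI[of _ "Inl ` U"] exI[of _ "f \<circ> projl"]) auto
qed (use assms in "auto simp: omanif_sum mf_sum_simps")

section \<open>Boundaries of disjoint unions, transported manifolds and products\<close>

lemma bmanif_sum:
 "oriented_manifold_with_boundary X ==> oriented_manifold_with_boundary Y ==> mf_dim X = mf_dim Y ==>
  oriented_manifold_with_boundary (mf_sum X Y)"
 by (simp add: oriented_manifold_with_boundary_def manifold_sum mf_sum_simps)

lemma bmanif_image:
 "inj e ==> oriented_manifold_with_boundary X ==> oriented_manifold_with_boundary (mf_image e X)"
 by (simp add: oriented_manifold_with_boundary_def manifold_image mf_image_simps)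

lemma boundary_pointsI: "(U,f,s) \<in> mf_charts X ==> p \<in> U ==> f p 0 = 0 ==> p \<in> boundary_points X"
 by (force simp: boundary_points_def)

lemma boundary_pointsE:
 assumes "p \<in> boundary_points X"
 obtains U f s where "(U,f,s) \<in> mf_charts X" "p \<in> U" "f p 0 = 0"
 using assms by (auto simp: boundary_points_def)

lemma bd_points_sum: "boundary_points (mf_sum X Y) = Inl ` boundary_points X \<union> Inr ` boundary_points Y"
proof (intro equalityI subsetI)
 fix z assume "z \<in> boundary_points (mf_sum X Y)"
 then obtain U f s where c: "(U,f,s) \<in> mf_charts (mf_sum X Y)" "z \<in> U" "f z 0 = 0" by (rule boundary_pointsE)
 from c(1) show "z \<in> Inl ` boundary_points X \<union> Inr ` boundary_points Y"
 proof (cases rule: mf_charts_sum_cases)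
  case (1 V \<psi> \<delta>)
  thus ?thesis using c boundary_pointsI by fastforce
 next
  case (2 V \<psi> \<delta>)
  thus ?thesis using c boundary_pointsI by fastforce
 qed
next
 fix z assume "z \<in> Inl ` boundary_points X \<union> Inr ` boundary_points Y"
 thus "z \<in> boundary_points (mf_sum X Y)"
 proof (elim UnE imageE)
  fix p assume z: "z = Inl p" "p \<in> boundary_points X"
  from z(2) obtain U f s where c: "(U,f,s) \<in> mf_charts X" "p \<in> U" "f p 0 = 0" by (rule boundary_pointsE)
  show ?thesis by (rule boundary_pointsI[OF mf_charts_sumI(1)[OF c(1)]]) (use c z in auto)
 next
  fix p assume z: "z = Inr p" "p \<in> boundary_points Y"
  from z(2) obtain U f s where c: "(U,f,s) \<in> mf_charts Y" "p \<in> U" "f p 0 = 0" by (rule boundary_pointsE)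
  show ?thesis by (rule boundary_pointsI[OF mf_charts_sumI(2)[OF c(1)]]) (use c z in auto)
 qed
qed

lemma odiff_boundary_sum:
 assumes X: "oriented_manifold_with_boundary X" and Y: "oriented_manifold_with_boundary Y" and d: "mf_dim X = mf_dim Y"
 shows "odiff (mf_sum (mf_boundary X) (mf_boundary Y)) (mf_boundary (mf_sum X Y)) (\<lambda>x. x) (\<lambda>x. x)"
proof (rule odiff_match')
 note XY = bmanif_sum[OF X Y d]
 show "omanif (mf_boundary (mf_sum X Y))" by (rule omanif_boundary[OF XY])
 show "omanif (mf_sum (mf_boundary X) (mf_boundary Y))"
  by (intro omanif_sum omanif_boundary X Y) (simp add: mf_boundary_simps d)
 have pts: "mf_pts (mf_boundary (mf_sum X Y)) = mf_pts (mf_sum (mf_boundary X) (mf_boundary Y))"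
  by (simp add: mf_pts_boundary X Y XY mf_sum_simps bd_points_sum)
 show "q \<in> mf_pts (mf_boundary (mf_sum X Y)) ==> q \<in> mf_pts (mf_sum (mf_boundary X) (mf_boundary Y))" for q
  using pts by simp
 fix U f s assume "(U,f,s) \<in> mf_charts (mf_sum (mf_boundary X) (mf_boundary Y))"
 thus "\<exists>U' f'. (U',f',s) \<in> mf_charts (mf_boundary (mf_sum X Y)) \<and> (\<forall>p\<in>U. p \<in> U' \<and> f p = f' p)"
 proof (cases rule: mf_charts_sum_cases)
  case (1 V \<psi> \<delta>)
  then obtain V' \<psi>' where v: "(V',\<psi>',\<delta>) \<in> mf_charts X" "V = V' \<inter> boundary_points X" "\<psi> = (\<lambda>p. seq_tl (\<psi>' p))"
   unfolding mf_charts_boundary_iff by blast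
  have "(Inl ` V' \<inter> boundary_points (mf_sum X Y),\<lambda>p. seq_tl ((\<psi>' \<circ> projl) p),\<delta>) \<in> mf_charts (mf_boundary (mf_sum X Y))"
   unfolding mf_charts_boundary_iff using mf_charts_sumI(1)[OF v(1),of Y] by blast
  thus ?thesis using 1 v
   by (intro exI[of _ "Inl ` V' \<inter> boundary_points (mf_sum X Y)"] exI[of _ "\<lambda>p. seq_tl ((\<psi>' \<circ> projl) p)"])
     (auto simp: bd_points_sum)
 next
  case (2 V \<psi> \<delta>)
  then obtain V' \<psi>' where v: "(V',\<psi>',\<delta>) \<in> mf_charts Y" "V = V' \<inter> boundary_points Y" "\<psi> = (\<lambda>p. seq_tl (\<psi>' p))"
   unfolding mf_charts_boundary_iff by blast
  have "(Inr ` V' \<inter> boundary_points (mf_sum X Y),\<lambda>p. seq_tl ((\<psi>' \<circ> projr) p),\<delta>) \<in> mf_charts (mf_boundary (mf_sum X Y))"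
   unfolding mf_charts_boundary_iff using mf_charts_sumI(2)[OF v(1),of X] by blast
  thus ?thesis using 2 v
   by (intro exI[of _ "Inr ` V' \<inter> boundary_points (mf_sum X Y)"] exI[of _ "\<lambda>p. seq_tl ((\<psi>' \<circ> projr) p)"])
     (auto simp: bd_points_sum)
 qed
qed (auto simp: mf_sum_simps mf_boundary_simps)

lemma bd_points_image: "inj e ==> boundary_points (mf_image e X) = e ` boundary_points X"
 unfolding boundary_points_def mf_image_def by auto force+

lemma odiff_boundary_image:
 assumes X: "oriented_manifold_with_boundary X" and e: "inj e"
 shows "odiff (mf_boundary X) (mf_boundary (mf_image e X)) e (inv_into UNIV e)"
proof (rule odiff_match')
 note X' = bmanif_image[OF e X]
 show "omanif (mf_boundary X)" "omanif (mf_boundary (mf_image e X))"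
  by (intro omanif_boundary X X')+
 fix U f s assume "(U,f,s) \<in> mf_charts (mf_boundary X)"
 then obtain V \<psi> where v: "(V,\<psi>,s) \<in> mf_charts X" "U = V \<inter> boundary_points X" "f = (\<lambda>p. seq_tl (\<psi> p))"
  unfolding mf_charts_boundary_iff by blast
 have "(e ` V \<inter> boundary_points (mf_image e X),\<lambda>p. seq_tl ((\<psi> \<circ> inv_into UNIV e) p),s) \<in> mf_charts (mf_boundary (mf_image e X))"
  unfolding mf_charts_boundary_iff mf_charts_image_iff using v(1) by blast
 thus "\<exists>U' f'. (U',f',s) \<in> mf_charts (mf_boundary (mf_image e X)) \<and> (\<forall>p\<in>U. e p \<in> U' \<and> f p = f' (e p))"
  using v e by (intro exI[of _ "e ` V \<inter> boundary_points (mf_image e X)"] exI[of _ "\<lambda>p. seq_tl ((\<psi> \<circ> inv_into UNIV e) p)"])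
   (auto simp: bd_points_image)
qed (use e in "auto simp: mf_boundary_simps(2) mf_image_simps(2) bd_points_image mf_pts_boundary X bmanif_image")

lemma mf_charts_prodI:
 "(U,f,s) \<in> mf_charts X ==> (U',f',s') \<in> mf_charts Y ==>
  (U \<times> U',\<lambda>(p,q). seq_cat (mf_dim X) (f p) (f' q),s * s') \<in> mf_charts (mf_prod X Y)"
 unfolding mf_charts_prod_iff by blast

lemma mf_charts_prodE:
 assumes "(V,\<psi>,\<delta>) \<in> mf_charts (mf_prod X Y)"
 obtains U f s U' f' s' where "(U,f,s) \<in> mf_charts X" "(U',f',s') \<in> mf_charts Y"
  "V = U \<times> U'" "\<psi> = (\<lambda>(p,q). seq_cat (mf_dim X) (f p) (f' q))" "\<delta> = s * s'"
 using assms unfolding mf_charts_prod_iff by blast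

lemma bd_points_prod:
 assumes X: "oriented_manifold_with_boundary X" and Y: "omanif Y"
 shows "boundary_points (mf_prod X Y) = boundary_points X \<times> mf_pts Y"
proof (intro equalityI subsetI)
 have n: "0 < mf_dim X" using X by (simp add: oriented_manifold_with_boundary_def)
 fix z assume "z \<in> boundary_points (mf_prod X Y)"
 then obtain V \<psi> \<delta> where v: "(V,\<psi>,\<delta>) \<in> mf_charts (mf_prod X Y)" "z \<in> V" "\<psi> z 0 = 0" by (auto simp: boundary_points_def)
 from v(1) obtain U f s U' f' s' where 1: "(U,f,s) \<in> mf_charts X" "(U',f',s') \<in> mf_charts Y"
  "V = U \<times> U'" "\<psi> = (\<lambda>(p,q). seq_cat (mf_dim X) (f p) (f' q))" by (rule mf_charts_prodE)
 have "U' \<subseteq> mf_pts Y" using gchartD(2)[OF manifoldD(4)[OF Y[unfolded oriented_manifold_def] 1(2)]] .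
 moreover obtain p q where "z = (p,q)" by (cases z)
 ultimately show "z \<in> boundary_points X \<times> mf_pts Y" using v 1 n
  unfolding boundary_points_def by (auto simp: seq_cat_def)
next
 have n: "0 < mf_dim X" using X by (simp add: oriented_manifold_with_boundary_def)
 fix z assume "z \<in> boundary_points X \<times> mf_pts Y"
 then obtain p q U f s where z: "z = (p,q)" "q \<in> mf_pts Y" "(U,f,s) \<in> mf_charts X" "p \<in> U" "f p 0 = 0"
  unfolding boundary_points_def by auto
 obtain U' f' s' where c': "(U',f',s') \<in> mf_charts Y" "q \<in> U'" using manifoldD(3)[OF Y[unfolded oriented_manifold_def] z(2)] by blast
 show "z \<in> boundary_points (mf_prod X Y)"
  unfolding boundary_points_def
  by (rule UN_I[OF mf_charts_prodI[OF z(3) c'(1)]]) (use z c' n in "auto simp: seq_cat_def")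
qed

text \<open>With the factor \<open>X\<close> first, the dropped outward coordinate is the first one
  on both sides, so no sign appears.\<close>

lemma odiff_boundary_prod:
 assumes X: "oriented_manifold_with_boundary X" and Y: "omanif Y"
 shows "odiff (mf_prod (mf_boundary X) Y) (mf_boundary (mf_prod X Y)) (\<lambda>x. x) (\<lambda>x. x)"
proof (rule odiff_match')
 obtain m where n: "mf_dim X = Suc m" using X gr0_implies_Suc by (auto simp: oriented_manifold_with_boundary_def)
 note XY = bmanif_prod[OF X Y]
 show "omanif (mf_prod (mf_boundary X) Y)" "omanif (mf_boundary (mf_prod X Y))"
  by (intro omanif_prod omanif_boundary X Y XY)+
 show "mf_dim (mf_prod (mf_boundary X) Y) = mf_dim (mf_boundary (mf_prod X Y))"
  by (simp add: mf_prod_simps mf_boundary_simps n)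
 have pts: "mf_pts (mf_boundary (mf_prod X Y)) = mf_pts (mf_prod (mf_boundary X) Y)"
  by (simp add: mf_pts_boundary[OF XY] mf_pts_boundary[OF X] mf_prod_simps bd_points_prod[OF X Y])
 show "q \<in> mf_pts (mf_boundary (mf_prod X Y)) ==> q \<in> mf_pts (mf_prod (mf_boundary X) Y)" for q
  using pts by simp
 fix V \<psi> \<delta> assume "(V,\<psi>,\<delta>) \<in> mf_charts (mf_prod (mf_boundary X) Y)"
 then obtain U f s U' f' s' where 1: "(U,f,s) \<in> mf_charts (mf_boundary X)" "(U',f',s') \<in> mf_charts Y"
  "V = U \<times> U'" "\<psi> = (\<lambda>(p,q). seq_cat (mf_dim (mf_boundary X)) (f p) (f' q))" "\<delta> = s * s'" by (rule mf_charts_prodE)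
 obtain W \<xi> where 2: "(W,\<xi>,s) \<in> mf_charts X" "U = W \<inter> boundary_points X" "f = (\<lambda>p. seq_tl (\<xi> p))"
  using 1(1) unfolding mf_charts_boundary_iff by blast
 have U': "U' \<subseteq> mf_pts Y" using gchartD(2)[OF manifoldD(4)[OF Y[unfolded oriented_manifold_def] 1(2)]] .
 have tl: "seq_tl (seq_cat (Suc m) x y) = seq_cat m (seq_tl x) y" for x y by (auto simp: seq_tl_def seq_cat_def)
 have "((W \<times> U') \<inter> boundary_points (mf_prod X Y),\<lambda>p. seq_tl ((\<lambda>(p,q). seq_cat (mf_dim X) (\<xi> p) (f' q)) p),\<delta>)
   \<in> mf_charts (mf_boundary (mf_prod X Y))"
  unfolding mf_charts_boundary_iff 1(5) using mf_charts_prodI[OF 2(1) 1(2)] by blast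
 thus "\<exists>U' f'. (U',f',\<delta>) \<in> mf_charts (mf_boundary (mf_prod X Y)) \<and> (\<forall>p\<in>V. p \<in> U' \<and> \<psi> p = f' p)"
  using 1 2 U' n
  by (intro exI[of _ "(W \<times> U') \<inter> boundary_points (mf_prod X Y)"]
     exI[of _ "\<lambda>p. seq_tl ((\<lambda>(p,q). seq_cat (mf_dim X) (\<xi> p) (f' q)) p)"])
    (auto simp: bd_points_prod[OF X Y] tl mf_boundary_simps)
qed auto

lemma bd_points_unit: "boundary_points mf_unit = {0,1}"
 by (auto simp: boundary_points_def mf_unit_def)

text \<open>The chart of the interval at 1 has sign 1 and the one at 0 has sign -1. On the boundary
  of the cylinder the coordinate of the interval is dropped but its sign is kept, which leaves
  \<open>X\<close> at one end and \<open>X\<close> reversed at the other.\<close>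

lemma odiff_double_boundary:
 assumes X: "omanif X"
 shows "odiff (mf_sum X (mf_neg X)) (mf_boundary (mf_prod mf_unit X))
  (case_sum (Pair 1) (Pair 0)) (\<lambda>(t,v). if t = 1 then Inl v else Inr v)" (is "odiff _ _ ?h _")
proof (rule odiff_match')
 note UX = bmanif_prod[OF unit_manifold X]
 have d: "mf_dim mf_unit = 1" by (simp add: mf_unit_def)
 have bp: "boundary_points (mf_prod mf_unit X) = {0,1} \<times> mf_pts X"
  by (simp add: bd_points_prod[OF unit_manifold X] bd_points_unit)
 show "omanif (mf_sum X (mf_neg X))" "omanif (mf_boundary (mf_prod mf_unit X))"
  by (intro omanif_sum omanif_neg omanif_boundary X UX,simp add: mf_neg_simps)+
    (intro omanif_boundary UX)
 show "mf_dim (mf_sum X (mf_neg X)) = mf_dim (mf_boundary (mf_prod mf_unit X))"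
  by (simp add: mf_sum_simps mf_boundary_simps mf_prod_simps d)
 have tl: "seq_tl (seq_cat (Suc 0) x y) = y" for x y by (auto simp: seq_tl_def seq_cat_def)
 have ch: "({0<..1} \<times> U \<inter> boundary_points (mf_prod mf_unit X),\<lambda>p. seq_tl ((\<lambda>(p,q). seq_cat (mf_dim mf_unit) (unit_chart 1 1 p) (f q)) p),1 * s)
   \<in> mf_charts (mf_boundary (mf_prod mf_unit X))"
  "({0..<1} \<times> U \<inter> boundary_points (mf_prod mf_unit X),\<lambda>p. seq_tl ((\<lambda>(p,q). seq_cat (mf_dim mf_unit) (unit_chart (-1) 0 p) (f q)) p),(-1) * s)
   \<in> mf_charts (mf_boundary (mf_prod mf_unit X))"
  if "(U,f,s) \<in> mf_charts X" for U f s
  using mf_charts_prodI[OF _ that,of "{0<..1}" "unit_chart 1 1" 1 mf_unit]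
   mf_charts_prodI[OF _ that,of "{0..<1}" "unit_chart (-1) 0" "-1" mf_unit]
  unfolding mf_charts_boundary_iff by (auto simp: mf_unit_def)
 have sub: "U \<subseteq> mf_pts X" if "(U,f,s) \<in> mf_charts X" for U f s
  using gchartD(2)[OF manifoldD(4)[OF X[unfolded oriented_manifold_def] that]] .
 fix V \<psi> \<delta> assume "(V,\<psi>,\<delta>) \<in> mf_charts (mf_sum X (mf_neg X))"
 thus "\<exists>U' f'. (U',f',\<delta>) \<in> mf_charts (mf_boundary (mf_prod mf_unit X)) \<and> (\<forall>p\<in>V. ?h p \<in> U' \<and> \<psi> p = f' (?h p))"
 proof (cases rule: mf_charts_sum_cases)
  case (1 U f s)
  show ?thesis using 1 ch(1)[OF 1(1)] sub[OF 1(1)]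
   by (intro exI[of _ "{0<..1} \<times> U \<inter> boundary_points (mf_prod mf_unit X)"]
      exI[of _ "\<lambda>p. seq_tl ((\<lambda>(p,q). seq_cat (mf_dim mf_unit) (unit_chart 1 1 p) (f q)) p)"])
     (auto simp: bp tl d)
 next
  case (2 U f s)
  hence c: "(U,f,- s) \<in> mf_charts X" by (simp add: mf_charts_neg_iff)
  show ?thesis using 2 ch(2)[OF c] sub[OF c]
   by (intro exI[of _ "{0..<1} \<times> U \<inter> boundary_points (mf_prod mf_unit X)"]
      exI[of _ "\<lambda>p. seq_tl ((\<lambda>(p,q). seq_cat (mf_dim mf_unit) (unit_chart (-1) 0 p) (f q)) p)"])
     (auto simp: bp tl d)
 qed
next
 fix q assume "q \<in> mf_pts (mf_boundary (mf_prod mf_unit X))"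
 hence "q \<in> {0,1} \<times> mf_pts X"
  by (simp add: mf_pts_boundary[OF bmanif_prod[OF unit_manifold X]] bd_points_prod[OF unit_manifold X] bd_points_unit)
 thus "(\<lambda>(t,v). if t = 1 then Inl v else Inr v) q \<in> mf_pts (mf_sum X (mf_neg X))"
  "?h ((\<lambda>(t,v). if t = 1 then Inl v else Inr v) q) = q"
  by (auto simp: mf_sum_simps mf_neg_simps)
qed (auto simp: mf_sum_simps)

lemma odiff_prod_sum_left:
 assumes "omanif X" "omanif Y" "omanif Z" "mf_dim X = mf_dim Y"
 shows "odiff (mf_sum (mf_prod X Z) (mf_prod Y Z)) (mf_prod (mf_sum X Y) Z)
  (case_sum (\<lambda>(x,z). (Inl x,z)) (\<lambda>(y,z). (Inr y,z))) (\<lambda>(s,z). case s of Inl x => Inl (x,z) | Inr y => Inr (y,z))"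
  (is "odiff _ _ ?h ?g")
proof (rule odiff_match')
 fix V \<psi> \<delta> assume "(V,\<psi>,\<delta>) \<in> mf_charts (mf_sum (mf_prod X Z) (mf_prod Y Z))"
 thus "\<exists>U' f'. (U',f',\<delta>) \<in> mf_charts (mf_prod (mf_sum X Y) Z) \<and> (\<forall>p\<in>V. ?h p \<in> U' \<and> \<psi> p = f' (?h p))"
 proof (cases rule: mf_charts_sum_cases)
  case (1 V' \<psi>' \<delta>')
  from 1(1) obtain U f t U' f' t' where 2: "(U,f,t) \<in> mf_charts X" "(U',f',t') \<in> mf_charts Z"
   "V' = U \<times> U'" "\<psi>' = (\<lambda>(p,q). seq_cat (mf_dim X) (f p) (f' q))" "\<delta>' = t * t'" by (rule mf_charts_prodE)
  show ?thesis using mf_charts_prodI[OF mf_charts_sumI(1)[OF 2(1),of Y] 2(2)] 1 2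
   by (intro exI[of _ "(Inl ` U) \<times> U'"] exI[of _ "\<lambda>(p,q). seq_cat (mf_dim (mf_sum X Y)) ((f \<circ> projl) p) (f' q)"])
     (auto simp: mf_sum_simps)
 next
  case (2 V' \<psi>' \<delta>')
  from 2(1) obtain U f t U' f' t' where 1: "(U,f,t) \<in> mf_charts Y" "(U',f',t') \<in> mf_charts Z"
   "V' = U \<times> U'" "\<psi>' = (\<lambda>(p,q). seq_cat (mf_dim Y) (f p) (f' q))" "\<delta>' = t * t'" by (rule mf_charts_prodE)
  show ?thesis using mf_charts_prodI[OF mf_charts_sumI(2)[OF 1(1),of X] 1(2)] 1 2 assms(4)
   by (intro exI[of _ "(Inr ` U) \<times> U'"] exI[of _ "\<lambda>(p,q). seq_cat (mf_dim (mf_sum X Y)) ((f \<circ> projr) p) (f' q)"])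
     (auto simp: mf_sum_simps)
 qed
qed (use assms in "auto simp: omanif_sum omanif_prod mf_prod_simps mf_sum_simps")

lemma odiff_prod_assoc:
 assumes "omanif X" "omanif Y" "omanif Z"
 shows "odiff (mf_prod (mf_prod X Y) Z) (mf_prod X (mf_prod Y Z)) (\<lambda>((x,y),z). (x,(y,z))) (\<lambda>(x,(y,z)). ((x,y),z))"
  (is "odiff _ _ ?h ?g")
proof (rule odiff_match')
 have cat: "seq_cat (n + m) (seq_cat n x y) z = seq_cat n x (seq_cat m y z)" for n m x y z
  by (auto simp: seq_cat_def fun_eq_iff)
 fix V \<psi> \<delta> assume "(V,\<psi>,\<delta>) \<in> mf_charts (mf_prod (mf_prod X Y) Z)"
 then obtain W f s U3 f3 s3 where 1: "(W,f,s) \<in> mf_charts (mf_prod X Y)" "(U3,f3,s3) \<in> mf_charts Z"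
  "V = W \<times> U3" "\<psi> = (\<lambda>(p,q). seq_cat (mf_dim (mf_prod X Y)) (f p) (f3 q))" "\<delta> = s * s3" by (rule mf_charts_prodE)
 from 1(1) obtain U1 f1 s1 U2 f2 s2 where 2: "(U1,f1,s1) \<in> mf_charts X" "(U2,f2,s2) \<in> mf_charts Y"
  "W = U1 \<times> U2" "f = (\<lambda>(p,q). seq_cat (mf_dim X) (f1 p) (f2 q))" "s = s1 * s2" by (rule mf_charts_prodE)
 show "\<exists>U' f'. (U',f',\<delta>) \<in> mf_charts (mf_prod X (mf_prod Y Z)) \<and> (\<forall>p\<in>V. ?h p \<in> U' \<and> \<psi> p = f' (?h p))"
  using mf_charts_prodI[OF 2(1) mf_charts_prodI[OF 2(2) 1(2)]] 1 2
  by (intro exI[of _ "U1 \<times> (U2 \<times> U3)"]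
     exI[of _ "\<lambda>(p,q). seq_cat (mf_dim X) (f1 p) ((\<lambda>(p,q). seq_cat (mf_dim Y) (f2 p) (f3 q)) q)"])
    (auto simp: mf_prod_simps cat mult.assoc)
qed (use assms in "auto simp: omanif_prod mf_prod_simps")

text \<open>One pair of charts around each point suffices: any other pair differs from it by
  transitions of \<open>X\<close> and \<open>Y\<close>, which are composed before and after.\<close>

lemma omap_local:
 assumes X: "omanif X" and Y: "omanif Y" and d: "mf_dim X = mf_dim Y"
  and ch: "continuous_map (mf_top X) (mf_top Y) h"
  and loc: "!!p. p \<in> mf_pts X ==> \<exists>U f s U' f' s'. (U,f,s) \<in> mf_charts X \<and> (U',f',s') \<in> mf_charts Y \<and>
   p \<in> U \<and> h ` U \<subseteq> U' \<and> oloc (mf_dim X) h (U,f,s) (U',f',s')"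
 shows "omap X Y h"
 unfolding omap_def
proof (intro conjI ballI ch)
 note X = X[unfolded oriented_manifold_def] and Y = Y[unfolded oriented_manifold_def]
 let ?n = "mf_dim X"
 fix c1 c2 assume c: "c1 \<in> mf_charts X" "c2 \<in> mf_charts Y"
 obtain U1 f1 s1 where c1: "c1 = (U1,f1,s1)" using prod_cases3 by blast
 obtain U2 f2 s2 where c2: "c2 = (U2,f2,s2)" using prod_cases3 by blast
 note g1 = manifoldD(4)[OF X c(1),unfolded c1] and g2 = manifoldD(4)[OF Y c(2),unfolded c2]
 have pre: "openin (mf_top X) {p \<in> V. h p \<in> U2}" if "openin (mf_top X) V" for V
 proof -
  have "openin (mf_top X) (V \<inter> {p \<in> mf_pts X. h p \<in> U2})"
   by (intro openin_Int that openin_continuous_map_preimage[OF ch gchartD(1)[OF g2]])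
  moreover have "V \<inter> {p \<in> mf_pts X. h p \<in> U2} = {p \<in> V. h p \<in> U2}" using openin_subset[OF that] by auto
  ultimately show ?thesis by simp
 qed
 show "oloc ?n h c1 c2" unfolding c1 c2
 proof (rule oloc_local[OF g1 pre[OF gchartD(1)[OF g1]]])
  fix p assume p: "p \<in> U1" "h p \<in> U2"
  have "p \<in> mf_pts X" using p gchartD(2)[OF g1] by blast
  then obtain U f s U' f' s' where u: "(U,f,s) \<in> mf_charts X" "(U',f',s') \<in> mf_charts Y"
   "p \<in> U" "h ` U \<subseteq> U'" "oloc ?n h (U,f,s) (U',f',s')" using loc by blast
  note g = manifoldD(4)[OF X u(1)] and g' = manifoldD(4)[OF Y u(2),folded d]
  have oUU: "openin (mf_top X) (U1 \<inter> U)" using gchartD(1)[OF g1] gchartD(1)[OF g] by blast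
  have inj: "inj_on f1 (U1 \<inter> U)" using gchartD(3)[OF g1] by (rule inj_on_subset) blast
  have "{q \<in> U1. q \<in> U} = U1 \<inter> U" by auto
  hence A: "oloc ?n (\<lambda>x. x) (U1 \<inter> U,f1,s1) (U,f,s)"
   by (intro oloc_restrict[OF _ g1 gchartD(1)[OF g]]) (use manifoldD(6)[OF X c(1) u(1)] c1 oUU in auto)
  have B: "oloc ?n (\<lambda>p. h p) (U1 \<inter> U,f1,s1) (U',f',s')"
  proof (rule oloc_compose[where h = "\<lambda>x. x" and g = h,OF A u(5) inj gchartD(3)[OF g]])
   have "{p \<in> U1 \<inter> U. h p \<in> U'} = U1 \<inter> U" "{p \<in> U. h p \<in> U'} = U" using u(4) by auto
   thus "openin (Eucl ?n) (f1 ` {p \<in> U1 \<inter> U. h p \<in> U'})" "openin (Eucl ?n) (f ` {p \<in> U. h p \<in> U'})"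
    using gchart_image[OF g1 oUU] gchartD(7)[OF g] by auto
  qed (use gchartD(6)[OF g] in auto)
  have "oloc ?n (\<lambda>p. h p) (U1 \<inter> U,f1,s1) (U2,f2,s2)"
  proof (rule oloc_compose[where h = h and g = "\<lambda>x. x",OF B _ inj gchartD(3)[OF g']])
   show "oloc ?n (\<lambda>x. x) (U',f',s') (U2,f2,s2)" using manifoldD(6)[OF Y u(2) c(2)] c2 d by simp
   show "openin (Eucl ?n) (f1 ` {p \<in> U1 \<inter> U. h p \<in> U2})"
    using gchart_image[OF g1 pre[OF oUU]] by auto
   have "{q \<in> U'. q \<in> U2} = U' \<inter> U2" by auto
   thus "openin (Eucl ?n) (f' ` {q \<in> U'. q \<in> U2})"
    using gchart_image[OF g' openin_Int[OF gchartD(1)[OF g'] gchartD(1)[OF g2]]] by auto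
  qed (use gchartD(6)[OF g'] u(4) in auto)
  thus "\<exists>V. openin (mf_top X) V \<and> p \<in> V \<and> oloc ?n h (U1 \<inter> V,f1,s1) (U2,f2,s2)"
   using gchartD(1)[OF g] u(3) by blast
 qed
qed

text \<open>Moving \<open>m\<close> rows past \<open>n\<close> rows costs one sign for each pair.
  This is the origin of the sign in graded commutativity.\<close>

lemma det_block_swap:
 "Determinant.det (Matrix.mat (n + m) (n + m) (\<lambda>(i,k). if (if i < m then n + i else i - m) = k then 1 else 0)) = (-1 :: real) ^ (n * m)"
proof -
 let ?A = "Matrix.mat (m + n) (m + n) (\<lambda>(i,j). (1\<^sub>m (m + n) :: real mat) $$ (if i < m then i + n else i - m,j))"
 have "Determinant.det (1\<^sub>m (m + n) :: real mat) = (-1) ^ (m * n) * Determinant.det ?A"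
  by (rule det_swap_rows) auto
 hence "1 = (-1 :: real) ^ (m * n) * Determinant.det ?A" by simp
 \<comment> \<open>The sign is its own inverse, so multiplying by it solves for the
   determinant.\<close>
 hence "(-1 :: real) ^ (m * n) * 1 = (-1) ^ (m * n) * ((-1) ^ (m * n) * Determinant.det ?A)" by simp
 hence "Determinant.det ?A = (-1) ^ (n * m)"
  by (simp add: mult.assoc[symmetric] power_mult_distrib[symmetric] mult.commute)
 moreover have "Matrix.mat (n + m) (n + m) (\<lambda>(i,k). if (if i < m then n + i else i - m) = k then 1 else 0) = ?A"
  by (rule eq_matI) auto
 ultimately show ?thesis by simp
qed

section \<open>Interchange of the factors of a product\<close>

lemma sign_cancel:
 fixes e e' c :: real
 assumes "e * e = 1" "e' * e' = 1"
 shows "(e * e') * (e' * (c * e)) = c" "(e' * (c * e)) * (e * e') = c"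
proof -
 have "(e * e') * (e' * (c * e)) = c * (e * e) * (e' * e')" by (simp only: mult_ac)
 thus "(e * e') * (e' * (c * e)) = c" using assms by simp
 thus "(e' * (c * e)) * (e * e') = c" by (simp only: mult.commute)
qed

lemma oloc_swap:
 assumes g: "gchart UNIV n T (U,f,t)" and g': "gchart UNIV m T' (U',f',t')" and s: "\<delta> * \<delta>' = (-1) ^ (n * m)"
 shows "oloc (n + m) (\<lambda>(p,q). (q,p)) (U \<times> U',\<lambda>(p,q). seq_cat n (f p) (f' q),\<delta>)
  (U' \<times> U,\<lambda>(q,p). seq_cat m (f' q) (f p),\<delta>')"
proof -
 let ?\<Phi> = "\<lambda>(p,q). seq_cat n (f p) (f' q)" and ?\<Phi>' = "\<lambda>(q,p). seq_cat m (f' q) (f p)"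
 let ?h = "\<lambda>(p,q). (q,p)"
 let ?D = "?\<Phi> ` {z \<in> U \<times> U'. ?h z \<in> U' \<times> U}" and ?r = "chart_rep (U \<times> U',?\<Phi>,\<delta>) (U' \<times> U,?\<Phi>',\<delta>') ?h"
 let ?\<sigma> = "\<lambda>i. if i < m then n + i else i - m"
 note gp = gchart_prod[OF g g',simplified]
 have dom: "{z \<in> U \<times> U'. ?h z \<in> U' \<times> U} = U \<times> U'" by auto
 have D: "openin (Eucl (n + m)) ?D" unfolding dom using gchartD(7)[OF gp] by simp
 have r: "?r z i = z (?\<sigma> i)" if z: "z \<in> ?D" and i: "i < n + m" for z i
 proof -
  obtain p q where pq: "p \<in> U" "q \<in> U'" "z = ?\<Phi> (p,q)" using z by auto
  have "?r z = ?\<Phi>' (?h (p,q))" unfolding pq(3) by (rule rep_apply[OF gchartD(3)[OF gp]]) (use pq in auto)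
  thus ?thesis using pq i by (auto simp: seq_cat_def)
 qed
 have "smooth_on (n + m) (n + m) ?D ?r"
  by (rule smooth_on_coordinates[where \<sigma> = ?\<sigma>]) (use r openin_subset[OF D] in auto)
 moreover have "jacobian_det (n + m) ?D ?r z = (-1) ^ (n * m)" if z: "z \<in> ?D" for z
  using jacobian_det_coord[OF D z,where \<sigma> = ?\<sigma> and F = ?r] r by (simp only: det_block_swap)
 moreover have "sgn ((-1 :: real) ^ (n * m)) = (-1) ^ (n * m)" by (cases "even (n * m)") auto
 ultimately show ?thesis using s unfolding oloc_def rep_dom_eq by simp
qed

text \<open>The manifold \<open>X\<close> with its orientation multiplied by
  \<open>(-1) ^ k\<close>; it absorbs the sign of an interchange of factors.\<close>

definition mf_sgn :: "nat => 'a omanifold => 'a omanifold"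
 where "mf_sgn k X = (if even k then X else mf_neg X)"

lemma mf_sgn_simps: "mf_top (mf_sgn k X) = mf_top X" "mf_dim (mf_sgn k X) = mf_dim X"
 by (auto simp: mf_sgn_def mf_neg_simps)

lemma mf_charts_sgn_iff: "(U,f,s) \<in> mf_charts (mf_sgn k X) \<longleftrightarrow> (U,f,(-1) ^ k * s) \<in> mf_charts X"
 by (auto simp: mf_sgn_def mf_charts_neg_iff)

lemma omanif_sgn: "omanif X ==> omanif (mf_sgn k X)"
 by (simp add: mf_sgn_def omanif_neg)

text \<open>The defect of the interchange is put on one factor, which turns the interchange into an
  orientation preserving diffeomorphism. Statements about left factors can then be carried over to
  right factors.\<close>

lemma odiff_swap:
 assumes X: "omanif X" and Y: "omanif Y"
 shows "odiff (mf_prod X Y) (mf_prod Y (mf_sgn (mf_dim X * mf_dim Y) X)) (\<lambda>(p,q). (q,p)) (\<lambda>(p,q). (q,p))"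
proof -
 note X' = X[unfolded oriented_manifold_def] and Y' = Y[unfolded oriented_manifold_def]
 let ?n = "mf_dim X" and ?m = "mf_dim Y"
 let ?Z = "mf_sgn (?n * ?m) X"
 have Z: "omanif ?Z" using X by (rule omanif_sgn)
 have cont: "continuous_map (prod_topology S T) (prod_topology T S) (\<lambda>(p,q). (q,p))" for S :: "'c topology" and T :: "'d topology"
  by (auto simp: case_prod_unfold intro: continuous_intros)
 have sq: "(-1) ^ k * ((-1) ^ k * x) = x" for k and x :: real by (simp add: mult.assoc[symmetric] power_mult_distrib[symmetric])
 have 1: "omap (mf_prod X Y) (mf_prod Y ?Z) (\<lambda>(p,q). (q,p))"
 proof (rule omap_local)
  fix z assume "z \<in> mf_pts (mf_prod X Y)"
  then obtain p q where z: "z = (p,q)" "p \<in> mf_pts X" "q \<in> mf_pts Y" by (auto simp: mf_prod_simps)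
  obtain U f s where c: "(U,f,s) \<in> mf_charts X" "p \<in> U" using manifoldD(3)[OF X' z(2)] by blast
  obtain U' f' s' where c': "(U',f',s') \<in> mf_charts Y" "q \<in> U'" using manifoldD(3)[OF Y' z(3)] by blast
  note g = manifoldD(4)[OF X' c(1)] and g' = manifoldD(4)[OF Y' c'(1)]
  have cz: "(U,f,(-1) ^ (?n * ?m) * s) \<in> mf_charts ?Z" using c(1) by (simp add: mf_charts_sgn_iff sq)
  have e: "s * s = 1" "s' * s' = 1" using gchartD(6)[OF g] gchartD(6)[OF g'] by auto
  have "oloc (?n + ?m) (\<lambda>(p,q). (q,p)) (U \<times> U',\<lambda>(p,q). seq_cat ?n (f p) (f' q),s * s')
   (U' \<times> U,\<lambda>(q,p). seq_cat ?m (f' q) (f p),s' * ((-1) ^ (?n * ?m) * s))"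
   by (rule oloc_swap[OF g g' sign_cancel(1)[OF e]])
  thus "\<exists>U f s U' f' s'. (U,f,s) \<in> mf_charts (mf_prod X Y) \<and> (U',f',s') \<in> mf_charts (mf_prod Y ?Z) \<and>
   z \<in> U \<and> (\<lambda>(p,q). (q,p)) ` U \<subseteq> U' \<and> oloc (mf_dim (mf_prod X Y)) (\<lambda>(p,q). (q,p)) (U,f,s) (U',f',s')"
   using mf_charts_prodI[OF c(1) c'(1)] mf_charts_prodI[OF c'(1) cz] z c c'
   apply (rule_tac exI[of _ "U \<times> U'"],rule_tac exI,rule_tac exI,rule_tac exI[of _ "U' \<times> U"],rule_tac exI,rule_tac exI)
   apply (rule conjI,assumption,rule conjI,assumption)
   apply (auto simp: mf_prod_simps)
   done
 qed (use X Y Z cont in "auto simp: omanif_prod mf_prod_simps mf_sgn_simps")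
 have 2: "omap (mf_prod Y ?Z) (mf_prod X Y) (\<lambda>(p,q). (q,p))"
 proof (rule omap_local)
  fix z assume "z \<in> mf_pts (mf_prod Y ?Z)"
  then obtain p q where z: "z = (q,p)" "p \<in> mf_pts X" "q \<in> mf_pts Y" by (auto simp: mf_prod_simps mf_sgn_simps)
  obtain U f s where c: "(U,f,s) \<in> mf_charts X" "p \<in> U" using manifoldD(3)[OF X' z(2)] by blast
  obtain U' f' s' where c': "(U',f',s') \<in> mf_charts Y" "q \<in> U'" using manifoldD(3)[OF Y' z(3)] by blast
  note g = manifoldD(4)[OF X' c(1)] and g' = manifoldD(4)[OF Y' c'(1)]
  have cz: "(U,f,(-1) ^ (?n * ?m) * s) \<in> mf_charts ?Z" using c(1) by (simp add: mf_charts_sgn_iff sq)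
  have e: "s * s = 1" "s' * s' = 1" using gchartD(6)[OF g] gchartD(6)[OF g'] by auto
  have "oloc (?m + ?n) (\<lambda>(p,q). (q,p)) (U' \<times> U,\<lambda>(q,p). seq_cat ?m (f' q) (f p),s' * ((-1) ^ (?n * ?m) * s))
   (U \<times> U',\<lambda>(p,q). seq_cat ?n (f p) (f' q),s * s')"
   unfolding mult.commute[of ?n ?m] by (rule oloc_swap[OF g' g sign_cancel(2)[OF e]])
  thus "\<exists>U f s U' f' s'. (U,f,s) \<in> mf_charts (mf_prod Y ?Z) \<and> (U',f',s') \<in> mf_charts (mf_prod X Y) \<and>
   z \<in> U \<and> (\<lambda>(p,q). (q,p)) ` U \<subseteq> U' \<and> oloc (mf_dim (mf_prod Y ?Z)) (\<lambda>(p,q). (q,p)) (U,f,s) (U',f',s')"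
   using mf_charts_prodI[OF c(1) c'(1)] mf_charts_prodI[OF c'(1) cz] z c c'
   apply (rule_tac exI[of _ "U' \<times> U"],rule_tac exI,rule_tac exI,rule_tac exI[of _ "U \<times> U'"],rule_tac exI,rule_tac exI)
   apply (rule conjI,assumption,rule conjI,assumption)
   apply (auto simp: mf_prod_simps mf_sgn_simps)
   done
 qed (use X Y Z cont in "auto simp: omanif_prod mf_prod_simps mf_sgn_simps")
 show ?thesis unfolding odiff_def using 1 2 by (auto simp: mf_prod_simps mf_sgn_simps)
qed

section \<open>The bordism group\<close>

subsection \<open>Manifolds over a space, up to diffeomorphism\<close>

type_synonym ('a,'y) over = "'a omanifold \<times> ('a => 'y)"

definition osum :: "('a,'y) over => ('b,'y) over => ('a + 'b,'y) over"
 where "osum P Q = (mf_sum (fst P) (fst Q),case_sum (snd P) (snd Q))"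

definition obd :: "('a,'y) over => ('a,'y) over"
 where "obd P = (mf_boundary (fst P),snd P)"

text \<open>How the values are combined is a parameter: \<open>diagram_join\<close> for garlands of
  two fixed types, \<open>garland_join\<close> on the whole space of garlands, and either of them
  with its arguments interchanged.\<close>

definition oprod :: "('y \<times> 'z => 't) => ('a,'y) over => ('b,'z) over => ('a \<times> 'b,'t) over"
 where "oprod m P Q = (mf_prod (fst P) (fst Q),\<lambda>(p,q). m (snd P p,snd Q q))"

definition oempty :: "nat => ('a,'y) over"
 where "oempty j = (mf_empty j,\<lambda>_. undefined)"

abbreviation sing :: "nat => 'y topology => ('a,'y) over => bool"
 where "sing j Y P \<equiv> singular_manifold j Y (fst P) (snd P)"

abbreviation bdm :: "nat => 'y topology => ('a,'y) over => bool"
 where "bdm j Y P \<equiv> singular_bordism j Y (fst P) (snd P)"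

abbreviation bord :: "nat => 'y topology => ('a,'y) over => ('b,'y) over => bool"
 where "bord j Y P Q \<equiv> bordant j Y (fst P) (snd P) (fst Q) (snd Q)"

abbreviation cls :: "nat => 'y topology => ('a,'y) over => 'y bordism_class"
 where "cls j Y P \<equiv> bclass j Y (fst P) (snd P)"

abbreviation omf :: "nat => ('a,'y) over => bool"
 where "omf n P \<equiv> omanif (fst P) \<and> mf_dim (fst P) = n"

text \<open>Being manifolds is part of the relation, so that chains of isomorphisms carry no side
  conditions.\<close>

definition iso_over :: "('a,'y) over => ('b,'y) over => bool"
 where "iso_over P Q \<longleftrightarrow> omanif (fst P) \<and> omanif (fst Q) \<and>
  (\<exists>h g. odiff (fst P) (fst Q) h g \<and> (\<forall>p\<in>mf_pts (fst P). snd Q (h p) = snd P p))"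

lemma omap_pts: "omap X Y h ==> p \<in> mf_pts X ==> h p \<in> mf_pts Y"
 unfolding omap_def using continuous_map_image_subset_topspace by blast

lemma iso_overI:
 "omanif (fst P) ==> omanif (fst Q) ==> odiff (fst P) (fst Q) h g ==>
  (!!p. p \<in> mf_pts (fst P) ==> snd Q (h p) = snd P p) ==> iso_over P Q"
 unfolding iso_over_def by blast

lemma iso_over_refl: "omanif (fst P) ==> iso_over P P"
 by (rule iso_overI[OF _ _ odiff_id]) (auto simp: oriented_manifold_def)

lemma iso_over_sym:
 assumes "iso_over P Q" shows "iso_over Q P"
proof -
 obtain h g where hg: "odiff (fst P) (fst Q) h g" "\<forall>p\<in>mf_pts (fst P). snd Q (h p) = snd P p"
  using assms unfolding iso_over_def by blast
 hence "g q \<in> mf_pts (fst P)" "h (g q) = q" if "q \<in> mf_pts (fst Q)" for q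
  using that by (auto simp: odiff_def dest: omap_pts)
 hence "\<forall>q\<in>mf_pts (fst Q). snd P (g q) = snd Q q" using hg(2) by metis
 thus ?thesis using assms odiff_sym[OF hg(1)] unfolding iso_over_def by blast
qed

lemma iso_over_trans [trans]:
 assumes "iso_over P Q" "iso_over Q R" shows "iso_over P R"
proof -
 obtain h g where hg: "odiff (fst P) (fst Q) h g" "\<forall>p\<in>mf_pts (fst P). snd Q (h p) = snd P p"
  using assms(1) unfolding iso_over_def by blast
 obtain h' g' where hg': "odiff (fst Q) (fst R) h' g'" "\<forall>p\<in>mf_pts (fst Q). snd R (h' p) = snd Q p"
  using assms(2) unfolding iso_over_def by blast
 have o: "omanif (fst P)" "omanif (fst Q)" "omanif (fst R)"
  using assms by (auto simp: iso_over_def)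
 show ?thesis
 proof (rule iso_overI[OF o(1,3) odiff_trans[OF o hg(1) hg'(1)]])
  fix p assume p: "p \<in> mf_pts (fst P)"
  hence "h p \<in> mf_pts (fst Q)" using hg(1) by (auto simp: odiff_def dest: omap_pts)
  thus "snd R (h' (h p)) = snd P p" using hg(2) hg'(2) p by simp
 qed
qed

lemma iso_over_omf: "iso_over P Q ==> omf n P \<longleftrightarrow> omf n Q"
 by (auto simp: iso_over_def odiff_def)

lemma omf_osum: "omf n P ==> omf n Q ==> omf n (osum P Q)"
 by (simp add: osum_def omanif_sum mf_sum_simps)

lemma iso_osum:
 assumes "iso_over P P'" "iso_over Q Q'" "omf n P" "omf n Q" shows "iso_over (osum P Q) (osum P' Q')"
proof -
 obtain h g where hg: "odiff (fst P) (fst P') h g" "\<forall>p\<in>mf_pts (fst P). snd P' (h p) = snd P p"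
  using assms(1) unfolding iso_over_def by blast
 obtain h' g' where hg': "odiff (fst Q) (fst Q') h' g'" "\<forall>p\<in>mf_pts (fst Q). snd Q' (h' p) = snd Q p"
  using assms(2) unfolding iso_over_def by blast
 have o: "omf n P'" "omf n Q'" using assms iso_over_omf by blast+
 show ?thesis
  by (rule iso_overI[where h = "map_sum h h'" and g = "map_sum g g'"])
    (use assms o hg hg' omf_osum[OF assms(3,4)] omf_osum[OF o] in
     \<open>auto simp: osum_def mf_sum_simps intro!: odiff_sum\<close>)
qed

lemma iso_osum_comm: "omf n P ==> omf n Q ==> iso_over (osum P Q) (osum Q P)"
 by (rule iso_overI[where h = "case_sum Inr Inl" and g = "case_sum Inr Inl"])
   (auto simp: osum_def omanif_sum odiff_sum_commute mf_sum_simps)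

lemma iso_osum_assoc: "omf n P ==> omf n Q ==> omf n R ==> iso_over (osum (osum P Q) R) (osum P (osum Q R))"
 by (rule iso_overI[where h = "case_sum (case_sum Inl (Inr \<circ> Inl)) (Inr \<circ> Inr)" and g = "case_sum (Inl \<circ> Inl) (case_sum (Inl \<circ> Inr) Inr)"])
   (auto simp: osum_def omanif_sum odiff_sum_assoc mf_sum_simps)

lemma iso_osum_swap:
 assumes "omf n P" "omf n Q" "omf n R" shows "iso_over (osum (osum P Q) R) (osum (osum P R) Q)"
proof -
 have "iso_over (osum (osum P Q) R) (osum P (osum Q R))" by (rule iso_osum_assoc[OF assms])
 also have "iso_over \<dots> (osum P (osum R Q))"
  by (rule iso_osum[OF iso_over_refl iso_osum_comm[OF assms(2,3)],of _ n]) (use assms omf_osum[OF assms(2,3)] in auto)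
 also have "iso_over \<dots> (osum (osum P R) Q)" by (rule iso_over_sym[OF iso_osum_assoc]) (use assms in auto)
 finally show ?thesis .
qed

lemma iso_osum_empty:
 assumes "omf n P" "omf n E" "mf_pts (fst E) = {}" "mf_charts (fst E) = {}" shows "iso_over P (osum P E)"
 by (rule iso_overI[where h = Inl and g = "case_sum (\<lambda>x. x) (\<lambda>_. undefined)"])
   (use assms in "auto simp: osum_def omanif_sum odiff_sum_empty")

lemma omf_obd: "bdm j Y W ==> omf j (obd W)"
 by (simp add: obd_def singular_bordism_def omanif_boundary mf_boundary_simps)

lemma bdm_osum: "bdm j Y P ==> bdm j Y Q ==> bdm j Y (osum P Q)"
 by (simp add: osum_def singular_bordism_def bmanif_sum mf_sum_simps compact_space_coproduct cont_case_sum)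

lemma iso_obd_osum:
 assumes P: "bdm j Y P" and Q: "bdm j Y Q" shows "iso_over (osum (obd P) (obd Q)) (obd (osum P Q))"
proof (rule iso_overI)
 show "omanif (fst (osum (obd P) (obd Q)))" using omf_osum[OF omf_obd[OF P] omf_obd[OF Q]] by blast
 show "omanif (fst (obd (osum P Q)))" using omf_obd[OF bdm_osum[OF P Q]] by blast
 show "odiff (fst (osum (obd P) (obd Q))) (fst (obd (osum P Q))) (\<lambda>x. x) (\<lambda>x. x)"
  using P Q by (simp add: osum_def obd_def odiff_boundary_sum singular_bordism_def)
qed (simp add: osum_def obd_def)

lemma bdm_oempty: "bdm j Y (oempty (Suc j))"
 by (simp add: singular_bordism_def oempty_def oriented_manifold_with_boundary_def manifold_empty)
   (simp add: mf_empty_def)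

lemma obd_oempty: "mf_pts (fst (obd (oempty k))) = {}" "mf_charts (fst (obd (oempty k))) = {}"
 by (simp_all add: obd_def oempty_def mf_boundary_def mf_empty_def)

lemma sing_omf: "sing j Y P ==> omf j P"
 by (simp add: singular_manifold_def closed_oriented_manifold_def)

lemma sing_osum: "sing j Y P ==> sing j Y Q ==> sing j Y (osum P Q)"
 by (simp add: osum_def singular_manifold_def closed_oriented_manifold_def omanif_sum mf_sum_simps
   compact_space_coproduct cont_case_sum)

lemma sing_oempty: "sing j Y (oempty j)"
 by (simp add: singular_manifold_def closed_oriented_manifold_def oempty_def oriented_manifold_def manifold_empty)
   (simp add: mf_empty_def)

subsection \<open>Products and maps\<close>

lemma omf_oprod: "omf n P ==> omf k Q ==> omf (n + k) (oprod m P Q)"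
 by (simp add: oprod_def omanif_prod mf_prod_simps)

lemma iso_oprod:
 assumes "iso_over P P'" "iso_over Q Q'" shows "iso_over (oprod m P Q) (oprod m P' Q')"
proof -
 obtain h g where hg: "odiff (fst P) (fst P') h g" "\<forall>p\<in>mf_pts (fst P). snd P' (h p) = snd P p"
  using assms(1) unfolding iso_over_def by blast
 obtain h' g' where hg': "odiff (fst Q) (fst Q') h' g'" "\<forall>p\<in>mf_pts (fst Q). snd Q' (h' p) = snd Q p"
  using assms(2) unfolding iso_over_def by blast
 have o: "omanif (fst P)" "omanif (fst P')" "omanif (fst Q)" "omanif (fst Q')"
  using assms by (auto simp: iso_over_def)
 show ?thesis
  by (rule iso_overI[where h = "\<lambda>(p,q). (h p,h' q)" and g = "\<lambda>(p,q). (g p,g' q)"])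
    (use o hg hg' in "auto simp: oprod_def mf_prod_simps omanif_prod intro!: odiff_prod")
qed

lemma iso_oprod_osum_left:
 assumes "omf n P" "omf n Q" "omf k R"
 shows "iso_over (osum (oprod m P R) (oprod m Q R)) (oprod m (osum P Q) R)"
proof (rule iso_overI)
 show "odiff (fst (osum (oprod m P R) (oprod m Q R))) (fst (oprod m (osum P Q) R))
  (case_sum (\<lambda>(x,z). (Inl x,z)) (\<lambda>(y,z). (Inr y,z))) (\<lambda>(s,z). case s of Inl x => Inl (x,z) | Inr y => Inr (y,z))"
  using assms by (simp add: osum_def oprod_def odiff_prod_sum_left)
qed (use assms in "auto simp: osum_def oprod_def omanif_sum omanif_prod mf_prod_simps mf_sum_simps")

lemma iso_oprod_assoc:
 assumes "omanif (fst P)" "omanif (fst Q)" "omanif (fst R)"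
  and "!!p q r. p \<in> mf_pts (fst P) ==> q \<in> mf_pts (fst Q) ==> r \<in> mf_pts (fst R) ==>
   m2 (m1 (snd P p,snd Q q),snd R r) = m2' (snd P p,m1' (snd Q q,snd R r))"
 shows "iso_over (oprod m2 (oprod m1 P Q) R) (oprod m2' P (oprod m1' Q R))"
proof (rule iso_overI)
 show "odiff (fst (oprod m2 (oprod m1 P Q) R)) (fst (oprod m2' P (oprod m1' Q R)))
  (\<lambda>((x,y),z). (x,(y,z))) (\<lambda>(x,(y,z)). ((x,y),z))"
  using assms by (simp add: oprod_def odiff_prod_assoc)
qed (use assms in "auto simp: oprod_def omanif_prod mf_prod_simps")

lemma iso_oprod_swap:
 assumes "omf n P" "omf k Q"
  and "!!p q. p \<in> mf_pts (fst P) ==> q \<in> mf_pts (fst Q) ==> m' (snd Q q,snd P p) = m (snd P p,snd Q q)"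
 shows "iso_over (oprod m P Q) (oprod m' Q (mf_sgn (n * k) (fst P),snd P))"
proof (rule iso_overI)
 show "odiff (fst (oprod m P Q)) (fst (oprod m' Q (mf_sgn (n * k) (fst P),snd P))) (\<lambda>(p,q). (q,p)) (\<lambda>(p,q). (q,p))"
  using assms odiff_swap[of "fst P" "fst Q"] by (simp add: oprod_def)
qed (use assms in "auto simp: oprod_def omanif_prod omanif_sgn mf_prod_simps")

lemma bdm_oprod:
 assumes W: "bdm j Y W" and Q: "sing k Z Q" and m: "continuous_map (prod_topology Y Z) T m"
 shows "bdm (j + k) T (oprod m W Q)"
proof -
 have "continuous_map (prod_topology (mf_top (fst W)) (mf_top (fst Q))) (prod_topology Y Z) (\<lambda>(p,q). (snd W p,snd Q q))"
  using W Q by (simp add: continuous_map_prod_top singular_bordism_def singular_manifold_def)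
 from continuous_map_compose[OF this m]
 have "continuous_map (prod_topology (mf_top (fst W)) (mf_top (fst Q))) T (\<lambda>(p,q). m (snd W p,snd Q q))"
  by (simp add: o_def case_prod_unfold)
 thus ?thesis using W Q
  by (simp add: oprod_def singular_bordism_def singular_manifold_def closed_oriented_manifold_def
    bmanif_prod mf_prod_simps compact_space_prod_topology)
qed

lemma sing_oprod:
 assumes P: "sing j Y P" and Q: "sing k Z Q" and m: "continuous_map (prod_topology Y Z) T m"
 shows "sing (j + k) T (oprod m P Q)"
proof -
 have "continuous_map (prod_topology (mf_top (fst P)) (mf_top (fst Q))) (prod_topology Y Z) (\<lambda>(p,q). (snd P p,snd Q q))"
  using P Q by (simp add: continuous_map_prod_top singular_manifold_def)
 from continuous_map_compose[OF this m]
 have "continuous_map (prod_topology (mf_top (fst P)) (mf_top (fst Q))) T (\<lambda>(p,q). m (snd P p,snd Q q))"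
  by (simp add: o_def case_prod_unfold)
 thus ?thesis using P Q
  by (simp add: oprod_def singular_manifold_def closed_oriented_manifold_def
    omanif_prod mf_prod_simps compact_space_prod_topology)
qed

lemma iso_oprod_obd:
 assumes W: "bdm j Y W" and Q: "omf k Q" shows "iso_over (oprod m (obd W) Q) (obd (oprod m W Q))"
proof (rule iso_overI)
 have W': "oriented_manifold_with_boundary (fst W)" using W by (simp add: singular_bordism_def)
 show "odiff (fst (oprod m (obd W) Q)) (fst (obd (oprod m W Q))) (\<lambda>x. x) (\<lambda>x. x)"
  using W' Q by (simp add: oprod_def obd_def odiff_boundary_prod)
 show "omanif (fst (oprod m (obd W) Q))" "omanif (fst (obd (oprod m W Q)))"
  using W' Q by (auto simp: oprod_def obd_def omanif_prod omanif_boundary bmanif_prod)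
qed (simp add: oprod_def obd_def)

subsection \<open>Bordism is an equivalence relation\<close>

text \<open>Bordisms and the members of bordism classes have their points in \<open>pts\<close>,
  while sums, products and cylinders have them in other types. An injection into \<open>pts\<close>
  brings them back.\<close>

definition embeds :: "'a itself => bool"
 where "embeds _ \<longleftrightarrow> (\<exists>e :: 'a => pts. inj e)"

lemma emb_pts [simp]: "embeds TYPE(pts)"
 unfolding embeds_def by (rule exI[of _ "\<lambda>x. x"]) simp

lemma embeds_real [simp]: "embeds TYPE(real)"
 unfolding embeds_def by (rule exI[of _ "\<lambda>x _. x"]) (auto simp: inj_def fun_eq_iff)

text \<open>A leading entry 0 or 1 records the summand.\<close>

lemma embeds_sum [simp]:
 assumes "embeds TYPE('a)" "embeds TYPE('b)" shows "embeds TYPE('a + 'b)"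
proof -
 obtain e :: "'a => pts" and e' :: "'b => pts" where e: "inj e" "inj e'" using assms unfolding embeds_def by blast
 let ?f = "case_sum (\<lambda>x. case_nat 0 (e x)) (\<lambda>y. case_nat 1 (e' y)) :: 'a + 'b => pts"
 have cn: "case_nat a f = case_nat b g \<longleftrightarrow> a = b \<and> f = g" for a b :: real and f g
  by (auto simp: fun_eq_iff split: nat.splits)
 have "inj ?f"
 proof (rule injI)
  fix x y assume "?f x = ?f y"
  thus "x = y" using e by (cases x; cases y) (auto simp: cn dest: injD)
 qed
 thus ?thesis unfolding embeds_def by blast
qed

text \<open>The two sequences are interleaved at even and odd places.\<close>

lemma embeds_prod [simp]:
 assumes "embeds TYPE('a)" "embeds TYPE('b)" shows "embeds TYPE('a \<times> 'b)"
proof -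
 obtain e :: "'a => pts" and e' :: "'b => pts" where e: "inj e" "inj e'" using assms unfolding embeds_def by blast
 let ?f = "\<lambda>(x,y) n. if even n then e x (n div 2) else e' y (n div 2)"
 have "inj ?f"
 proof (rule injI,clarify)
  fix x y x' y' assume A: "(\<lambda>n. if even n then e x (n div 2) else e' y (n div 2)) = (\<lambda>n. if even n then e x' (n div 2) else e' y' (n div 2))"
  have "e x k = e x' k" for k using fun_cong[OF A,of "2 * k"] by simp
  hence 1: "e x = e x'" by (rule ext)
  have "e' y k = e' y' k" for k using fun_cong[OF A,of "Suc (2 * k)"] by simp
  hence 2: "e' y = e' y'" by (rule ext)
  show "x = x' \<and> y = y'" using injD[OF e(1) 1] injD[OF e(2) 2] by simp
 qed
 thus ?thesis unfolding embeds_def by blast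
qed

section \<open>Transport to the fixed type of points, and the laws of the bordism relation\<close>

definition oimage :: "('a => 'b) => ('a,'y) over => ('b,'y) over"
 where "oimage e P = (mf_image e (fst P),snd P \<circ> inv_into UNIV e)"

lemma bdm_oimage: "inj e ==> bdm j Y W ==> bdm j Y (oimage e W)"
 by (auto simp: oimage_def singular_bordism_def bmanif_image compact_space_image mf_image_simps
   intro: continuous_map_compose cont_inv_img_topology compact_space_image[unfolded mf_image_simps])

lemma sing_oimage: "inj e ==> sing j Y P ==> sing j Y (oimage e P)"
 by (auto simp: oimage_def singular_manifold_def closed_oriented_manifold_def omanif_image mf_image_simps
   intro: continuous_map_compose cont_inv_img_topology compact_space_image[unfolded mf_image_simps])

lemma iso_oimage: "inj e ==> omf n P ==> iso_over P (oimage e P)"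
 by (rule iso_overI[where h = e and g = "inv_into UNIV e"])
   (auto simp: oimage_def omanif_image odiff_image)

lemma iso_obd_oimage: "inj e ==> bdm j Y W ==> iso_over (obd W) (obd (oimage e W))"
 by (rule iso_overI[where h = e and g = "inv_into UNIV e"])
   (auto simp: oimage_def obd_def singular_bordism_def omanif_boundary bmanif_image odiff_boundary_image)

text \<open>Bordisms may have their points in any types that embed into \<open>pts\<close>, because
  transport along an injection commutes with taking boundaries.\<close>

lemma bordI:
 fixes P :: "('a,'y) over" and P' :: "('b,'y) over" and W :: "('c,'y) over" and W' :: "('d,'y) over"
 assumes emb: "embeds TYPE('c)" "embeds TYPE('d)" and W: "bdm j Y W" and W': "bdm j Y W'"
  and P: "omf j P" and P': "omf j P'" and iso: "iso_over (osum P (obd W)) (osum P' (obd W'))"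
 shows "bord j Y P P'"
proof -
 obtain e :: "'c => pts" and e' :: "'d => pts" where e: "inj e" "inj e'" using emb unfolding embeds_def by blast
 have "iso_over (osum P (obd (oimage e W))) (osum P (obd W))"
  by (rule iso_osum[OF iso_over_refl iso_over_sym[OF iso_obd_oimage[OF e(1) W]],of _ j])
    (use P omf_obd[OF bdm_oimage[OF e(1) W]] in auto)
 also note iso
 also have "iso_over (osum P' (obd W')) (osum P' (obd (oimage e' W')))"
  by (rule iso_osum[OF iso_over_refl iso_obd_oimage[OF e(2) W'],of _ j]) (use P' omf_obd[OF W'] in auto)
 finally have I: "iso_over (osum P (obd (oimage e W))) (osum P' (obd (oimage e' W')))" .
 then obtain h g where hg: "odiff (fst (osum P (obd (oimage e W)))) (fst (osum P' (obd (oimage e' W')))) h g"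
  "\<forall>p\<in>mf_pts (fst (osum P (obd (oimage e W)))). snd (osum P' (obd (oimage e' W'))) (h p) = snd (osum P (obd (oimage e W))) p"
  unfolding iso_over_def by blast
 have d: "oriented_diffeo (fst (osum P (obd (oimage e W)))) (fst (osum P' (obd (oimage e' W')))) h"
  by (rule odiff_imp_oriented_diffeo[OF _ _ hg(1)]) (use I in "auto simp: iso_over_def")
 show ?thesis unfolding bordant_def
  by (rule exI[of _ "fst (oimage e W)"],rule exI[of _ "snd (oimage e W)"],rule exI[of _ "fst (oimage e' W')"],
    rule exI[of _ "snd (oimage e' W')"],rule exI[of _ h])
    (use bdm_oimage[OF e(1) W] bdm_oimage[OF e(2) W'] d hg(2) in "simp add: osum_def obd_def")
qed

lemma bordE:
 fixes P :: "('a,'y) over" and P' :: "('b,'y) over"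
 assumes b: "bord j Y P P'" and P: "omf j P" and P': "omf j P'"
 obtains W W' :: "(pts,'y) over" where "bdm j Y W" "bdm j Y W'" "iso_over (osum P (obd W)) (osum P' (obd W'))"
proof -
 obtain W F W' F' h where w: "singular_bordism j Y (W :: pts omanifold) F" "singular_bordism j Y (W' :: pts omanifold) F'"
  "oriented_diffeo (mf_sum (fst P) (mf_boundary W)) (mf_sum (fst P') (mf_boundary W')) h"
  "\<forall>p\<in>mf_pts (mf_sum (fst P) (mf_boundary W)). case_sum (snd P') F' (h p) = case_sum (snd P) F p"
  using b unfolding bordant_def by blast
 have o: "omf j (osum P (obd (W,F)))" "omf j (osum P' (obd (W',F')))"
  using omf_osum[OF P omf_obd[of j Y "(W,F)"]] omf_osum[OF P' omf_obd[of j Y "(W',F')"]] w(1,2) by auto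
 hence "omanif (mf_sum (fst P) (mf_boundary W))" "omanif (mf_sum (fst P') (mf_boundary W'))"
  by (auto simp: osum_def obd_def)
 from oriented_diffeo_imp_odiff[OF this w(3)] obtain g
  where g: "odiff (mf_sum (fst P) (mf_boundary W)) (mf_sum (fst P') (mf_boundary W')) h g" .
 have "iso_over (osum P (obd (W,F))) (osum P' (obd (W',F')))"
  by (rule iso_overI[where h = h and g = g]) (use o g w(4) in "auto simp: osum_def obd_def")
 thus ?thesis using that[of "(W,F)" "(W',F')"] w(1,2) by simp
qed

text \<open>With the empty bordism on both sides only an empty summand is added.\<close>

lemma iso_imp_bord:
 fixes P :: "('a,'y) over" and P' :: "('b,'y) over"
 assumes I: "iso_over P P'" and P: "omf j P" shows "bord j Y P P'"
proof -
 let ?E = "oempty (Suc j) :: (pts,'y) over"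
 have P': "omf j P'" using iso_over_omf[OF I] P by blast
 have E: "omf j (obd ?E)" by (rule omf_obd[OF bdm_oempty])
 show ?thesis
  by (rule bordI[OF emb_pts emb_pts bdm_oempty bdm_oempty P P' iso_osum[OF I iso_over_refl P E]])
    (use E in blast)
qed

lemma bord_sym:
 assumes "bord j Y P P'" "omf j P" "omf j P'" shows "bord j Y P' P"
 using bordE[OF assms] bordI[OF emb_pts emb_pts _ _ assms(3,2) iso_over_sym] by metis

text \<open>Adding \<open>\<partial>V\<close> to the first isomorphism and
  \<open>\<partial>W'\<close> to the second gives \<open>P + \<partial>W + \<partial>V = P' +
  \<partial>W' + \<partial>V = P'' + \<partial>V' + \<partial>W'\<close>, and a sum of boundaries is
  the boundary of the sum.\<close>

lemma bord_trans:
 fixes P :: "('a,'y) over" and P' :: "('b,'y) over" and P'' :: "('c,'y) over"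
 assumes 1: "bord j Y P P'" and 2: "bord j Y P' P''" and P: "omf j P" "omf j P'" "omf j P''"
 shows "bord j Y P P''"
proof -
 obtain W W' :: "(pts,'y) over" where w: "bdm j Y W" "bdm j Y W'" "iso_over (osum P (obd W)) (osum P' (obd W'))"
  by (rule bordE[OF 1 P(1,2)])
 obtain V V' :: "(pts,'y) over" where v: "bdm j Y V" "bdm j Y V'" "iso_over (osum P' (obd V)) (osum P'' (obd V'))"
  by (rule bordE[OF 2 P(2,3)])
 note o = omf_obd[OF w(1)] omf_obd[OF w(2)] omf_obd[OF v(1)] omf_obd[OF v(2)]
 have "iso_over (osum P (obd (osum W V))) (osum P (osum (obd W) (obd V)))"
  by (rule iso_osum[OF iso_over_refl iso_over_sym[OF iso_obd_osum[OF w(1) v(1)]] P(1) omf_obd[OF bdm_osum[OF w(1) v(1)]]])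
    (use P in auto)
 also have "iso_over \<dots> (osum (osum P (obd W)) (obd V))" by (rule iso_over_sym[OF iso_osum_assoc[OF P(1) o(1,3)]])
 also have "iso_over \<dots> (osum (osum P' (obd W')) (obd V))"
  by (rule iso_osum[OF w(3) iso_over_refl omf_osum[OF P(1) o(1)] o(3)]) (use o in auto)
 also have "iso_over \<dots> (osum (osum P' (obd V)) (obd W'))" by (rule iso_osum_swap[OF P(2) o(2,3)])
 also have "iso_over \<dots> (osum (osum P'' (obd V')) (obd W'))"
  by (rule iso_osum[OF v(3) iso_over_refl omf_osum[OF P(2) o(3)] o(2)]) (use o in auto)
 also have "iso_over \<dots> (osum P'' (osum (obd V') (obd W')))" by (rule iso_osum_assoc[OF P(3) o(4,2)])
 also have "iso_over \<dots> (osum P'' (obd (osum V' W')))"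
  by (rule iso_osum[OF iso_over_refl iso_obd_osum[OF v(2) w(2)] P(3) omf_osum[OF o(4,2)]]) (use P in auto)
 finally show ?thesis by (rule bordI[rotated -1]) (use w v P bdm_osum[OF w(1) v(1)] bdm_osum[OF v(2) w(2)] in auto)
qed

text \<open>One summand is changed at a time; the second one is brought to the front by
  commutativity.\<close>

lemma bord_osum:
 fixes P :: "('a,'y) over" and P' :: "('b,'y) over" and Q :: "('c,'y) over" and Q' :: "('d,'y) over"
 assumes 1: "bord j Y P P'" and 2: "bord j Y Q Q'" and P: "omf j P" "omf j P'" and Q: "omf j Q" "omf j Q'"
 shows "bord j Y (osum P Q) (osum P' Q')"
proof -
 have *: "bord j Y (osum P Q) (osum P' Q)" if b: "bord j Y P P'" and P: "omf j P" "omf j P'" and Q: "omf j Q"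
  for P :: "('e,'y) over" and P' :: "('f,'y) over" and Q :: "('g,'y) over"
 proof -
  obtain W W' :: "(pts,'y) over" where w: "bdm j Y W" "bdm j Y W'" "iso_over (osum P (obd W)) (osum P' (obd W'))"
   by (rule bordE[OF b P(1,2)])
  note o = omf_obd[OF w(1)] omf_obd[OF w(2)]
  have "iso_over (osum (osum P Q) (obd W)) (osum (osum P (obd W)) Q)" by (rule iso_osum_swap[OF P(1) Q o(1)])
  also have "iso_over \<dots> (osum (osum P' (obd W')) Q)"
   by (rule iso_osum[OF w(3) iso_over_refl omf_osum[OF P(1) o(1)] Q]) (use Q in auto)
  also have "iso_over \<dots> (osum (osum P' Q) (obd W'))" by (rule iso_osum_swap[OF P(2) o(2) Q])
  finally show ?thesis by (rule bordI[rotated -1]) (use w omf_osum[OF P(1) Q] omf_osum[OF P(2) Q] in auto)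
 qed
 have c: "bord j Y (osum P' Q) (osum Q P')" "bord j Y (osum Q' P') (osum P' Q')"
  using iso_imp_bord[OF iso_osum_comm[OF P(2) Q(1)]] iso_imp_bord[OF iso_osum_comm[OF Q(2) P(2)]] omf_osum P Q by blast+
 have o: "omf j (osum P Q)" "omf j (osum P' Q)" "omf j (osum Q P')" "omf j (osum Q' P')" "omf j (osum P' Q')"
  using omf_osum P Q by blast+
 show ?thesis
  by (rule bord_trans[OF bord_trans[OF bord_trans[OF *[OF 1 P Q(1)] c(1)] *[OF 2 Q P(2)]] c(2)]) (use o in auto)
qed

text \<open>Since \<open>Q\<close> has no boundary, the product of \<open>W\<close> and
  \<open>Q\<close> is a bordism whose boundary is the product of \<open>\<partial>W\<close> and
  \<open>Q\<close>. Distributivity over sums in the left factor does the rest.\<close>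

lemma bord_oprod_left:
 fixes P :: "('a,'y) over" and P' :: "('b,'y) over" and Q :: "('c,'z) over"
 assumes emb: "embeds TYPE('c)" and b: "bord j Y P P'" and P: "omf j P" "omf j P'" and Q: "sing k Z Q" and m: "continuous_map (prod_topology Y Z) T m"
 shows "bord (j + k) T (oprod m P Q) (oprod m P' Q)"
proof -
 obtain W W' :: "(pts,'y) over" where w: "bdm j Y W" "bdm j Y W'" "iso_over (osum P (obd W)) (osum P' (obd W'))"
  by (rule bordE[OF b P])
 note o = omf_obd[OF w(1)] omf_obd[OF w(2)] and q = sing_omf[OF Q]
 have half: "iso_over (osum (oprod m P Q) (obd (oprod m W Q))) (oprod m (osum P (obd W)) Q)"
  if P: "omf j P" and w: "bdm j Y W" for P :: "('e,'y) over" and W :: "(pts,'y) over"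
 proof -
  note o = omf_obd[OF w]
  have "iso_over (osum (oprod m P Q) (obd (oprod m W Q))) (osum (oprod m P Q) (oprod m (obd W) Q))"
   by (rule iso_osum[OF iso_over_refl iso_over_sym[OF iso_oprod_obd[OF w q]] omf_oprod[OF P q] omf_obd[OF bdm_oprod[OF w Q m]]])
     (use omf_oprod[OF P q] in blast)
  also have "iso_over \<dots> (oprod m (osum P (obd W)) Q)" by (rule iso_oprod_osum_left[OF P o q])
  finally show ?thesis .
 qed
 have "iso_over (oprod m (osum P (obd W)) Q) (oprod m (osum P' (obd W')) Q)"
  by (rule iso_oprod[OF w(3) iso_over_refl]) (use q in blast)
 hence "iso_over (osum (oprod m P Q) (obd (oprod m W Q))) (osum (oprod m P' Q) (obd (oprod m W' Q)))"
  by (rule iso_over_trans[OF half[OF P(1) w(1)] iso_over_trans[OF _ iso_over_sym[OF half[OF P(2) w(2)]]]])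
 thus ?thesis
 proof (rule bordI[rotated -1])
  show "bdm (j + k) T (oprod m W Q)" "bdm (j + k) T (oprod m W' Q)" by (rule bdm_oprod[OF _ Q m],rule w)+
  show "omf (j + k) (oprod m P Q)" "omf (j + k) (oprod m P' Q)" using omf_oprod P q by blast+
  show "embeds TYPE(pts \<times> 'c)" "embeds TYPE(pts \<times> 'c)" using emb by simp_all
 qed
qed

lemma bord_push:
 fixes P :: "('a,'y) over" and P' :: "('b,'y) over"
 assumes b: "bord j Y P P'" and P: "omf j P" "omf j P'" and h: "continuous_map Y Z h"
 shows "bord j Z (fst P,h \<circ> snd P) (fst P',h \<circ> snd P')"
proof -
 obtain W W' :: "(pts,'y) over" where w: "bdm j Y W" "bdm j Y W'" "iso_over (osum P (obd W)) (osum P' (obd W'))"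
  by (rule bordE[OF b P])
 have cs: "case_sum (h \<circ> f) (h \<circ> g) z = h (case_sum f g z)" for f g and z :: "'e + 'f" by (cases z) auto
 have "iso_over (osum (fst P,h \<circ> snd P) (obd (fst W,h \<circ> snd W))) (osum (fst P',h \<circ> snd P') (obd (fst W',h \<circ> snd W')))"
  using w(3) unfolding iso_over_def osum_def obd_def fst_conv snd_conv cs by metis
 thus ?thesis
  by (rule bordI[rotated -1]) (use w P h in "auto simp: singular_bordism_def intro: continuous_map_compose")
qed

subsection \<open>Bordism classes and their addition\<close>

lemma mem_cls: "Q \<in> cls j Y P \<longleftrightarrow> sing j Y Q \<and> bord j Y P Q"
 by (cases Q) (simp add: bclass_def)

lemma cls_cong:
 fixes P :: "('a,'y) over" and P' :: "('b,'y) over"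
 assumes b: "bord j Y P P'" and P: "sing j Y P" "sing j Y P'" shows "cls j Y P = cls j Y P'"
proof (rule Set.set_eqI)
 fix Q :: "(pts,'y) over"
 note o = sing_omf[OF P(1)] sing_omf[OF P(2)]
 show "Q \<in> cls j Y P \<longleftrightarrow> Q \<in> cls j Y P'"
  unfolding mem_cls
  using bord_trans[OF b _ o] bord_trans[OF bord_sym[OF b o] _ o(2,1)] sing_omf[of j Y Q] by blast
qed

lemma cls_iso: "iso_over P P' ==> sing j Y P ==> sing j Y P' ==> cls j Y P = cls j Y P'"
 using cls_cong iso_imp_bord sing_omf by metis

text \<open>Transport along an injection into \<open>pts\<close> gives a diffeomorphic
  representative that can be a member of the class.\<close>

lemma cls_rep:
 fixes P :: "('a,'y) over"
 assumes emb: "embeds TYPE('a)" and P: "sing j Y P"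
 obtains Q :: "(pts,'y) over" where "Q \<in> cls j Y P" "sing j Y Q" "bord j Y P Q" "cls j Y Q = cls j Y P"
proof -
 obtain e :: "'a => pts" where e: "inj e" using emb unfolding embeds_def by blast
 let ?Q = "oimage e P"
 have Q: "sing j Y ?Q" using sing_oimage[OF e P] .
 have b: "bord j Y P ?Q" by (rule iso_imp_bord[OF iso_oimage[OF e sing_omf[OF P]] sing_omf[OF P]])
 show ?thesis by (rule that[of ?Q]) (use Q b cls_cong[OF b P Q] in "auto simp: mem_cls")
qed

text \<open>Operations on classes are unions over representatives. Equal values make up that value
  only if there is a representative at all, and the embedding into \<open>pts\<close> provides
  one.\<close>

lemma UN_cls:
 fixes P :: "('a,'y) over"
 assumes emb: "embeds TYPE('a)" and P: "sing j Y P"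
  and G: "!!Q :: (pts,'y) over. sing j Y Q ==> bord j Y P Q ==> G Q = c"
 shows "(\<Union>Q\<in>cls j Y P. G Q) = c"
proof -
 obtain Q :: "(pts,'y) over" where Q: "Q \<in> cls j Y P" by (rule cls_rep[OF emb P])
 have "G Q' = c" if "Q' \<in> cls j Y P" for Q' using that G unfolding mem_cls by blast
 thus ?thesis using Q by auto
qed

lemma cls_mem:
 fixes P :: "('a,'y) over"
 assumes emb: "embeds TYPE('a)" and P: "sing j Y P" shows "cls j Y P \<in> Om j Y"
proof -
 obtain Q :: "(pts,'y) over" where Q: "sing j Y Q" "cls j Y Q = cls j Y P" by (rule cls_rep[OF emb P])
 have "cls j Y Q \<in> Om j Y" unfolding bordism_group_def using Q(1) by auto
 thus ?thesis using Q(2) by simp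
qed

lemma bordismE:
 assumes "\<omega> \<in> Om j Y"
 obtains P :: "(pts,'y) over" where "sing j Y P" "\<omega> = cls j Y P"
proof -
 obtain V :: "pts omanifold" and f where "singular_manifold j Y V f" "\<omega> = bclass j Y V f"
  using assms unfolding bordism_group_def by auto
 thus ?thesis using that[of "(V,f)"] by simp
qed

lemma bordism_mult:
 fixes P :: "('a,'y) over" and Q :: "('b,'y) over"
 assumes emb: "embeds TYPE('a)" "embeds TYPE('b)" and P: "sing j Y P" and Q: "sing j Y Q"
 shows "cls j Y P \<otimes>\<^bsub>bordism_group j Y\<^esub> cls j Y Q = cls j Y (osum P Q)"
proof -
 have "cls j Y P \<otimes>\<^bsub>bordism_group j Y\<^esub> cls j Y Q = (\<Union>P'\<in>cls j Y P. \<Union>Q'\<in>cls j Y Q. cls j Y (osum P' Q'))"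
  by (simp add: bordism_group_def osum_def case_prod_unfold)
 also have "\<dots> = cls j Y (osum P Q)"
 proof (rule UN_cls[OF emb(1) P])
  fix P' :: "(pts,'y) over" assume P': "sing j Y P'" "bord j Y P P'"
  show "(\<Union>Q'\<in>cls j Y Q. cls j Y (osum P' Q')) = cls j Y (osum P Q)"
  proof (rule UN_cls[OF emb(2) Q])
   fix Q' :: "(pts,'y) over" assume Q': "sing j Y Q'" "bord j Y Q Q'"
   have b: "bord j Y (osum P Q) (osum P' Q')"
    by (rule bord_osum[OF P'(2) Q'(2)]) (use P P'(1) Q Q'(1) sing_omf in blast)+
   show "cls j Y (osum P' Q') = cls j Y (osum P Q)"
    by (rule cls_cong[OF b sing_osum[OF P Q] sing_osum[OF P'(1) Q'(1)],symmetric])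
  qed
 qed
 finally show ?thesis .
qed

lemma bordism_closed:
 assumes "a \<in> Om j Y" "b \<in> Om j Y"
 shows "a \<otimes>\<^bsub>bordism_group j Y\<^esub> b \<in> Om j Y"
proof -
 obtain P :: "(pts,'a) over" where P: "sing j Y P" "a = cls j Y P" by (rule bordismE[OF assms(1)])
 obtain Q :: "(pts,'a) over" where Q: "sing j Y Q" "b = cls j Y Q" by (rule bordismE[OF assms(2)])
 show ?thesis unfolding P(2) Q(2) bordism_mult[OF emb_pts emb_pts P(1) Q(1)]
  by (rule cls_mem[OF _ sing_osum[OF P(1) Q(1)]]) simp
qed

lemma bordism_one: "\<one>\<^bsub>bordism_group j Y\<^esub> = cls j Y (oempty j :: (pts,'y) over)"
 by (simp add: bordism_group_def oempty_def)

lemma oempty_pts: "mf_pts (fst (oempty j)) = {}" "mf_charts (fst (oempty j)) = {}"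
 by (simp_all add: oempty_def mf_empty_def)

lemma bordism_mult_one:
 assumes "a \<in> Om j Y" shows "a \<otimes>\<^bsub>bordism_group j Y\<^esub> \<one>\<^bsub>bordism_group j Y\<^esub> = a"
proof -
 obtain P :: "(pts,'a) over" where P: "sing j Y P" "a = cls j Y P" by (rule bordismE[OF assms])
 let ?E = "oempty j :: (pts,'a) over"
 have "cls j Y P \<otimes>\<^bsub>bordism_group j Y\<^esub> cls j Y ?E = cls j Y (osum P ?E)"
  by (rule bordism_mult[OF emb_pts emb_pts P(1) sing_oempty])
 also have "\<dots> = cls j Y P"
  by (rule cls_iso[OF iso_osum_empty[OF sing_omf[OF P(1)] sing_omf[OF sing_oempty] oempty_pts] P(1) sing_osum[OF P(1) sing_oempty],symmetric])
 finally show ?thesis by (simp add: P(2) bordism_one)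
qed

lemma bordism_one_in_carrier: "\<one>\<^bsub>bordism_group j Y\<^esub> \<in> Om j Y"
 unfolding bordism_one by (rule cls_mem[OF emb_pts sing_oempty])

section \<open>Inverses of bordism classes\<close>

definition oneg :: "('a,'y) over => ('a,'y) over"
 where "oneg P = (mf_neg (fst P),snd P)"

lemma sing_oneg: "sing j Y P ==> sing j Y (oneg P)"
 by (simp add: oneg_def singular_manifold_def closed_oriented_manifold_def omanif_neg mf_neg_simps)

lemma bdm_cylinder: "sing j Y P ==> bdm j Y (mf_prod mf_unit (fst P),\<lambda>z. snd P (snd z))"
 using continuous_map_compose[OF continuous_map_snd,of "mf_top (fst P)" Y "snd P" "mf_top mf_unit"]
 by (simp add: singular_bordism_def singular_manifold_def closed_oriented_manifold_def bmanif_prod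
   unit_manifold mf_prod_simps compact_space_prod_topology compact_mf_unit o_def)
   (simp add: mf_unit_def)

text \<open>The boundary of the cylinder \<open>W\<close> on \<open>P\<close> is \<open>P\<close>
  together with its reverse. Hence \<open>P + (- P)\<close> plus an empty boundary is isomorphic to
  the empty manifold plus \<open>\<partial>W\<close>.\<close>

lemma bordism_mult_neg:
 fixes P :: "('a,'y) over"
 assumes emb: "embeds TYPE('a)" and P: "sing j Y P"
 shows "cls j Y P \<otimes>\<^bsub>bordism_group j Y\<^esub> cls j Y (oneg P) = \<one>\<^bsub>bordism_group j Y\<^esub>"
proof -
 let ?E = "oempty j :: (pts,'y) over" and ?E' = "oempty (Suc j) :: (pts,'y) over"
 let ?W = "(mf_prod mf_unit (fst P),\<lambda>z. snd P (snd z)) :: (real \<times> 'a,'y) over"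
 let ?X = "osum P (oneg P)"
 have W: "bdm j Y ?W" by (rule bdm_cylinder[OF P])
 have X: "sing j Y ?X" by (rule sing_osum[OF P sing_oneg[OF P]])
 note oX = sing_omf[OF X] and oE = sing_omf[OF sing_oempty] and oW = omf_obd[OF W] and oE' = omf_obd[OF bdm_oempty]
 have "iso_over (osum ?X (obd ?E')) ?X"
  by (rule iso_over_sym[OF iso_osum_empty[OF oX oE' obd_oempty]])
 also have "iso_over \<dots> (obd ?W)"
 proof (rule iso_overI)
  show "odiff (fst ?X) (fst (obd ?W)) (case_sum (Pair 1) (Pair 0)) (\<lambda>(t,v). if t = 1 then Inl v else Inr v)"
   using sing_omf[OF P] by (simp add: osum_def oneg_def obd_def odiff_double_boundary)
 qed (use oX oW in "auto simp: osum_def oneg_def obd_def split: sum.split")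
 also have "iso_over \<dots> (osum (obd ?W) ?E)" by (rule iso_osum_empty[OF oW oE oempty_pts])
 also have "iso_over \<dots> (osum ?E (obd ?W))" by (rule iso_osum_comm[OF oW oE])
 finally have "bord j Y ?X ?E"
  by (rule bordI[OF emb_pts _ bdm_oempty W oX oE,rotated]) (simp add: emb)
 thus ?thesis unfolding bordism_mult[OF emb emb P sing_oneg[OF P]] bordism_one
  by (rule cls_cong[OF _ X sing_oempty])
qed

lemma sing_push: "sing j Y P ==> continuous_map Y Z h ==> sing j Z (fst P,h \<circ> snd P)"
 by (auto simp: singular_manifold_def intro: continuous_map_compose)

lemma bpush_cls:
 fixes P :: "('a,'y) over"
 assumes emb: "embeds TYPE('a)" and P: "sing j Y P" and h: "continuous_map Y Z h"
 shows "bordism_push j Z h (cls j Y P) = cls j Z (fst P,h \<circ> snd P)"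
proof -
 have "bordism_push j Z h (cls j Y P) = (\<Union>Q\<in>cls j Y P. cls j Z (fst Q,h \<circ> snd Q))"
  by (simp add: bordism_push_def case_prod_unfold)
 also have "\<dots> = cls j Z (fst P,h \<circ> snd P)"
 proof (rule UN_cls[OF emb P])
  fix Q :: "(pts,'y) over" assume Q: "sing j Y Q" "bord j Y P Q"
  show "cls j Z (fst Q,h \<circ> snd Q) = cls j Z (fst P,h \<circ> snd P)"
   by (rule cls_cong[OF bord_push[OF Q(2) sing_omf[OF P] sing_omf[OF Q(1)] h] sing_push[OF P h] sing_push[OF Q(1) h],symmetric])
 qed
 finally show ?thesis .
qed

text \<open>The map of a representative is a total function, but only its values on the points of
  the manifold matter for the class.\<close>

lemma cls_cong_map:
 assumes P: "sing j Y P" and eq: "!!p. p \<in> mf_pts (fst P) ==> g p = snd P p"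
 shows "sing j Y (fst P,g)" "cls j Y (fst P,g) = cls j Y P"
proof -
 show s: "sing j Y (fst P,g)"
  using P eq continuous_map_eq[of "mf_top (fst P)" Y "snd P" g] by (auto simp: singular_manifold_def)
 have "iso_over P (fst P,g)"
  by (rule iso_overI[where h = "\<lambda>x. x" and g = "\<lambda>x. x"])
    (use sing_omf[OF P] eq in "auto simp: oriented_manifold_def intro: odiff_id")
 thus "cls j Y (fst P,g) = cls j Y P" using cls_iso[OF _ P s] by simp
qed

subsection \<open>Products of bordism classes\<close>

definition bprod ::
  "nat => nat => 't topology => ('y \<times> 'z => 't) => 'y bordism_class => 'z bordism_class => 't bordism_class"
 where "bprod j k T m \<omega>1 \<omega>2 = (\<Union>P\<in>\<omega>1. \<Union>Q\<in>\<omega>2. cls (j + k) T (oprod m P Q))"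

lemma sing_sgn: "sing j Y P ==> sing j Y (mf_sgn k (fst P),snd P)"
 by (simp add: singular_manifold_def closed_oriented_manifold_def omanif_sgn mf_sgn_simps)

lemma cont_swap: "continuous_map (prod_topology Y Z) T m ==> continuous_map (prod_topology Z Y) T (\<lambda>(z,y). m (y,z))"
 using continuous_map_compose[of "prod_topology Z Y" "prod_topology Y Z" "\<lambda>(z,y). (y,z)" T m]
 by (auto simp: case_prod_unfold o_def intro: continuous_intros)

text \<open>The left factor is replaced directly. To replace the right one, the factors are
  interchanged, the factor now on the left is replaced, and the factors are interchanged back; both
  interchanges put the same sign on \<open>P'\<close>, so that it disappears at the end.\<close>

lemma bord_oprod:
 fixes P :: "('a,'y) over" and P' :: "('b,'y) over" and Q :: "('c,'z) over" and Q' :: "('d,'z) over"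
 assumes emb: "embeds TYPE('b)" "embeds TYPE('c)"
  and m: "continuous_map (prod_topology Y Z) T m" and b: "bord j Y P P'" "bord k Z Q Q'"
  and P: "sing j Y P" "sing j Y P'" and Q: "sing k Z Q" "sing k Z Q'"
 shows "bord (j + k) T (oprod m P Q) (oprod m P' Q')"
proof -
 let ?m = "\<lambda>(z,y). m (y,z)" and ?P' = "(mf_sgn (j * k) (fst P'),snd P')"
 note oP = sing_omf[OF P(1)] sing_omf[OF P(2)] and oQ = sing_omf[OF Q(1)] sing_omf[OF Q(2)]
 note P'' = sing_sgn[OF P(2),of "j * k"] note oP'' = sing_omf[OF P'']
 have o: "omf (j + k) (oprod m P Q)" "omf (j + k) (oprod m P' Q)" "omf (j + k) (oprod m P' Q')"
  using omf_oprod oP oQ by blast+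
 have o': "omf (j + k) (oprod ?m Q ?P')" "omf (j + k) (oprod ?m Q' ?P')"
  using omf_oprod[OF oQ(1) oP''] omf_oprod[OF oQ(2) oP''] by (simp_all only: add.commute)
 have 1: "bord (j + k) T (oprod m P Q) (oprod m P' Q)"
  by (rule bord_oprod_left[OF emb(2) b(1) oP Q(1) m])
 have 2: "bord (j + k) T (oprod m P' Q) (oprod ?m Q ?P')"
  by (rule iso_imp_bord[OF iso_oprod_swap[OF oP(2) oQ(1)] o(2)]) simp
 have 3: "bord (j + k) T (oprod ?m Q ?P') (oprod ?m Q' ?P')"
  using bord_oprod_left[OF emb(1) b(2) oQ P'' cont_swap[OF m]] by (simp only: add.commute)
 have 4: "bord (j + k) T (oprod ?m Q' ?P') (oprod m P' Q')"
  by (rule bord_sym[OF iso_imp_bord[OF iso_oprod_swap[OF oP(2) oQ(2)] o(3)] o(3) o'(2)]) simp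
 show ?thesis
  by (rule bord_trans[OF 1 bord_trans[OF 2 bord_trans[OF 3 4 o' o(3)] o(2) o'(1) o(3)] o])
qed

lemma bprod_cls:
 fixes P :: "('a,'y) over" and Q :: "('b,'z) over"
 assumes emb: "embeds TYPE('a)" "embeds TYPE('b)"
  and m: "continuous_map (prod_topology Y Z) T m" and P: "sing j Y P" and Q: "sing k Z Q"
 shows "bprod j k T m (cls j Y P) (cls k Z Q) = cls (j + k) T (oprod m P Q)"
 unfolding bprod_def
proof (rule UN_cls[OF emb(1) P])
 fix P' :: "(pts,'y) over" assume P': "sing j Y P'" "bord j Y P P'"
 show "(\<Union>Q\<in>cls k Z Q. cls (j + k) T (oprod m P' Q)) = cls (j + k) T (oprod m P Q)"
 proof (rule UN_cls[OF emb(2) Q])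
  fix Q' :: "(pts,'z) over" assume Q': "sing k Z Q'" "bord k Z Q Q'"
  show "cls (j + k) T (oprod m P' Q') = cls (j + k) T (oprod m P Q)"
   by (rule cls_cong[OF bord_oprod[OF emb_pts emb(2) m P'(2) Q'(2) P P'(1) Q Q'(1)]
      sing_oprod[OF P Q m] sing_oprod[OF P'(1) Q'(1) m],symmetric])
 qed
qed

lemma bprod_closed:
 assumes m: "continuous_map (prod_topology Y Z) T m"
  and a: "a \<in> Om j Y" and b: "b \<in> Om k Z"
 shows "bprod j k T m a b \<in> (Om (j + k) T)"
proof -
 obtain P :: "(pts,'a) over" where P: "sing j Y P" "a = cls j Y P" by (rule bordismE[OF a])
 obtain Q :: "(pts,'b) over" where Q: "sing k Z Q" "b = cls k Z Q" by (rule bordismE[OF b])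
 show ?thesis unfolding P(2) Q(2) bprod_cls[OF emb_pts emb_pts m P(1) Q(1)]
  by (rule cls_mem[OF _ sing_oprod[OF P(1) Q(1) m]]) simp
qed

lemma bprod_mult_left:
 assumes m: "continuous_map (prod_topology Y Z) T m"
  and a: "a \<in> Om j Y" "a' \<in> Om j Y" and b: "b \<in> Om k Z"
 shows "bprod j k T m (a \<otimes>\<^bsub>bordism_group j Y\<^esub> a') b =
  bprod j k T m a b \<otimes>\<^bsub>bordism_group (j + k) T\<^esub> bprod j k T m a' b"
proof -
 obtain P :: "(pts,'a) over" where P: "sing j Y P" "a = cls j Y P" by (rule bordismE[OF a(1)])
 obtain P' :: "(pts,'a) over" where P': "sing j Y P'" "a' = cls j Y P'" by (rule bordismE[OF a(2)])
 obtain Q :: "(pts,'b) over" where Q: "sing k Z Q" "b = cls k Z Q" by (rule bordismE[OF b])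
 note S = sing_osum[OF P(1) P'(1)] and s1 = sing_oprod[OF P(1) Q(1) m] and s2 = sing_oprod[OF P'(1) Q(1) m]
 have e: "embeds TYPE(pts + pts)" "embeds TYPE(pts \<times> pts)" by simp_all
 have "iso_over (osum (oprod m P Q) (oprod m P' Q)) (oprod m (osum P P') Q)"
  by (rule iso_oprod_osum_left[OF sing_omf[OF P(1)] sing_omf[OF P'(1)] sing_omf[OF Q(1)]])
 from cls_iso[OF this sing_osum[OF s1 s2] sing_oprod[OF S Q(1) m]]
 show ?thesis unfolding P(2) P'(2) Q(2) bordism_mult[OF emb_pts emb_pts P(1) P'(1)]
   bprod_cls[OF emb_pts emb_pts m P(1) Q(1)] bprod_cls[OF emb_pts emb_pts m P'(1) Q(1)]
   bprod_cls[OF e(1) emb_pts m S Q(1)] bordism_mult[OF e(2) e(2) s1 s2] by simp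
qed

lemma cls_oprod_swap:
 assumes m: "continuous_map (prod_topology Y Z) T m" and P: "sing j Y P" and Q: "sing k Z Q"
 shows "cls (j + k) T (oprod m P Q) = cls (j + k) T (oprod (\<lambda>(z,y). m (y,z)) Q (mf_sgn (j * k) (fst P),snd P))"
proof (rule cls_iso[OF iso_oprod_swap[OF sing_omf[OF P] sing_omf[OF Q]] sing_oprod[OF P Q m]])
 show "sing (j + k) T (oprod (\<lambda>(z,y). m (y,z)) Q (mf_sgn (j * k) (fst P),snd P))"
  using sing_oprod[OF Q sing_sgn[OF P] cont_swap[OF m]] by (simp only: add.commute)
qed simp

text \<open>The interchange reduces this to additivity on the left. Its sign is attached to the
  representative \<open>P\<close> of the fixed class, hence is the same for \<open>b\<close>,
  \<open>b'\<close> and their sum.\<close>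

lemma bprod_mult_right:
 assumes m: "continuous_map (prod_topology Y Z) T m"
  and a: "a \<in> Om j Y" and b: "b \<in> Om k Z" "b' \<in> Om k Z"
 shows "bprod j k T m a (b \<otimes>\<^bsub>bordism_group k Z\<^esub> b') =
  bprod j k T m a b \<otimes>\<^bsub>bordism_group (j + k) T\<^esub> bprod j k T m a b'"
proof -
 obtain P :: "(pts,'a) over" where P: "sing j Y P" "a = cls j Y P" by (rule bordismE[OF a])
 note P' = sing_sgn[OF P(1),of "j * k"] and m' = cont_swap[OF m]
 have swap: "bprod j k T m a c = bprod k j T (\<lambda>(z,y). m (y,z)) c (cls j Y (mf_sgn (j * k) (fst P),snd P))"
  if c: "c \<in> Om k Z" for c
 proof -
  obtain Q :: "(pts,'b) over" where Q: "sing k Z Q" "c = cls k Z Q" by (rule bordismE[OF c])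
  show ?thesis
   unfolding P(2) Q(2) bprod_cls[OF emb_pts emb_pts m P(1) Q(1)] bprod_cls[OF emb_pts emb_pts m' Q(1) P']
    cls_oprod_swap[OF m P(1) Q(1)] by (simp only: add.commute)
 qed
 show ?thesis
  unfolding swap[OF bordism_closed[OF b]] swap[OF b(1)] swap[OF b(2)] bprod_mult_left[OF m' b cls_mem[OF emb_pts P']]
  by (simp only: add.commute)
qed

subsection \<open>Decomposition into connected components\<close>

text \<open>Local connectedness is inherited from Euclidean space through the charts; it makes
  connected components open.\<close>

lemma locally_connected_manifold:
 assumes X: "omanif X" shows "locally_connected_space (mf_top X)"
 unfolding locally_connected_space
proof (intro allI impI)
 note X = X[unfolded oriented_manifold_def]
 fix V x assume Vx: "openin (mf_top X) V \<and> x \<in> V"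
 hence "x \<in> mf_pts X" using openin_subset by blast
 then obtain U f s where c: "(U,f,s) \<in> mf_charts X" "x \<in> U" using manifoldD(3)[OF X] by blast
 note g = manifoldD(4)[OF X c(1)] note gD = gchartD[OF g]
 let ?n = "mf_dim X"
 have oW: "openin (Eucl ?n) (f ` (V \<inter> U))"
  using gchart_image[OF g openin_Int[OF _ gD(1)],of V] Vx by simp
 have "f x \<in> f ` (V \<inter> U)" using Vx c by blast
 then obtain Q where Q: "openin (Eucl ?n) Q" "connectedin (Eucl ?n) Q" "f x \<in> Q" "Q \<subseteq> f ` (V \<inter> U)"
  using oW locally_connected_Euclidean_space[of ?n] unfolding locally_connected_space by blast
 let ?R = "{p \<in> U. f p \<in> Q}"
 have "openin (mf_top X) ?R" by (rule gchart_preimage[OF g]) (use Q in simp)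
 moreover have "?R \<subseteq> V"
 proof
  fix p assume p: "p \<in> ?R"
  then obtain q where "q \<in> V" "q \<in> U" "f p = f q" using Q(4) by blast
  thus "p \<in> V" using inj_onD[OF gD(3),of p q] p by simp
 qed
 moreover have "connectedin (mf_top X) ?R"
 proof -
  have h: "homeomorphic_map (subtopology (mf_top X) U) (subtopology (Eucl ?n) (f ` U)) f"
   using g unfolding gchart_homeomorphic by blast
  have R: "?R \<subseteq> topspace (subtopology (mf_top X) U)" using gD(2) by auto
  have im: "f ` ?R = Q" "Q \<subseteq> f ` U" using Q(4) by auto
  have "connectedin (subtopology (Eucl ?n) (f ` U)) (f ` ?R)"
   unfolding im(1) connectedin_subtopology using Q(2) im(2) by (rule conjI)
  hence "connectedin (subtopology (mf_top X) U) ?R" using homeomorphic_map_connectedness[OF h R] by blast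
  thus ?thesis by (simp add: connectedin_subtopology)
 qed
 ultimately show "\<exists>U. openin (mf_top X) U \<and> connectedin (mf_top X) U \<and> x \<in> U \<and> U \<subseteq> V"
  using Q(3) c(2) by blast
qed

text \<open>The components are open and disjoint, so a finite subfamily that covers the space
  already contains all of them.\<close>

lemma finite_components:
 assumes T: "locally_connected_space T" "compact_space T" shows "finite (connected_components_of T)"
proof -
 have o: "openin T C" if "C \<in> connected_components_of T" for C
  using openin_connected_components_of_locally_connected_space[OF T(1) that] .
 have "compactin T (topspace T)" using T(2) by (simp add: compact_space_def)
 moreover have "topspace T \<subseteq> \<Union>(connected_components_of T)" by (simp add: Union_connected_components_of)
 ultimately obtain F where F: "finite F" "F \<subseteq> connected_components_of T" "topspace T \<subseteq> \<Union>F"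
  using o unfolding compactin_def by meson
 have "connected_components_of T \<subseteq> F"
 proof
  fix C assume C: "C \<in> connected_components_of T"
  then obtain x where "x \<in> C" using nonempty_connected_components_of by blast
  moreover have "x \<in> topspace T" using calculation C connected_components_of_subset by blast
  ultimately obtain D where D: "D \<in> F" "x \<in> D" using F(3) by blast
  hence "D \<in> connected_components_of T" "\<not> disjnt C D" using \<open>x \<in> C\<close> F(2) by (auto simp: disjnt_def)
  hence "C = D" using C pairwise_disjoint_connected_components_of[of T] by (auto simp: pairwise_def)
  thus "C \<in> F" using D by simp
 qed
 thus ?thesis using F(1) finite_subset by blast
qed

lemma mf_restrict_restrict: "mf_restrict (mf_restrict X B) A = mf_restrict X (B \<inter> A)"
 unfolding mf_restrict_def by (auto simp: subtopology_subtopology image_image case_prod_unfold Int_assoc)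

lemma sing_restrict:
 assumes P: "sing j Y (V,f)" and A: "openin (mf_top V) A" "closedin (mf_top V) A"
 shows "sing j Y (mf_restrict V A,f)"
proof -
 have "compactin (mf_top V) A"
  using P A(2) closedin_compact_space by (auto simp: singular_manifold_def closed_oriented_manifold_def)
 hence "compact_space (subtopology (mf_top V) A)" by (simp add: compact_space_subtopology)
 thus ?thesis using P manifold_restrict[OF _ A(1)]
  by (auto simp: singular_manifold_def closed_oriented_manifold_def oriented_manifold_def mf_restrict_simps
    intro: continuous_map_from_subtopology)
qed

text \<open>There are finitely many components, and unions of components are open and closed.
  Induction over finite sets of components adds one component at a time, starting from the empty
  manifold, which represents the neutral element.\<close>

lemma connected_induct:
 assumes a: "a \<in> Om j Y" and one: "Pr \<one>\<^bsub>bordism_group j Y\<^esub>"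
  and mult: "!!a b. a \<in> Om j Y ==> b \<in> Om j Y ==> Pr a ==> Pr b ==>
   Pr (a \<otimes>\<^bsub>bordism_group j Y\<^esub> b)"
  and conn: "!!P :: (pts,'y) over. sing j Y P ==> connected_manifold (fst P) ==> Pr (cls j Y P)"
 shows "Pr a"
proof -
 obtain P :: "(pts,'y) over" where P: "sing j Y P" "a = cls j Y P" by (rule bordismE[OF a])
 obtain V f where Vf: "P = (V,f)" by (cases P)
 note S = P(1)[unfolded Vf]
 let ?T = "mf_top V" and ?CC = "connected_components_of (mf_top V)"
 have oV: "omanif V" "compact_space ?T" using S by (auto simp: singular_manifold_def closed_oriented_manifold_def)
 have lc: "locally_connected_space ?T" by (rule locally_connected_manifold[OF oV(1)])
 have fin: "finite ?CC" by (rule finite_components[OF lc oV(2)])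
 have oC: "openin ?T C" if "C \<in> ?CC" for C by (rule openin_connected_components_of_locally_connected_space[OF lc that])
 have clop: "openin ?T (\<Union>\<C>) \<and> closedin ?T (\<Union>\<C>)" if "\<C> \<subseteq> ?CC" for \<C>
 proof -
  have "closedin ?T (\<Union>\<C>)"
   using that finite_subset[OF that fin] closedin_connected_components_of by (intro closedin_Union) auto
  thus ?thesis using that oC by blast
 qed
 have main: "Pr (cls j Y (mf_restrict V (\<Union>\<C>),f))" if "finite \<C>" "\<C> \<subseteq> ?CC" for \<C>
  using that
 proof (induction \<C> rule: finite_induct)
  case empty
  let ?E = "oempty j :: (pts,'y) over"
  have R: "sing j Y (mf_restrict V {},f)" by (rule sing_restrict[OF S]) auto
  have E: "sing j Y ?E" by (rule sing_oempty)
  have "iso_over ?E (mf_restrict V {},f)"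
  proof (rule iso_overI[where h = "\<lambda>x. x" and g = "\<lambda>x. x"])
   show "odiff (fst ?E) (fst (mf_restrict V {},f)) (\<lambda>x. x) (\<lambda>x. x)"
    by (rule odiff_match')
      (use sing_omf[OF E] sing_omf[OF R] in "auto simp: oempty_pts mf_restrict_simps")
  qed (use sing_omf[OF E] sing_omf[OF R] in "auto simp: oempty_pts")
  from cls_iso[OF this sing_oempty R] show ?case using one by (simp add: bordism_one)
 next
  case (insert C \<C>)
  have cC: "openin ?T C" "closedin ?T C" using clop[of "{C}"] insert.prems by auto
  have cU: "openin ?T (\<Union>\<C>)" "closedin ?T (\<Union>\<C>)" using clop[of \<C>] insert.prems by auto
  have cI: "openin ?T (C \<union> \<Union>\<C>)" "closedin ?T (C \<union> \<Union>\<C>)" using clop[of "insert C \<C>"] insert.prems by auto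
  have disj: "C \<inter> \<Union>\<C> = {}"
   using insert.hyps insert.prems pairwise_disjoint_connected_components_of[of ?T]
   by (fastforce simp: pairwise_def disjnt_def)
  let ?X = "mf_restrict V (C \<union> \<Union>\<C>)"
  have R: "sing j Y (mf_restrict V C,f)" "sing j Y (mf_restrict V (\<Union>\<C>),f)" "sing j Y (?X,f)"
   using sing_restrict[OF S cC] sing_restrict[OF S cU] sing_restrict[OF S cI] by auto
  have rr: "mf_restrict ?X C = mf_restrict V C" "mf_restrict ?X (\<Union>\<C>) = mf_restrict V (\<Union>\<C>)"
   by (simp_all add: mf_restrict_restrict Int_absorb1 Un_upper1 Un_upper2)
  have "odiff (mf_sum (mf_restrict ?X C) (mf_restrict ?X (\<Union>\<C>))) ?X (case_sum (\<lambda>x. x) (\<lambda>x. x)) (\<lambda>x. if x \<in> C then Inl x else Inr x)"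
  proof (rule odiff_restrict_sum)
   show "openin (mf_top ?X) C" "openin (mf_top ?X) (\<Union>\<C>)"
    using cC cU cI by (auto simp: mf_restrict_simps openin_open_subtopology)
   show "C \<union> \<Union>\<C> = mf_pts ?X" using openin_subset[OF cI(1)] by (auto simp: mf_restrict_simps)
  qed (use sing_omf[OF R(3)] disj in auto)
  hence "iso_over (osum (mf_restrict V C,f) (mf_restrict V (\<Union>\<C>),f)) (?X,f)"
   unfolding rr
   by (intro iso_overI[where h = "case_sum (\<lambda>x. x) (\<lambda>x. x)" and g = "\<lambda>x. if x \<in> C then Inl x else Inr x"])
     (use sing_omf[OF R(3)] sing_omf[OF sing_osum[OF R(1,2)]] in "auto simp: osum_def split: sum.split")
  from cls_iso[OF this sing_osum[OF R(1,2)] R(3)]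
  have eq: "cls j Y (?X,f) = cls j Y (mf_restrict V C,f) \<otimes>\<^bsub>bordism_group j Y\<^esub> cls j Y (mf_restrict V (\<Union>\<C>),f)"
   using bordism_mult[OF emb_pts emb_pts R(1,2)] by simp
  have "connectedin ?T C" using insert.prems connectedin_connected_components_of by blast
  hence "connected_manifold (mf_restrict V C)" by (simp add: connected_manifold_def mf_restrict_simps connectedin_def)
  hence "Pr (cls j Y (mf_restrict V C,f))" using conn[OF R(1)] by simp
  moreover have "Pr (cls j Y (mf_restrict V (\<Union>\<C>),f))" using insert by auto
  ultimately show ?case
   using mult[OF cls_mem[OF emb_pts R(1)] cls_mem[OF emb_pts R(2)]] eq by simp
 qed
 have "\<Union>?CC = mf_pts V" by (rule Union_connected_components_of)
 hence "Pr (cls j Y (mf_restrict V (mf_pts V),f))" using main[OF fin] by simp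
 \<comment> \<open>Restriction to all points changes no domain of a chart, so the result of the
   induction concerns \<open>V\<close> itself.\<close>
 moreover have "mf_restrict V (mf_pts V) = V"
 proof -
  have "U \<inter> mf_pts V = U" if "(U,F,s) \<in> mf_charts V" for U F s
   using gchartD(2)[OF manifoldD(4)[OF oV(1)[unfolded oriented_manifold_def] that]] by blast
  hence "(\<lambda>(U,F,s). (U \<inter> mf_pts V,F,s)) ` mf_charts V = (\<lambda>c. c) ` mf_charts V"
   by (intro image_cong) auto
  thus ?thesis unfolding mf_restrict_def by simp
 qed
 ultimately show ?thesis using P(2) Vf by simp
qed

section \<open>Rational bordism\<close>

subsection \<open>Tensor products with the rationals\<close>

text \<open>With the carrier closed under multiplication the relators lie in the free abelian group,
  and the quotient by them is an abelian group.\<close>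

definition mult_closed :: "('a,'b) monoid_scheme => bool"
 where "mult_closed A \<longleftrightarrow> (\<forall>a\<in>carrier A. \<forall>b\<in>carrier A. a \<otimes>\<^bsub>A\<^esub> b \<in> carrier A)"

definition biadditive :: "('a,'b) monoid_scheme => ('c,'d) monoid_scheme => ('a => rat => 'c) => bool"
 where "biadditive A B F \<longleftrightarrow> (\<forall>a\<in>carrier A. \<forall>q. F a q \<in> carrier B) \<and>
  (\<forall>a\<in>carrier A. \<forall>b\<in>carrier A. \<forall>q. F (a \<otimes>\<^bsub>A\<^esub> b) q = F a q \<otimes>\<^bsub>B\<^esub> F b q) \<and>
  (\<forall>a\<in>carrier A. \<forall>q r. F a (q + r) = F a q \<otimes>\<^bsub>B\<^esub> F a r)"

lemma cgroup_gens: "comm_group (tensor_gens A)"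
 by (simp add: tensor_gens_def abelian_free_Abelian_group)

lemma tensor_gens_simps:
 "x \<in> carrier (tensor_gens A) \<longleftrightarrow> Poly_Mapping.keys x \<subseteq> carrier A \<times> UNIV"
 "x \<otimes>\<^bsub>tensor_gens A\<^esub> y = x + y" "\<one>\<^bsub>tensor_gens A\<^esub> = 0"
 by (simp_all add: tensor_gens_def)

lemma tensor_rels_gens:
 assumes A: "mult_closed A"
 shows "{frag_of (a \<otimes>\<^bsub>A\<^esub> b,q :: rat) - frag_of (a,q) - frag_of (b,q) | a b q. a \<in> carrier A \<and> b \<in> carrier A} \<union>
   {frag_of (a,q + r :: rat) - frag_of (a,q) - frag_of (a,r) | a q r. a \<in> carrier A} \<subseteq> carrier (tensor_gens A)"
proof -
 have k: "Poly_Mapping.keys (frag_of x - frag_of y - frag_of z) \<subseteq> {x,y,z}" for x y z :: "'a \<times> rat"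
  using keys_diff[of "frag_of x - frag_of y" "frag_of z"] keys_diff[of "frag_of x" "frag_of y"] by auto
 show ?thesis
 proof
  fix u assume "u \<in> {frag_of (a \<otimes>\<^bsub>A\<^esub> b,q :: rat) - frag_of (a,q) - frag_of (b,q) | a b q. a \<in> carrier A \<and> b \<in> carrier A} \<union>
   {frag_of (a,q + r :: rat) - frag_of (a,q) - frag_of (a,r) | a q r. a \<in> carrier A}"
  then obtain x y z where "u = frag_of x - frag_of y - frag_of z" "{x,y,z} \<subseteq> carrier A \<times> UNIV"
   using A by (auto simp: mult_closed_def)
  thus "u \<in> carrier (tensor_gens A)" using k[of x y z] by (auto simp: tensor_gens_simps)
 qed
qed

lemma subgroup_tensor_rels: "mult_closed A ==> subgroup (tensor_rels A) (tensor_gens A)"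
 unfolding tensor_rels_def
 by (rule group.generate_is_subgroup[OF comm_group.axioms(2)[OF cgroup_gens] tensor_rels_gens])

lemma normal_tensor_rels: "mult_closed A ==> tensor_rels A \<lhd> tensor_gens A"
 by (rule comm_group.subgroup_imp_normal[OF cgroup_gens subgroup_tensor_rels])

lemma comm_group_rat_tensor: "mult_closed A ==> comm_group (rat_tensor A)"
 unfolding rat_tensor_def by (rule comm_group.abelian_FactGroup[OF cgroup_gens subgroup_tensor_rels])

definition tproj :: "('a,'b) monoid_scheme => ('a \<times> rat \<Rightarrow>\<^sub>0 int) => 'a tensor"
 where "tproj A z = tensor_rels A #>\<^bsub>tensor_gens A\<^esub> z"

lemma tproj_hom: "mult_closed A ==> tproj A \<in> hom (tensor_gens A) (rat_tensor A)"
 unfolding tproj_def[abs_def] rat_tensor_def by (rule normal.r_coset_hom_Mod[OF normal_tensor_rels])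

lemma tproj_add:
 "mult_closed A ==> x \<in> carrier (tensor_gens A) ==> y \<in> carrier (tensor_gens A) ==>
  tproj A (x + y) = tproj A x \<otimes>\<^bsub>rat_tensor A\<^esub> tproj A y"
 using hom_mult[OF tproj_hom,of A x y] by (simp add: tensor_gens_simps)

lemma tproj_rels: "mult_closed A ==> x \<in> tensor_rels A ==> tproj A x = \<one>\<^bsub>rat_tensor A\<^esub>"
 unfolding tproj_def rat_tensor_def
 using group.coset_join2[OF comm_group.axioms(2)[OF cgroup_gens] _ subgroup_tensor_rels,of x A]
  subgroup.subset[OF subgroup_tensor_rels,of A] by (auto simp: FactGroup_def)

lemma tproj_rel3:
 assumes A: "mult_closed A" and r: "frag_of x - frag_of y - frag_of z \<in> tensor_rels A"
  and c: "{y,z} \<subseteq> carrier A \<times> UNIV"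
 shows "tproj A (frag_of x) = tproj A (frag_of y) \<otimes>\<^bsub>rat_tensor A\<^esub> tproj A (frag_of z)"
proof -
 let ?u = "frag_of x - frag_of y - frag_of z"
 interpret R: comm_group "rat_tensor A" by (rule comm_group_rat_tensor[OF A])
 have u: "?u \<in> carrier (tensor_gens A)" using r subgroup.subset[OF subgroup_tensor_rels[OF A]] by blast
 have yz: "frag_of y \<in> carrier (tensor_gens A)" "frag_of z \<in> carrier (tensor_gens A)"
  using c by (auto simp: tensor_gens_simps)
 have yz': "frag_of y + frag_of z \<in> carrier (tensor_gens A)"
  using c keys_add[of "frag_of y" "frag_of z"] by (auto simp: tensor_gens_simps)
 have "tproj A (frag_of x) = tproj A (?u + (frag_of y + frag_of z))" by simp
 also have "\<dots> = tproj A ?u \<otimes>\<^bsub>rat_tensor A\<^esub> tproj A (frag_of y + frag_of z)"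
  by (rule tproj_add[OF A u yz'])
 also have "\<dots> = tproj A (frag_of y + frag_of z)"
  using tproj_rels[OF A r] hom_in_carrier[OF tproj_hom[OF A] yz'] by simp
 finally show ?thesis using tproj_add[OF A yz] by simp
qed

lemma tensor_elt_proj: "tensor_elt A a q = tproj A (frag_of (a,q))"
 by (simp add: tensor_elt_def tproj_def)

lemma biadditive_tensor_elt:
 assumes A: "mult_closed A" shows "biadditive A (rat_tensor A) (tensor_elt A)"
 unfolding biadditive_def
proof (intro conjI ballI allI)
 show "tensor_elt A a q \<in> carrier (rat_tensor A)" if "a \<in> carrier A" for a q
  unfolding tensor_elt_proj using hom_in_carrier[OF tproj_hom[OF A]] that by (simp add: tensor_gens_simps)
 show "tensor_elt A (a \<otimes>\<^bsub>A\<^esub> b) q = tensor_elt A a q \<otimes>\<^bsub>rat_tensor A\<^esub> tensor_elt A b q"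
  if "a \<in> carrier A" "b \<in> carrier A" for a b q
 proof -
  have "frag_of (a \<otimes>\<^bsub>A\<^esub> b,q) - frag_of (a,q) - frag_of (b,q) \<in> tensor_rels A"
   unfolding tensor_rels_def by (rule generate.incl,rule UnI1) (use that in blast)
  thus ?thesis unfolding tensor_elt_proj by (rule tproj_rel3[OF A]) (use that in auto)
 qed
 show "tensor_elt A a (q + r) = tensor_elt A a q \<otimes>\<^bsub>rat_tensor A\<^esub> tensor_elt A a r" if "a \<in> carrier A" for a q r
 proof -
  have "frag_of (a,q + r) - frag_of (a,q) - frag_of (a,r) \<in> tensor_rels A"
   unfolding tensor_rels_def by (rule generate.incl,rule UnI2) (use that in blast)
  thus ?thesis unfolding tensor_elt_proj by (rule tproj_rel3[OF A]) (use that in auto)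
 qed
qed

section \<open>Induction and the universal property for tensor products with the rationals\<close>

lemma rat_tensor_carrierE:
 assumes "x \<in> carrier (rat_tensor A)"
 obtains z where "z \<in> carrier (tensor_gens A)" "x = tproj A z"
 using assms unfolding rat_tensor_def FactGroup_def RCOSETS_def tproj_def by auto

lemma biadditiveD:
 assumes "biadditive A B F"
 shows "!!a q. a \<in> carrier A ==> F a q \<in> carrier B"
  "!!a b q. a \<in> carrier A ==> b \<in> carrier A ==> F (a \<otimes>\<^bsub>A\<^esub> b) q = F a q \<otimes>\<^bsub>B\<^esub> F b q"
  "!!a q r. a \<in> carrier A ==> F a (q + r) = F a q \<otimes>\<^bsub>B\<^esub> F a r"
 using assms by (auto simp: biadditive_def)

lemma biadditive_zero:
 assumes F: "biadditive A B F" and B: "comm_group B" and a: "a \<in> carrier A"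
 shows "F a 0 = \<one>\<^bsub>B\<^esub>"
proof -
 interpret B: comm_group B by fact
 have "F a 0 = F a 0 \<otimes>\<^bsub>B\<^esub> F a 0" using biadditiveD(3)[OF F a,of 0 0] by simp
 thus ?thesis using biadditiveD(1)[OF F a] B.r_cancel_one' by metis
qed

text \<open>The induction principle of free abelian groups runs over differences, so the claim is
  proved for \<open>z\<close> and \<open>- z\<close> together. The negative of a generator is again
  a generator, since the elements with coefficients \<open>q\<close> and \<open>- q\<close> are
  inverse to each other.\<close>

lemma rat_tensor_induct:
 assumes A: "mult_closed A" and x: "x \<in> carrier (rat_tensor A)"
  and one: "P \<one>\<^bsub>rat_tensor A\<^esub>"
  and mult: "!!x y. x \<in> carrier (rat_tensor A) ==> y \<in> carrier (rat_tensor A) ==> P x ==> P y ==> P (x \<otimes>\<^bsub>rat_tensor A\<^esub> y)"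
  and elt: "!!a q. a \<in> carrier A ==> P (tensor_elt A a q)"
 shows "P x"
proof -
 interpret R: comm_group "rat_tensor A" by (rule comm_group_rat_tensor[OF A])
 obtain z where z: "z \<in> carrier (tensor_gens A)" "x = tproj A z" by (rule rat_tensor_carrierE[OF x])
 note hom = tproj_hom[OF A]
 have c: "tproj A u \<in> carrier (rat_tensor A)" if "u \<in> carrier (tensor_gens A)" for u
  using hom_in_carrier[OF hom that] .
 have zero: "tproj A 0 = \<one>\<^bsub>rat_tensor A\<^esub>"
  using hom_one[OF hom comm_group.axioms(2)[OF cgroup_gens] R.is_group] by (simp add: tensor_gens_simps)
 have "Poly_Mapping.keys z \<subseteq> carrier A \<times> UNIV" using z(1) by (simp add: tensor_gens_simps)
 hence "P (tproj A z) \<and> P (tproj A (- z))"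
 proof (rule free_Abelian_group_induct)
  show "P (tproj A 0) \<and> P (tproj A (- 0))" using one zero by simp
 next
  fix u v
  assume 2: "Poly_Mapping.keys u \<subseteq> carrier A \<times> UNIV" "Poly_Mapping.keys v \<subseteq> carrier A \<times> UNIV"
   "P (tproj A u) \<and> P (tproj A (- u))" "P (tproj A v) \<and> P (tproj A (- v))"
  hence uv: "u \<in> carrier (tensor_gens A)" "v \<in> carrier (tensor_gens A)" "- u \<in> carrier (tensor_gens A)" "- v \<in> carrier (tensor_gens A)"
   by (auto simp: tensor_gens_simps keys_minus)
  have "tproj A (u - v) = tproj A u \<otimes>\<^bsub>rat_tensor A\<^esub> tproj A (- v)"
   using tproj_add[OF A uv(1,4)] by simp
  moreover have "tproj A (- (u - v)) = tproj A v \<otimes>\<^bsub>rat_tensor A\<^esub> tproj A (- u)"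
   using tproj_add[OF A uv(2,3)] by simp
  ultimately show "P (tproj A (u - v)) \<and> P (tproj A (- (u - v)))" using 2 mult c uv by simp
 next
  fix s assume 3: "s \<in> carrier A \<times> (UNIV :: rat set)"
  then obtain a q where s: "s = (a,q)" "a \<in> carrier A" by auto
  have f: "frag_of s \<in> carrier (tensor_gens A)" "- frag_of s \<in> carrier (tensor_gens A)"
   using 3 by (auto simp: tensor_gens_simps keys_minus)
  have "tproj A (frag_of s) \<otimes>\<^bsub>rat_tensor A\<^esub> tproj A (- frag_of s) = \<one>\<^bsub>rat_tensor A\<^esub>"
   using tproj_add[OF A f] zero by simp
  moreover have "tproj A (frag_of s) \<otimes>\<^bsub>rat_tensor A\<^esub> tensor_elt A a (- q) = \<one>\<^bsub>rat_tensor A\<^esub>"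
   using biadditiveD(3)[OF biadditive_tensor_elt[OF A] s(2),of q "- q"]
    biadditive_zero[OF biadditive_tensor_elt[OF A] comm_group_rat_tensor[OF A] s(2)]
   by (simp add: tensor_elt_proj s(1))
  ultimately have "tproj A (- frag_of s) = tensor_elt A a (- q)"
   using R.inv_unique[OF _ _ c[OF f(1)] c[OF f(2)] biadditiveD(1)[OF biadditive_tensor_elt[OF A] s(2)]]
    R.m_comm[OF c[OF f(1)] c[OF f(2)]] by simp
  thus "P (tproj A (frag_of s)) \<and> P (tproj A (- frag_of s))"
   using elt[OF s(2)] by (simp add: tensor_elt_proj s(1))
 qed
 thus ?thesis using z(2) by simp
qed

text \<open>The extension to the free abelian group kills both families of relators by biadditivity,
  hence factors through the quotient.\<close>

lemma rat_tensor_universal: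
 assumes A: "mult_closed A" and B: "comm_group B" and F: "biadditive A B F"
 obtains f where "f \<in> hom (rat_tensor A) B" "!!a q. a \<in> carrier A ==> f (tensor_elt A a q) = F a q"
proof -
 interpret B: comm_group B by fact
 interpret G: comm_group "tensor_gens A" by (rule cgroup_gens)
 have "(\<lambda>(a,q). F a q) ` (carrier A \<times> UNIV) \<subseteq> carrier B" using biadditiveD(1)[OF F] by auto
 from B.free_Abelian_group_universal[OF this] obtain h where
  h: "h \<in> hom (tensor_gens A) B" "!!x. x \<in> carrier A \<times> UNIV ==> h (frag_of x) = (\<lambda>(a,q). F a q) x"
  unfolding tensor_gens_def by blast
 interpret gh: group_hom "tensor_gens A" B h
  using h(1) by (simp add: group_hom_def group_hom_axioms_def)
 \<comment> \<open>Adding the two subtracted generators to the relator gives back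
   \<open>frag_of x\<close>; cancelling its image leaves the neutral element.\<close>
 have key: "h (frag_of x - frag_of y - frag_of z) = \<one>\<^bsub>B\<^esub>"
  if xyz: "{x,y,z} \<subseteq> carrier A \<times> UNIV" and e: "h (frag_of x) = h (frag_of y) \<otimes>\<^bsub>B\<^esub> h (frag_of z)" for x y z
 proof -
  let ?u = "frag_of x - frag_of y - frag_of z"
  have k: "Poly_Mapping.keys ?u \<subseteq> {x,y,z}"
   using keys_diff[of "frag_of x - frag_of y" "frag_of z"] keys_diff[of "frag_of x" "frag_of y"] by auto
  have c: "?u \<in> carrier (tensor_gens A)" "frag_of y \<in> carrier (tensor_gens A)" "frag_of z \<in> carrier (tensor_gens A)"
   using k xyz by (auto simp: tensor_gens_simps)
  have c': "frag_of y + frag_of z \<in> carrier (tensor_gens A)"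
   using xyz keys_add[of "frag_of y" "frag_of z"] by (auto simp: tensor_gens_simps)
  have "h (?u + (frag_of y + frag_of z)) = h ?u \<otimes>\<^bsub>B\<^esub> h (frag_of y + frag_of z)"
   using gh.hom_mult[OF c(1) c'] by (simp add: tensor_gens_simps)
  moreover have "h (frag_of y + frag_of z) = h (frag_of y) \<otimes>\<^bsub>B\<^esub> h (frag_of z)"
   using gh.hom_mult[OF c(2,3)] by (simp add: tensor_gens_simps)
  ultimately have "h (frag_of x) = h ?u \<otimes>\<^bsub>B\<^esub> h (frag_of x)" using e by simp
  moreover have "h (frag_of x) \<in> carrier B" "h ?u \<in> carrier B" using gh.hom_closed c xyz e by (auto simp: tensor_gens_simps)
  ultimately show ?thesis using B.r_cancel_one' by metis
 qed
 have "tensor_rels A \<subseteq> kernel (tensor_gens A) B h"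
  unfolding tensor_rels_def
 proof (rule G.generate_subgroup_incl[OF _ gh.subgroup_kernel],rule subsetI)
  fix u assume u: "u \<in> {frag_of (a \<otimes>\<^bsub>A\<^esub> b,q :: rat) - frag_of (a,q) - frag_of (b,q) | a b q. a \<in> carrier A \<and> b \<in> carrier A} \<union>
   {frag_of (a,q + r :: rat) - frag_of (a,q) - frag_of (a,r) | a q r. a \<in> carrier A}"
  hence "u \<in> carrier (tensor_gens A)" using tensor_rels_gens[OF A] by blast
  moreover have "h u = \<one>\<^bsub>B\<^esub>"
   using u
  proof (elim UnE CollectE exE conjE)
   fix a b q assume "u = frag_of (a \<otimes>\<^bsub>A\<^esub> b,q) - frag_of (a,q) - frag_of (b,q)" and ab: "a \<in> carrier A" "b \<in> carrier A"
   moreover have "a \<otimes>\<^bsub>A\<^esub> b \<in> carrier A" using A ab by (simp add: mult_closed_def)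
   ultimately show ?thesis using biadditiveD(2)[OF F ab] by (simp add: key h(2))
  next
   fix a q r assume "u = frag_of (a,q + r) - frag_of (a,q) - frag_of (a,r)" and a: "a \<in> carrier A"
   thus ?thesis using biadditiveD(3)[OF F a] by (simp add: key h(2))
  qed
  ultimately show "u \<in> kernel (tensor_gens A) B h" by (simp add: kernel_def)
 qed
 from gh.FactGroup_universal_kernel[OF normal_tensor_rels[OF A] this] obtain g where
  g: "g \<in> hom (rat_tensor A) B" "!!x. x \<in> carrier (tensor_gens A) ==> g (tproj A x) = h x"
  unfolding rat_tensor_def tproj_def by blast
 show ?thesis
  by (rule that[OF g(1)]) (simp add: tensor_elt_proj g(2) h(2) tensor_gens_simps)
qed

text \<open>\<open>tensor_scale\<close> is a union over the members of a coset. Comparison with the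
  map \<open>f\<close> from the universal property shows that all members give the same
  value.\<close>

lemma tensor_scale:
 assumes A: "mult_closed A"
 shows "tensor_scale A q \<in> hom (rat_tensor A) (rat_tensor A)" (is ?hom)
  and "!!a r. a \<in> carrier A ==> tensor_scale A q (tensor_elt A a r) = tensor_elt A a (q * r)" (is "!!a r. _ ==> ?elt a r")
proof -
 interpret R: comm_group "rat_tensor A" by (rule comm_group_rat_tensor[OF A])
 interpret G: comm_group "tensor_gens A" by (rule cgroup_gens)
 have "biadditive A (rat_tensor A) (\<lambda>a r. tensor_elt A a (q * r))"
  using biadditive_tensor_elt[OF A] unfolding biadditive_def by (simp add: distrib_left)
 from rat_tensor_universal[OF A R.comm_group_axioms this] obtain f where
  f: "f \<in> hom (rat_tensor A) (rat_tensor A)" "!!a r. a \<in> carrier A ==> f (tensor_elt A a r) = tensor_elt A a (q * r)" by blast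
 interpret p: group_hom "rat_tensor A" "rat_tensor A" f
  using f(1) by (simp add: group_hom_def group_hom_axioms_def)
 interpret pr: group_hom "tensor_gens A" "rat_tensor A" "tproj A"
  using tproj_hom[OF A] by (simp add: group_hom_def group_hom_axioms_def)
 let ?k = "frag_extend (\<lambda>(a,r). frag_of (a,q * r))"
 have diff: "tproj A (u - v) = tproj A u \<otimes>\<^bsub>rat_tensor A\<^esub> inv\<^bsub>rat_tensor A\<^esub> tproj A v"
  if uv: "u \<in> carrier (tensor_gens A)" "v \<in> carrier (tensor_gens A)" for u v
 proof -
  have "inv\<^bsub>tensor_gens A\<^esub> v = - v" using uv(2) by (simp add: tensor_gens_def)
  thus ?thesis using pr.hom_mult[OF uv(1) G.inv_closed[OF uv(2)]] pr.hom_inv[OF uv(2)]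
   by (simp add: tensor_gens_simps)
 qed
 have k: "?k z \<in> carrier (tensor_gens A) \<and> tproj A (?k z) = f (tproj A z)"
  if "z \<in> carrier (tensor_gens A)" for z
 proof -
  have "Poly_Mapping.keys z \<subseteq> carrier A \<times> UNIV" using that by (simp add: tensor_gens_simps)
  thus ?thesis
  proof (rule free_Abelian_group_induct)
   have "tproj A 0 = \<one>\<^bsub>rat_tensor A\<^esub>" using pr.hom_one by (simp add: tensor_gens_simps)
   thus "?k 0 \<in> carrier (tensor_gens A) \<and> tproj A (?k 0) = f (tproj A 0)"
    by (simp add: tensor_gens_simps)
  next
   fix u v
   assume 2: "Poly_Mapping.keys u \<subseteq> carrier A \<times> UNIV" "Poly_Mapping.keys v \<subseteq> carrier A \<times> UNIV"
    "?k u \<in> carrier (tensor_gens A) \<and> tproj A (?k u) = f (tproj A u)"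
    "?k v \<in> carrier (tensor_gens A) \<and> tproj A (?k v) = f (tproj A v)"
   have uv: "u \<in> carrier (tensor_gens A)" "v \<in> carrier (tensor_gens A)" using 2 by (auto simp: tensor_gens_simps)
   have "?k (u - v) = ?k u - ?k v" by (simp add: frag_extend_diff)
   moreover have "?k u - ?k v \<in> carrier (tensor_gens A)"
    using 2 keys_diff[of "?k u" "?k v"] by (auto simp: tensor_gens_simps)
   ultimately show "?k (u - v) \<in> carrier (tensor_gens A) \<and> tproj A (?k (u - v)) = f (tproj A (u - v))"
    using 2 diff[OF uv] diff[of "?k u" "?k v"] uv pr.hom_closed by simp
  next
   fix s assume "s \<in> carrier A \<times> (UNIV :: rat set)"
   then obtain a r where s: "s = (a,r)" "a \<in> carrier A" by auto
   thus "?k (frag_of s) \<in> carrier (tensor_gens A) \<and> tproj A (?k (frag_of s)) = f (tproj A (frag_of s))"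
    using f(2)[OF s(2),of r] by (simp add: tensor_gens_simps tensor_elt_proj)
  qed
 qed
 have eq: "tensor_scale A q x = f x" if x: "x \<in> carrier (rat_tensor A)" for x
 proof -
  obtain z where z: "z \<in> carrier (tensor_gens A)" "x = tproj A z" by (rule rat_tensor_carrierE[OF x])
  have N: "subgroup (tensor_rels A) (tensor_gens A)" by (rule subgroup_tensor_rels[OF A])
  have "tproj A (?k w) = f x" if w: "w \<in> x" for w
  proof -
   have "w \<in> carrier (tensor_gens A)" using w z G.r_coset_subset_G[OF subgroup.subset[OF N]] unfolding tproj_def by blast
   moreover have "tproj A w = x"
    using G.repr_independence[OF _ _ N] w z unfolding tproj_def by blast
   ultimately show ?thesis using k by simp
  qed
  moreover have "z \<in> x" using G.rcos_self[OF z(1) N] z(2) by (simp add: tproj_def)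
  ultimately show ?thesis unfolding tensor_scale_def tproj_def[symmetric] by auto
 qed
 show ?hom
  using f(1) eq R.m_closed unfolding hom_def by (auto simp: Pi_iff)
 show "?elt a r" if "a \<in> carrier A" for a r
  using eq biadditiveD(1)[OF biadditive_tensor_elt[OF A] that] f(2)[OF that] by simp
qed

subsection \<open>The graded vector space\<close>

text \<open>The homogeneous element of degree \<open>j\<close> given by
  \<open>a \<otimes> q\<close>. Admitting every coefficient makes these elements generate under
  addition alone.\<close>

definition hom_elt :: "'y topology => nat => 'y bordism_class => rat => 'y graded_bordism"
 where "hom_elt Y j a q = (\<lambda>i. if i = j then tensor_elt (bordism_group j Y) a q else \<one>\<^bsub>rOm i Y\<^esub>)"

lemma brat_elt_eq: "bordism_rat_elt j Y a = hom_elt Y j a 1"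
 by (simp add: bordism_rat_elt_def hom_elt_def)

lemma bordism_mult_closed: "mult_closed (bordism_group j Y)"
 by (simp add: mult_closed_def bordism_closed)

lemma comm_group_rat: "comm_group (rOm j Y)"
 by (rule comm_group_rat_tensor[OF bordism_mult_closed])

lemma group_rat: "group (rOm j Y)"
 using comm_group_rat comm_group.axioms(2) by blast

lemma mem_bordism_rat: "x \<in> OmQ Y \<longleftrightarrow>
  (\<forall>i. x i \<in> carrier (rOm i Y)) \<and> finite {i. x i \<noteq> \<one>\<^bsub>rOm i Y\<^esub>}"
 unfolding bordism_rat_def by (subst carrier_sum_group) (auto simp: group_rat)

lemma brat_mult: "x \<otimes>\<^bsub>bordism_rat Y\<^esub> y = (\<lambda>i. x i \<otimes>\<^bsub>rOm i Y\<^esub> y i)"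
 by (auto simp: bordism_rat_def restrict_def)

lemma brat_one: "\<one>\<^bsub>bordism_rat Y\<^esub> = (\<lambda>i. \<one>\<^bsub>rOm i Y\<^esub>)"
 by (auto simp: bordism_rat_def restrict_def)

lemma cgroup_rat: "comm_group (bordism_rat Y)"
proof (rule group.group_comm_groupI)
 show "group (bordism_rat Y)" unfolding bordism_rat_def by (rule sum_group) (rule group_rat)
 show "x \<otimes>\<^bsub>bordism_rat Y\<^esub> y = y \<otimes>\<^bsub>bordism_rat Y\<^esub> x" if "x \<in> OmQ Y" "y \<in> OmQ Y" for x y
  unfolding brat_mult
  by (rule ext,rule comm_monoid.m_comm[OF comm_group.axioms(1)[OF comm_group_rat]]) (use that in "auto simp: mem_bordism_rat")
qed

lemma biadditive_hom_elt: "biadditive (bordism_group j Y) (bordism_rat Y) (hom_elt Y j)"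
proof -
 note b = biadditiveD[OF biadditive_tensor_elt[OF bordism_mult_closed[of j Y]]]
 have one: "\<one>\<^bsub>rOm i Y\<^esub> \<in> carrier (rOm i Y)"
  "\<one>\<^bsub>rOm i Y\<^esub> \<otimes>\<^bsub>rOm i Y\<^esub> \<one>\<^bsub>rOm i Y\<^esub> = \<one>\<^bsub>rOm i Y\<^esub>" for i
  using group.is_monoid[OF group_rat[of i Y]] by (auto intro: monoid.one_closed monoid.l_one)
 have "finite {i. hom_elt Y j a q i \<noteq> \<one>\<^bsub>rOm i Y\<^esub>}" for a q
  by (rule finite_subset[of _ "{j}"]) (auto simp: hom_elt_def)
 thus ?thesis
  unfolding biadditive_def mem_bordism_rat brat_mult using b one by (auto simp: hom_elt_def fun_eq_iff)
qed

lemmas hom_elt_closed = biadditiveD(1)[OF biadditive_hom_elt]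
lemmas hom_elt_mult = biadditiveD(2)[OF biadditive_hom_elt]
lemmas hom_elt_add = biadditiveD(3)[OF biadditive_hom_elt]

section \<open>Homogeneous parts, induction over degrees and extension of additive maps\<close>

definition single :: "'y topology => nat => 'y bordism_class tensor => 'y graded_bordism"
 where "single Y j t = (\<lambda>i. if i = j then t else \<one>\<^bsub>rOm i Y\<^esub>)"

lemma single_closed: "t \<in> carrier (rOm j Y) ==> single Y j t \<in> OmQ Y"
proof -
 have "finite {i. single Y j t i \<noteq> \<one>\<^bsub>rOm i Y\<^esub>}"
  by (rule finite_subset[of _ "{j}"]) (auto simp: single_def)
 thus "t \<in> carrier (rOm j Y) ==> single Y j t \<in> OmQ Y"
  using group.is_monoid[OF group_rat] by (auto simp: mem_bordism_rat single_def intro: monoid.one_closed)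
qed

lemma single_mult: "single Y j (s \<otimes>\<^bsub>rOm j Y\<^esub> t) = single Y j s \<otimes>\<^bsub>bordism_rat Y\<^esub> single Y j t"
 using group.is_monoid[OF group_rat] by (auto simp: brat_mult single_def fun_eq_iff intro!: monoid.l_one[symmetric] monoid.one_closed)

lemma single_one: "single Y j \<one>\<^bsub>rOm j Y\<^esub> = \<one>\<^bsub>bordism_rat Y\<^esub>"
 by (auto simp: single_def brat_one fun_eq_iff)

lemma brat_deg_single: "x \<in> bordism_rat_deg j Y ==> x = single Y j (x j)"
 by (auto simp: bordism_rat_deg_def single_def fun_eq_iff)

lemma single_induct:
 assumes t: "t \<in> carrier (rOm j Y)" and one: "P \<one>\<^bsub>bordism_rat Y\<^esub>"
  and mult: "!!x y. x \<in> OmQ Y ==> y \<in> OmQ Y ==> P x ==> P y ==> P (x \<otimes>\<^bsub>bordism_rat Y\<^esub> y)"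
  and elt: "!!a q. a \<in> Om j Y ==> P (hom_elt Y j a q)"
 shows "P (single Y j t)"
 using t
proof (rule rat_tensor_induct[OF bordism_mult_closed])
 show "P (single Y j \<one>\<^bsub>rOm j Y\<^esub>)" using one by (simp add: single_one)
 show "P (single Y j (s \<otimes>\<^bsub>rOm j Y\<^esub> t))"
  if "s \<in> carrier (rOm j Y)" "t \<in> carrier (rOm j Y)" "P (single Y j s)" "P (single Y j t)" for s t
  using mult[OF single_closed[OF that(1)] single_closed[OF that(2)] that(3,4)] by (simp add: single_mult)
 show "P (single Y j (tensor_elt (bordism_group j Y) a q))" if "a \<in> Om j Y" for a q
  using elt[OF that] by (simp add: single_def hom_elt_def)
qed

lemma brat_deg_induct:
 assumes x: "x \<in> bordism_rat_deg j Y" and one: "P \<one>\<^bsub>bordism_rat Y\<^esub>"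
  and mult: "!!x y. x \<in> OmQ Y ==> y \<in> OmQ Y ==> P x ==> P y ==> P (x \<otimes>\<^bsub>bordism_rat Y\<^esub> y)"
  and elt: "!!a q. a \<in> Om j Y ==> P (hom_elt Y j a q)"
 shows "P x"
proof -
 have "x j \<in> carrier (rOm j Y)" using x by (simp add: bordism_rat_deg_def mem_bordism_rat)
 hence "P (single Y j (x j))" by (rule single_induct[OF _ one mult elt])
 thus ?thesis using brat_deg_single[OF x] by simp
qed

lemma brat_induct:
 assumes x: "x \<in> OmQ Y" and one: "P \<one>\<^bsub>bordism_rat Y\<^esub>"
  and mult: "!!x y. x \<in> OmQ Y ==> y \<in> OmQ Y ==> P x ==> P y ==> P (x \<otimes>\<^bsub>bordism_rat Y\<^esub> y)"
  and elt: "!!j a q. a \<in> Om j Y ==> P (hom_elt Y j a q)"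
 shows "P x"
proof -
 interpret R: comm_group "bordism_rat Y" by (rule cgroup_rat)
 \<comment> \<open>The truncation of \<open>x\<close> to the degrees in \<open>F\<close>; for the
   finite support of \<open>x\<close> it is \<open>x\<close> itself.\<close>
 let ?r = "\<lambda>F i. if i \<in> F then x i else \<one>\<^bsub>rOm i Y\<^esub>"
 have xc: "x i \<in> carrier (rOm i Y)" for i using x by (simp add: mem_bordism_rat)
 have oc: "\<one>\<^bsub>rOm i Y\<^esub> \<in> carrier (rOm i Y)" for i
  using group.is_monoid[OF group_rat] by (rule monoid.one_closed)
 have main: "?r F \<in> OmQ Y \<and> P (?r F)" if "finite F" for F
  using that
 proof (induction F rule: finite_induct)
  case empty
  thus ?case using one R.one_closed by (simp add: brat_one)
 next
  case (insert j F)
  have s: "single Y j (x j) \<in> OmQ Y" "P (single Y j (x j))"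
   by (rule single_closed[OF xc]) (rule single_induct[OF xc one mult elt])
  have "?r (insert j F) = single Y j (x j) \<otimes>\<^bsub>bordism_rat Y\<^esub> ?r F"
  proof
   fix i
   have "monoid (rOm i Y)" by (rule group.is_monoid[OF group_rat])
   thus "?r (insert j F) i = (single Y j (x j) \<otimes>\<^bsub>bordism_rat Y\<^esub> ?r F) i"
    using insert.hyps xc[of i] oc[of i] by (auto simp: brat_mult single_def monoid.l_one monoid.r_one)
  qed
  thus ?case using s insert.IH mult R.m_closed by simp
 qed
 have fin: "finite {i. x i \<noteq> \<one>\<^bsub>rOm i Y\<^esub>}" using x by (simp add: mem_bordism_rat)
 have eq: "?r {i. x i \<noteq> \<one>\<^bsub>rOm i Y\<^esub>} = x" by (auto simp: fun_eq_iff)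
 show ?thesis by (rule subst[OF eq,of P]) (rule main[OF fin,THEN conjunct2])
qed

lemma brat_hom_eqI:
 assumes f: "f \<in> hom (bordism_rat Y) C" and g: "g \<in> hom (bordism_rat Y) C" and C: "comm_group C"
  and eq: "!!j a q. a \<in> Om j Y ==> f (hom_elt Y j a q) = g (hom_elt Y j a q)"
  and x: "x \<in> OmQ Y"
 shows "f x = g x"
 using x
proof (rule brat_induct)
 have G: "group (bordism_rat Y)" "group C" using cgroup_rat C comm_group.axioms(2) by blast+
 show "f \<one>\<^bsub>bordism_rat Y\<^esub> = g \<one>\<^bsub>bordism_rat Y\<^esub>" using hom_one[OF f G] hom_one[OF g G] by simp
qed (use hom_mult[OF f] hom_mult[OF g] eq in auto)

text \<open>An element has finitely many components that are not neutral, so the images of its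
  components under the maps \<open>l i\<close> have a finite product in \<open>C\<close>. On a
  homogeneous generator only its own degree can contribute.\<close>

lemma brat_universal:
 assumes C: "comm_group C" and F: "!!j. biadditive (bordism_group j Y) C (F j)"
 obtains \<Phi> where "\<Phi> \<in> hom (bordism_rat Y) C"
  "!!j a q. a \<in> Om j Y ==> \<Phi> (hom_elt Y j a q) = F j a q"
proof -
 interpret C: comm_group C by fact
 have "\<forall>j. \<exists>l. l \<in> hom (rOm j Y) C \<and> (\<forall>a\<in>Om j Y. \<forall>q. l (tensor_elt (bordism_group j Y) a q) = F j a q)"
  using rat_tensor_universal[OF bordism_mult_closed C F] by metis
 then obtain l where l: "!!j. l j \<in> hom (rOm j Y) C"
  "!!j a q. a\<in>Om j Y ==> l j (tensor_elt (bordism_group j Y) a q) = F j a q" by metis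
 let ?\<Phi> = "\<lambda>x. gfinprod C (\<lambda>i. l i (x i)) UNIV"
 have "?\<Phi> \<in> hom (bordism_rat Y) C" unfolding bordism_rat_def by (rule C.hom_group_sum) (auto simp: l group_rat)
 moreover have "?\<Phi> (hom_elt Y j a q) = F j a q" if a: "a \<in> Om j Y" for j a q
 proof -
  let ?f = "\<lambda>i. l i (hom_elt Y j a q i)"
  have fj: "?f j = F j a q" using l(2)[OF a] by (simp add: hom_elt_def)
  have fi: "?f i = \<one>\<^bsub>C\<^esub>" if "i \<noteq> j" for i
   using hom_one[OF l(1) group_rat C.is_group] that by (simp add: hom_elt_def)
  have Fc: "F j a q \<in> carrier C" using biadditiveD(1)[OF F a] .
  \<comment> \<open>The support is \<open>{j}\<close>, unless the value itself is neutral and the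
    support is empty.\<close>
  show ?thesis
  proof (cases "F j a q = \<one>\<^bsub>C\<^esub>")
   case True
   have "?f i = \<one>\<^bsub>C\<^esub>" for i by (cases "i = j") (use True fi fj in auto)
   hence "{i \<in> UNIV. ?f i \<noteq> \<one>\<^bsub>C\<^esub>} = {}" by blast
   thus ?thesis using True by (simp add: gfinprod_def)
  next
   case False
   have e: "{i \<in> UNIV. ?f i \<noteq> \<one>\<^bsub>C\<^esub>} = {j}"
   proof (intro equalityI subsetI)
    fix i assume "i \<in> {i \<in> UNIV. ?f i \<noteq> \<one>\<^bsub>C\<^esub>}"
    thus "i \<in> {j}" using fi by blast
   qed (use False fj in auto)
   show ?thesis unfolding gfinprod_def e using fj Fc by (simp add: C.finprod_singleton_swap C.finprod_insert)
  qed
 qed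
 ultimately show ?thesis using that by blast
qed

lemma bscale_hom: "bordism_scale Y q \<in> hom (bordism_rat Y) (bordism_rat Y)"
proof (rule homI)
 note h = tensor_scale(1)[OF bordism_mult_closed[of _ Y]]
 have one: "tensor_scale (bordism_group i Y) q \<one>\<^bsub>rOm i Y\<^esub> = \<one>\<^bsub>rOm i Y\<^esub>" for i
  by (rule hom_one[OF h group_rat group_rat])
 show "bordism_scale Y q x \<in> OmQ Y" if "x \<in> OmQ Y" for x
 proof -
  have "{i. tensor_scale (bordism_group i Y) q (x i) \<noteq> \<one>\<^bsub>rOm i Y\<^esub>} \<subseteq> {i. x i \<noteq> \<one>\<^bsub>rOm i Y\<^esub>}"
   using one by auto
  hence "finite {i. tensor_scale (bordism_group i Y) q (x i) \<noteq> \<one>\<^bsub>rOm i Y\<^esub>}"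
   using that finite_subset by (auto simp: mem_bordism_rat)
  thus ?thesis using that unfolding mem_bordism_rat bordism_scale_def
   by (intro conjI allI hom_in_carrier[OF h]) auto
 qed
 show "bordism_scale Y q (x \<otimes>\<^bsub>bordism_rat Y\<^esub> y) = bordism_scale Y q x \<otimes>\<^bsub>bordism_rat Y\<^esub> bordism_scale Y q y"
  if "x \<in> OmQ Y" "y \<in> OmQ Y" for x y
  using that hom_mult[OF h] by (simp add: bordism_scale_def brat_mult mem_bordism_rat fun_eq_iff)
qed

lemma bscale_elt:
 "a \<in> Om j Y ==> bordism_scale Y q (hom_elt Y j a r) = hom_elt Y j a (q * r)"
 using hom_one[OF tensor_scale(1)[OF bordism_mult_closed] group_rat group_rat]
 by (auto simp: bordism_scale_def hom_elt_def fun_eq_iff tensor_scale(2)[OF bordism_mult_closed])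

text \<open>A choice of the additive extension; by \<open>brat_hom_eqI\<close> it is unique on the
  carrier when \<open>C\<close> is an abelian group.\<close>

definition hom_extend :: "'y topology => ('c,'d) monoid_scheme => (nat => 'y bordism_class => rat => 'c) => 'y graded_bordism => 'c"
 where "hom_extend Y C F = (SOME f. f \<in> hom (bordism_rat Y) C \<and>
  (\<forall>j q. \<forall>a\<in>Om j Y. f (hom_elt Y j a q) = F j a q))"

lemma hom_extend:
 assumes "comm_group C" "!!j. biadditive (bordism_group j Y) C (F j)"
 shows "hom_extend Y C F \<in> hom (bordism_rat Y) C"
  and "a \<in> Om j Y ==> hom_extend Y C F (hom_elt Y j a q) = F j a q"
proof -
 have "\<exists>f. f \<in> hom (bordism_rat Y) C \<and> (\<forall>j q. \<forall>a\<in>Om j Y. f (hom_elt Y j a q) = F j a q)"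
  by (rule brat_universal[OF assms]) blast
 hence "hom_extend Y C F \<in> hom (bordism_rat Y) C \<and>
  (\<forall>j q. \<forall>a\<in>Om j Y. hom_extend Y C F (hom_elt Y j a q) = F j a q)"
  unfolding hom_extend_def by (rule someI_ex)
 thus "hom_extend Y C F \<in> hom (bordism_rat Y) C"
  "a \<in> Om j Y ==> hom_extend Y C F (hom_elt Y j a q) = F j a q" by blast+
qed

section \<open>Garlands\<close>

subsection \<open>Joining and renumbering graphs\<close>

lemma agraph_indexE:
 assumes "allowed_graph \<NN> \<Gamma>" "e \<in> gg_indices \<Gamma>"
 obtains a b where "a < b" "b < gg_nu \<Gamma>" "e = {a,b}"
proof -
 have "\<forall>e\<in>gg_indices \<Gamma>. \<exists>a b. a < b \<and> b < gg_nu \<Gamma> \<and> e = {a,b}"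
  using assms(1) unfolding allowed_graph_def by (elim conjE)
 thus thesis using assms(2) that by blast
qed

lemma agraph_index:
 "allowed_graph \<NN> \<Gamma> ==> e \<in> gg_indices \<Gamma> ==> i \<in> e ==> i < gg_nu \<Gamma>"
 by (erule (1) agraph_indexE) auto

lemma gg_nu_join [simp]: "gg_nu (gg_join \<Gamma>1 \<Gamma>2) = gg_nu \<Gamma>1 + gg_nu \<Gamma>2"
 by (simp add: gg_nu_def gg_join_def)

lemma gg_edges_join: "(e,i) \<in> gg_edges (gg_join \<Gamma>1 \<Gamma>2) \<longleftrightarrow>
  (e,i) \<in> gg_edges \<Gamma>1 \<or> (\<exists>e' i'. (e',i') \<in> gg_edges \<Gamma>2 \<and> e = (+) (gg_nu \<Gamma>1) ` e' \<and> i = gg_nu \<Gamma>1 + i')"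
 by (auto simp: gg_edges_def gg_join_def)

lemma gg_cycle_map:
 assumes c: "gg_cycle \<Gamma> vs" and inj: "inj_on F (set vs)"
  and adj: "!!v w. v \<in> set vs ==> w \<in> set vs ==> gg_adj \<Gamma> v w ==> gg_adj \<Gamma>' (F v) (F w)"
 shows "gg_cycle \<Gamma>' (map F vs)"
proof -
 have l: "3 \<le> length vs" "distinct vs" "!!k. k < length vs ==> gg_adj \<Gamma> (vs ! k) (vs ! (Suc k mod length vs))"
  using c by (auto simp: gg_cycle_def)
 have "gg_adj \<Gamma>' (map F vs ! k) (map F vs ! (Suc k mod length vs))" if k: "k < length vs" for k
 proof -
  have "Suc k mod length vs < length vs" using k by (intro mod_less_divisor) auto
  thus ?thesis using adj[OF _ _ l(3)[OF k]] k by simp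
 qed
 thus ?thesis using l inj by (simp add: gg_cycle_def distinct_map)
qed

text \<open>Apart from the vertex \<open>M\<close> the join is a disjoint union. No edge leads from
  one part to the other, so a cycle would lie in one part and yield a cycle of
  \<open>\<Gamma>1\<close> or, after shifting back, of \<open>\<Gamma>2\<close>.\<close>

lemma agraph_join:
 assumes 1: "allowed_graph \<NN> \<Gamma>1" and 2: "allowed_graph \<NN> \<Gamma>2" shows "allowed_graph \<NN> (gg_join \<Gamma>1 \<Gamma>2)"
proof -
 let ?n = "gg_nu \<Gamma>1" and ?G = "gg_join \<Gamma>1 \<Gamma>2"
 have "\<exists>a b. a < b \<and> b < gg_nu ?G \<and> e = {a,b}" if "e \<in> gg_indices ?G" for e
 proof -
  from that consider "e \<in> gg_indices \<Gamma>1" | e' where "e' \<in> gg_indices \<Gamma>2" "e = (+) ?n ` e'" by (auto simp: gg_join_def)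
  thus ?thesis
  proof cases
   case 1
   obtain a b where "a < b" "b < ?n" "e = {a,b}" using assms(1) 1 by (rule agraph_indexE)
   thus ?thesis by (intro exI[of _ a] exI[of _ b]) auto
  next
   case 2
   obtain a b where "a < b" "b < gg_nu \<Gamma>2" "e' = {a,b}" using assms(2) 2(1) by (rule agraph_indexE)
   thus ?thesis using 2 by (intro exI[of _ "?n + a"] exI[of _ "?n + b"]) auto
  qed
 qed
 moreover have "\<not> gg_cycle ?G vs" for vs
 proof
  assume c: "gg_cycle ?G vs"
  \<comment> \<open>The embedding of the vertices of the second graph: numbers are shifted by
    \<open>?n\<close>, indices elementwise.\<close>
  let ?S = "map_sum ((+) ?n) ((`) ((+) ?n)) :: nat + nat set => nat + nat set"
  have adj: "gg_adj \<Gamma>1 v w \<and> v \<notin> range ?S \<and> w \<notin> range ?S \<or> (\<exists>v' w'. v = ?S v' \<and> w = ?S w' \<and> gg_adj \<Gamma>2 v' w')"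
   if vw: "gg_adj ?G v w" for v w
  proof -
   obtain e i where e: "(e,i) \<in> gg_edges ?G" "v = Inl i \<and> w = Inr e \<or> v = Inr e \<and> w = Inl i"
    using vw unfolding gg_adj_def by blast
   from e(1)[unfolded gg_edges_join] show ?thesis
   proof (elim disjE exE conjE)
    assume 1: "(e,i) \<in> gg_edges \<Gamma>1"
    \<comment> \<open>Containing the small number \<open>i\<close> keeps \<open>e\<close> out of the
      range of \<open>?S\<close>; the empty set would be its own shift.\<close>
    hence "i \<in> e" "i < ?n" using agraph_index[OF assms(1)] by (auto simp: gg_edges_def)
    hence "?S u \<noteq> Inl i" "?S u \<noteq> Inr e" for u by (cases u; auto)+
    moreover have "gg_adj \<Gamma>1 v w" using 1 e(2) unfolding gg_adj_def by blast
    ultimately show ?thesis using e(2) by blast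
   next
    fix e' i' assume 2: "(e',i') \<in> gg_edges \<Gamma>2" "e = (+) ?n ` e'" "i = ?n + i'"
    have "gg_adj \<Gamma>2 (Inl i') (Inr e')" "gg_adj \<Gamma>2 (Inr e') (Inl i')" using 2(1) unfolding gg_adj_def by blast+
    moreover have "?S (Inl i') = Inl i" "?S (Inr e') = Inr e" using 2 by simp_all
    ultimately show ?thesis using e(2) by metis
   qed
  qed
  have l: "3 \<le> length vs" "!!k. k < length vs ==> gg_adj ?G (vs ! k) (vs ! (Suc k mod length vs))"
   using c by (auto simp: gg_cycle_def)
  \<comment> \<open>Neighbours lie in the same part, so the first vertex of the cycle decides for
    all of them.\<close>
  have same: "vs ! k \<in> range ?S \<longleftrightarrow> vs ! 0 \<in> range ?S" if "k < length vs" for k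
   using that
  proof (induction k)
   case (Suc k)
   hence "k < length vs" by simp
   hence "vs ! k \<in> range ?S \<longleftrightarrow> vs ! (Suc k mod length vs) \<in> range ?S" using adj[OF l(2)[of k]] by blast
   thus ?case using Suc by simp
  qed simp
  have mem: "v \<in> range ?S \<longleftrightarrow> vs ! 0 \<in> range ?S" if "v \<in> set vs" for v using that same by (auto simp: in_set_conv_nth)
  show False
  proof (cases "vs ! 0 \<in> range ?S")
   case False
   have "gg_cycle \<Gamma>1 (map (\<lambda>v. v) vs)"
    by (rule gg_cycle_map[OF c inj_on_id2]) (use adj mem False in blast)
   thus False using 1 unfolding allowed_graph_def by blast
  next
   case True
   let ?F = "map_sum (\<lambda>i. i - ?n) ((`) (\<lambda>i. i - ?n)) :: nat + nat set => nat + nat set"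
   have FS: "?F (?S v) = v" for v by (cases v) (auto simp: image_image)
   have "gg_cycle \<Gamma>2 (map ?F vs)"
   proof (rule gg_cycle_map[OF c])
    show "inj_on ?F (set vs)"
    proof (rule inj_on_inverseI)
     fix v assume "v \<in> set vs"
     then obtain u where "v = ?S u" using mem True by blast
     thus "?S (?F v) = v" by (simp only: FS)
    qed
    fix v w assume vw: "v \<in> set vs" "gg_adj ?G v w"
    then obtain v' w' where "v = ?S v'" "w = ?S w'" "gg_adj \<Gamma>2 v' w'" using adj[OF vw(2)] mem[OF vw(1)] True by blast
    thus "gg_adj \<Gamma>2 (?F v) (?F w)" by (simp only: FS)
   qed
   thus False using 2 unfolding allowed_graph_def by blast
  qed
 qed
 ultimately show ?thesis using 1 2 by (auto simp: allowed_graph_def gg_join_def)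
qed

section \<open>Renumbering of graphs\<close>

lemma permutes_inv_into:
 assumes "\<alpha> permutes S"
 shows "inv_into UNIV \<alpha> permutes S" "inv_into UNIV \<alpha> (\<alpha> i) = i" "\<alpha> (inv_into UNIV \<alpha> i) = i"
  "inv_into UNIV \<alpha> ` \<alpha> ` e = e" "\<alpha> ` inv_into UNIV \<alpha> ` e = e"
 using permutes_inv[OF assms] permutes_inverses[OF assms] by (auto simp: image_image)

lemma permute_list_eqI:
 assumes "\<alpha> permutes {..<length xs}" "length ys = length xs" "!!i. i < length xs ==> ys ! \<alpha> i = xs ! i"
 shows "permute_list (inv_into UNIV \<alpha>) xs = ys"
proof (rule nth_equalityI)
 fix i assume "i < length (permute_list (inv_into UNIV \<alpha>) xs)"
 hence i: "i < length xs" by simp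
 hence "inv_into UNIV \<alpha> i < length xs" using permutes_in_image[OF permutes_inv_into(1)[OF assms(1)],of i] by simp
 thus "permute_list (inv_into UNIV \<alpha>) xs ! i = ys ! i"
  using assms(3)[of "inv_into UNIV \<alpha> i"] i permutes_inv_into[OF assms(1)] by (simp add: permute_list_nth)
qed (use assms in simp)

lemma permute_list_inv_nth:
 assumes "\<alpha> permutes {..<length xs}" "i < length xs"
 shows "permute_list (inv_into UNIV \<alpha>) xs ! \<alpha> i = xs ! i"
proof -
 have "\<alpha> i < length xs" using permutes_in_image[OF assms(1),of i] assms(2) by simp
 thus ?thesis using permutes_inv_into[OF assms(1)] by (simp add: permute_list_nth)
qed

lemma gg_permute_simps:
 assumes "gg_nu \<Gamma> = n"
 shows "gg_labels (gg_permute n \<alpha> \<Gamma>) = permute_list (inv_into UNIV \<alpha>) (gg_labels \<Gamma>)"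
  "gg_indices (gg_permute n \<alpha> \<Gamma>) = (`) \<alpha> ` gg_indices \<Gamma>" "gg_nu (gg_permute n \<alpha> \<Gamma>) = n"
 using assms by (auto simp: gg_permute_def gg_nu_def)

lemma gg_edges_permute:
 assumes "gg_nu \<Gamma> = n" "\<alpha> permutes {..<n}"
 shows "gg_edges (gg_permute n \<alpha> \<Gamma>) = (\<lambda>(e,i). (\<alpha> ` e,\<alpha> i)) ` gg_edges \<Gamma>"
 by (auto simp: gg_edges_def gg_permute_simps[OF assms(1)])

lemma agraph_permute:
 assumes a: "allowed_graph \<NN> \<Gamma>" and n: "gg_nu \<Gamma> = n" and p: "\<alpha> permutes {..<n}"
 shows "allowed_graph \<NN> (gg_permute n \<alpha> \<Gamma>)"
proof -
 note inv = permutes_inv_into[OF p]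
 let ?G = "gg_permute n \<alpha> \<Gamma>" and ?i = "inv_into UNIV \<alpha>"
 have "set (gg_labels ?G) \<subseteq> \<NN>"
  using a inv(1) n by (simp add: gg_permute_simps[OF n] set_permute_list gg_nu_def allowed_graph_def)
 moreover have "\<exists>a b. a < b \<and> b < gg_nu ?G \<and> e = {a,b}" if e: "e \<in> gg_indices ?G" for e
 proof -
  obtain e' where e': "e' \<in> gg_indices \<Gamma>" "e = \<alpha> ` e'" using e by (auto simp: gg_permute_simps[OF n])
  obtain a b where ab: "a < b" "b < n" "e' = {a,b}" using a e'(1) unfolding n[symmetric] by (rule agraph_indexE)
  have lt: "\<alpha> a < n" "\<alpha> b < n" using permutes_in_image[OF p,of a] permutes_in_image[OF p,of b] ab by auto
  have "\<alpha> a \<noteq> \<alpha> b" using inv(2) ab(1) by (metis less_irrefl)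
  \<comment> \<open>A renumbering may reverse the order of the two ends of an index.\<close>
  then consider "\<alpha> a < \<alpha> b" | "\<alpha> b < \<alpha> a" by linarith
  thus ?thesis
  proof cases
   case 1
   thus ?thesis using lt e' ab by (intro exI[of _ "\<alpha> a"] exI[of _ "\<alpha> b"]) (auto simp: gg_permute_simps[OF n])
  next
   case 2
   thus ?thesis using lt e' ab by (intro exI[of _ "\<alpha> b"] exI[of _ "\<alpha> a"]) (auto simp: gg_permute_simps[OF n])
  qed
 qed
 moreover have "\<not> gg_cycle ?G vs" for vs
 proof
  assume c: "gg_cycle ?G vs"
  let ?F = "map_sum ?i ((`) ?i) :: nat + nat set => nat + nat set"
  have "map_sum \<alpha> ((`) \<alpha>) (?F v) = v" for v by (cases v) (auto simp: inv)
  hence "inj ?F" by (rule inj_on_inverseI)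
  hence "gg_cycle \<Gamma> (map ?F vs)"
  proof (intro gg_cycle_map[OF c])
   fix v w assume "gg_adj ?G v w"
   then obtain e i where "(e,i) \<in> gg_edges ?G" and vw: "v = Inl i \<and> w = Inr e \<or> v = Inr e \<and> w = Inl i"
    unfolding gg_adj_def by blast
   then obtain e' i' where e': "(e',i') \<in> gg_edges \<Gamma>" "e = \<alpha> ` e'" "i = \<alpha> i'" unfolding gg_edges_permute[OF n p] by auto
   show "gg_adj \<Gamma> (?F v) (?F w)"
    unfolding gg_adj_def by (rule exI[of _ e'],rule exI[of _ i']) (use vw e' in "auto simp: inv")
  qed (auto intro: inj_on_subset)
  thus False using a unfolding allowed_graph_def by blast
 qed
 ultimately show ?thesis by (auto simp: allowed_graph_def)
qed

subsection \<open>Joining and renumbering diagrams\<close>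

lemma garlands_of_type_pts:
 assumes "d \<in> topspace (diagrams M \<Gamma>)"
 shows "fst d \<in> extensional (gg_edges \<Gamma>)" "snd d \<in> extensional {..<gg_nu \<Gamma>}"
  "!!e a b. e \<in> gg_indices \<Gamma> ==> a \<in> e ==> b \<in> e ==> snd d a (fst d (e,a)) = snd d b (fst d (e,b))"
proof -
 have d: "fst d \<in> topspace (product_topology (\<lambda>(e,i). mf_top (gg_labels \<Gamma> ! i)) (gg_edges \<Gamma>))"
  "snd d \<in> topspace (product_topology (\<lambda>i. compact_open_topology (mf_top (gg_labels \<Gamma> ! i)) (mf_top M)) {..<gg_nu \<Gamma>})"
  "d \<in> {(x,f). \<forall>e\<in>gg_indices \<Gamma>. \<forall>a\<in>e. \<forall>b\<in>e. f a (x (e,a)) = f b (x (e,b))}"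
  using assms unfolding garlands_of_type_def topspace_subtopology topspace_prod_topology Int_iff mem_Times_iff by (simp_all only:)
 show "fst d \<in> extensional (gg_edges \<Gamma>)" "snd d \<in> extensional {..<gg_nu \<Gamma>}"
  using d(1,2) by (auto simp only: topspace_product_topology PiE_iff)
 show "snd d a (fst d (e,a)) = snd d b (fst d (e,b))" if "e \<in> gg_indices \<Gamma>" "a \<in> e" "b \<in> e" for e a b
  using d(3)[unfolded mem_Collect_eq case_prod_unfold,rule_format,OF that] .
qed

lemma cont_garland_fst:
 "(e,i) \<in> gg_edges \<Gamma> ==> continuous_map (diagrams M \<Gamma>) (mf_top (gg_labels \<Gamma> ! i)) (\<lambda>d. fst d (e,i))"
proof -
 assume a: "(e,i) \<in> gg_edges \<Gamma>"
 have "continuous_map (product_topology (\<lambda>(e,i). mf_top (gg_labels \<Gamma> ! i)) (gg_edges \<Gamma>)) (mf_top (gg_labels \<Gamma> ! i)) (\<lambda>x. x (e,i))"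
  using continuous_map_product_projection[OF a,of "\<lambda>(e,i). mf_top (gg_labels \<Gamma> ! i)"] by simp
 thus ?thesis unfolding garlands_of_type_def
  using continuous_map_compose[OF continuous_map_fst] by (intro continuous_map_from_subtopology) (auto simp: o_def)
qed

lemma cont_garland_snd:
 "i < gg_nu \<Gamma> ==> continuous_map (diagrams M \<Gamma>) (compact_open_topology (mf_top (gg_labels \<Gamma> ! i)) (mf_top M)) (\<lambda>d. snd d i)"
proof -
 assume a: "i < gg_nu \<Gamma>"
 have "continuous_map (product_topology (\<lambda>i. compact_open_topology (mf_top (gg_labels \<Gamma> ! i)) (mf_top M)) {..<gg_nu \<Gamma>})
   (compact_open_topology (mf_top (gg_labels \<Gamma> ! i)) (mf_top M)) (\<lambda>x. x i)"
  using continuous_map_product_projection[of i "{..<gg_nu \<Gamma>}" "\<lambda>i. compact_open_topology (mf_top (gg_labels \<Gamma> ! i)) (mf_top M)"] a by simp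
 thus ?thesis unfolding garlands_of_type_def
  using continuous_map_compose[OF continuous_map_snd] by (intro continuous_map_from_subtopology) (auto simp: o_def)
qed

lemma cont_into_garlands:
 assumes ext: "!!p. p \<in> topspace X ==> fst (f p) \<in> extensional (gg_edges \<Gamma>)" "!!p. p \<in> topspace X ==> snd (f p) \<in> extensional {..<gg_nu \<Gamma>}"
  and c1: "!!e i. (e,i) \<in> gg_edges \<Gamma> ==> continuous_map X (mf_top (gg_labels \<Gamma> ! i)) (\<lambda>p. fst (f p) (e,i))"
  and c2: "!!i. i < gg_nu \<Gamma> ==> continuous_map X (compact_open_topology (mf_top (gg_labels \<Gamma> ! i)) (mf_top M)) (\<lambda>p. snd (f p) i)"
  and com: "!!p e a b. p \<in> topspace X ==> e \<in> gg_indices \<Gamma> ==> a \<in> e ==> b \<in> e ==>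
   snd (f p) a (fst (f p) (e,a)) = snd (f p) b (fst (f p) (e,b))"
 shows "continuous_map X (diagrams M \<Gamma>) f"
proof -
 have 1: "continuous_map X (product_topology (\<lambda>(e,i). mf_top (gg_labels \<Gamma> ! i)) (gg_edges \<Gamma>)) (\<lambda>p. fst (f p))"
  unfolding continuous_map_componentwise using ext(1) c1 by auto
 have 2: "continuous_map X (product_topology (\<lambda>i. compact_open_topology (mf_top (gg_labels \<Gamma> ! i)) (mf_top M)) {..<gg_nu \<Gamma>}) (\<lambda>p. snd (f p))"
  unfolding continuous_map_componentwise using ext(2) c2 by auto
 show ?thesis unfolding garlands_of_type_def continuous_map_in_subtopology
 proof (intro conjI)
  show "continuous_map X (prod_topology (product_topology (\<lambda>(e,i). mf_top (gg_labels \<Gamma> ! i)) (gg_edges \<Gamma>))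
   (product_topology (\<lambda>i. compact_open_topology (mf_top (gg_labels \<Gamma> ! i)) (mf_top M)) {..<gg_nu \<Gamma>})) f"
   unfolding continuous_map_componentwise_UNIV continuous_map_pairwise using 1 2 by (simp add: o_def)
  show "f \<in> topspace X \<rightarrow> {(x,F). \<forall>e\<in>gg_indices \<Gamma>. \<forall>a\<in>e. \<forall>b\<in>e. F a (x (e,a)) = F b (x (e,b))}"
   unfolding Pi_iff mem_Collect_eq case_prod_unfold by (intro ballI com)
 qed
qed

lemma djoin_simps:
 assumes a: "allowed_graph \<NN> \<Gamma>1"
 shows "(e,i) \<in> gg_edges \<Gamma>1 ==> fst (diagram_join \<Gamma>1 \<Gamma>2 d1 d2) (e,i) = fst d1 (e,i)"
  and "(e,i) \<in> gg_edges \<Gamma>2 ==> fst (diagram_join \<Gamma>1 \<Gamma>2 d1 d2) ((+) (gg_nu \<Gamma>1) ` e,gg_nu \<Gamma>1 + i) = fst d2 (e,i)"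
  and "i < gg_nu \<Gamma>1 ==> snd (diagram_join \<Gamma>1 \<Gamma>2 d1 d2) i = snd d1 i"
  and "i < gg_nu \<Gamma>2 ==> snd (diagram_join \<Gamma>1 \<Gamma>2 d1 d2) (gg_nu \<Gamma>1 + i) = snd d2 i"
  and "fst (diagram_join \<Gamma>1 \<Gamma>2 d1 d2) \<in> extensional (gg_edges (gg_join \<Gamma>1 \<Gamma>2))"
  and "snd (diagram_join \<Gamma>1 \<Gamma>2 d1 d2) \<in> extensional {..<gg_nu (gg_join \<Gamma>1 \<Gamma>2)}"
proof -
 show "(e,i) \<in> gg_edges \<Gamma>1 ==> fst (diagram_join \<Gamma>1 \<Gamma>2 d1 d2) (e,i) = fst d1 (e,i)"
 proof -
  assume e: "(e,i) \<in> gg_edges \<Gamma>1"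
  hence "(e,i) \<in> gg_edges (gg_join \<Gamma>1 \<Gamma>2)" unfolding gg_edges_join by blast
  moreover have "i < gg_nu \<Gamma>1" using e agraph_index[OF a,of e i] by (simp add: gg_edges_def)
  ultimately show ?thesis by (simp add: diagram_join_def case_prod_unfold)
 qed
 show "(e,i) \<in> gg_edges \<Gamma>2 ==> fst (diagram_join \<Gamma>1 \<Gamma>2 d1 d2) ((+) (gg_nu \<Gamma>1) ` e,gg_nu \<Gamma>1 + i) = fst d2 (e,i)"
  by (auto simp: diagram_join_def case_prod_unfold gg_edges_join image_image)
qed (auto simp: diagram_join_def case_prod_unfold)

text \<open>The maps \<open>diagram_join\<close> for all pairs of graphs form a single operation on
  the space of garlands, so the product on bordism can be built for one space with one
  multiplication.\<close>

definition garland_join :: "('n,'m) garland \<times> ('n,'m) garland => ('n,'m) garland"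
 where "garland_join = (\<lambda>((\<Gamma>1,d1),(\<Gamma>2,d2)). (gg_join \<Gamma>1 \<Gamma>2,diagram_join \<Gamma>1 \<Gamma>2 d1 d2))"

lemma gg_labels_join_nth:
 "i < gg_nu \<Gamma>1 ==> gg_labels (gg_join \<Gamma>1 \<Gamma>2) ! i = gg_labels \<Gamma>1 ! i"
 "gg_labels (gg_join \<Gamma>1 \<Gamma>2) ! (gg_nu \<Gamma>1 + j) = gg_labels \<Gamma>2 ! j"
 by (auto simp: gg_join_def gg_nu_def nth_append)

lemma cont_diagram_join:
 assumes a: "allowed_graph \<NN> \<Gamma>1" "allowed_graph \<NN> \<Gamma>2"
 shows "continuous_map (prod_topology (diagrams M \<Gamma>1) (diagrams M \<Gamma>2)) (diagrams M (gg_join \<Gamma>1 \<Gamma>2))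
  (\<lambda>(d1,d2). diagram_join \<Gamma>1 \<Gamma>2 d1 d2)"
proof -
 let ?X = "prod_topology (diagrams M \<Gamma>1) (diagrams M \<Gamma>2)"
 let ?f = "\<lambda>p. diagram_join \<Gamma>1 \<Gamma>2 (fst p) (snd p)"
 note js = djoin_simps[OF a(1)]
 have pr1: "continuous_map ?X T (\<lambda>p. g (fst p))" if "continuous_map (diagrams M \<Gamma>1) T g" for T :: "'t topology" and g
  using continuous_map_compose[OF continuous_map_fst that] by (simp add: o_def)
 have pr2: "continuous_map ?X T (\<lambda>p. g (snd p))" if "continuous_map (diagrams M \<Gamma>2) T g" for T :: "'t topology" and g
  using continuous_map_compose[OF continuous_map_snd that] by (simp add: o_def)
 have "continuous_map ?X (diagrams M (gg_join \<Gamma>1 \<Gamma>2)) ?f"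
 proof (rule cont_into_garlands)
  show "fst (?f p) \<in> extensional (gg_edges (gg_join \<Gamma>1 \<Gamma>2))" "snd (?f p) \<in> extensional {..<gg_nu (gg_join \<Gamma>1 \<Gamma>2)}" for p
   using js(5,6) .
 next
  fix e i assume "(e,i) \<in> gg_edges (gg_join \<Gamma>1 \<Gamma>2)"
  then consider "(e,i) \<in> gg_edges \<Gamma>1" | e' i' where "(e',i') \<in> gg_edges \<Gamma>2" "e = (+) (gg_nu \<Gamma>1) ` e'" "i = gg_nu \<Gamma>1 + i'"
   unfolding gg_edges_join by blast
  thus "continuous_map ?X (mf_top (gg_labels (gg_join \<Gamma>1 \<Gamma>2) ! i)) (\<lambda>p. fst (?f p) (e,i))"
  proof cases
   case 1
   hence "i < gg_nu \<Gamma>1" using agraph_index[OF a(1)] by (auto simp: gg_edges_def)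
   thus ?thesis using pr1[OF cont_garland_fst[OF 1,of M]] by (simp add: js(1)[OF 1] gg_labels_join_nth)
  next
   case 2
   thus ?thesis using pr2[OF cont_garland_fst[OF 2(1),of M]] by (simp add: js(2)[OF 2(1)] gg_labels_join_nth)
  qed
 next
  fix i assume i: "i < gg_nu (gg_join \<Gamma>1 \<Gamma>2)"
  show "continuous_map ?X (compact_open_topology (mf_top (gg_labels (gg_join \<Gamma>1 \<Gamma>2) ! i)) (mf_top M)) (\<lambda>p. snd (?f p) i)"
  proof (cases "i < gg_nu \<Gamma>1")
   case True
   thus ?thesis using pr1[OF cont_garland_snd[OF True,of M]] by (simp add: js(3)[OF True] gg_labels_join_nth)
  next
   case False
   then obtain j where j: "i = gg_nu \<Gamma>1 + j" using le_Suc_ex by (metis not_less)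
   hence "j < gg_nu \<Gamma>2" using i by simp
   thus ?thesis using pr2[OF cont_garland_snd[of j \<Gamma>2 M]] by (simp add: j js(4) gg_labels_join_nth)
  qed
 next
  fix p e i j assume p: "p \<in> topspace ?X" and e: "e \<in> gg_indices (gg_join \<Gamma>1 \<Gamma>2)" "i \<in> e" "j \<in> e"
  have p1: "fst p \<in> topspace (diagrams M \<Gamma>1)" and p2: "snd p \<in> topspace (diagrams M \<Gamma>2)" using p by auto
  from e(1) consider "e \<in> gg_indices \<Gamma>1" | e' where "e' \<in> gg_indices \<Gamma>2" "e = (+) (gg_nu \<Gamma>1) ` e'" by (auto simp: gg_join_def)
  thus "snd (?f p) i (fst (?f p) (e,i)) = snd (?f p) j (fst (?f p) (e,j))"
  proof cases
   case 1
   hence "(e,i) \<in> gg_edges \<Gamma>1" "(e,j) \<in> gg_edges \<Gamma>1" "i < gg_nu \<Gamma>1" "j < gg_nu \<Gamma>1"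
    using e agraph_index[OF a(1)] by (auto simp: gg_edges_def)
   thus ?thesis using garlands_of_type_pts(3)[OF p1 1 e(2,3)] by (simp add: js)
  next
   case 2
   then obtain i' j' where ij: "i = gg_nu \<Gamma>1 + i'" "j = gg_nu \<Gamma>1 + j'" "i' \<in> e'" "j' \<in> e'" using e by auto
   hence "(e',i') \<in> gg_edges \<Gamma>2" "(e',j') \<in> gg_edges \<Gamma>2" "i' < gg_nu \<Gamma>2" "j' < gg_nu \<Gamma>2"
    using 2 agraph_index[OF a(2)] by (auto simp: gg_edges_def)
   thus ?thesis using garlands_of_type_pts(3)[OF p2 2(1) ij(3,4)] by (simp add: js ij 2(2))
  qed
 qed
 thus ?thesis by (simp add: case_prod_unfold)
qed

lemma topspace_garlands: "g \<in> topspace (garlands \<NN> M) \<longleftrightarrow> allowed_graph \<NN> (fst g) \<and> snd g \<in> topspace (diagrams M (fst g))"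
 by (cases g) (auto simp: garlands_def)

lemma cont_from_sum_topology:
 assumes "!!i. i \<in> I ==> continuous_map (X i) Y (\<lambda>x. f (i,x))"
 shows "continuous_map (sum_topology X I) Y f"
 unfolding continuous_map_def
proof (intro conjI allI impI)
 show "f \<in> topspace (sum_topology X I) \<rightarrow> topspace Y"
  using continuous_map_image_subset_topspace[OF assms] by fastforce
 fix U assume U: "openin Y U"
 show "openin (sum_topology X I) {x \<in> topspace (sum_topology X I). f x \<in> U}"
  unfolding openin_sum_topology
 proof (intro conjI ballI)
  fix i assume i: "i \<in> I"
  have "{x. (i,x) \<in> {x \<in> topspace (sum_topology X I). f x \<in> U}} = {x \<in> topspace (X i). f (i,x) \<in> U}" using i by auto
  thus "openin (X i) {x. (i,x) \<in> {x \<in> topspace (sum_topology X I). f x \<in> U}}"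
   using openin_continuous_map_preimage[OF assms[OF i] U] by simp
 qed auto
qed

lemma cont_garland_incl: "allowed_graph \<NN> \<Gamma> ==> continuous_map (diagrams M \<Gamma>) (garlands \<NN> M) (Pair \<Gamma>)"
 unfolding garlands_def by (rule continuous_map_component_injection) simp

text \<open>Continuity is tested at a pair of garlands. The summands belonging to their two graphs
  are open in the disjoint union, so an open box of pairs of diagrams is also an open box of pairs
  of garlands.\<close>

lemma cont_garland_join: "continuous_map (prod_topology (garlands \<NN> M) (garlands \<NN> M)) (garlands \<NN> M) garland_join"
 unfolding continuous_map_def
proof (intro conjI allI impI)
 let ?G = "garlands \<NN> M"
 have comp: "continuous_map (prod_topology (diagrams M \<Gamma>1) (diagrams M \<Gamma>2)) ?G (\<lambda>p. garland_join ((\<Gamma>1,fst p),(\<Gamma>2,snd p)))"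
  if "allowed_graph \<NN> \<Gamma>1" "allowed_graph \<NN> \<Gamma>2" for \<Gamma>1 \<Gamma>2
  using continuous_map_compose[OF cont_diagram_join[OF that] cont_garland_incl[OF agraph_join[OF that]]]
  by (simp add: garland_join_def o_def case_prod_unfold)
 show "garland_join \<in> topspace (prod_topology ?G ?G) \<rightarrow> topspace ?G"
 proof
  fix z assume "z \<in> topspace (prod_topology ?G ?G)"
  then obtain \<Gamma>1 d1 \<Gamma>2 d2 where z: "z = ((\<Gamma>1,d1),(\<Gamma>2,d2))" "(\<Gamma>1,d1) \<in> topspace ?G" "(\<Gamma>2,d2) \<in> topspace ?G" by (cases z) auto
  hence a: "allowed_graph \<NN> \<Gamma>1" "allowed_graph \<NN> \<Gamma>2" "(d1,d2) \<in> topspace (prod_topology (diagrams M \<Gamma>1) (diagrams M \<Gamma>2))"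
   by (auto simp: topspace_garlands)
  show "garland_join z \<in> topspace ?G"
   using continuous_map_image_subset_topspace[OF comp[OF a(1,2)]] a(3) z(1) by fastforce
 qed
 fix U assume U: "openin ?G U"
 show "openin (prod_topology ?G ?G) {z \<in> topspace (prod_topology ?G ?G). garland_join z \<in> U}"
  unfolding openin_prod_topology_alt
 proof (intro allI impI)
  fix x y assume xy: "(x,y) \<in> {z \<in> topspace (prod_topology ?G ?G). garland_join z \<in> U}"
  obtain \<Gamma>1 d1 \<Gamma>2 d2 where e: "x = (\<Gamma>1,d1)" "y = (\<Gamma>2,d2)" by (cases x,cases y) auto
  hence a: "allowed_graph \<NN> \<Gamma>1" "allowed_graph \<NN> \<Gamma>2" "d1 \<in> topspace (diagrams M \<Gamma>1)" "d2 \<in> topspace (diagrams M \<Gamma>2)"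
   using xy by (auto simp: topspace_garlands)
  let ?P = "{p \<in> topspace (prod_topology (diagrams M \<Gamma>1) (diagrams M \<Gamma>2)). garland_join ((\<Gamma>1,fst p),(\<Gamma>2,snd p)) \<in> U}"
  have oP: "openin (prod_topology (diagrams M \<Gamma>1) (diagrams M \<Gamma>2)) ?P"
   by (rule openin_continuous_map_preimage[OF comp[OF a(1,2)] U])
  have "(d1,d2) \<in> ?P" using xy e a by simp
  from oP[unfolded openin_prod_topology_alt,rule_format,OF this]
  obtain A B where AB: "openin (diagrams M \<Gamma>1) A" "openin (diagrams M \<Gamma>2) B" "d1 \<in> A" "d2 \<in> B" "A \<times> B \<subseteq> ?P"
   by blast
  have "open_map (diagrams M \<Gamma>1) ?G (Pair \<Gamma>1)" "open_map (diagrams M \<Gamma>2) ?G (Pair \<Gamma>2)"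
   unfolding garlands_def using a by (auto intro: open_map_component_injection)
  hence o: "openin ?G (Pair \<Gamma>1 ` A)" "openin ?G (Pair \<Gamma>2 ` B)" using AB by (auto simp: open_map_def)
  have "Pair \<Gamma>1 ` A \<times> Pair \<Gamma>2 ` B \<subseteq> {z \<in> topspace (prod_topology ?G ?G). garland_join z \<in> U}"
   using AB(5) openin_subset[OF o(1)] openin_subset[OF o(2)] by auto
  thus "\<exists>A B. openin ?G A \<and> openin ?G B \<and> x \<in> A \<and> y \<in> B \<and> A \<times> B \<subseteq> {z \<in> topspace (prod_topology ?G ?G). garland_join z \<in> U}"
   using o AB(3,4) e by blast
 qed
qed

lemma garland_eqI:
 assumes "\<Gamma> = \<Gamma>'" "fst d \<in> extensional (gg_edges \<Gamma>)" "fst d' \<in> extensional (gg_edges \<Gamma>)"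
  "snd d \<in> extensional {..<gg_nu \<Gamma>}" "snd d' \<in> extensional {..<gg_nu \<Gamma>}"
  "!!e i. (e,i) \<in> gg_edges \<Gamma> ==> fst d (e,i) = fst d' (e,i)" "!!i. i < gg_nu \<Gamma> ==> snd d i = snd d' i"
 shows "(\<Gamma>,d) = (\<Gamma>',d')"
proof -
 have "fst d = fst d'" by (rule extensionalityI[OF assms(2,3)]) (use assms(6) in auto)
 moreover have "snd d = snd d'" by (rule extensionalityI[OF assms(4,5)]) (use assms(7) in auto)
 ultimately show ?thesis using assms(1) by (simp add: prod_eq_iff)
qed

section \<open>Renumbering of diagrams and its compatibility with joins\<close>

lemma gpermute_other: "gg_nu (fst g) \<noteq> n ==> garland_permute n \<alpha> g = g"
 by (cases g) (auto simp: garland_permute_def)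

lemma gpermute_simps:
 assumes n: "gg_nu \<Gamma> = n" and p: "\<alpha> permutes {..<n}"
 shows "fst (garland_permute n \<alpha> (\<Gamma>,d)) = gg_permute n \<alpha> \<Gamma>"
  "(e,i) \<in> gg_edges \<Gamma> ==> fst (snd (garland_permute n \<alpha> (\<Gamma>,d))) (\<alpha> ` e,\<alpha> i) = fst d (e,i)"
  "i < n ==> snd (snd (garland_permute n \<alpha> (\<Gamma>,d))) (\<alpha> i) = snd d i"
  "fst (snd (garland_permute n \<alpha> (\<Gamma>,d))) \<in> extensional (gg_edges (gg_permute n \<alpha> \<Gamma>))"
  "snd (snd (garland_permute n \<alpha> (\<Gamma>,d))) \<in> extensional {..<n}"
proof -
 note inv = permutes_inv_into[OF p]
 have "i < n ==> \<alpha> i < n" using permutes_in_image[OF p,of i] by simp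
 moreover have "(e,i) \<in> gg_edges \<Gamma> ==> (\<alpha> ` e,\<alpha> i) \<in> gg_edges (gg_permute n \<alpha> \<Gamma>)"
  unfolding gg_edges_permute[OF n p] by force
 ultimately show "fst (garland_permute n \<alpha> (\<Gamma>,d)) = gg_permute n \<alpha> \<Gamma>"
  "(e,i) \<in> gg_edges \<Gamma> ==> fst (snd (garland_permute n \<alpha> (\<Gamma>,d))) (\<alpha> ` e,\<alpha> i) = fst d (e,i)"
  "i < n ==> snd (snd (garland_permute n \<alpha> (\<Gamma>,d))) (\<alpha> i) = snd d i"
  "fst (snd (garland_permute n \<alpha> (\<Gamma>,d))) \<in> extensional (gg_edges (gg_permute n \<alpha> \<Gamma>))"
  "snd (snd (garland_permute n \<alpha> (\<Gamma>,d))) \<in> extensional {..<n}"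
  using n inv by (auto simp: garland_permute_def case_prod_unfold)
qed

text \<open>Describing the candidate at the renumbered places \<open>\<alpha> i\<close> avoids the
  inverse permutation that occurs in \<open>garland_permute\<close>. By extensionality these values
  determine the diagram.\<close>

lemma gpermute_eqI:
 assumes n: "gg_nu \<Gamma> = n" and p: "\<alpha> permutes {..<n}"
  and lab: "length (gg_labels \<Gamma>') = n" "!!i. i < n ==> gg_labels \<Gamma>' ! \<alpha> i = gg_labels \<Gamma> ! i"
  and ind: "gg_indices \<Gamma>' = (`) \<alpha> ` gg_indices \<Gamma>"
  and ext: "fst d' \<in> extensional (gg_edges \<Gamma>')" "snd d' \<in> extensional {..<n}"
  and x: "!!e i. (e,i) \<in> gg_edges \<Gamma> ==> fst d' (\<alpha> ` e,\<alpha> i) = fst d (e,i)"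
  and f: "!!i. i < n ==> snd d' (\<alpha> i) = snd d i"
 shows "garland_permute n \<alpha> (\<Gamma>,d) = (\<Gamma>',d')"
proof -
 note s = gpermute_simps[OF n p,where d = d]
 have "permute_list (inv_into UNIV \<alpha>) (gg_labels \<Gamma>) = gg_labels \<Gamma>'"
  by (rule permute_list_eqI) (use n p lab in "auto simp: gg_nu_def")
 hence g: "gg_permute n \<alpha> \<Gamma> = \<Gamma>'" using n ind by (auto simp: gg_permute_def)
 have nu': "gg_nu \<Gamma>' = n" using lab(1) by (simp add: gg_nu_def)
 obtain \<Gamma>0 d0 where g0: "garland_permute n \<alpha> (\<Gamma>,d) = (\<Gamma>0,d0)" by (cases "garland_permute n \<alpha> (\<Gamma>,d)")
 note s = s[unfolded g0 fst_conv snd_conv g]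
 show ?thesis unfolding g0
 proof (rule garland_eqI)
  show "\<Gamma>0 = \<Gamma>'" by (rule s(1))
  show "fst d0 (e,i) = fst d' (e,i)" if "(e,i) \<in> gg_edges \<Gamma>0" for e i
  proof -
   have "(e,i) \<in> (\<lambda>(e,i). (\<alpha> ` e,\<alpha> i)) ` gg_edges \<Gamma>" using that gg_edges_permute[OF n p] g s(1) by simp
   then obtain e' i' where "(e',i') \<in> gg_edges \<Gamma>" "e = \<alpha> ` e'" "i = \<alpha> i'" by auto
   thus ?thesis using s(2) x by simp
  qed
  show "snd d0 i = snd d' i" if "i < gg_nu \<Gamma>0" for i
  proof -
   have "i < n" using that s(1) nu' by simp
   hence "inv_into UNIV \<alpha> i < n" using permutes_in_image[OF permutes_inv_into(1)[OF p],of i] by simp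
   thus ?thesis using s(3)[of "inv_into UNIV \<alpha> i"] f[of "inv_into UNIV \<alpha> i"] permutes_inv_into(3)[OF p] by simp
  qed
 qed (use s ext nu' in auto)
qed

lemma cont_garland_permute:
 assumes p: "\<alpha> permutes {..<n}" shows "continuous_map (garlands \<NN> M) (garlands \<NN> M) (garland_permute n \<alpha>)"
proof -
 have "continuous_map (diagrams M \<Gamma>) (garlands \<NN> M) (\<lambda>d. garland_permute n \<alpha> (\<Gamma>,d))" if a: "allowed_graph \<NN> \<Gamma>" for \<Gamma>
 proof (cases "gg_nu \<Gamma> = n")
  case False
  thus ?thesis using cont_garland_incl[OF a,of M] by (simp add: gpermute_other)
 next
  case n: True
  let ?G = "gg_permute n \<alpha> \<Gamma>" and ?f = "\<lambda>d. snd (garland_permute n \<alpha> (\<Gamma>,d))"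
  note s = gpermute_simps[OF n p] and inv = permutes_inv_into[OF p]
  have lab: "gg_labels ?G ! \<alpha> i = gg_labels \<Gamma> ! i" if "i < n" for i
   using permute_list_inv_nth[of \<alpha> "gg_labels \<Gamma>" i] p n that by (simp add: gg_permute_simps[OF n] gg_nu_def)
  have "continuous_map (diagrams M \<Gamma>) (diagrams M ?G) ?f"
  proof (rule cont_into_garlands)
   show "fst (?f d) \<in> extensional (gg_edges ?G)" for d by (rule s(4))
   show "snd (?f d) \<in> extensional {..<gg_nu ?G}" for d unfolding gg_permute_simps(3)[OF n] by (rule s(5))
  next
   fix e i assume "(e,i) \<in> gg_edges ?G"
   then obtain e' i' where e': "(e',i') \<in> gg_edges \<Gamma>" "e = \<alpha> ` e'" "i = \<alpha> i'" unfolding gg_edges_permute[OF n p] by auto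
   hence "i' < n" using agraph_index[OF a] n by (auto simp: gg_edges_def)
   thus "continuous_map (diagrams M \<Gamma>) (mf_top (gg_labels ?G ! i)) (\<lambda>d. fst (?f d) (e,i))"
    using cont_garland_fst[OF e'(1),of M] by (simp add: e' s(2)[OF e'(1)] lab)
  next
   fix i assume "i < gg_nu ?G"
   hence "i < n" by (simp add: gg_permute_simps[OF n])
   hence i: "inv_into UNIV \<alpha> i < n" using permutes_in_image[OF inv(1),of i] by simp
   show "continuous_map (diagrams M \<Gamma>) (compact_open_topology (mf_top (gg_labels ?G ! i)) (mf_top M)) (\<lambda>d. snd (?f d) i)"
    using cont_garland_snd[of "inv_into UNIV \<alpha> i" \<Gamma> M] i n lab[OF i]
    by (simp add: inv(3) s(3)[OF i,unfolded inv(3)])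
  next
   fix d e i j assume d: "d \<in> topspace (diagrams M \<Gamma>)" and e: "e \<in> gg_indices ?G" "i \<in> e" "j \<in> e"
   obtain e' where e': "e' \<in> gg_indices \<Gamma>" "e = \<alpha> ` e'" using e(1) by (auto simp: gg_permute_simps[OF n])
   then obtain i' j' where ij: "i = \<alpha> i'" "j = \<alpha> j'" "i' \<in> e'" "j' \<in> e'" using e by auto
   hence "(e',i') \<in> gg_edges \<Gamma>" "(e',j') \<in> gg_edges \<Gamma>" "i' < n" "j' < n"
    using e' agraph_index[OF a] n by (auto simp: gg_edges_def)
   thus "snd (?f d) i (fst (?f d) (e,i)) = snd (?f d) j (fst (?f d) (e,j))"
    using garlands_of_type_pts(3)[OF d e'(1) ij(3,4)] by (simp add: ij e'(2) s)
  qed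
  from continuous_map_compose[OF this cont_garland_incl[OF agraph_permute[OF a n p]]]
  have "continuous_map (diagrams M \<Gamma>) (garlands \<NN> M) (\<lambda>d. (?G,?f d))" by (simp add: o_def)
  thus ?thesis by (rule continuous_map_eq) (simp add: prod_eq_iff s(1))
 qed
 hence "continuous_map (sum_topology (diagrams M) {\<Gamma>. allowed_graph \<NN> \<Gamma>}) (garlands \<NN> M) (garland_permute n \<alpha>)"
  by (intro cont_from_sum_topology) auto
 thus ?thesis by (simp add: garlands_def)
qed

lemma gg_nu_garland_permute: "gg_nu (fst (garland_permute n \<alpha> g)) = gg_nu (fst g)"
 by (cases g) (auto simp: garland_permute_def gg_permute_simps)

lemma gpermute_compose:
 assumes a: "\<alpha> permutes {..<n}" and b: "\<beta> permutes {..<n}" and g: "g \<in> topspace (garlands \<NN> M)"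
 shows "garland_permute n (\<alpha> \<circ> \<beta>) g = garland_permute n \<alpha> (garland_permute n \<beta> g)"
proof (cases "gg_nu (fst g) = n")
 case False
 thus ?thesis by (simp add: gpermute_other)
next
 case True
 obtain \<Gamma> d where ge: "g = (\<Gamma>,d)" by (cases g)
 obtain \<Gamma>1 d1 where g1: "garland_permute n \<beta> g = (\<Gamma>1,d1)" by (cases "garland_permute n \<beta> g")
 obtain \<Gamma>2 d2 where g2: "garland_permute n \<alpha> (\<Gamma>1,d1) = (\<Gamma>2,d2)" by (cases "garland_permute n \<alpha> (\<Gamma>1,d1)")
 have n: "gg_nu \<Gamma> = n" using True ge by simp
 note s1 = gpermute_simps[OF n b,where d = d,folded ge,unfolded g1 fst_conv snd_conv]
 have n1: "gg_nu \<Gamma>1 = n" using s1(1) gg_permute_simps(3)[OF n] by simp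
 note s2 = gpermute_simps[OF n1 a,where d = d1,unfolded g2 fst_conv snd_conv]
 have lt: "\<beta> i < n" if "i < n" for i using permutes_in_image[OF b,of i] that by simp
 show ?thesis unfolding ge g1[unfolded ge] g2
 proof (rule gpermute_eqI[OF n])
  show "\<alpha> \<circ> \<beta> permutes {..<n}" using a b by (rule permutes_compose[rotated])
  show "length (gg_labels \<Gamma>2) = n" using s2(1) gg_permute_simps(3)[OF n1] by (simp add: gg_nu_def)
  show "gg_labels \<Gamma>2 ! (\<alpha> \<circ> \<beta>) i = gg_labels \<Gamma> ! i" if i: "i < n" for i
  proof -
   have "gg_labels \<Gamma>2 ! \<alpha> (\<beta> i) = gg_labels \<Gamma>1 ! \<beta> i"
    unfolding s2(1) gg_permute_simps(1)[OF n1] by (rule permute_list_inv_nth) (use a n1 lt[OF i] in "auto simp: gg_nu_def")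
   also have "\<dots> = gg_labels \<Gamma> ! i"
    unfolding s1(1) gg_permute_simps(1)[OF n] by (rule permute_list_inv_nth) (use b n i in "auto simp: gg_nu_def")
   finally show ?thesis by simp
  qed
  have "gg_indices \<Gamma>2 = (`) \<alpha> ` gg_indices \<Gamma>1" unfolding s2(1) by (rule gg_permute_simps(2)[OF n1])
  moreover have "gg_indices \<Gamma>1 = (`) \<beta> ` gg_indices \<Gamma>" unfolding s1(1) by (rule gg_permute_simps(2)[OF n])
  ultimately show "gg_indices \<Gamma>2 = (`) (\<alpha> \<circ> \<beta>) ` gg_indices \<Gamma>" by (simp add: image_image)
  show "fst d2 \<in> extensional (gg_edges \<Gamma>2)" "snd d2 \<in> extensional {..<n}" using s2 by auto
  show "fst d2 ((\<alpha> \<circ> \<beta>) ` e,(\<alpha> \<circ> \<beta>) i) = fst d (e,i)" if e: "(e,i) \<in> gg_edges \<Gamma>" for e i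
  proof -
   have "(\<beta> ` e,\<beta> i) \<in> gg_edges \<Gamma>1" unfolding s1(1) gg_edges_permute[OF n b] using e by force
   from s2(2)[OF this] show ?thesis using s1(2)[OF e] by (simp add: image_comp)
  qed
  show "snd d2 ((\<alpha> \<circ> \<beta>) i) = snd d i" if "i < n" for i using s2(3)[OF lt[OF that]] s1(3)[OF that] by simp
 qed
qed

text \<open>Associativity is strict because shifting by \<open>gg_nu B\<close> and then by
  \<open>gg_nu A\<close> is the shift by their sum.\<close>

lemma garland_join_assoc:
 assumes "a \<in> topspace (garlands \<NN> M)" "b \<in> topspace (garlands \<NN> M)" "c \<in> topspace (garlands \<NN> M)"
 shows "garland_join (garland_join (a,b),c) = garland_join (a,garland_join (b,c))"
proof -
 obtain A x B y C z where e: "a = (A,x)" "b = (B,y)" "c = (C,z)" by (cases a,cases b,cases c)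
 have al: "allowed_graph \<NN> A" "allowed_graph \<NN> B" "allowed_graph \<NN> C" using assms e by (auto simp: topspace_garlands)
 have AB: "allowed_graph \<NN> (gg_join A B)" by (rule agraph_join[OF al(1,2)])
 \<comment> \<open>Rules 1 to 6 evaluate joins with first graph \<open>A\<close>, rules 7 to 12
   those with \<open>B\<close>, and rules 13 to 18 those with \<open>gg_join A B\<close>.\<close>
 note j = djoin_simps[OF al(1)] djoin_simps[OF al(2)] djoin_simps[OF AB]
 have G: "gg_join (gg_join A B) C = gg_join A (gg_join B C)"
  by (auto simp: gg_join_def gg_nu_def image_Un image_image add.assoc Un_assoc)
 let ?l = "diagram_join (gg_join A B) C (diagram_join A B x y) z" and ?r = "diagram_join A (gg_join B C) x (diagram_join B C y z)"
 have "(gg_join (gg_join A B) C,?l) = (gg_join A (gg_join B C),?r)"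
 proof (rule garland_eqI[OF G])
  show "fst ?l \<in> extensional (gg_edges (gg_join (gg_join A B) C))" "snd ?l \<in> extensional {..<gg_nu (gg_join (gg_join A B) C)}"
   by (rule j)+
  show "fst ?r \<in> extensional (gg_edges (gg_join (gg_join A B) C))" "snd ?r \<in> extensional {..<gg_nu (gg_join (gg_join A B) C)}"
   unfolding G by (rule j)+
 next
  fix e i assume "(e,i) \<in> gg_edges (gg_join (gg_join A B) C)"
  then consider "(e,i) \<in> gg_edges A" | e' i' where "(e',i') \<in> gg_edges B" "e = (+) (gg_nu A) ` e'" "i = gg_nu A + i'"
   | e' i' where "(e',i') \<in> gg_edges C" "e = (+) (gg_nu A + gg_nu B) ` e'" "i = gg_nu A + gg_nu B + i'"
   unfolding gg_edges_join by auto
  thus "fst ?l (e,i) = fst ?r (e,i)"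
  proof cases
   case 1
   hence "(e,i) \<in> gg_edges (gg_join A B)" by (simp add: gg_edges_join)
   thus ?thesis using 1 by (simp add: j)
  next
   case 2
   hence "(e,i) \<in> gg_edges (gg_join A B)" "(e',i') \<in> gg_edges (gg_join B C)" by (auto simp: gg_edges_join)
   thus ?thesis using j(13)[of e i C "diagram_join A B x y" z] j(2)[of e' i' "gg_join B C" x "diagram_join B C y z"] 2
    by (simp add: j(2)[OF 2(1)] j(7)[OF 2(1)])
  next
   case 3
   let ?e = "(+) (gg_nu B) ` e'" and ?i = "gg_nu B + i'"
   have "(?e,?i) \<in> gg_edges (gg_join B C)" using 3(1) by (auto simp: gg_edges_join)
   moreover have "e = (+) (gg_nu A) ` ?e" "i = gg_nu A + ?i" using 3 by (auto simp: image_image add.assoc)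
   ultimately have "fst ?r (e,i) = fst (diagram_join B C y z) (?e,?i)" using j(2) by simp
   also have "\<dots> = fst z (e',i')" by (rule j(8)[OF 3(1)])
   also have "\<dots> = fst ?l (e,i)" using j(14)[OF 3(1),of "diagram_join A B x y" z] 3(2,3) by simp
   finally show ?thesis by simp
  qed
 next
  fix i assume "i < gg_nu (gg_join (gg_join A B) C)"
  then consider "i < gg_nu A" | i' where "i' < gg_nu B" "i = gg_nu A + i'" | i' where "i' < gg_nu C" "i = gg_nu A + gg_nu B + i'"
   by (metis add.assoc gg_nu_join le_Suc_ex nat_add_left_cancel_less not_less)
  thus "snd ?l i = snd ?r i"
  proof cases
   case 1
   thus ?thesis using j(3)[of i B x y] j(15)[of i C "diagram_join A B x y" z] j(3)[of i "gg_join B C" x "diagram_join B C y z"] by simp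
  next
   case 2
   thus ?thesis using j(4)[of i' B x y] j(15)[of i C "diagram_join A B x y" z] j(4)[of i' "gg_join B C" x "diagram_join B C y z"]
     j(9)[of i' C y z] by simp
  next
   case 3
   thus ?thesis using j(16)[of i' C "diagram_join A B x y" z] j(4)[of "gg_nu B + i'" "gg_join B C" x "diagram_join B C y z"]
     j(10)[of i' C y z] by (simp add: add.assoc)
  qed
 qed
 thus ?thesis by (simp add: e garland_join_def)
qed

text \<open>A permutation of the first \<open>n\<close> numbers fixes the shifted numbers of the
  second graph, so as a renumbering of the join it affects the first part only.\<close>

lemma join_permute_left:
 assumes a: "a \<in> topspace (garlands \<NN> M)" and b: "b \<in> topspace (garlands \<NN> M)"
  and n: "gg_nu (fst a) = n" "gg_nu (fst b) = m" and p: "\<beta> permutes {..<n}"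
 shows "garland_join (garland_permute n \<beta> a,b) = garland_permute (n + m) \<beta> (garland_join (a,b))"
proof -
 obtain A x B y where e: "a = (A,x)" "b = (B,y)" by (cases a,cases b)
 have al: "allowed_graph \<NN> A" "allowed_graph \<NN> B" using a b e by (auto simp: topspace_garlands)
 have nu: "gg_nu A = n" "gg_nu B = m" using n e by auto
 obtain A' x' where e': "garland_permute n \<beta> a = (A',x')" by (cases "garland_permute n \<beta> a")
 note s = gpermute_simps[OF nu(1) p,where d = x,folded e(1),unfolded e' fst_conv snd_conv]
 have A': "A' = gg_permute n \<beta> A" by (rule s(1))
 have nu': "gg_nu A' = n" unfolding A' by (rule gg_permute_simps(3)[OF nu(1)])
 have al': "allowed_graph \<NN> A'" unfolding A' by (rule agraph_permute[OF al(1) nu(1) p])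
 have lt: "\<beta> i < n" if "i < n" for i using permutes_in_image[OF p,of i] that by simp
 have fix1: "\<beta> (n + i) = n + i" for i using permutes_not_in[OF p] by simp
 have fix2: "\<beta> ` (+) n ` E = (+) n ` E" for E by (simp add: image_image fix1)
 note j = djoin_simps[OF al(1),unfolded nu] and j' = djoin_simps[OF al',unfolded nu']
 have "garland_permute (n + m) \<beta> (gg_join A B,diagram_join A B x y) = (gg_join A' B,diagram_join A' B x' y)"
 proof (rule gpermute_eqI)
  show "gg_nu (gg_join A B) = n + m" by (simp add: nu)
  show "\<beta> permutes {..<n + m}" by (rule permutes_subset[OF p]) auto
  show "length (gg_labels (gg_join A' B)) = n + m" using nu nu' by (simp add: gg_nu_def gg_join_def)
  show "gg_labels (gg_join A' B) ! \<beta> i = gg_labels (gg_join A B) ! i" if "i < n + m" for i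
  proof (cases "i < n")
   case True
   have "gg_labels A' ! \<beta> i = gg_labels A ! i"
    using permute_list_inv_nth[of \<beta> "gg_labels A" i] p nu True by (simp add: A' gg_permute_simps(1)[OF nu(1)] gg_nu_def)
   thus ?thesis using True lt[OF True] by (simp add: gg_labels_join_nth nu nu')
  next
   case False
   then obtain k where k: "i = n + k" using le_Suc_ex by (metis not_less)
   show ?thesis using gg_labels_join_nth(2)[of A' B k] gg_labels_join_nth(2)[of A B k] by (simp add: k fix1 nu nu')
  qed
  show "gg_indices (gg_join A' B) = (`) \<beta> ` gg_indices (gg_join A B)"
   by (simp add: gg_join_def nu nu' image_Un) (simp add: A' gg_permute_simps(2)[OF nu(1)] image_image[of "(`) \<beta>"] fix2)
  show "fst (diagram_join A' B x' y) \<in> extensional (gg_edges (gg_join A' B))" by (rule j'(5))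
  show "snd (diagram_join A' B x' y) \<in> extensional {..<n + m}" using j'(6)[of B x' y] by (simp add: nu nu')
  show "fst (diagram_join A' B x' y) (\<beta> ` e,\<beta> i) = fst (diagram_join A B x y) (e,i)" if ei: "(e,i) \<in> gg_edges (gg_join A B)" for e i
  proof -
   from ei consider "(e,i) \<in> gg_edges A" | e' i' where "(e',i') \<in> gg_edges B" "e = (+) n ` e'" "i = n + i'"
    unfolding gg_edges_join nu by blast
   thus ?thesis
   proof cases
    case 1
    have "(\<beta> ` e,\<beta> i) \<in> gg_edges A'" unfolding A' gg_edges_permute[OF nu(1) p] using 1 by force
    thus ?thesis using s(2)[OF 1] by (simp add: j'(1) j(1)[OF 1])
   next
    case 2
    thus ?thesis by (simp add: fix1 fix2 j(2)[OF 2(1)] j'(2)[OF 2(1)])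
   qed
  qed
  show "snd (diagram_join A' B x' y) (\<beta> i) = snd (diagram_join A B x y) i" if i: "i < n + m" for i
  proof (cases "i < n")
   case True
   thus ?thesis using lt[OF True] s(3)[OF True] by (simp add: j j')
  next
   case False
   then obtain k where k: "i = n + k" "k < m" using i by (metis le_Suc_ex not_less nat_add_left_cancel_less)
   thus ?thesis using nu by (simp add: fix1 j(4) j'(4))
  qed
 qed
 thus ?thesis using e e' by (simp add: garland_join_def)
qed

text \<open>The inverse is the same map with \<open>n\<close> and \<open>m\<close>
  exchanged.\<close>

lemma permutes_swap_blocks:
 "(\<lambda>i. if i < n then m + i else if i < n + m then i - n else i) permutes {..<n + m::nat}"
 by (rule bij_imp_permutes,
   rule bij_betw_byWitness[where f' = "\<lambda>i. if i < m then n + i else if i < n + m then i - m else i"]) auto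

text \<open>The indices of an allowed graph consist of numbers of its N-vertices. On those of
  \<open>A\<close> the block exchange is the shift by \<open>m\<close>; on the shifted ones of
  \<open>B\<close> it undoes the shift by \<open>n\<close>.\<close>

lemma garland_join_swap:
 assumes a: "a \<in> topspace (garlands \<NN> M)" and b: "b \<in> topspace (garlands \<NN> M)"
  and n: "gg_nu (fst a) = n" "gg_nu (fst b) = m"
 shows "garland_join (b,a) =
  garland_permute (n + m) (\<lambda>i. if i < n then m + i else if i < n + m then i - n else i) (garland_join (a,b))"
proof -
 let ?f = "\<lambda>i. if i < n then m + i else if i < n + m then i - n else i"
 obtain A x B y where e: "a = (A,x)" "b = (B,y)" by (cases a,cases b)
 have al: "allowed_graph \<NN> A" "allowed_graph \<NN> B" using a b e by (auto simp: topspace_garlands)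
 have nu: "gg_nu A = n" "gg_nu B = m" using n e by auto
 note j = djoin_simps[OF al(1),unfolded nu] and j' = djoin_simps[OF al(2),unfolded nu]
 have fA: "?f ` E = (+) m ` E" if "E \<in> gg_indices A" for E
 proof (rule image_cong[OF refl])
  fix i assume "i \<in> E"
  thus "?f i = m + i" using agraph_index[OF al(1) that] nu by simp
 qed
 have fB: "?f ` (+) n ` E = E" if "E \<in> gg_indices B" for E
 proof -
  have "?f ` (+) n ` E = (\<lambda>i. i) ` E" unfolding image_image
  proof (rule image_cong[OF refl])
   fix i assume "i \<in> E"
   thus "?f (n + i) = i" using agraph_index[OF al(2) that] nu by simp
  qed
  thus ?thesis by simp
 qed
 have "garland_permute (n + m) ?f (gg_join A B,diagram_join A B x y) = (gg_join B A,diagram_join B A y x)"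
 proof (rule gpermute_eqI)
  show "gg_nu (gg_join A B) = n + m" by (simp add: nu)
  show "?f permutes {..<n + m}" by (rule permutes_swap_blocks)
  show "length (gg_labels (gg_join B A)) = n + m" using nu by (simp add: gg_nu_def gg_join_def)
  show "gg_labels (gg_join B A) ! ?f i = gg_labels (gg_join A B) ! i" if i: "i < n + m" for i
  proof (cases "i < n")
   case True
   thus ?thesis using gg_labels_join_nth(2)[of B A i] by (simp add: gg_labels_join_nth(1) nu)
  next
   case False
   then obtain k where k: "i = n + k" "k < m" using i by (metis le_Suc_ex not_less nat_add_left_cancel_less)
   thus ?thesis using gg_labels_join_nth(2)[of A B k] by (simp add: gg_labels_join_nth(1) nu)
  qed
  show "gg_indices (gg_join B A) = (`) ?f ` gg_indices (gg_join A B)"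
  proof -
   have "(`) ?f ` gg_indices (gg_join A B) = (`) ?f ` gg_indices A \<union> (`) ?f ` (`) ((+) n) ` gg_indices B"
    by (simp add: gg_join_def nu image_Un)
   also have "(`) ?f ` gg_indices A = (`) ((+) m) ` gg_indices A" by (rule image_cong[OF refl fA])
   also have "(`) ?f ` (`) ((+) n) ` gg_indices B = (\<lambda>E. E) ` gg_indices B"
    unfolding image_image[of "(`) ?f"] by (rule image_cong[OF refl fB])
   finally show ?thesis by (simp add: gg_join_def nu Un_commute)
  qed
  show "fst (diagram_join B A y x) \<in> extensional (gg_edges (gg_join B A))" by (rule j'(5))
  show "snd (diagram_join B A y x) \<in> extensional {..<n + m}" using j'(6)[of A y x] by (simp add: nu add.commute)
  show "fst (diagram_join B A y x) (?f ` e,?f i) = fst (diagram_join A B x y) (e,i)" if ei: "(e,i) \<in> gg_edges (gg_join A B)" for e i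
  proof -
   from ei consider "(e,i) \<in> gg_edges A" | e' i' where "(e',i') \<in> gg_edges B" "e = (+) n ` e'" "i = n + i'"
    unfolding gg_edges_join nu by blast
   thus ?thesis
   proof cases
    case 1
    hence ee: "e \<in> gg_indices A" "i \<in> e" by (auto simp: gg_edges_def)
    have i: "?f i = m + i" using agraph_index[OF al(1) ee] nu by simp
    show ?thesis unfolding fA[OF ee(1)] i by (simp only: j(1)[OF 1] j'(2)[OF 1])
   next
    case 2
    hence ee: "e' \<in> gg_indices B" "i' \<in> e'" by (auto simp: gg_edges_def)
    have i: "?f (n + i') = i'" using agraph_index[OF al(2) ee] nu by simp
    show ?thesis unfolding 2(2,3) fB[OF ee(1)] i by (simp only: j'(1)[OF 2(1)] j(2)[OF 2(1)])
   qed
  qed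
  show "snd (diagram_join B A y x) (?f i) = snd (diagram_join A B x y) i" if i: "i < n + m" for i
  proof (cases "i < n")
   case True
   thus ?thesis using j'(4)[of i A y x] by (simp add: j nu)
  next
   case False
   then obtain k where k: "i = n + k" "k < m" using i by (metis le_Suc_ex not_less nat_add_left_cancel_less)
   thus ?thesis using j(4)[of k B x y] j'(3)[of k A y x] nu by simp
  qed
 qed
 thus ?thesis using e by (simp add: garland_join_def)
qed

section \<open>Rational linearity and induced maps\<close>

text \<open>Lets \<open>brat_hom_eqI\<close> compare an additive map with a sum of two
  others.\<close>

lemma homprod_hom:
 assumes C: "comm_group C" and A: "group A" and f: "f \<in> hom A C" and g: "g \<in> hom A C"
 shows "(\<lambda>x. f x \<otimes>\<^bsub>C\<^esub> g x) \<in> hom A C"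
proof -
 interpret C: comm_group C by fact
 show ?thesis using f g by (intro homI) (auto simp: hom_mult hom_in_carrier C.m_ac C.m_closed)
qed

lemma bgroup_rat: "group (bordism_rat Y)"
 by (rule comm_group.axioms(2)[OF cgroup_rat])

lemma bscale_closed: "x \<in> OmQ Y ==> bordism_scale Y q x \<in> OmQ Y"
 by (rule hom_in_carrier[OF bscale_hom])

lemma bscale_1: "x \<in> OmQ Y ==> bordism_scale Y 1 x = x"
 by (rule brat_hom_eqI[OF bscale_hom _ cgroup_rat,where g = "\<lambda>x. x"])
   (auto simp: bscale_elt intro: homI)

lemma bscale_scale:
 assumes "x \<in> OmQ Y" shows "bordism_scale Y p (bordism_scale Y q x) = bordism_scale Y (p * q) x"
proof -
 have "(bordism_scale Y p \<circ> bordism_scale Y q) x = bordism_scale Y (p * q) x"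
  by (rule brat_hom_eqI[OF hom_compose[OF bscale_hom bscale_hom] bscale_hom cgroup_rat _ assms])
    (simp add: bscale_elt mult.assoc)
 thus ?thesis by simp
qed

lemma bscale_add:
 assumes "x \<in> OmQ Y"
 shows "bordism_scale Y (p + q) x = bordism_scale Y p x \<otimes>\<^bsub>bordism_rat Y\<^esub> bordism_scale Y q x"
 by (rule brat_hom_eqI[OF bscale_hom
    homprod_hom[OF cgroup_rat bgroup_rat bscale_hom bscale_hom] cgroup_rat _ assms])
   (simp add: bscale_elt hom_elt_add distrib_right)

lemma bscale_0:
 assumes x: "x \<in> OmQ Y" shows "bordism_scale Y 0 x = \<one>\<^bsub>bordism_rat Y\<^esub>"
proof -
 interpret R: group "bordism_rat Y" by (rule bgroup_rat)
 have "bordism_scale Y 0 x \<otimes>\<^bsub>bordism_rat Y\<^esub> bordism_scale Y 0 x = bordism_scale Y 0 x"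
  using bscale_add[OF x,of 0 0] by simp
 thus ?thesis using R.l_cancel_one bscale_closed[OF x] by blast
qed

lemma bscale_of_nat:
 assumes x: "x \<in> OmQ Y" shows "bordism_scale Y (of_nat n) x = x [^]\<^bsub>bordism_rat Y\<^esub> n"
proof (induction n)
 case 0
 thus ?case by (simp add: bscale_0[OF x])
next
 case (Suc n)
 have "bordism_scale Y (of_nat (Suc n)) x = bordism_scale Y (of_nat n + 1) x" by (simp add: add.commute)
 thus ?case using Suc by (simp add: bscale_add[OF x] bscale_1[OF x])
qed

text \<open>Scaling by \<open>1 / n\<close> undoes the \<open>n\<close>-th power.\<close>

lemma bordism_pow_cancel:
 assumes x: "x \<in> OmQ Y" and y: "y \<in> OmQ Y"
  and n: "0 < n" and eq: "x [^]\<^bsub>bordism_rat Y\<^esub> (n::nat) = y [^]\<^bsub>bordism_rat Y\<^esub> n"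
 shows "x = y"
proof -
 have "bordism_scale Y (1 / of_nat n) (bordism_scale Y (of_nat n) x) = bordism_scale Y (1 / of_nat n) (bordism_scale Y (of_nat n) y)"
  using eq by (simp add: bscale_of_nat x y)
 thus ?thesis using n by (simp add: bscale_scale bscale_1 x y)
qed

text \<open>The groups \<open>\<Omega>\<^sub>*(Y)\<^sub>\<rat>\<close> are uniquely divisible, so additive maps between them are linear.\<close>

lemma hom_bordism_scale:
 assumes f: "f \<in> hom (bordism_rat Y) (bordism_rat Z)" and x: "x \<in> OmQ Y"
 shows "f (bordism_scale Y q x) = bordism_scale Z q (f x)"
proof -
 interpret Z: group "bordism_rat Z" by (rule bgroup_rat)
 have fx: "f x \<in> OmQ Z" by (rule hom_in_carrier[OF f x])
 have nonneg: "f (bordism_scale Y p x) = bordism_scale Z p (f x)" if p: "0 \<le> p" for p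
 proof -
  obtain a b where "p = Rat.Fract a b" "0 < b" by (cases p)
  moreover hence "0 \<le> a" using p by (simp add: Rat.zero_le_Fract_iff)
  ultimately obtain n m where nm: "p = of_nat n / of_nat m" "0 < m"
   by (metis Rat.Fract_of_int_quotient nonneg_eq_int of_int_of_nat_eq of_nat_0_less_iff order_less_imp_le)
  have sx: "bordism_scale Y p x \<in> OmQ Y" by (rule bscale_closed[OF x])
  have mp: "of_nat m * p = of_nat n" using nm by simp
  \<comment> \<open>Passing to \<open>m\<close>-th powers reduces the scalar \<open>n / m\<close> to
    integral multiples, with which every additive map is compatible.\<close>
  have "f (bordism_scale Y p x) [^]\<^bsub>bordism_rat Z\<^esub> m = f (bordism_scale Y p x [^]\<^bsub>bordism_rat Y\<^esub> m)"
   by (rule hom_nat_pow[OF f sx bgroup_rat bgroup_rat,symmetric])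
  also have "\<dots> = f (x [^]\<^bsub>bordism_rat Y\<^esub> n)"
   by (simp only: bscale_of_nat[OF sx,symmetric] bscale_scale[OF x] mp bscale_of_nat[OF x])
  also have "\<dots> = f x [^]\<^bsub>bordism_rat Z\<^esub> n" by (rule hom_nat_pow[OF f x bgroup_rat bgroup_rat])
  also have "\<dots> = bordism_scale Z p (f x) [^]\<^bsub>bordism_rat Z\<^esub> m"
   by (simp only: bscale_of_nat[OF fx,symmetric] bscale_of_nat[OF bscale_closed[OF fx],symmetric]
     bscale_scale[OF fx] mp)
  finally show ?thesis by (rule bordism_pow_cancel[OF hom_in_carrier[OF f sx] bscale_closed[OF fx] nm(2)])
 qed
 show ?thesis
 proof (cases "0 \<le> q")
  case False
  have "f (bordism_scale Y q x) \<otimes>\<^bsub>bordism_rat Z\<^esub> f (bordism_scale Y (- q) x) = f (bordism_scale Y (q + - q) x)"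
   unfolding bscale_add[OF x] by (rule hom_mult[OF f bscale_closed[OF x] bscale_closed[OF x],symmetric])
  also have "\<dots> = \<one>\<^bsub>bordism_rat Z\<^esub>" using hom_one[OF f bgroup_rat bgroup_rat] by (simp add: bscale_0[OF x])
  also have "\<dots> = bordism_scale Z q (f x) \<otimes>\<^bsub>bordism_rat Z\<^esub> bordism_scale Z (- q) (f x)"
   using bscale_add[OF fx,of q "- q"] by (simp add: bscale_0[OF fx])
  finally have "f (bordism_scale Y q x) \<otimes>\<^bsub>bordism_rat Z\<^esub> bordism_scale Z (- q) (f x) =
    bordism_scale Z q (f x) \<otimes>\<^bsub>bordism_rat Z\<^esub> bordism_scale Z (- q) (f x)"
   using nonneg[of "- q"] False by simp
  thus ?thesis
   using hom_in_carrier[OF f bscale_closed[OF x]] bscale_closed[OF fx] by (simp add: Z.right_cancel)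
 qed (rule nonneg)
qed

lemma hom_elt_one: "hom_elt Y j \<one>\<^bsub>bordism_group j Y\<^esub> q = \<one>\<^bsub>bordism_rat Y\<^esub>"
proof -
 interpret R: group "bordism_rat Y" by (rule bgroup_rat)
 note o = bordism_one_in_carrier[of j Y]
 have "hom_elt Y j \<one>\<^bsub>bordism_group j Y\<^esub> q \<otimes>\<^bsub>bordism_rat Y\<^esub> hom_elt Y j \<one>\<^bsub>bordism_group j Y\<^esub> q = hom_elt Y j \<one>\<^bsub>bordism_group j Y\<^esub> q"
  using hom_elt_mult[OF o o,of q] by (simp add: bordism_mult_one[OF o])
 thus ?thesis using R.l_cancel_one hom_elt_closed[OF o] by blast
qed

text \<open>Both sides are inverse to the element of the class of \<open>P\<close> with coefficient
  \<open>q\<close>: one by the cylinder, the other by additivity in the coefficient.\<close>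

lemma hom_elt_oneg:
 assumes emb: "embeds TYPE('a)" and P: "sing j Y (P :: ('a,'y) over)"
 shows "hom_elt Y j (cls j Y (oneg P)) q = hom_elt Y j (cls j Y P) (- q)"
proof -
 interpret R: comm_group "bordism_rat Y" by (rule cgroup_rat)
 let ?a = "cls j Y P" and ?b = "cls j Y (oneg P)"
 have c: "?a \<in> Om j Y" "?b \<in> Om j Y"
  by (rule cls_mem[OF emb P],rule cls_mem[OF emb sing_oneg[OF P]])
 have "hom_elt Y j ?a q \<otimes>\<^bsub>bordism_rat Y\<^esub> hom_elt Y j ?b q = \<one>\<^bsub>bordism_rat Y\<^esub>"
  using hom_elt_mult[OF c,of q] by (simp add: bordism_mult_neg[OF emb P] hom_elt_one)
 moreover have "hom_elt Y j ?a q \<otimes>\<^bsub>bordism_rat Y\<^esub> hom_elt Y j ?a (- q) = \<one>\<^bsub>bordism_rat Y\<^esub>"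
  using hom_elt_add[OF c(1),of q "- q"] biadditive_zero[OF biadditive_hom_elt cgroup_rat c(1)] by simp
 ultimately show ?thesis using hom_elt_closed[OF c(1)] hom_elt_closed[OF c(2)] R.inv_equality R.m_comm by metis
qed

lemma hom_elt_sgn:
 assumes emb: "embeds TYPE('a)" and P: "sing j Y (P :: ('a,'y) over)"
 shows "hom_elt Y j (cls j Y (mf_sgn k (fst P),snd P)) q = hom_elt Y j (cls j Y P) ((-1) ^ k * q)"
proof (cases "even k")
 case False
 hence "(mf_sgn k (fst P),snd P) = oneg P" by (simp add: mf_sgn_def oneg_def)
 thus ?thesis using hom_elt_oneg[OF assms,of q] False by (simp only:) simp
qed (simp add: mf_sgn_def)

lemma bpush_closed:
 assumes h: "continuous_map Y Z h" and a: "a \<in> Om j Y"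
 shows "bordism_push j Z h a \<in> Om j Z"
proof -
 obtain P :: "(pts,'a) over" where P: "sing j Y P" "a = cls j Y P" by (rule bordismE[OF a])
 show ?thesis unfolding P(2) bpush_cls[OF emb_pts P(1) h] by (rule cls_mem[OF emb_pts sing_push[OF P(1) h]])
qed

lemma bpush_mult:
 assumes h: "continuous_map Y Z h" and a: "a \<in> Om j Y" and b: "b \<in> Om j Y"
 shows "bordism_push j Z h (a \<otimes>\<^bsub>bordism_group j Y\<^esub> b) = bordism_push j Z h a \<otimes>\<^bsub>bordism_group j Z\<^esub> bordism_push j Z h b"
proof -
 obtain P :: "(pts,'a) over" where P: "sing j Y P" "a = cls j Y P" by (rule bordismE[OF a])
 obtain Q :: "(pts,'a) over" where Q: "sing j Y Q" "b = cls j Y Q" by (rule bordismE[OF b])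
 have e: "(fst (osum P Q),h \<circ> snd (osum P Q)) = osum (fst P,h \<circ> snd P) (fst Q,h \<circ> snd Q)"
  by (auto simp: osum_def fun_eq_iff split: sum.split)
 have "bordism_push j Z h (cls j Y (osum P Q)) = cls j Z (fst (osum P Q),h \<circ> snd (osum P Q))"
  by (rule bpush_cls[OF _ sing_osum[OF P(1) Q(1)] h]) simp
 also have "\<dots> = cls j Z (fst P,h \<circ> snd P) \<otimes>\<^bsub>bordism_group j Z\<^esub> cls j Z (fst Q,h \<circ> snd Q)"
  unfolding e by (rule bordism_mult[OF emb_pts emb_pts sing_push[OF P(1) h] sing_push[OF Q(1) h],symmetric])
 finally show ?thesis
  unfolding P(2) Q(2) bpush_cls[OF emb_pts P(1) h] bpush_cls[OF emb_pts Q(1) h]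
   bordism_mult[OF emb_pts emb_pts P(1) Q(1)] .
qed

section \<open>Induced maps and products on rational bordism\<close>

definition rat_push :: "'y topology => 'z topology => ('y => 'z) => 'y graded_bordism => 'z graded_bordism"
 where "rat_push Y Z h = hom_extend Y (bordism_rat Z) (\<lambda>j a q. hom_elt Z j (bordism_push j Z h a) q)"

lemma rat_push:
 assumes h: "continuous_map Y Z h"
 shows "rat_push Y Z h \<in> hom (bordism_rat Y) (bordism_rat Z)"
  and "a \<in> Om j Y ==> rat_push Y Z h (hom_elt Y j a q) = hom_elt Z j (bordism_push j Z h a) q"
proof -
 have "biadditive (bordism_group j Y) (bordism_rat Z) (\<lambda>a q. hom_elt Z j (bordism_push j Z h a) q)" for j
  unfolding biadditive_def
  by (intro conjI ballI allI)
    (simp_all add: bpush_mult[OF h] bpush_closed[OF h] hom_elt_closed hom_elt_mult hom_elt_add)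
 note e = hom_extend[OF cgroup_rat this]
 show "rat_push Y Z h \<in> hom (bordism_rat Y) (bordism_rat Z)" unfolding rat_push_def by (rule e(1))
 show "a \<in> Om j Y ==> rat_push Y Z h (hom_elt Y j a q) = hom_elt Z j (bordism_push j Z h a) q"
  unfolding rat_push_def by (rule e(2))
qed

lemma rat_push_cls:
 assumes h: "continuous_map Y Z h" and emb: "embeds TYPE('a)" and P: "sing j Y (P :: ('a,'y) over)"
 shows "rat_push Y Z h (hom_elt Y j (cls j Y P) q) = hom_elt Z j (cls j Z (fst P,h \<circ> snd P)) q"
 by (simp only: rat_push(2)[OF h cls_mem[OF emb P]] bpush_cls[OF emb P h])

text \<open>The product is extended in two rounds: the inner extension concerns the left factor,
  with a generator \<open>b \<otimes> r\<close> on the right held fixed, and the outer one concerns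
  the right factor.\<close>

definition rat_prod :: "'y topology => ('y \<times> 'y => 'y) => 'y graded_bordism => 'y graded_bordism => 'y graded_bordism"
 where "rat_prod Y m x = hom_extend Y (bordism_rat Y) (\<lambda>k b r.
  hom_extend Y (bordism_rat Y) (\<lambda>j a q. hom_elt Y (j + k) (bprod j k Y m a b) (q * r)) x)"

lemma rat_prod:
 assumes m: "continuous_map (prod_topology Y Y) Y m"
 shows "y \<in> OmQ Y ==> (\<lambda>x. rat_prod Y m x y) \<in> hom (bordism_rat Y) (bordism_rat Y)"
  and "x \<in> OmQ Y ==> rat_prod Y m x \<in> hom (bordism_rat Y) (bordism_rat Y)"
  and "a \<in> Om j Y ==> b \<in> Om k Y ==>
   rat_prod Y m (hom_elt Y j a q) (hom_elt Y k b r) = hom_elt Y (j + k) (bprod j k Y m a b) (q * r)"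
proof -
 let ?R = "bordism_rat Y" and ?F = "\<lambda>k b r j a q. hom_elt Y (j + k) (bprod j k Y m a b) (q * r)"
 interpret R: comm_group ?R by (rule cgroup_rat)
 have F: "biadditive (bordism_group j Y) ?R (?F k b r j)" if "b \<in> Om k Y" for j k b r
  unfolding biadditive_def
  by (intro conjI ballI allI)
    (simp_all add: that bprod_mult_left[OF m] bprod_closed[OF m] hom_elt_closed hom_elt_mult hom_elt_add distrib_right)
 note e = hom_extend[OF cgroup_rat F]
 \<comment> \<open>The outer extension needs biadditivity in the right generator. Both sides of each
   law are additive in \<open>x\<close>, so they are compared on generators of the left
   factor.\<close>
 have bi: "biadditive (bordism_group k Y) ?R (\<lambda>b r. hom_extend Y ?R (?F k b r) x)" if x: "x \<in> carrier ?R" for k x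
  unfolding biadditive_def
 proof (intro conjI ballI allI)
  fix b r assume b: "b \<in> Om k Y"
  show "hom_extend Y ?R (?F k b r) x \<in> carrier ?R" by (rule hom_in_carrier[OF e(1)[OF b] x])
  show "hom_extend Y ?R (?F k (b \<otimes>\<^bsub>bordism_group k Y\<^esub> b') r) x = hom_extend Y ?R (?F k b r) x \<otimes>\<^bsub>?R\<^esub> hom_extend Y ?R (?F k b' r) x"
   if b': "b' \<in> Om k Y" for b'
   by (rule brat_hom_eqI[OF e(1)[OF bordism_closed[OF b b']] homprod_hom[OF R.comm_group_axioms R.is_group e(1)[OF b] e(1)[OF b']]
      R.comm_group_axioms _ x])
     (simp add: e(2) b b' bordism_closed bprod_mult_right[OF m] bprod_closed[OF m] hom_elt_mult)
  show "hom_extend Y ?R (?F k b (q + r)) x = hom_extend Y ?R (?F k b q) x \<otimes>\<^bsub>?R\<^esub> hom_extend Y ?R (?F k b r) x" for q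
   by (rule brat_hom_eqI[OF e(1)[OF b] homprod_hom[OF R.comm_group_axioms R.is_group e(1)[OF b] e(1)[OF b]] R.comm_group_axioms _ x])
     (simp only: e(2)[OF b],simp add: b bprod_closed[OF m] hom_elt_add distrib_left)
 qed
 show E1: "rat_prod Y m x \<in> hom ?R ?R" if "x \<in> carrier ?R" for x
  unfolding rat_prod_def by (rule hom_extend(1)[OF cgroup_rat bi[OF that]])
 have E2: "rat_prod Y m x (hom_elt Y k b r) = hom_extend Y ?R (?F k b r) x"
  if "x \<in> carrier ?R" "b \<in> Om k Y" for x k b r
  unfolding rat_prod_def by (rule hom_extend(2)[OF cgroup_rat bi[OF that(1)] that(2)])
 show "(\<lambda>x. rat_prod Y m x y) \<in> hom ?R ?R" if y: "y \<in> carrier ?R" for y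
 proof (rule homI)
  show "rat_prod Y m x y \<in> carrier ?R" if "x \<in> carrier ?R" for x by (rule hom_in_carrier[OF E1[OF that] y])
  fix x x' assume x: "x \<in> carrier ?R" "x' \<in> carrier ?R"
  show "rat_prod Y m (x \<otimes>\<^bsub>?R\<^esub> x') y = rat_prod Y m x y \<otimes>\<^bsub>?R\<^esub> rat_prod Y m x' y"
   by (rule brat_hom_eqI[OF E1[OF R.m_closed[OF x]] homprod_hom[OF R.comm_group_axioms R.is_group E1[OF x(1)] E1[OF x(2)]]
      R.comm_group_axioms _ y])
     (simp add: E2 x hom_mult[OF e(1) x])
 qed
 show "rat_prod Y m (hom_elt Y j a q) (hom_elt Y k b r) = ?F k b r j a q"
  if "a \<in> Om j Y" "b \<in> Om k Y"
  using E2[OF hom_elt_closed[OF that(1)] that(2)] e(2)[OF that(2,1)] by simp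
qed

lemma rat_prod_closed:
 "continuous_map (prod_topology Y Y) Y m ==> x \<in> OmQ Y ==> y \<in> OmQ Y ==>
  rat_prod Y m x y \<in> OmQ Y"
 by (rule hom_in_carrier[OF rat_prod(2)])

lemma rat_prod_cls:
 fixes P :: "('a,'y) over" and Q :: "('b,'y) over"
 assumes m: "continuous_map (prod_topology Y Y) Y m" and emb: "embeds TYPE('a)" "embeds TYPE('b)"
  and P: "sing j Y P" and Q: "sing k Y Q"
 shows "rat_prod Y m (hom_elt Y j (cls j Y P) q) (hom_elt Y k (cls k Y Q) r) = hom_elt Y (j + k) (cls (j + k) Y (oprod m P Q)) (q * r)"
 by (simp only: rat_prod(3)[OF m cls_mem[OF emb(1) P] cls_mem[OF emb(2) Q]] bprod_cls[OF emb m P Q])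

text \<open>On generators, products of manifolds are associative up to diffeomorphism and
  \<open>m\<close> is strictly associative. Additivity then extends the identity to arbitrary
  \<open>z\<close>, then \<open>y\<close>, then \<open>x\<close>.\<close>

lemma rat_prod_assoc:
 assumes m: "continuous_map (prod_topology Y Y) Y m"
  and as: "!!a b c. a \<in> topspace Y ==> b \<in> topspace Y ==> c \<in> topspace Y ==> m (m (a,b),c) = m (a,m (b,c))"
  and x: "x \<in> OmQ Y" and y: "y \<in> OmQ Y" and z: "z \<in> OmQ Y"
 shows "rat_prod Y m (rat_prod Y m x y) z = rat_prod Y m x (rat_prod Y m y z)"
proof -
 let ?p = "rat_prod Y m" and ?R = "bordism_rat Y"
 note C = cgroup_rat[of Y] and cl = rat_prod_closed[OF m] and h1 = rat_prod(1)[OF m] and h2 = rat_prod(2)[OF m]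
 have gen: "?p (?p (hom_elt Y j a q) (hom_elt Y k b r)) (hom_elt Y l c s) = ?p (hom_elt Y j a q) (?p (hom_elt Y k b r) (hom_elt Y l c s))"
  if abc: "a \<in> Om j Y" "b \<in> Om k Y" "c \<in> Om l Y" for a j q b k r c l s
 proof -
  obtain A :: "(pts,'a) over" where A: "sing j Y A" "a = cls j Y A" by (rule bordismE[OF abc(1)])
  obtain B :: "(pts,'a) over" where B: "sing k Y B" "b = cls k Y B" by (rule bordismE[OF abc(2)])
  obtain D :: "(pts,'a) over" where D: "sing l Y D" "c = cls l Y D" by (rule bordismE[OF abc(3)])
  have e: "embeds TYPE(pts \<times> pts)" by simp
  note AB = sing_oprod[OF A(1) B(1) m] and BD = sing_oprod[OF B(1) D(1) m]
  have pts: "snd X p \<in> topspace Y" if "sing i Y X" "p \<in> mf_pts (fst X)" for X :: "(pts,'a) over" and i p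
   using that continuous_map_image_subset_topspace unfolding singular_manifold_def by blast
  have "iso_over (oprod m (oprod m A B) D) (oprod m A (oprod m B D))"
   by (rule iso_oprod_assoc) (use A B D pts as sing_omf in blast)+
  hence "cls (j + k + l) Y (oprod m (oprod m A B) D) = cls (j + k + l) Y (oprod m A (oprod m B D))"
   by (rule cls_iso) (use sing_oprod[OF AB D(1) m] sing_oprod[OF A(1) BD m] in "simp_all add: add.assoc")
  thus ?thesis
   unfolding A(2) B(2) D(2) rat_prod_cls[OF m emb_pts emb_pts A(1) B(1)] rat_prod_cls[OF m emb_pts emb_pts B(1) D(1)]
    rat_prod_cls[OF m e emb_pts AB D(1)] rat_prod_cls[OF m emb_pts e A(1) BD] by (simp add: add.assoc mult.assoc)
 qed
 have 1: "?p (?p (hom_elt Y j a q) (hom_elt Y k b r)) z = ?p (hom_elt Y j a q) (?p (hom_elt Y k b r) z)"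
  if ab: "a \<in> Om j Y" "b \<in> Om k Y" for a j q b k r
 proof -
  note c = hom_elt_closed[OF ab(1),of q] hom_elt_closed[OF ab(2),of r]
  have "(?p (?p (hom_elt Y j a q) (hom_elt Y k b r))) z = (?p (hom_elt Y j a q) \<circ> ?p (hom_elt Y k b r)) z"
   by (rule brat_hom_eqI[OF h2[OF cl[OF c]] hom_compose[OF h2[OF c(2)] h2[OF c(1)]] C _ z]) (simp add: gen[OF ab])
  thus ?thesis by simp
 qed
 have 2: "?p (?p (hom_elt Y j a q) y) z = ?p (hom_elt Y j a q) (?p y z)" if a: "a \<in> Om j Y" for a j q
 proof -
  note c = hom_elt_closed[OF a,of q]
  have "((\<lambda>u. ?p u z) \<circ> ?p (hom_elt Y j a q)) y = (?p (hom_elt Y j a q) \<circ> (\<lambda>u. ?p u z)) y"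
   by (rule brat_hom_eqI[OF hom_compose[OF h2[OF c] h1[OF z]] hom_compose[OF h1[OF z] h2[OF c]] C _ y]) (simp add: 1[OF a])
  thus ?thesis by simp
 qed
 have "((\<lambda>u. ?p u z) \<circ> (\<lambda>u. ?p u y)) x = ?p x (?p y z)"
  by (rule brat_hom_eqI[OF hom_compose[OF h1[OF y] h1[OF z]] h1[OF cl[OF y z]] C _ x]) (simp add: 2)
 thus ?thesis by simp
qed

section \<open>The algebra of garlands\<close>

subsection \<open>Generators\<close>

text \<open>The graph is locally constant on the disjoint union, so any condition on it alone is
  open.\<close>

lemma openin_garlands_type: "openin (garlands \<NN> M) {g \<in> topspace (garlands \<NN> M). Q (fst g)}"
 unfolding garlands_def openin_sum_topology
proof (intro conjI ballI)
 fix \<Gamma> assume "\<Gamma> \<in> {\<Gamma>. allowed_graph \<NN> \<Gamma>}"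
 hence "{x. (\<Gamma>,x) \<in> {g \<in> topspace (sum_topology (diagrams M) {\<Gamma>. allowed_graph \<NN> \<Gamma>}). Q (fst g)}} =
   (if Q \<Gamma> then topspace (diagrams M \<Gamma>) else {})" by auto
 thus "openin (diagrams M \<Gamma>)
   {x. (\<Gamma>,x) \<in> {g \<in> topspace (sum_topology (diagrams M) {\<Gamma>. allowed_graph \<NN> \<Gamma>}). Q (fst g)}}" by simp
qed auto

text \<open>Provides a type of garlands for maps of the empty manifold, which determine no graph
  themselves.\<close>

lemma agraph_empty:
 fixes \<NN> :: "'a omanifold set" shows "allowed_graph \<NN> \<lparr>gg_labels = [],gg_indices = {}\<rparr>"
proof -
 have "\<not> gg_cycle (\<lparr>gg_labels = [],gg_indices = {}\<rparr> :: 'a garland_graph) vs" for vs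
 proof
  assume c: "gg_cycle (\<lparr>gg_labels = [],gg_indices = {}\<rparr> :: 'a garland_graph) vs"
  hence "0 < length vs" by (auto simp: gg_cycle_def)
  thus False using c by (auto simp: gg_cycle_def gg_adj_def gg_edges_def)
 qed
 thus ?thesis by (simp add: allowed_graph_def)
qed

text \<open>The graph of \<open>snd P p\<close> is locally constant in \<open>p\<close>, hence
  constant on a connected manifold. Since the inclusion of the corresponding summand is an open map,
  the diagram part is continuous into the space of that type.\<close>

lemma garland_connected:
 fixes P :: "(pts,('n,'m) garland) over"
 assumes P: "sing j (garlands \<NN> M) P" and conn: "connected_manifold (fst P)"
 obtains \<Gamma> and Q :: "(pts,('n,'m) diagram) over" where "allowed_graph \<NN> \<Gamma>" "sing j (diagrams M \<Gamma>) Q"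
  "connected_manifold (fst Q)" "cls j (garlands \<NN> M) P = cls j (garlands \<NN> M) (fst Q,Pair \<Gamma> \<circ> snd Q)"
proof -
 let ?G = "garlands \<NN> M"
 have c: "continuous_map (mf_top (fst P)) ?G (snd P)" using P by (simp add: singular_manifold_def)
 have pts: "snd P p \<in> topspace ?G" if "p \<in> mf_pts (fst P)" for p using continuous_map_image_subset_topspace[OF c] that by blast
 have "\<exists>\<Gamma>. allowed_graph \<NN> \<Gamma> \<and> (\<forall>p\<in>mf_pts (fst P). fst (snd P p) = \<Gamma>)"
 proof (cases "mf_pts (fst P) = {}")
  case True
  thus ?thesis using agraph_empty by blast
 next
  case False
  then obtain p0 where p0: "p0 \<in> mf_pts (fst P)" by blast
  let ?\<Gamma> = "fst (snd P p0)" and ?T = "mf_top (fst P)"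
  have o: "openin ?T {p \<in> topspace ?T. Q (fst (snd P p))}" for Q
  proof -
   have "{p \<in> topspace ?T. Q (fst (snd P p))} = {p \<in> topspace ?T. snd P p \<in> {g \<in> topspace ?G. Q (fst g)}}" using pts by auto
   thus ?thesis using openin_continuous_map_preimage[OF c openin_garlands_type,of Q] by simp
  qed
  let ?A = "{p \<in> topspace ?T. fst (snd P p) = ?\<Gamma>}"
  have "topspace ?T - ?A = {p \<in> topspace ?T. fst (snd P p) \<noteq> ?\<Gamma>}" by auto
  hence "openin ?T ?A" "closedin ?T ?A" using o[of "\<lambda>g. g = ?\<Gamma>"] o[of "\<lambda>g. g \<noteq> ?\<Gamma>"] by (auto simp: closedin_def)
  hence "?A = {} \<or> ?A = topspace ?T" using conn unfolding connected_manifold_def connected_space_clopen_in by blast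
  hence "?A = topspace ?T" using p0 by blast
  moreover have "allowed_graph \<NN> ?\<Gamma>" using pts[OF p0] by (simp add: topspace_garlands)
  ultimately show ?thesis by blast
 qed
 then obtain \<Gamma> where G: "allowed_graph \<NN> \<Gamma>" "!!p. p \<in> mf_pts (fst P) ==> fst (snd P p) = \<Gamma>" by blast
 let ?Q = "(fst P,snd \<circ> snd P) :: (pts,('n,'m) diagram) over"
 have eq: "Pair \<Gamma> (snd (snd P p)) = snd P p" if "p \<in> mf_pts (fst P)" for p using G(2)[OF that] by (auto simp: prod_eq_iff)
 have "continuous_map (mf_top (fst P)) (diagrams M \<Gamma>) (snd \<circ> snd P)"
  unfolding continuous_map_def
 proof (intro conjI allI impI)
  show "snd \<circ> snd P \<in> mf_pts (fst P) \<rightarrow> topspace (diagrams M \<Gamma>)"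
  proof
   fix p assume p: "p \<in> mf_pts (fst P)"
   show "(snd \<circ> snd P) p \<in> topspace (diagrams M \<Gamma>)" using pts[OF p] G(2)[OF p] by (simp add: topspace_garlands)
  qed
  fix U assume U: "openin (diagrams M \<Gamma>) U"
  have "open_map (diagrams M \<Gamma>) ?G (Pair \<Gamma>)"
   unfolding garlands_def using G(1) by (auto intro: open_map_component_injection)
  hence "openin ?G (Pair \<Gamma> ` U)" using U by (auto simp: open_map_def)
  moreover have "{p \<in> mf_pts (fst P). (snd \<circ> snd P) p \<in> U} = {p \<in> mf_pts (fst P). snd P p \<in> Pair \<Gamma> ` U}"
   using eq by (metis (no_types,lifting) comp_apply image_iff snd_conv)
  ultimately show "openin (mf_top (fst P)) {p \<in> mf_pts (fst P). (snd \<circ> snd P) p \<in> U}"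
   using openin_continuous_map_preimage[OF c] by simp
 qed
 hence Q: "sing j (diagrams M \<Gamma>) ?Q" using P by (simp add: singular_manifold_def)
 have "cls j ?G (fst P,Pair \<Gamma> \<circ> snd ?Q) = cls j ?G P"
  by (rule cls_cong_map(2)[OF P]) (use eq in simp)
 thus ?thesis using that[OF G(1) Q] conn by simp
qed

lemma sing_incl: "allowed_graph \<NN> \<Gamma> ==> sing j (diagrams M \<Gamma>) Q ==> sing j (garlands \<NN> M) (fst Q,Pair \<Gamma> \<circ> snd Q)"
 by (rule sing_push[OF _ cont_garland_incl])

text \<open>Fixing the number of N-vertices rather than the graph isolates what decides whether
  \<open>garland_permute n\<close> acts. This number is preserved by renumberings and adds up under
  joins.\<close>

definition sized :: "'n omanifold set => 'm omanifold => nat => nat => ('a,('n,'m) garland) over => bool"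
 where "sized \<NN> M j n P \<longleftrightarrow> sing j (garlands \<NN> M) P \<and> (\<forall>p\<in>mf_pts (fst P). gg_nu (fst (snd P p)) = n)"

lemma sized_incl: "allowed_graph \<NN> \<Gamma> ==> sing j (diagrams M \<Gamma>) Q ==> sized \<NN> M j (gg_nu \<Gamma>) (fst Q,Pair \<Gamma> \<circ> snd Q)"
 using sing_incl[of \<NN> \<Gamma> j M Q] by (simp add: sized_def)

lemma sizedD:
 assumes "sized \<NN> M j n P"
 shows "sing j (garlands \<NN> M) P" "p \<in> mf_pts (fst P) ==> snd P p \<in> topspace (garlands \<NN> M)"
  "p \<in> mf_pts (fst P) ==> gg_nu (fst (snd P p)) = n"
proof -
 show S: "sing j (garlands \<NN> M) P" using assms by (simp add: sized_def)
 thus "p \<in> mf_pts (fst P) ==> snd P p \<in> topspace (garlands \<NN> M)"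
  using continuous_map_image_subset_topspace unfolding singular_manifold_def by blast
 show "p \<in> mf_pts (fst P) ==> gg_nu (fst (snd P p)) = n" using assms by (simp add: sized_def)
qed

context
 fixes \<NN> :: "'n omanifold set" and M :: "'m omanifold"
begin

abbreviation \<GG> :: "('n,'m) garland topology" where "\<GG> \<equiv> garlands \<NN> M"
abbreviation \<RR> :: "('n,'m) garland graded_bordism monoid" where "\<RR> \<equiv> bordism_rat \<GG>"
abbreviation elt :: "nat => ('a,('n,'m) garland) over => rat => ('n,'m) garland graded_bordism"
 where "elt j P q \<equiv> hom_elt \<GG> j (cls j \<GG> P) q"
abbreviation perm :: "nat => (nat => nat) => ('n,'m) garland graded_bordism => ('n,'m) garland graded_bordism"
 where "perm n \<beta> \<equiv> rat_push \<GG> \<GG> (garland_permute n \<beta>)"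
abbreviation mult :: "('n,'m) garland graded_bordism => ('n,'m) garland graded_bordism => ('n,'m) garland graded_bordism"
 where "mult \<equiv> rat_prod \<GG> garland_join"

lemma cgroup_RR: "comm_group \<RR>" and group_RR: "group \<RR>"
 using cgroup_rat comm_group.axioms(2) by blast+

lemma garland_elt_induct:
 assumes a: "a \<in> Om j \<GG>" and one: "Pr \<one>\<^bsub>\<RR>\<^esub>"
  and mult: "!!x y. x \<in> carrier \<RR> ==> y \<in> carrier \<RR> ==> Pr x ==> Pr y ==> Pr (x \<otimes>\<^bsub>\<RR>\<^esub> y)"
  and gen: "!!\<Gamma> Q :: (pts,('n,'m) diagram) over. allowed_graph \<NN> \<Gamma> ==> sing j (diagrams M \<Gamma>) Q ==>
   connected_manifold (fst Q) ==> Pr (elt j (fst Q,Pair \<Gamma> \<circ> snd Q) q)"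
 shows "Pr (hom_elt \<GG> j a q)"
 using a
proof (rule connected_induct)
 show "Pr (hom_elt \<GG> j \<one>\<^bsub>bordism_group j \<GG>\<^esub> q)" using one by (simp add: hom_elt_one)
 show "Pr (hom_elt \<GG> j (a \<otimes>\<^bsub>bordism_group j \<GG>\<^esub> b) q)"
  if "a \<in> Om j \<GG>" "b \<in> Om j \<GG>" "Pr (hom_elt \<GG> j a q)" "Pr (hom_elt \<GG> j b q)" for a b
  unfolding hom_elt_mult[OF that(1,2)] by (rule mult[OF hom_elt_closed[OF that(1)] hom_elt_closed[OF that(2)] that(3,4)])
 fix P :: "(pts,('n,'m) garland) over" assume P: "sing j \<GG> P" "connected_manifold (fst P)"
 obtain \<Gamma> and Q :: "(pts,('n,'m) diagram) over" where "allowed_graph \<NN> \<Gamma>" "sing j (diagrams M \<Gamma>) Q"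
  "connected_manifold (fst Q)" "cls j \<GG> P = cls j \<GG> (fst Q,Pair \<Gamma> \<circ> snd Q)"
  by (rule garland_connected[OF P])
 thus "Pr (elt j P q)" using gen by simp
qed

lemma garland_hom_eqI:
 assumes f: "f \<in> hom \<RR> \<RR>" and g: "g \<in> hom \<RR> \<RR>"
  and eq: "!!j n q P :: (pts,('n,'m) garland) over. sized \<NN> M j n P ==> f (elt j P q) = g (elt j P q)"
  and x: "x \<in> carrier \<RR>"
 shows "f x = g x"
proof (rule brat_hom_eqI[OF f g cgroup_RR _ x])
 fix j a q assume "a \<in> Om j \<GG>"
 thus "f (hom_elt \<GG> j a q) = g (hom_elt \<GG> j a q)"
 proof (rule garland_elt_induct)
  show "f \<one>\<^bsub>\<RR>\<^esub> = g \<one>\<^bsub>\<RR>\<^esub>" using hom_one[OF f group_RR group_RR] hom_one[OF g group_RR group_RR] by simp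
  show "f (elt j (fst Q,Pair \<Gamma> \<circ> snd Q) q) = g (elt j (fst Q,Pair \<Gamma> \<circ> snd Q) q)"
   if "allowed_graph \<NN> \<Gamma>" "sing j (diagrams M \<Gamma>) Q" for \<Gamma> and Q :: "(pts,('n,'m) diagram) over"
   by (rule eq[OF sized_incl[OF that]])
 qed (simp add: hom_mult[OF f] hom_mult[OF g])
qed

lemma garland_bihom_eqI:
 assumes F: "!!y. y \<in> carrier \<RR> ==> (\<lambda>x. F x y) \<in> hom \<RR> \<RR>" "!!x. x \<in> carrier \<RR> ==> F x \<in> hom \<RR> \<RR>"
  and F': "!!y. y \<in> carrier \<RR> ==> (\<lambda>x. F' x y) \<in> hom \<RR> \<RR>" "!!x. x \<in> carrier \<RR> ==> F' x \<in> hom \<RR> \<RR>"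
  and eq: "!!j n q k m r (P :: (pts,('n,'m) garland) over) Q :: (pts,('n,'m) garland) over. sized \<NN> M j n P ==> sized \<NN> M k m Q ==>
   F (elt j P q) (elt k Q r) = F' (elt j P q) (elt k Q r)"
  and x: "x \<in> carrier \<RR>" and y: "y \<in> carrier \<RR>"
 shows "F x y = F' x y"
proof (rule garland_hom_eqI[OF F(1)[OF y] F'(1)[OF y] _ x])
 fix j n q and P :: "(pts,('n,'m) garland) over" assume P: "sized \<NN> M j n P"
 have c: "elt j P q \<in> carrier \<RR>" by (rule hom_elt_closed[OF cls_mem[OF emb_pts sizedD(1)[OF P]]])
 show "F (elt j P q) y = F' (elt j P q) y" by (rule garland_hom_eqI[OF F(2)[OF c] F'(2)[OF c] eq[OF P] y])
qed

lemma elt_closed: "embeds TYPE('a) ==> sized \<NN> M j n (P :: ('a,('n,'m) garland) over) ==> elt j P q \<in> carrier \<RR>"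
 by (rule hom_elt_closed[OF cls_mem[OF _ sizedD(1)]])

lemma perm_hom: "\<beta> permutes {..<n} ==> perm n \<beta> \<in> hom \<RR> \<RR>"
 by (rule rat_push(1)[OF cont_garland_permute])

lemma perm_closed: "\<beta> permutes {..<n} ==> x \<in> carrier \<RR> ==> perm n \<beta> x \<in> carrier \<RR>"
 by (rule hom_in_carrier[OF perm_hom])

lemma perm_elt:
 "\<beta> permutes {..<n} ==> embeds TYPE('a) ==> sized \<NN> M j m (P :: ('a,('n,'m) garland) over) ==>
  perm n \<beta> (elt j P q) = elt j (fst P,garland_permute n \<beta> \<circ> snd P) q"
 by (rule rat_push_cls[OF cont_garland_permute _ sizedD(1)])

lemma sized_permute:
 "\<beta> permutes {..<n} ==> sized \<NN> M j m P ==> sized \<NN> M j m (fst P,garland_permute n \<beta> \<circ> snd P)"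
 using sing_push[OF sizedD(1) cont_garland_permute] by (simp add: sized_def gg_nu_garland_permute)

lemma elt_cong:
 assumes "sized \<NN> M j m P" "!!p. p \<in> mf_pts (fst P) ==> g p = snd P p" shows "elt j (fst P,g) q = elt j P q"
 using cls_cong_map(2)[OF sizedD(1)[OF assms(1)] assms(2)] by simp

lemma perm_other:
 fixes P :: "('a,('n,'m) garland) over"
 assumes "\<beta> permutes {..<k}" "embeds TYPE('a)" "sized \<NN> M j m P" "k \<noteq> m" shows "perm k \<beta> (elt j P q) = elt j P q"
 unfolding perm_elt[OF assms(1-3)]
 by (rule elt_cong[OF assms(3)]) (use sizedD(3)[OF assms(3)] assms(4) in "simp add: gpermute_other")

subsection \<open>Averaging over the permutations\<close>

text \<open>On garlands whose number of N-vertices is not \<open>n\<close> every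
  \<open>perm n \<beta>\<close> is the identity. The operator is therefore defined on everything but
  averages only the part with \<open>n\<close> N-vertices.\<close>

definition average :: "nat => ('n,'m) garland graded_bordism => ('n,'m) garland graded_bordism"
 where "average n x = bordism_scale \<GG> (1 / fact n) (finprod \<RR> (\<lambda>\<beta>. perm n \<beta> x) {\<beta>. \<beta> permutes {..<n}})"

text \<open>Since \<open>average n\<close> only affects garlands with \<open>n\<close> of the \<open>N\<close>-vertices, the iterates
 \<open>avg_upto n x\<close> are eventually constant.\<close>

primrec avg_upto :: "nat => ('n,'m) garland graded_bordism => ('n,'m) garland graded_bordism"
 where "avg_upto 0 x = x" | "avg_upto (Suc n) x = average n (avg_upto n x)"

text \<open>The eventual value of the iterates; a suitable index exists by
  \<open>avg_upto_eventually\<close>. On garlands with \<open>n\<close> N-vertices it is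
  \<open>average n\<close>.\<close>

definition symm :: "('n,'m) garland graded_bordism => ('n,'m) garland graded_bordism"
 where "symm x = avg_upto (SOME N. \<forall>n\<ge>N. avg_upto n x = avg_upto N x) x"

lemma finite_perms: "finite {\<beta>. \<beta> permutes {..<n::nat}}"
 by (rule finite_permutations) simp

lemma perms_closed: "x \<in> carrier \<RR> ==> (\<lambda>\<beta>. perm n \<beta> x) \<in> {\<beta>. \<beta> permutes {..<n}} \<rightarrow> carrier \<RR>"
 using perm_closed by auto

lemma hom_average:
 assumes f: "f \<in> hom \<RR> \<RR>" and x: "x \<in> carrier \<RR>"
 shows "f (average n x) = bordism_scale \<GG> (1 / fact n) (finprod \<RR> (\<lambda>\<beta>. f (perm n \<beta> x)) {\<beta>. \<beta> permutes {..<n}})"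
proof -
 interpret R: comm_group \<RR> by (rule cgroup_RR)
 have "f (finprod \<RR> h A) = finprod \<RR> (\<lambda>i. f (h i)) A" if "finite A" "h \<in> A \<rightarrow> carrier \<RR>" for A and h :: "(nat => nat) => _"
  using that
 proof (induction A)
  case empty
  thus ?case using hom_one[OF f group_RR group_RR] by simp
 next
  case (insert a A)
  hence h: "h \<in> A \<rightarrow> carrier \<RR>" "h a \<in> carrier \<RR>" by auto
  have fh: "(\<lambda>i. f (h i)) \<in> A \<rightarrow> carrier \<RR>" "f (h a) \<in> carrier \<RR>" using h hom_in_carrier[OF f] by auto
  show ?case
   by (simp add: R.finprod_insert insert.hyps h fh hom_mult[OF f h(2) R.finprod_closed[OF h(1)]] insert.IH[OF h(1)])
 qed
 note this[OF finite_perms perms_closed[OF x,of n]]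
 thus ?thesis
  unfolding average_def hom_bordism_scale[OF f R.finprod_closed[OF perms_closed[OF x]]] by simp
qed

text \<open>All summands become equal, and their number \<open>fact n\<close> cancels the factor in
  front of the sum.\<close>

lemma hom_average_absorb:
 assumes f: "f \<in> hom \<RR> \<RR>" and x: "x \<in> carrier \<RR>" and eq: "!!\<beta>. \<beta> permutes {..<n} ==> f (perm n \<beta> x) = f x"
 shows "f (average n x) = f x"
proof -
 interpret R: comm_group \<RR> by (rule cgroup_RR)
 have fx: "f x \<in> carrier \<RR>" by (rule hom_in_carrier[OF f x])
 have "finprod \<RR> (\<lambda>\<beta>. f (perm n \<beta> x)) {\<beta>. \<beta> permutes {..<n}} = finprod \<RR> (\<lambda>_. f x) {\<beta>. \<beta> permutes {..<n}}"
  by (rule R.finprod_cong') (use fx eq in auto)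
 also have "\<dots> = f x [^]\<^bsub>\<RR>\<^esub> card {\<beta>. \<beta> permutes {..<n}}" by (rule R.finprod_const[OF fx])
 also have "\<dots> = bordism_scale \<GG> (fact n) (f x)"
  using bscale_of_nat[OF fx,of "fact n"] by (simp add: card_permutations)
 finally show ?thesis unfolding hom_average[OF f x] using fx by (simp add: bscale_scale bscale_1)
qed

lemma average_hom: "average n \<in> hom \<RR> \<RR>"
proof -
 interpret R: comm_group \<RR> by (rule cgroup_RR)
 let ?f = "\<lambda>x. finprod \<RR> (\<lambda>\<beta>. perm n \<beta> x) {\<beta>. \<beta> permutes {..<n}}"
 have "?f \<in> hom \<RR> \<RR>"
 proof (rule homI)
  show "?f x \<in> carrier \<RR>" if "x \<in> carrier \<RR>" for x by (rule R.finprod_closed[OF perms_closed[OF that]])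
  fix x y assume xy: "x \<in> carrier \<RR>" "y \<in> carrier \<RR>"
  have "?f (x \<otimes>\<^bsub>\<RR>\<^esub> y) = finprod \<RR> (\<lambda>\<beta>. perm n \<beta> x \<otimes>\<^bsub>\<RR>\<^esub> perm n \<beta> y) {\<beta>. \<beta> permutes {..<n}}"
   by (rule R.finprod_cong') (use xy perm_closed hom_mult[OF perm_hom] in auto)
  also have "\<dots> = ?f x \<otimes>\<^bsub>\<RR>\<^esub> ?f y" by (rule R.finprod_multf[OF perms_closed[OF xy(1)] perms_closed[OF xy(2)]])
  finally show "?f (x \<otimes>\<^bsub>\<RR>\<^esub> y) = ?f x \<otimes>\<^bsub>\<RR>\<^esub> ?f y" .
 qed
 from hom_compose[OF this bscale_hom] show ?thesis by (simp add: average_def[abs_def] comp_def)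
qed

lemma avg_upto_hom: "avg_upto n \<in> hom \<RR> \<RR>"
proof (induction n)
 case 0
 thus ?case by (intro homI) auto
next
 case (Suc n)
 have eq: "avg_upto (Suc n) = average n \<circ> avg_upto n" by (simp add: fun_eq_iff)
 show ?case unfolding eq by (rule hom_compose[OF Suc average_hom])
qed

lemma average_other:
 fixes P :: "('a,('n,'m) garland) over"
 assumes "embeds TYPE('a)" "sized \<NN> M j m P" "k \<noteq> m" shows "average k (elt j P q) = elt j P q"
 using hom_average_absorb[of "\<lambda>x. x" "elt j P q" k] elt_closed[OF assms(1,2)] perm_other[OF _ assms] by (auto intro: homI)

text \<open>Renumbered garlands still have \<open>m\<close> N-vertices, so \<open>average k\<close>
  fixes every summand.\<close>

lemma average_average:
 fixes P :: "('a,('n,'m) garland) over"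
 assumes e: "embeds TYPE('a)" and P: "sized \<NN> M j m P" and k: "k \<noteq> m"
 shows "average k (average m (elt j P q)) = average m (elt j P q)"
proof -
 interpret R: comm_group \<RR> by (rule cgroup_RR)
 have "average k (perm m \<beta> (elt j P q)) = perm m \<beta> (elt j P q)" if "\<beta> permutes {..<m}" for \<beta>
  unfolding perm_elt[OF that e P] by (rule average_other[OF e sized_permute[OF that P] k])
 hence "finprod \<RR> (\<lambda>\<beta>. average k (perm m \<beta> (elt j P q))) {\<beta>. \<beta> permutes {..<m}} =
   finprod \<RR> (\<lambda>\<beta>. perm m \<beta> (elt j P q)) {\<beta>. \<beta> permutes {..<m}}"
  by (intro R.finprod_cong' perms_closed elt_closed[OF e P]) auto
 thus ?thesis unfolding hom_average[OF average_hom elt_closed[OF e P]] by (simp add: average_def)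
qed

text \<open>Only the operator \<open>average m\<close> has an effect. As \<open>avg_upto n\<close>
  has applied the operators with index below \<open>n\<close>, it has acted exactly when
  \<open>m < n\<close>.\<close>

lemma avg_upto_elt:
 fixes P :: "('a,('n,'m) garland) over"
 assumes e: "embeds TYPE('a)" and P: "sized \<NN> M j m P"
 shows "avg_upto n (elt j P q) = (if n \<le> m then elt j P q else average m (elt j P q))"
proof (induction n)
 case (Suc n)
 consider "n < m" | "n = m" | "n > m" by linarith
 thus ?case
  by cases (use Suc average_other[OF e P,of n q] average_average[OF e P,of n q] in auto)
qed simp

text \<open>A generator is stationary beyond its number of N-vertices, and a sum is stationary
  beyond the larger of the bounds of its summands.\<close>

lemma avg_upto_eventually:
 assumes x: "x \<in> carrier \<RR>" shows "\<exists>N. \<forall>n\<ge>N. avg_upto n x = avg_upto N x"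
proof -
 let ?Q = "\<lambda>x. \<exists>N. \<forall>n\<ge>N. avg_upto n x = avg_upto N x"
 have one: "?Q \<one>\<^bsub>\<RR>\<^esub>" using hom_one[OF avg_upto_hom group_RR group_RR] by simp
 have mult: "?Q (x \<otimes>\<^bsub>\<RR>\<^esub> y)" if xy: "x \<in> carrier \<RR>" "y \<in> carrier \<RR>" "?Q x" "?Q y" for x y
 proof -
  obtain N N' where N: "!!n. n \<ge> N ==> avg_upto n x = avg_upto N x" "!!n. n \<ge> N' ==> avg_upto n y = avg_upto N' y"
   using xy by blast
  have "avg_upto n (x \<otimes>\<^bsub>\<RR>\<^esub> y) = avg_upto N x \<otimes>\<^bsub>\<RR>\<^esub> avg_upto N' y" if "n \<ge> max N N'" for n
   using that N(1)[of n] N(2)[of n] by (simp add: hom_mult[OF avg_upto_hom xy(1,2)])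
  thus ?thesis by (intro exI[of _ "max N N'"]) simp
 qed
 show ?thesis
  using x
 proof (rule brat_induct[where P = ?Q,OF _ one mult])
  fix j a q assume a: "a \<in> Om j \<GG>"
  show "?Q (hom_elt \<GG> j a q)"
  proof (rule garland_elt_induct[where Pr = ?Q,OF a one mult])
   fix \<Gamma> and Q :: "(pts,('n,'m) diagram) over"
   assume "allowed_graph \<NN> \<Gamma>" "sing j (diagrams M \<Gamma>) Q"
   note s = avg_upto_elt[OF emb_pts sized_incl[OF this],of _ q]
   show "?Q (elt j (fst Q,Pair \<Gamma> \<circ> snd Q) q)" by (rule exI[of _ "Suc (gg_nu \<Gamma>)"]) (simp only: s,simp)
  qed
 qed
qed

lemma symm_eventually:
 assumes x: "x \<in> carrier \<RR>" obtains N where "!!n. N \<le> n ==> symm x = avg_upto n x"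
proof -
 let ?N = "SOME N. \<forall>n\<ge>N. avg_upto n x = avg_upto N x"
 have "\<forall>n\<ge>?N. avg_upto n x = avg_upto ?N x" by (rule someI_ex[OF avg_upto_eventually[OF x]])
 hence "symm x = avg_upto n x" if "?N \<le> n" for n
  unfolding symm_def using that by (intro sym[of "avg_upto n x"]) (elim allE impE)
 thus thesis by (rule that)
qed

lemma symm_hom: "symm \<in> hom \<RR> \<RR>"
proof (rule homI)
 fix x assume x: "x \<in> carrier \<RR>"
 obtain N where "!!n. N \<le> n ==> symm x = avg_upto n x" by (rule symm_eventually[OF x]) blast
 hence "symm x = avg_upto N x" by simp
 thus sx: "symm x \<in> carrier \<RR>" using hom_in_carrier[OF avg_upto_hom x] by simp
next
 interpret R: comm_group \<RR> by (rule cgroup_RR)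
 fix x y assume x: "x \<in> carrier \<RR>" and y: "y \<in> carrier \<RR>"
 obtain N1 where 1: "!!n. N1 \<le> n ==> symm x = avg_upto n x" by (rule symm_eventually[OF x]) blast
 obtain N2 where 2: "!!n. N2 \<le> n ==> symm y = avg_upto n y" by (rule symm_eventually[OF y]) blast
 obtain N3 where 3: "!!n. N3 \<le> n ==> symm (x \<otimes>\<^bsub>\<RR>\<^esub> y) = avg_upto n (x \<otimes>\<^bsub>\<RR>\<^esub> y)"
  by (rule symm_eventually[OF R.m_closed[OF x y]]) blast
 show "symm (x \<otimes>\<^bsub>\<RR>\<^esub> y) = symm x \<otimes>\<^bsub>\<RR>\<^esub> symm y"
  using 1[of "N1 + N2 + N3"] 2[of "N1 + N2 + N3"] 3[of "N1 + N2 + N3"] hom_mult[OF avg_upto_hom x y] by simp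
qed

lemma symm_closed: "x \<in> carrier \<RR> ==> symm x \<in> carrier \<RR>"
 by (rule hom_in_carrier[OF symm_hom])

lemma symm_elt:
 fixes P :: "('a,('n,'m) garland) over"
 assumes e: "embeds TYPE('a)" and P: "sized \<NN> M j m P" shows "symm (elt j P q) = average m (elt j P q)"
proof -
 obtain N where "!!n. N \<le> n ==> symm (elt j P q) = avg_upto n (elt j P q)"
  by (rule symm_eventually[OF elt_closed[OF e P]]) blast
 from this[of "N + Suc m"] show ?thesis by (simp only: avg_upto_elt[OF e P]) simp
qed

text \<open>Composition with \<open>\<beta>\<close> is a right translation of the symmetric group
  and only rearranges the summands.\<close>

lemma average_perm:
 fixes P :: "('a,('n,'m) garland) over"
 assumes e: "embeds TYPE('a)" and P: "sized \<NN> M j n P" and b: "\<beta> permutes {..<n}"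
 shows "average n (perm n \<beta> (elt j P q)) = average n (elt j P q)"
proof -
 interpret R: comm_group \<RR> by (rule cgroup_RR)
 let ?S = "{\<gamma>. \<gamma> permutes {..<n}}" and ?w = "elt j P q"
 have "perm n \<gamma> (perm n \<beta> ?w) = perm n (\<gamma> \<circ> \<beta>) ?w" if g: "\<gamma> permutes {..<n}" for \<gamma>
 proof -
  note gb = permutes_compose[OF b g]
  have "elt j (fst P,garland_permute n \<gamma> \<circ> (garland_permute n \<beta> \<circ> snd P)) q = elt j (fst P,garland_permute n (\<gamma> \<circ> \<beta>) \<circ> snd P) q"
   using elt_cong[OF sized_permute[OF gb P],of "garland_permute n \<gamma> \<circ> (garland_permute n \<beta> \<circ> snd P)" q]
   by (simp add: gpermute_compose[OF g b sizedD(2)[OF P]])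
  thus ?thesis using perm_elt[OF g e sized_permute[OF b P]] unfolding perm_elt[OF b e P] perm_elt[OF gb e P] by simp
 qed
 hence "finprod \<RR> (\<lambda>\<gamma>. perm n \<gamma> (perm n \<beta> ?w)) ?S = finprod \<RR> (\<lambda>\<gamma>. perm n (\<gamma> \<circ> \<beta>) ?w) ?S"
  by (intro R.finprod_cong') (auto intro!: perm_closed permutes_compose[OF b] elt_closed[OF e P])
 also have "\<dots> = finprod \<RR> (\<lambda>\<gamma>. perm n \<gamma> ?w) ((\<lambda>\<gamma>. \<gamma> \<circ> \<beta>) ` ?S)"
 proof (rule R.finprod_reindex[symmetric])
  show "(\<lambda>\<gamma>. perm n \<gamma> ?w) \<in> (\<lambda>\<gamma>. \<gamma> \<circ> \<beta>) ` ?S \<rightarrow> carrier \<RR>"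
   by (auto intro!: perm_closed permutes_compose[OF b] elt_closed[OF e P])
  show "inj_on (\<lambda>\<gamma>. \<gamma> \<circ> \<beta>) ?S"
  proof (rule inj_onI)
   fix \<gamma> \<delta> assume "\<gamma> \<circ> \<beta> = \<delta> \<circ> \<beta>"
   hence "\<gamma> (\<beta> (inv_into UNIV \<beta> i)) = \<delta> (\<beta> (inv_into UNIV \<beta> i))" for i by (metis comp_apply)
   thus "\<gamma> = \<delta>" using permutes_inv_into(3)[OF b] by (simp add: fun_eq_iff)
  qed
 qed
 also have "(\<lambda>\<gamma>. \<gamma> \<circ> \<beta>) ` ?S = ?S"
  using image_compose_permutations_right[OF b] by (auto simp: image_def)
 finally show ?thesis by (simp add: average_def)
qed

lemma symm_perm:
 assumes b: "\<beta> permutes {..<n}" and x: "x \<in> carrier \<RR>" shows "symm (perm n \<beta> x) = symm x"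
proof -
 have "(symm \<circ> perm n \<beta>) x = symm x"
 proof (rule garland_hom_eqI[OF hom_compose[OF perm_hom[OF b] symm_hom] symm_hom _ x])
  fix j m q and P :: "(pts,('n,'m) garland) over" assume P: "sized \<NN> M j m P"
  show "(symm \<circ> perm n \<beta>) (elt j P q) = symm (elt j P q)"
  proof (cases "n = m")
   case False
   thus ?thesis using perm_other[OF b emb_pts P] by simp
  next
   case True
   have "symm (perm n \<beta> (elt j P q)) = average m (perm n \<beta> (elt j P q))"
    unfolding perm_elt[OF b emb_pts P] by (rule symm_elt[OF emb_pts sized_permute[OF b P]])
   thus ?thesis using average_perm[OF emb_pts P] b True by (simp add: symm_elt[OF emb_pts P])
  qed
 qed
 thus ?thesis by simp
qed

text \<open>A map invariant under all renumberings absorbs each averaging operator in turn. Applied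
  to \<open>\<lambda>x. symm (mult x z)\<close> it removes an inner symmetrization.\<close>

lemma hom_symmetrize_absorb:
 assumes f: "f \<in> hom \<RR> \<RR>" and eq: "!!n \<beta> x. \<beta> permutes {..<n} ==> x \<in> carrier \<RR> ==> f (perm n \<beta> x) = f x" and x: "x \<in> carrier \<RR>"
 shows "f (symm x) = f x"
proof -
 have *: "f (avg_upto n x) = f x" for n
 proof (induction n)
  case (Suc n)
  show ?case using hom_average_absorb[OF f hom_in_carrier[OF avg_upto_hom x] eq,of n n] hom_in_carrier[OF avg_upto_hom x] Suc by simp
 qed simp
 obtain N where "!!n. N \<le> n ==> symm x = avg_upto n x" by (rule symm_eventually[OF x]) blast
 hence "symm x = avg_upto N x" by simp
 thus ?thesis using * by simp
qed

subsection \<open>The symmetrized product\<close>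

lemmas mult_hom = rat_prod(1,2)[OF cont_garland_join,of _ \<NN> M]
lemmas mult_closed = rat_prod_closed[OF cont_garland_join,of _ \<NN> M]

lemma mult_elt:
 fixes P :: "('a,('n,'m) garland) over" and Q :: "('b,('n,'m) garland) over"
 assumes "embeds TYPE('a)" "embeds TYPE('b)" "sized \<NN> M j n P" "sized \<NN> M k m Q"
 shows "mult (elt j P q) (elt k Q r) = elt (j + k) (oprod garland_join P Q) (q * r)"
 by (rule rat_prod_cls[OF cont_garland_join assms(1,2) sizedD(1)[OF assms(3)] sizedD(1)[OF assms(4)]])

lemma sized_oprod:
 assumes "sized \<NN> M j n P" "sized \<NN> M k m Q" shows "sized \<NN> M (j + k) (n + m) (oprod garland_join P Q)"
 unfolding sized_def
proof (intro conjI ballI)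
 show "sing (j + k) (garlands \<NN> M) (oprod garland_join P Q)"
  by (rule sing_oprod[OF sizedD(1)[OF assms(1)] sizedD(1)[OF assms(2)] cont_garland_join])
 fix p assume "p \<in> mf_pts (fst (oprod garland_join P Q))"
 hence "fst p \<in> mf_pts (fst P)" "snd p \<in> mf_pts (fst Q)" by (auto simp: oprod_def mf_prod_simps)
 thus "gg_nu (fst (snd (oprod garland_join P Q) p)) = n + m"
  using sizedD(3)[OF assms(1)] sizedD(3)[OF assms(2)] by (simp add: oprod_def garland_join_def case_prod_unfold)
qed

lemma oprod_pts:
 "z \<in> mf_pts (fst (oprod m P Q)) \<longleftrightarrow> fst z \<in> mf_pts (fst P) \<and> snd z \<in> mf_pts (fst Q)"
 "snd (oprod m P Q) z = m (snd P (fst z),snd Q (snd z))" "fst (oprod m P Q) = mf_prod (fst P) (fst Q)"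
 by (auto simp: oprod_def mf_prod_simps case_prod_unfold mem_Times_iff)

text \<open>Turns an identity of garlands that holds point by point, up to one fixed renumbering,
  into an identity of symmetrized classes.\<close>

lemma symm_elt_cong:
 fixes P P' :: "('a,('n,'m) garland) over"
 assumes e: "embeds TYPE('a)" and P: "sized \<NN> M j n P" and b: "\<beta> permutes {..<k}" and V: "fst P' = fst P"
  and eq: "!!p. p \<in> mf_pts (fst P) ==> snd P' p = garland_permute k \<beta> (snd P p)"
 shows "symm (elt j P' q) = symm (elt j P q)"
proof -
 have "elt j (fst P,snd P') q = elt j (fst P,garland_permute k \<beta> \<circ> snd P) q"
  using elt_cong[OF sized_permute[OF b P],of "snd P'"] eq by simp
 also have "\<dots> = perm k \<beta> (elt j P q)" by (rule perm_elt[OF b e P,symmetric])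
 finally have "elt j P' q = perm k \<beta> (elt j P q)" by (simp add: V)
 thus ?thesis using symm_perm[OF b elt_closed[OF e P]] by simp
qed

lemma star_hom:
 "y \<in> carrier \<RR> ==> (\<lambda>x. symm (mult x y)) \<in> hom \<RR> \<RR>" "x \<in> carrier \<RR> ==> (\<lambda>y. symm (mult x y)) \<in> hom \<RR> \<RR>"
 using hom_compose[OF mult_hom(1) symm_hom] hom_compose[OF mult_hom(2) symm_hom] by (simp_all add: comp_def)

text \<open>Two cases on generators: if the left factor has \<open>l\<close> N-vertices, the
  renumbering passes to the join, extended by the identity, and \<open>symm\<close> absorbs it;
  otherwise it does nothing.\<close>

lemma symm_mult_perm_left:
 assumes b: "\<beta> permutes {..<l}" and x: "x \<in> carrier \<RR>" and y: "y \<in> carrier \<RR>"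
 shows "symm (mult (perm l \<beta> x) y) = symm (mult x y)"
proof (rule garland_bihom_eqI[OF _ _ star_hom _ x y,where F = "\<lambda>x y. symm (mult (perm l \<beta> x) y)"])
 show "(\<lambda>x. symm (mult (perm l \<beta> x) y)) \<in> hom \<RR> \<RR>" if "y \<in> carrier \<RR>" for y
  using hom_compose[OF perm_hom[OF b] star_hom(1)[OF that]] by (simp add: comp_def)
 show "(\<lambda>y. symm (mult (perm l \<beta> x) y)) \<in> hom \<RR> \<RR>" if "x \<in> carrier \<RR>" for x
  by (rule star_hom(2)[OF perm_closed[OF b that]])
 fix j n q k m r and P Q :: "(pts,('n,'m) garland) over" assume P: "sized \<NN> M j n P" and Q: "sized \<NN> M k m Q"
 show "symm (mult (perm l \<beta> (elt j P q)) (elt k Q r)) = symm (mult (elt j P q) (elt k Q r))"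
 proof (cases "l = n")
  case False
  thus ?thesis by (simp add: perm_other[OF b emb_pts P])
 next
  case l: True
  note b = b[unfolded l] and P' = sized_permute[OF b[unfolded l] P]
  have b': "\<beta> permutes {..<n + m}" by (rule permutes_subset[OF b]) auto
  show ?thesis
   unfolding l perm_elt[OF b emb_pts P] mult_elt[OF emb_pts emb_pts P' Q] mult_elt[OF emb_pts emb_pts P Q]
  proof (rule symm_elt_cong[OF _ sized_oprod[OF P Q] b'])
   fix z assume "z \<in> mf_pts (fst (oprod garland_join P Q))"
   hence z: "fst z \<in> mf_pts (fst P)" "snd z \<in> mf_pts (fst Q)" by (simp_all only: oprod_pts(1))
   show "snd (oprod garland_join (fst P,garland_permute n \<beta> \<circ> snd P) Q) z = garland_permute (n + m) \<beta> (snd (oprod garland_join P Q) z)"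
    using join_permute_left[OF sizedD(2)[OF P z(1)] sizedD(2)[OF Q z(2)] sizedD(3)[OF P z(1)] sizedD(3)[OF Q z(2)] b]
    by (simp add: oprod_pts)
  qed (simp_all add: oprod_pts)
 qed
qed

text \<open>Interchanging the manifolds leaves a sign on \<open>P\<close>, which
  \<open>hom_elt_sgn\<close> turns into a scalar that linearity moves to the front. The interchange
  of the garlands is a block exchange of numbers and disappears under \<open>symm\<close>.\<close>

lemma symm_mult_comm:
 fixes P Q :: "(pts,('n,'m) garland) over"
 assumes P: "sized \<NN> M j n P" and Q: "sized \<NN> M k m Q"
 shows "symm (mult (elt j P q) (elt k Q r)) = bordism_scale \<GG> ((-1) ^ (j * k)) (symm (mult (elt k Q r) (elt j P q)))"
proof -
 let ?P = "(mf_sgn (j * k) (fst P),snd P)" and ?m = "\<lambda>(b,a). garland_join (a,b)" and ?W = "elt j P q" and ?Z = "elt k Q r"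
 have P': "sized \<NN> M j n ?P" using P sing_sgn[OF sizedD(1)[OF P]] by (simp add: sized_def mf_sgn_simps)
 have e: "embeds TYPE(pts \<times> pts)" by simp
 let ?O = "oprod garland_join Q ?P" and ?O' = "oprod ?m Q ?P"
 note O = sized_oprod[OF Q P']
 have W: "?W \<in> carrier \<RR>" "?Z \<in> carrier \<RR>" by (rule elt_closed[OF emb_pts P],rule elt_closed[OF emb_pts Q])
 note iso = cls_oprod_swap[OF cont_garland_join sizedD(1)[OF P] sizedD(1)[OF Q]]
 have "symm (mult ?W ?Z) = symm (elt (k + j) ?O' (r * q))"
  unfolding mult_elt[OF emb_pts emb_pts P Q] iso by (simp add: add.commute mult.commute)
 also have "\<dots> = symm (elt (k + j) ?O (r * q))"
 proof (rule symm_elt_cong[OF e O permutes_swap_blocks])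
  fix z assume "z \<in> mf_pts (fst ?O)"
  hence z: "fst z \<in> mf_pts (fst Q)" "snd z \<in> mf_pts (fst ?P)" by (simp_all only: oprod_pts(1))
  from garland_join_swap[OF sizedD(2)[OF Q z(1)] sizedD(2)[OF P' z(2)] sizedD(3)[OF Q z(1)] sizedD(3)[OF P' z(2)]]
  show "snd ?O' z = garland_permute (m + n) (\<lambda>i. if i < m then n + i else if i < m + n then i - m else i) (snd ?O z)"
   by (simp add: oprod_pts)
 qed (simp add: oprod_pts)
 also have "elt (k + j) ?O (r * q) = mult ?Z (elt j ?P q)" by (rule mult_elt[OF emb_pts emb_pts Q P',symmetric])
 also have "elt j ?P q = bordism_scale \<GG> ((-1) ^ (j * k)) ?W"
  unfolding hom_elt_sgn[OF emb_pts sizedD(1)[OF P]] bscale_elt[OF cls_mem[OF emb_pts sizedD(1)[OF P]]] ..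
 also have "symm (mult ?Z (bordism_scale \<GG> ((-1) ^ (j * k)) ?W)) = bordism_scale \<GG> ((-1) ^ (j * k)) (symm (mult ?Z ?W))"
  by (rule hom_bordism_scale[OF star_hom(2)[OF W(2)] W(1)])
 finally show ?thesis .
qed

text \<open>Commute, renumber on the left, commute back. Renumbering keeps the degree, so the two
  signs agree.\<close>

lemma symm_mult_perm_right:
 assumes b: "\<beta> permutes {..<l}" and x: "x \<in> carrier \<RR>" and y: "y \<in> carrier \<RR>"
 shows "symm (mult x (perm l \<beta> y)) = symm (mult x y)"
proof (rule garland_bihom_eqI[OF _ _ star_hom _ x y,where F = "\<lambda>x y. symm (mult x (perm l \<beta> y))"])
 show "(\<lambda>y. symm (mult x (perm l \<beta> y))) \<in> hom \<RR> \<RR>" if "x \<in> carrier \<RR>" for x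
  using hom_compose[OF perm_hom[OF b] star_hom(2)[OF that]] by (simp add: comp_def)
 show "(\<lambda>x. symm (mult x (perm l \<beta> y))) \<in> hom \<RR> \<RR>" if "y \<in> carrier \<RR>" for y
  by (rule star_hom(1)[OF perm_closed[OF b that]])
 fix j n q k m r and P Q :: "(pts,('n,'m) garland) over" assume P: "sized \<NN> M j n P" and Q: "sized \<NN> M k m Q"
 show "symm (mult (elt j P q) (perm l \<beta> (elt k Q r))) = symm (mult (elt j P q) (elt k Q r))"
  using symm_mult_comm[OF P sized_permute[OF b Q]] symm_mult_comm[OF P Q]
   symm_mult_perm_left[OF b elt_closed[OF emb_pts Q] elt_closed[OF emb_pts P]]
  by (simp add: perm_elt[OF b emb_pts Q])
qed

text \<open>The default value off the carrier comes from the extensional function space in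
  \<open>bordism_rat_bilinear\<close>; it makes the operation unique as a function.\<close>

definition star :: "('n,'m) garland graded_bordism \<times> ('n,'m) garland graded_bordism => ('n,'m) garland graded_bordism"
 where "star = restrict (\<lambda>(x,y). symm (mult x y)) (carrier \<RR> \<times> carrier \<RR>)"

lemma star_eq: "x \<in> carrier \<RR> ==> y \<in> carrier \<RR> ==> star (x,y) = symm (mult x y)"
 by (simp add: star_def)

lemma star_closed: "x \<in> carrier \<RR> ==> y \<in> carrier \<RR> ==> star (x,y) \<in> carrier \<RR>"
 using symm_closed[OF mult_closed] by (simp add: star_eq)

lemma star_assoc:
 assumes x: "x \<in> carrier \<RR>" and y: "y \<in> carrier \<RR>" and z: "z \<in> carrier \<RR>"
 shows "star (star (x,y),z) = star (x,star (y,z))"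
proof -
 have "star (star (x,y),z) = symm (mult (symm (mult x y)) z)"
  using star_closed[OF x y] by (simp add: star_eq x y z)
 also have "\<dots> = symm (mult (mult x y) z)"
  by (rule hom_symmetrize_absorb[OF star_hom(1)[OF z] symm_mult_perm_left[OF _ _ z] mult_closed[OF x y]])
 also have "\<dots> = symm (mult x (mult y z))"
  by (simp add: rat_prod_assoc[OF cont_garland_join garland_join_assoc x y z])
 also have "\<dots> = symm (mult x (symm (mult y z)))"
  by (rule hom_symmetrize_absorb[OF star_hom(2)[OF x] symm_mult_perm_right[OF _ x] mult_closed[OF y z],symmetric])
 also have "\<dots> = star (x,star (y,z))" using star_closed[OF y z] by (simp add: star_eq x y z)
 finally show ?thesis .
qed

subsection \<open>Degrees and graded commutativity\<close>

lemma deg_closed: "x \<in> bordism_rat_deg j \<GG> ==> x \<in> carrier \<RR>"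
 by (simp add: bordism_rat_deg_def)

lemma deg_one: "\<one>\<^bsub>\<RR>\<^esub> \<in> bordism_rat_deg j \<GG>"
 using monoid.one_closed[OF group.is_monoid[OF group_RR]] by (simp add: bordism_rat_deg_def brat_one)

lemma deg_mult: "x \<in> bordism_rat_deg j \<GG> ==> y \<in> bordism_rat_deg j \<GG> ==> x \<otimes>\<^bsub>\<RR>\<^esub> y \<in> bordism_rat_deg j \<GG>"
 using monoid.m_closed[OF group.is_monoid[OF bgroup_rat[of \<GG>]],of x y]
 by (simp add: bordism_rat_deg_def)
   (simp add: brat_mult monoid.l_one[OF group.is_monoid[OF group_rat] monoid.one_closed[OF group.is_monoid[OF group_rat]]])

lemma deg_elt: "a \<in> Om j \<GG> ==> hom_elt \<GG> j a q \<in> bordism_rat_deg j \<GG>"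
 using hom_elt_closed by (auto simp: bordism_rat_deg_def hom_elt_def)

lemma hom_deg:
 assumes f: "f \<in> hom \<RR> \<RR>" and x: "x \<in> bordism_rat_deg j \<GG>"
  and elt: "!!a q. a \<in> Om j \<GG> ==> f (hom_elt \<GG> j a q) \<in> bordism_rat_deg k \<GG>"
 shows "f x \<in> bordism_rat_deg k \<GG>"
 using x
proof (rule brat_deg_induct)
 show "f \<one>\<^bsub>\<RR>\<^esub> \<in> bordism_rat_deg k \<GG>" using hom_one[OF f group_RR group_RR] deg_one by simp
qed (simp_all add: hom_mult[OF f] deg_mult elt)

lemma scale_deg: "x \<in> bordism_rat_deg j \<GG> ==> bordism_scale \<GG> q x \<in> bordism_rat_deg j \<GG>"
 by (rule hom_deg[OF bscale_hom]) (auto simp: bscale_elt intro: deg_elt)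

lemma average_deg:
 assumes x: "x \<in> bordism_rat_deg j \<GG>" shows "average n x \<in> bordism_rat_deg j \<GG>"
proof -
 interpret R: comm_group \<RR> by (rule cgroup_RR)
 have p: "perm n \<beta> x \<in> bordism_rat_deg j \<GG>" if b: "\<beta> permutes {..<n}" for \<beta>
 proof (rule hom_deg[OF perm_hom[OF b] x])
  note c = cont_garland_permute[OF b]
  show "perm n \<beta> (hom_elt \<GG> j a q) \<in> bordism_rat_deg j \<GG>" if a: "a \<in> Om j \<GG>" for a q
   unfolding rat_push(2)[OF c a] by (rule deg_elt[OF bpush_closed[OF c a]])
 qed
 have "finprod \<RR> h A \<in> bordism_rat_deg j \<GG>" if "finite A" "!!i. i \<in> A ==> h i \<in> bordism_rat_deg j \<GG>" for A and h :: "(nat => nat) => _"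
  using that
 proof (induction A)
  case (insert a A)
  hence c: "h \<in> A \<rightarrow> carrier \<RR>" "h a \<in> carrier \<RR>" using deg_closed by auto
  show ?case using insert by (simp add: R.finprod_insert c deg_mult)
 qed (simp add: deg_one)
 from scale_deg[OF this[OF finite_perms p]] show ?thesis by (simp add: average_def)
qed

lemma symm_deg:
 assumes x: "x \<in> bordism_rat_deg j \<GG>" shows "symm x \<in> bordism_rat_deg j \<GG>"
proof -
 have *: "avg_upto n x \<in> bordism_rat_deg j \<GG>" for n by (induction n) (auto intro: x average_deg)
 obtain N where "!!n. N \<le> n ==> symm x = avg_upto n x" by (rule symm_eventually[OF deg_closed[OF x]]) blast
 hence "symm x = avg_upto N x" by simp
 thus ?thesis using * by simp
qed

lemma star_deg:
 assumes x: "x \<in> bordism_rat_deg j \<GG>" and y: "y \<in> bordism_rat_deg k \<GG>" shows "star (x,y) \<in> bordism_rat_deg (j + k) \<GG>"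
proof -
 have "mult x y \<in> bordism_rat_deg (j + k) \<GG>"
 proof (rule hom_deg[OF mult_hom(1)[OF deg_closed[OF y]] x])
  fix a q assume a: "a \<in> Om j \<GG>"
  show "mult (hom_elt \<GG> j a q) y \<in> bordism_rat_deg (j + k) \<GG>"
  proof (rule hom_deg[OF mult_hom(2)[OF hom_elt_closed[OF a]] y])
   fix b r assume b: "b \<in> Om k \<GG>"
   show "mult (hom_elt \<GG> j a q) (hom_elt \<GG> k b r) \<in> bordism_rat_deg (j + k) \<GG>"
    unfolding rat_prod(3)[OF cont_garland_join a b] by (rule deg_elt[OF bprod_closed[OF cont_garland_join a b]])
  qed
 qed
 thus ?thesis using symm_deg by (simp add: star_eq deg_closed[OF x] deg_closed[OF y])
qed

lemma garland_induct:
 assumes x: "x \<in> carrier \<RR>" and one: "Pr \<one>\<^bsub>\<RR>\<^esub>"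
  and mult: "!!x y. x \<in> carrier \<RR> ==> y \<in> carrier \<RR> ==> Pr x ==> Pr y ==> Pr (x \<otimes>\<^bsub>\<RR>\<^esub> y)"
  and gen: "!!j q \<Gamma> Q :: (pts,('n,'m) diagram) over. allowed_graph \<NN> \<Gamma> ==> sing j (diagrams M \<Gamma>) Q ==>
   connected_manifold (fst Q) ==> Pr (elt j (fst Q,Pair \<Gamma> \<circ> snd Q) q)"
 shows "Pr x"
 by (rule brat_induct[where P = Pr,OF x one mult garland_elt_induct[where Pr = Pr,OF _ one mult gen]])

lemma garland_deg_induct:
 assumes x: "x \<in> bordism_rat_deg j \<GG>" and one: "Pr \<one>\<^bsub>\<RR>\<^esub>"
  and mult: "!!x y. x \<in> carrier \<RR> ==> y \<in> carrier \<RR> ==> Pr x ==> Pr y ==> Pr (x \<otimes>\<^bsub>\<RR>\<^esub> y)"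
  and gen: "!!n q P :: (pts,('n,'m) garland) over. sized \<NN> M j n P ==> Pr (elt j P q)"
 shows "Pr x"
 by (rule brat_deg_induct[where P = Pr,OF x one mult garland_elt_induct[where Pr = Pr,OF _ one mult gen[OF sized_incl]]])

text \<open>The sign depends on the degrees only, so it is the same for all generators of the two
  homogeneous parts, and the identity extends additively in one variable after the other.\<close>

lemma star_comm:
 assumes x: "x \<in> bordism_rat_deg j \<GG>" and y: "y \<in> bordism_rat_deg k \<GG>"
 shows "star (x,y) = bordism_scale \<GG> ((-1) ^ (j * k)) (star (y,x))"
proof -
 let ?s = "bordism_scale \<GG> ((-1) ^ (j * k))"
 let ?Q = "\<lambda>x y. symm (mult x y) = ?s (symm (mult y x))"
 note s1 = hom_one[OF bscale_hom bgroup_rat bgroup_rat] and sm = hom_mult[OF bscale_hom]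
 note h = star_hom and o1 = hom_one[OF star_hom(1) group_RR group_RR] and o2 = hom_one[OF star_hom(2) group_RR group_RR]
 have oneL: "?Q \<one>\<^bsub>\<RR>\<^esub> y" and oneR: "?Q y \<one>\<^bsub>\<RR>\<^esub>" if "y \<in> carrier \<RR>" for y
  using o1[OF that] o2[OF that] by (simp_all add: s1)
 have cl: "symm (mult u v) \<in> carrier \<RR>" if "u \<in> carrier \<RR>" "v \<in> carrier \<RR>" for u v
  by (rule symm_closed[OF mult_closed[OF that]])
 have multL: "?Q (u \<otimes>\<^bsub>\<RR>\<^esub> v) y" if y: "y \<in> carrier \<RR>" and u: "u \<in> carrier \<RR>" "v \<in> carrier \<RR>" and Q: "?Q u y" "?Q v y" for u v y
  unfolding hom_mult[OF h(1)[OF y] u] hom_mult[OF h(2)[OF y] u] sm[OF cl[OF y u(1)] cl[OF y u(2)]] by (simp only: Q)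
 have multR: "?Q y (u \<otimes>\<^bsub>\<RR>\<^esub> v)" if y: "y \<in> carrier \<RR>" and u: "u \<in> carrier \<RR>" "v \<in> carrier \<RR>" and Q: "?Q y u" "?Q y v" for u v y
  unfolding hom_mult[OF h(1)[OF y] u] hom_mult[OF h(2)[OF y] u] sm[OF cl[OF u(1) y] cl[OF u(2) y]] by (simp only: Q)
 have "?Q x y"
 proof (rule garland_deg_induct[where Pr = "\<lambda>x. ?Q x y",OF x oneL[OF deg_closed[OF y]] multL[OF deg_closed[OF y]]])
  fix n q and P :: "(pts,('n,'m) garland) over" assume P: "sized \<NN> M j n P"
  note c = elt_closed[OF emb_pts P,of q]
  show "?Q (elt j P q) y"
   by (rule garland_deg_induct[where Pr = "\<lambda>y. ?Q (elt j P q) y",OF y oneR[OF c] multR[OF c] symm_mult_comm[OF P]])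
 qed
 thus ?thesis by (simp only: star_eq[OF deg_closed[OF x] deg_closed[OF y]] star_eq[OF deg_closed[OF y] deg_closed[OF x]])
qed

subsection \<open>The product \<open>\<star>\<close>\<close>

lemma star_bilinear: "bordism_rat_bilinear \<GG> star"
 unfolding bordism_rat_bilinear_def
proof (intro conjI ballI allI)
 interpret R: comm_group \<RR> by (rule cgroup_RR)
 show "star \<in> carrier \<RR> \<times> carrier \<RR> \<rightarrow>\<^sub>E carrier \<RR>"
 proof (rule PiE_I)
  show "star z \<in> carrier \<RR>" if "z \<in> carrier \<RR> \<times> carrier \<RR>" for z using that star_closed by (cases z) auto
  show "star z = undefined" if "z \<notin> carrier \<RR> \<times> carrier \<RR>" for z using that by (simp add: star_def)
 qed
 fix x y assume x: "x \<in> carrier \<RR>" and y: "y \<in> carrier \<RR>"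
 show "star (x \<otimes>\<^bsub>\<RR>\<^esub> y,z) = star (x,z) \<otimes>\<^bsub>\<RR>\<^esub> star (y,z)" if z: "z \<in> carrier \<RR>" for z
  using hom_mult[OF star_hom(1)[OF z] x y] R.m_closed[OF x y] by (simp add: star_eq x y z)
 show "star (x,y \<otimes>\<^bsub>\<RR>\<^esub> z) = star (x,y) \<otimes>\<^bsub>\<RR>\<^esub> star (x,z)" if z: "z \<in> carrier \<RR>" for z
  using hom_mult[OF star_hom(2)[OF x] y z] R.m_closed[OF y z] by (simp add: star_eq x y z)
 show "star (bordism_scale \<GG> q x,y) = bordism_scale \<GG> q (star (x,y))" for q
  using hom_bordism_scale[OF star_hom(1)[OF y] x,of q] by (simp add: star_eq x y bscale_closed)
 show "star (x,bordism_scale \<GG> q y) = bordism_scale \<GG> q (star (x,y))" for q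
  using hom_bordism_scale[OF star_hom(2)[OF x] y,of q] by (simp add: star_eq x y bscale_closed)
qed

lemma garland_incl_cls:
 assumes "allowed_graph \<NN> \<Gamma>" "embeds TYPE('a)" "sing j (diagrams M \<Gamma>) (Q :: ('a,('n,'m) diagram) over)"
 shows "garland_incl \<NN> M j \<Gamma> (cls j (diagrams M \<Gamma>) Q) = cls j \<GG> (fst Q,Pair \<Gamma> \<circ> snd Q)"
 unfolding garland_incl_def by (rule bpush_cls[OF assms(2,3) cont_garland_incl[OF assms(1)]])

text \<open>Joining diagrams and then including the result in the space of garlands is the same as
  including them and applying \<open>garland_join\<close>. So \<open>c\<close> is the product of the
  two included classes, and its \<open>n\<close> N-vertices select \<open>average n\<close> in
  \<open>symm\<close>.\<close>

lemma star_formula: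
 fixes P Q :: "(pts,('n,'m) diagram) over"
 assumes a: "allowed_graph \<NN> \<Gamma>1" "allowed_graph \<NN> \<Gamma>2"
  and P: "sing j1 (diagrams M \<Gamma>1) P" and Q: "sing j2 (diagrams M \<Gamma>2) Q"
  and w: "\<omega>1 = cls j1 (diagrams M \<Gamma>1) P" "\<omega>2 = cls j2 (diagrams M \<Gamma>2) Q"
  and n: "n = gg_nu \<Gamma>1 + gg_nu \<Gamma>2" and c: "c = garland_incl \<NN> M (j1 + j2) (gg_join \<Gamma>1 \<Gamma>2) (garland_C M j1 j2 \<Gamma>1 \<Gamma>2 \<omega>1 \<omega>2)"
 shows "star (bordism_rat_elt j1 \<GG> (garland_incl \<NN> M j1 \<Gamma>1 \<omega>1),bordism_rat_elt j2 \<GG> (garland_incl \<NN> M j2 \<Gamma>2 \<omega>2)) =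
  bordism_scale \<GG> (1 / fact n) (finprod \<RR> (\<lambda>\<beta>. bordism_rat_elt (j1 + j2) \<GG> (bordism_push (j1 + j2) \<GG> (garland_permute n \<beta>) c))
   {\<beta>. \<beta> permutes {..<n}})"
proof -
 interpret R: comm_group \<RR> by (rule cgroup_RR)
 let ?J = "gg_join \<Gamma>1 \<Gamma>2" and ?m = "\<lambda>(d1,d2). diagram_join \<Gamma>1 \<Gamma>2 d1 d2"
 let ?P = "(fst P,Pair \<Gamma>1 \<circ> snd P)" and ?Q = "(fst Q,Pair \<Gamma>2 \<circ> snd Q)"
 note SP = sized_incl[OF a(1) P] and SQ = sized_incl[OF a(2) Q] and S = sized_oprod[OF sized_incl[OF a(1) P] sized_incl[OF a(2) Q]]
 have e: "embeds TYPE(pts \<times> pts)" by simp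
 have "garland_C M j1 j2 \<Gamma>1 \<Gamma>2 \<omega>1 \<omega>2 = bprod j1 j2 (diagrams M ?J) ?m \<omega>1 \<omega>2"
  by (simp add: garland_C_def bprod_def oprod_def case_prod_unfold)
 also have "\<dots> = cls (j1 + j2) (diagrams M ?J) (oprod ?m P Q)"
  unfolding w by (rule bprod_cls[OF emb_pts emb_pts cont_diagram_join[OF a] P Q])
 finally have "c = cls (j1 + j2) \<GG> (fst (oprod ?m P Q),Pair ?J \<circ> snd (oprod ?m P Q))"
  unfolding c
  by (simp only: garland_incl_cls[OF agraph_join[OF a] e sing_oprod[OF P Q cont_diagram_join[OF a]]])
 also have "(fst (oprod ?m P Q),Pair ?J \<circ> snd (oprod ?m P Q)) = oprod garland_join ?P ?Q"
  by (auto simp: oprod_def garland_join_def)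
 finally have c': "c = cls (j1 + j2) \<GG> (oprod garland_join ?P ?Q)" .
 have "star (bordism_rat_elt j1 \<GG> (garland_incl \<NN> M j1 \<Gamma>1 \<omega>1),bordism_rat_elt j2 \<GG> (garland_incl \<NN> M j2 \<Gamma>2 \<omega>2)) =
   star (elt j1 ?P 1,elt j2 ?Q 1)"
  by (simp only: brat_elt_eq w garland_incl_cls[OF a(1) emb_pts P] garland_incl_cls[OF a(2) emb_pts Q])
 also have "\<dots> = symm (elt (j1 + j2) (oprod garland_join ?P ?Q) 1)"
  by (simp only: star_eq[OF elt_closed[OF emb_pts SP] elt_closed[OF emb_pts SQ]] mult_elt[OF emb_pts emb_pts SP SQ] mult_1_left)
 also have "\<dots> = average n (hom_elt \<GG> (j1 + j2) c 1)" unfolding n c' by (rule symm_elt[OF e S])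
 also have "\<dots> = bordism_scale \<GG> (1 / fact n) (finprod \<RR> (\<lambda>\<beta>. bordism_rat_elt (j1 + j2) \<GG> (bordism_push (j1 + j2) \<GG> (garland_permute n \<beta>) c))
   {\<beta>. \<beta> permutes {..<n}})"
  unfolding average_def
 proof (rule arg_cong[where f = "bordism_scale \<GG> (1 / fact n)"],rule R.finprod_cong')
  have cc: "c \<in> (Om (j1 + j2) \<GG>)" unfolding c' by (rule cls_mem[OF e sizedD(1)[OF S]])
  show "perm n \<beta> (hom_elt \<GG> (j1 + j2) c 1) = bordism_rat_elt (j1 + j2) \<GG> (bordism_push (j1 + j2) \<GG> (garland_permute n \<beta>) c)"
   if "\<beta> \<in> {\<beta>. \<beta> permutes {..<n}}" for \<beta>
   using that rat_push(2)[OF cont_garland_permute cc] by (simp add: brat_elt_eq)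
  show "(\<lambda>\<beta>. bordism_rat_elt (j1 + j2) \<GG> (bordism_push (j1 + j2) \<GG> (garland_permute n \<beta>) c)) \<in> {\<beta>. \<beta> permutes {..<n}} \<rightarrow> carrier \<RR>"
   using hom_elt_closed[OF bpush_closed[OF cont_garland_permute cc]] by (auto simp: brat_elt_eq)
 qed simp
 finally show ?thesis .
qed

lemma is_garland_star_star: "is_garland_star \<NN> M star"
 unfolding is_garland_star_def Let_def
proof (intro conjI allI impI,rule star_bilinear,elim conjE)
 fix \<Gamma>1 \<Gamma>2 :: "'n garland_graph" and j1 j2 and V1 V2 :: "pts omanifold" and f1 f2 :: "pts => ('n,'m) diagram"
 assume a: "allowed_graph \<NN> \<Gamma>1" "allowed_graph \<NN> \<Gamma>2"
  and P: "singular_manifold j1 (diagrams M \<Gamma>1) V1 f1" "singular_manifold j2 (diagrams M \<Gamma>2) V2 f2"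
 show "star (bordism_rat_elt j1 \<GG> (garland_incl \<NN> M j1 \<Gamma>1 (bclass j1 (diagrams M \<Gamma>1) V1 f1)),
   bordism_rat_elt j2 \<GG> (garland_incl \<NN> M j2 \<Gamma>2 (bclass j2 (diagrams M \<Gamma>2) V2 f2))) =
  bordism_scale \<GG> (1 / fact (gg_nu \<Gamma>1 + gg_nu \<Gamma>2)) (finprod \<RR> (\<lambda>\<beta>. bordism_rat_elt (j1 + j2) \<GG>
   (bordism_push (j1 + j2) \<GG> (garland_permute (gg_nu \<Gamma>1 + gg_nu \<Gamma>2) \<beta>) (garland_incl \<NN> M (j1 + j2) (gg_join \<Gamma>1 \<Gamma>2)
    (garland_C M j1 j2 \<Gamma>1 \<Gamma>2 (bclass j1 (diagrams M \<Gamma>1) V1 f1) (bclass j2 (diagrams M \<Gamma>2) V2 f2)))))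
   {\<beta>. \<beta> permutes {..<gg_nu \<Gamma>1 + gg_nu \<Gamma>2}})"
  by (rule star_formula[OF a,where P = "(V1,f1)" and Q = "(V2,f2)"]) (use P in simp_all)
qed

text \<open>The averaging formula fixes the values on \<open>1\<omega>\<close> for connected
  representatives. Linearity over the rationals gives all coefficients, the resulting elements
  generate additively in each variable, and off the carrier both operations have the default
  value.\<close>

lemma garland_star_unique:
 assumes S: "is_garland_star \<NN> M S" shows "S = star"
proof -
 have B: "bordism_rat_bilinear \<GG> S" using S unfolding is_garland_star_def by (elim conjE)
 note S' = B[unfolded bordism_rat_bilinear_def,THEN conjunct1] and
  B' = B[unfolded bordism_rat_bilinear_def,THEN conjunct2,THEN conjunct1,rule_format] and
  Sc = B[unfolded bordism_rat_bilinear_def,THEN conjunct2,THEN conjunct2,rule_format]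
 note T' = star_bilinear[unfolded bordism_rat_bilinear_def,THEN conjunct1] and
  Tc = star_bilinear[unfolded bordism_rat_bilinear_def,THEN conjunct2,THEN conjunct2,rule_format]
 have h: "z \<in> carrier \<RR> ==> (\<lambda>x. S (x,z)) \<in> hom \<RR> \<RR>" "z \<in> carrier \<RR> ==> (\<lambda>x. S (z,x)) \<in> hom \<RR> \<RR>" for z
  using PiE_mem[OF S'] B' by (auto intro!: homI)
 have t: "z \<in> carrier \<RR> ==> (\<lambda>x. star (x,z)) \<in> hom \<RR> \<RR>" "z \<in> carrier \<RR> ==> (\<lambda>x. star (z,x)) \<in> hom \<RR> \<RR>" for z
  using PiE_mem[OF T'] star_bilinear[unfolded bordism_rat_bilinear_def,THEN conjunct2,THEN conjunct1,rule_format]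
  by (auto intro!: homI)
 let ?i = "\<lambda>\<Gamma> Q. (fst Q,Pair \<Gamma> \<circ> snd Q) :: (pts,('n,'m) garland) over"
 have gen: "S (elt j (?i \<Gamma> P) q,elt k (?i \<Delta> Q) r) = star (elt j (?i \<Gamma> P) q,elt k (?i \<Delta> Q) r)"
  if P: "allowed_graph \<NN> \<Gamma>" "sing j (diagrams M \<Gamma>) P" "connected_manifold (fst P)"
   and Q: "allowed_graph \<NN> \<Delta>" "sing k (diagrams M \<Delta>) Q" "connected_manifold (fst Q)"
  for j k q r \<Gamma> \<Delta> and P Q :: "(pts,('n,'m) diagram) over"
 proof -
  let ?P = "?i \<Gamma> P" and ?Q = "?i \<Delta> Q"
  note cP = cls_mem[OF emb_pts sizedD(1)[OF sized_incl[OF P(1,2)]]] and cQ = cls_mem[OF emb_pts sizedD(1)[OF sized_incl[OF Q(1,2)]]]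
  have e: "elt j ?P q = bordism_scale \<GG> q (elt j ?P 1)" "elt k ?Q r = bordism_scale \<GG> r (elt k ?Q 1)"
   using bscale_elt[OF cP,of q 1] bscale_elt[OF cQ,of r 1] by simp_all
  note s = S[unfolded is_garland_star_def Let_def,THEN conjunct2,rule_format,of \<Gamma> \<Delta> j "fst P" "snd P" k "fst Q" "snd Q"]
  note s' = star_formula[OF P(1) Q(1) P(2) Q(2) refl refl refl refl]
  have "S (elt j ?P 1,elt k ?Q 1) = star (elt j ?P 1,elt k ?Q 1)"
   using s P Q s' unfolding brat_elt_eq garland_incl_cls[OF P(1) emb_pts P(2)] garland_incl_cls[OF Q(1) emb_pts Q(2)] by simp
  moreover note c = hom_elt_closed[OF cP,of 1] hom_elt_closed[OF cQ,of 1]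
  ultimately show ?thesis
   by (simp only: e Sc[THEN conjunct1,OF c(1) bscale_closed[OF c(2)]] Sc[THEN conjunct2,OF c]
     Tc[THEN conjunct1,OF c(1) bscale_closed[OF c(2)]] Tc[THEN conjunct2,OF c])
 qed
 have "S (x,y) = star (x,y)" if x: "x \<in> carrier \<RR>" and y: "y \<in> carrier \<RR>" for x y
 proof (rule garland_induct[where Pr = "\<lambda>x. S (x,y) = star (x,y)",OF x])
  show "S (\<one>\<^bsub>\<RR>\<^esub>,y) = star (\<one>\<^bsub>\<RR>\<^esub>,y)"
   using hom_one[OF h(1)[OF y] group_RR group_RR] hom_one[OF t(1)[OF y] group_RR group_RR] by simp
  show "S (u \<otimes>\<^bsub>\<RR>\<^esub> v,y) = star (u \<otimes>\<^bsub>\<RR>\<^esub> v,y)"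
   if "u \<in> carrier \<RR>" "v \<in> carrier \<RR>" "S (u,y) = star (u,y)" "S (v,y) = star (v,y)" for u v
   using hom_mult[OF h(1)[OF y] that(1,2)] hom_mult[OF t(1)[OF y] that(1,2)] that(3,4) by simp
  fix j q \<Gamma> and P :: "(pts,('n,'m) diagram) over"
  assume P: "allowed_graph \<NN> \<Gamma>" "sing j (diagrams M \<Gamma>) P" "connected_manifold (fst P)"
  note c = elt_closed[OF emb_pts sized_incl[OF P(1,2)],of q]
  show "S (elt j (?i \<Gamma> P) q,y) = star (elt j (?i \<Gamma> P) q,y)"
  proof (rule garland_induct[where Pr = "\<lambda>y. S (elt j (?i \<Gamma> P) q,y) = star (elt j (?i \<Gamma> P) q,y)",OF y _ _ gen[OF P]])
   show "S (elt j (?i \<Gamma> P) q,\<one>\<^bsub>\<RR>\<^esub>) = star (elt j (?i \<Gamma> P) q,\<one>\<^bsub>\<RR>\<^esub>)"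
    using hom_one[OF h(2)[OF c] group_RR group_RR] hom_one[OF t(2)[OF c] group_RR group_RR] by simp
   show "S (elt j (?i \<Gamma> P) q,u \<otimes>\<^bsub>\<RR>\<^esub> v) = star (elt j (?i \<Gamma> P) q,u \<otimes>\<^bsub>\<RR>\<^esub> v)"
    if "u \<in> carrier \<RR>" "v \<in> carrier \<RR>" "S (elt j (?i \<Gamma> P) q,u) = star (elt j (?i \<Gamma> P) q,u)"
     "S (elt j (?i \<Gamma> P) q,v) = star (elt j (?i \<Gamma> P) q,v)" for u v
    using hom_mult[OF h(2)[OF c] that(1,2)] hom_mult[OF t(2)[OF c] that(1,2)] that(3,4) by simp
  qed
 qed
 thus ?thesis by (intro PiE_ext[OF S' T']) auto
qed

lemma garland_star_eq: "garland_star \<NN> M x y = star (x,y)"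
 unfolding garland_star_def using the_equality[of "is_garland_star \<NN> M",OF is_garland_star_star garland_star_unique] by simp

end

theorem theorem1p4:
  fixes \<NN> :: "'n omanifold set" and M :: "'m omanifold" and dim_M dim_N :: nat
  assumes "oriented_manifold M" and "connected_manifold M" and "mf_dim M = dim_M"
    and "\<forall>N\<in>\<NN>. closed_oriented_manifold N \<and> connected_manifold N \<and> mf_dim N = dim_N"
    and "odd dim_N"
  shows
    "is_garland_star \<NN> M (\<lambda>(\<eta>1, \<eta>2). garland_star \<NN> M \<eta>1 \<eta>2) \<and>
     (\<forall>j1 j2. \<forall>\<eta>1\<in>bordism_rat_deg j1 (garlands \<NN> M). \<forall>\<eta>2\<in>bordism_rat_deg j2 (garlands \<NN> M).
        garland_star \<NN> M \<eta>1 \<eta>2 =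
        bordism_scale (garlands \<NN> M) ((-1) ^ (j1 * j2)) (garland_star \<NN> M \<eta>2 \<eta>1)) \<and>
     (\<forall>j1 j2 j3. \<forall>\<eta>1\<in>bordism_rat_deg j1 (garlands \<NN> M). \<forall>\<eta>2\<in>bordism_rat_deg j2 (garlands \<NN> M).
        \<forall>\<eta>3\<in>bordism_rat_deg j3 (garlands \<NN> M).
        garland_star \<NN> M (garland_star \<NN> M \<eta>1 \<eta>2) \<eta>3 =
        garland_star \<NN> M \<eta>1 (garland_star \<NN> M \<eta>2 \<eta>3)) \<and>
     (\<forall>j1 j2. \<forall>\<eta>1\<in>bordism_rat_deg j1 (garlands \<NN> M). \<forall>\<eta>2\<in>bordism_rat_deg j2 (garlands \<NN> M).
        garland_star \<NN> M \<eta>1 \<eta>2 \<in> bordism_rat_deg (j1 + j2) (garlands \<NN> M))"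
proof (intro conjI allI ballI)
 have "(\<lambda>(\<eta>1,\<eta>2). garland_star \<NN> M \<eta>1 \<eta>2) = star \<NN> M" by (auto simp: garland_star_eq fun_eq_iff)
 thus "is_garland_star \<NN> M (\<lambda>(\<eta>1,\<eta>2). garland_star \<NN> M \<eta>1 \<eta>2)" by (simp only: is_garland_star_star)
 fix j1 j2 j3 \<eta>1 \<eta>2 \<eta>3
 assume \<eta>: "\<eta>1 \<in> bordism_rat_deg j1 (garlands \<NN> M)" "\<eta>2 \<in> bordism_rat_deg j2 (garlands \<NN> M)"
 thus "garland_star \<NN> M \<eta>1 \<eta>2 = bordism_scale (garlands \<NN> M) ((-1) ^ (j1 * j2)) (garland_star \<NN> M \<eta>2 \<eta>1)"
  unfolding garland_star_eq by (rule star_comm)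
 show "garland_star \<NN> M \<eta>1 \<eta>2 \<in> bordism_rat_deg (j1 + j2) (garlands \<NN> M)"
  unfolding garland_star_eq using \<eta> by (rule star_deg)
 assume "\<eta>3 \<in> bordism_rat_deg j3 (garlands \<NN> M)"
 with \<eta> show "garland_star \<NN> M (garland_star \<NN> M \<eta>1 \<eta>2) \<eta>3 = garland_star \<NN> M \<eta>1 (garland_star \<NN> M \<eta>2 \<eta>3)"
  unfolding garland_star_eq by (intro star_assoc deg_closed)
qed

end
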